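(* Let $\sigma\in\,]-\tfrac32,\tfrac12[$, $\sigma\ne-\tfrac12$. There exists a constant $C$ such that for every $(\lambda,\zeta)\in\mathbb{S}\times(\mathbb{Z}^2\setminus\{0\})$, $\zeta=(\xi,\eta)$, the operator $$\mathcal{L}:(H^{\sigma+2}_\zeta)^2_{\mathrm{div}}\times\mathbb{C}\times H^{\sigma+2}_\zeta\to(H^\sigma_\zeta)^3,\quad (u,v,p_0,\theta)\mapsto\begin{bmatrix}(\omega^2-\nu\partial_{zz})u+i\xi p_0-\alpha v+i\xi\beta\int_0^z\theta\\(\omega^2-\nu\partial_{zz})v+i\eta p_0+\alpha u+i\eta\beta\int_0^z\theta\\(\omega^2-\nu\partial_{zz})\theta-\gamma\int_0^z(i\xi u+i\eta v)\end{bmatrix}=F$$ is continuous and bijective, and $Y=(u,v)$ splits as $Y=Y_1+Y_2$ with $$\begin{aligned} &(a)\ |\zeta|\,|p_0|\le C\langle\omega\rangle^2M_\sigma\|F\|_{\sigma,\zeta},\\ &(b)\ \frac{M_{-\sigma-2}}{M_{-\sigma}}\|Y_1\|_{\sigma,\zeta}+\|Y_1\|_{\sigma+2,\zeta}\le C\langle\omega\rangle^2M_\sigma M_{-\sigma-2}\|F\|_{\sigma,\zeta},\\ &(c)\ \langle\omega\rangle^2\|Y_2\|_{\sigma,\zeta}+\|Y_2\|_{\sigma+2,\zeta}\le C\|F\|_{\sigma,\zeta},\\ &(d)\ \langle\omega\rangle^2\|\theta\|_{\sigma,\zeta}+\|\theta\|_{\sigma+2,\zeta}\le C\|F\|_{\sigma,\zeta},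 \end{aligned}$$ where $\int_0^z g$ denotes $z\mapsto\int_0^zg(z')dz'$ and $M_\sigma,M_{-\sigma},M_{-\sigma-2}$ are evaluated at $(\lambda,\zeta)$.
   Context: Fix $a>0$, $\nu>0$, $\alpha\in\mathbb{R}$, $\beta,\gamma>0$, $\Omega=\mathbb{T}^2\times(0,a)$, $\mathbb{T}^2=(\mathbb{R}/2\pi\mathbb{Z})^2$. Let $e_k(z)=\sqrt{2/a}\sin(k\pi z/a)$, $k\in\mathbb{N}^*$. For $\zeta\in\mathbb{Z}^2$, $s\in\mathbb{R}$, $H^s_\zeta$ is the Hilbert space of series $f=\sum_{k\ge1}f_ke_k(z)$ on $(0,a)$ with norm $\|f\|_{s,\zeta}^2=\sum_k(1+\nu k^2+\nu|\zeta|^2)^s|f_k|^2<\infty$; for vectors the norm is the $\ell^2$ combination of component norms. $(H^{s}_\zeta)^2_{\mathrm{div}}=\{(u,v)\in(H^s_\zeta)^2:\int_0^a(\xi u+\eta v)\,dz=0\}$. Spectral set: let $\mathcal{V}=\mathcal{V}_1\times\mathcal{V}_2$, where $\mathcal{V}_1$ is the closure in $H^1(\Omega)^2$ of smooth $(u,v)$ periodic in $x,y$, vanishing at $z=0,a$, with $\int_0^a(\partial_xu+\partial_yv)dz=0$, and $\mathcal{V}_2$ the closure in $H^1(\Omega)$ of smooth $\theta$ periodic in $x,y$ vanishing at $z=0,a$. For $X=(u,v,\theta),X'=(u',v',\theta')\in\mathcal{V}$ put $(X,X')_{\mathcal{H}}=\int_\Omega(u\bar u'+v\bar v'+\frac\beta\gamma\theta\bar\theta')$,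 $(X,X')_{\mathcal{V}}=\int_\Omega(\nabla u\cdot\nabla\bar u'+\nabla v\cdot\nabla\bar v'+\frac\beta\gamma\nabla\theta\cdot\nabla\bar\theta')$, $w=-\int_0^z(\partial_xu+\partial_yv)$, $w'=-\int_0^z(\partial_xu'+\partial_yv')$, $B(X,X')=-\int_\Omega\theta\bar w'+\int_\Omega w\bar\theta'$, $C(X,X')=-\int_\Omega v\bar u'+\int_\Omega u\bar v'$, and $\langle PX,X'\rangle=\nu(X,X')_{\mathcal{V}}+\beta B(X,X')+\alpha C(X,X')$. $\mathbb{V}_P=\{\lambda\in\mathbb{C}:\exists X\in\mathcal{V}\setminus\{0\},\ \lambda(X,X')_{\mathcal{H}}+\langle PX,X'\rangle=0\ \forall X'\in\mathcal{V}\}$. Then $\mathbb{S}=\{-\delta_2-\mu_1+i\mu_2:(\mu_1,\mu_2)\in\mathbb{R}^2,\ |\mu_2|\ge\mu_1/\delta_1\}$, where $\delta_1>0$ is small enough that $\mathbb{S}\cap\mathbb{V}_P=\emptyset$ and $\delta_2<\min(\frac{\nu\pi^2}{2a^2},\frac\nu2)$. Parameters: $\omega^2=\lambda+\nu|\zeta|^2$, $\langle\zeta\rangle=1+|\zeta|$, $\langle\omega\rangle^2=|\lambda|+\langle\zeta\rangle^2$, and $M_s(\lambda,\zeta)=\big(\sum_{k\ge1}\frac{1}{k^2(k^4+\langle\omega\rangle^4)(k^2+\langle\zeta\rangle^2)^s}\big)^{1/2}$. *)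

theory Defs
  imports "HOL-Analysis.Analysis"
begin

type_synonym pt = "real \<times> real \<times> real"

(* fundamental cell of Omega = T^2 x (0,a) *)
definition Om :: "real \<Rightarrow> pt set" where
  "Om a = {0..2*pi} \<times> {0..2*pi} \<times> {0<..<a}"

definition pd :: "(pt \<Rightarrow> complex) \<Rightarrow> pt \<Rightarrow> pt \<Rightarrow> complex" where
  "pd f d p = frechet_derivative f (at p) d"

definition dX :: pt where "dX = (1,0,0)"
definition dY :: pt where "dY = (0,1,0)"
definition dZ :: pt where "dZ = (0,0,1)"

fun Ck :: "nat \<Rightarrow> (pt \<Rightarrow> complex) \<Rightarrow> bool" where
  "Ck 0 f = continuous_on UNIV f"
| "Ck (Suc n) f = ((\<forall>p. f differentiable (at p)) \<and>
      (\<forall>d\<in>{dX, dY, dZ}. Ck n (pd f d)))"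

definition smooth :: "(pt \<Rightarrow> complex) \<Rightarrow> bool" where
  "smooth f \<longleftrightarrow> (\<forall>n. Ck n f)"

definition grad :: "(pt \<Rightarrow> complex) \<Rightarrow> pt \<Rightarrow> complex \<times> complex \<times> complex" where
  "grad f p = (pd f dX p, pd f dY p, pd f dZ p)"

definition adm :: "real \<Rightarrow> (pt \<Rightarrow> complex) \<Rightarrow> bool" where
  "adm a f \<longleftrightarrow> smooth f \<and>
     (\<forall>x y z. f (x + 2*pi, y, z) = f (x, y, z) \<and> f (x, y + 2*pi, z) = f (x, y, z)) \<and>
     (\<forall>x y. f (x, y, 0) = 0 \<and> f (x, y, a) = 0)"

(* smooth pairs (u,v) in the dense class of V_1: vertical mean of the divergence vanishes *)
definition adm1 :: "real \<Rightarrow> (pt \<Rightarrow> complex) \<Rightarrow> (pt \<Rightarrow> complex) \<Rightarrow> bool" where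
  "adm1 a u v \<longleftrightarrow> adm a u \<and> adm a v \<and>
     (\<forall>x y. (LINT z:{0..a}|lborel. pd u dX (x, y, z) + pd v dY (x, y, z)) = 0)"

definition L2d :: "real \<Rightarrow> (pt \<Rightarrow> 'b::real_normed_vector) \<Rightarrow> (pt \<Rightarrow> 'b) \<Rightarrow> ennreal" where
  "L2d a f g = (\<integral>\<^sup>+p \<in> Om a. ennreal ((norm (f p - g p))\<^sup>2) \<partial>lborel)"

(* Elements of V are represented by (square integrable) functions u, v, theta together with
   their H^1 gradients Gu, Gv, Gt, obtained as H^1(Omega)-limits of the dense smooth classes. *)
type_synonym vfun = "pt \<Rightarrow> complex"
type_synonym gfun = "pt \<Rightarrow> complex \<times> complex \<times> complex"

definition inV :: "real \<Rightarrow> vfun \<Rightarrow> vfun \<Rightarrow> vfun \<Rightarrow> gfun \<Rightarrow> gfun \<Rightarrow> gfun \<Rightarrow> bool" where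
  "inV a u v t Gu Gv Gt \<longleftrightarrow>
     u \<in> borel_measurable lborel \<and> v \<in> borel_measurable lborel \<and> t \<in> borel_measurable lborel \<and>
     Gu \<in> borel_measurable lborel \<and> Gv \<in> borel_measurable lborel \<and> Gt \<in> borel_measurable lborel \<and>
     (\<exists>\<phi> \<psi>. (\<forall>n. adm1 a (\<phi> n) (\<psi> n)) \<and>
        (\<lambda>n. L2d a (\<phi> n) u) \<longlonglongrightarrow> 0 \<and> (\<lambda>n. L2d a (\<psi> n) v) \<longlonglongrightarrow> 0 \<and>
        (\<lambda>n. L2d a (grad (\<phi> n)) Gu) \<longlonglongrightarrow> 0 \<and> (\<lambda>n. L2d a (grad (\<psi> n)) Gv) \<longlonglongrightarrow> 0) \<and>
     (\<exists>\<rho>. (\<forall>n. adm a (\<rho> n)) \<and>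
        (\<lambda>n. L2d a (\<rho> n) t) \<longlonglongrightarrow> 0 \<and> (\<lambda>n. L2d a (grad (\<rho> n)) Gt) \<longlonglongrightarrow> 0)"

definition intOm :: "real \<Rightarrow> (pt \<Rightarrow> complex) \<Rightarrow> complex" where
  "intOm a f = (LINT p:Om a|lborel. f p)"

definition gdot :: "complex \<times> complex \<times> complex \<Rightarrow> complex \<times> complex \<times> complex \<Rightarrow> complex" where
  "gdot g h = fst g * cnj (fst h) + fst (snd g) * cnj (fst (snd h)) + snd (snd g) * cnj (snd (snd h))"

definition wfun :: "gfun \<Rightarrow> gfun \<Rightarrow> pt \<Rightarrow> complex" where
  "wfun Gu Gv p = (case p of (x, y, z) \<Rightarrow>
      - (LINT s:{0..z}|lborel. fst (Gu (x, y, s)) + fst (snd (Gv (x, y, s)))))"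

definition formH :: "real \<Rightarrow> real \<Rightarrow> real \<Rightarrow> vfun \<Rightarrow> vfun \<Rightarrow> vfun \<Rightarrow> vfun \<Rightarrow> vfun \<Rightarrow> vfun \<Rightarrow> complex" where
  "formH a \<beta> \<gamma> u v t u' v' t' =
     intOm a (\<lambda>p. u p * cnj (u' p) + v p * cnj (v' p) + of_real (\<beta> / \<gamma>) * t p * cnj (t' p))"

definition formV :: "real \<Rightarrow> real \<Rightarrow> real \<Rightarrow> gfun \<Rightarrow> gfun \<Rightarrow> gfun \<Rightarrow> gfun \<Rightarrow> gfun \<Rightarrow> gfun \<Rightarrow> complex" where
  "formV a \<beta> \<gamma> Gu Gv Gt Gu' Gv' Gt' =
     intOm a (\<lambda>p. gdot (Gu p) (Gu' p) + gdot (Gv p) (Gv' p) + of_real (\<beta> / \<gamma>) * gdot (Gt p) (Gt' p))"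

definition formB :: "real \<Rightarrow> vfun \<Rightarrow> gfun \<Rightarrow> gfun \<Rightarrow> vfun \<Rightarrow> gfun \<Rightarrow> gfun \<Rightarrow> complex" where
  "formB a t Gu Gv t' Gu' Gv' =
     - intOm a (\<lambda>p. t p * cnj (wfun Gu' Gv' p)) + intOm a (\<lambda>p. wfun Gu Gv p * cnj (t' p))"

definition formC :: "real \<Rightarrow> vfun \<Rightarrow> vfun \<Rightarrow> vfun \<Rightarrow> vfun \<Rightarrow> complex" where
  "formC a u v u' v' = - intOm a (\<lambda>p. v p * cnj (u' p)) + intOm a (\<lambda>p. u p * cnj (v' p))"

definition VP :: "real \<Rightarrow> real \<Rightarrow> real \<Rightarrow> real \<Rightarrow> real \<Rightarrow> complex set" where
  "VP a \<nu> \<alpha> \<beta> \<gamma> = {lam. \<exists>u v t Gu Gv Gt.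
      inV a u v t Gu Gv Gt \<and>
      \<not> (AE p in lborel. p \<in> Om a \<longrightarrow> u p = 0 \<and> v p = 0 \<and> t p = 0) \<and>
      (\<forall>u' v' t' Gu' Gv' Gt'. inV a u' v' t' Gu' Gv' Gt' \<longrightarrow>
         lam * formH a \<beta> \<gamma> u v t u' v' t'
         + of_real \<nu> * formV a \<beta> \<gamma> Gu Gv Gt Gu' Gv' Gt'
         + of_real \<beta> * formB a t Gu Gv t' Gu' Gv'
         + of_real \<alpha> * formC a u v u' v' = 0)}"

definition Sset :: "real \<Rightarrow> real \<Rightarrow> complex set" where
  "Sset \<delta>1 \<delta>2 = {Complex (- \<delta>2 - \<mu>1) \<mu>2 | \<mu>1 \<mu>2. \<bar>\<mu>2\<bar> \<ge> \<mu>1 / \<delta>1}"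

(* a coefficient sequence f represents sum_{k>=1} f k * e_k; the entry f 0 is unused and must be 0 *)
type_synonym coef = "nat \<Rightarrow> complex"

definition zabs2 :: "int \<times> int \<Rightarrow> real" where
  "zabs2 \<zeta> = real_of_int (fst \<zeta>)^2 + real_of_int (snd \<zeta>)^2"

definition zabs :: "int \<times> int \<Rightarrow> real" where
  "zabs \<zeta> = sqrt (zabs2 \<zeta>)"

definition wt :: "real \<Rightarrow> real \<Rightarrow> int \<times> int \<Rightarrow> nat \<Rightarrow> real" where
  "wt \<nu> s \<zeta> k = (1 + \<nu> * real k ^ 2 + \<nu> * zabs2 \<zeta>) powr s"

definition Hs :: "real \<Rightarrow> real \<Rightarrow> int \<times> int \<Rightarrow> coef set" where
  "Hs \<nu> s \<zeta> = {f. f 0 = 0 \<and> summable (\<lambda>k. wt \<nu> s \<zeta> k * (cmod (f k))^2)}"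

definition nrm :: "real \<Rightarrow> real \<Rightarrow> int \<times> int \<Rightarrow> coef \<Rightarrow> real" where
  "nrm \<nu> s \<zeta> f = sqrt (\<Sum>k. wt \<nu> s \<zeta> k * (cmod (f k))^2)"

definition ek :: "real \<Rightarrow> nat \<Rightarrow> real \<Rightarrow> real" where
  "ek a k z = sqrt (2 / a) * sin (real k * pi * z / a)"

definition one_c :: "real \<Rightarrow> coef" where
  "one_c a k = (if k = 0 then 0 else complex_of_real (integral {0..a} (ek a k)))"

definition primM :: "real \<Rightarrow> nat \<Rightarrow> nat \<Rightarrow> real" where
  "primM a k j = integral {0..a} (\<lambda>z. integral {0..z} (ek a j) * ek a k z)"

(* sine coefficients of int_0^z g, for g = sum_j g_j e_j in L^2 *)
definition prim :: "real \<Rightarrow> coef \<Rightarrow> coef" where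
  "prim a g k = (if k = 0 then 0 else (\<Sum>j. complex_of_real (primM a k j) * g j))"

(* omega^2 + nu (k pi / a)^2 : symbol of omega^2 - nu d_zz on e_k *)
definition symb :: "real \<Rightarrow> real \<Rightarrow> complex \<Rightarrow> int \<times> int \<Rightarrow> nat \<Rightarrow> complex" where
  "symb a \<nu> lam \<zeta> k = lam + of_real (\<nu> * zabs2 \<zeta>) + of_real (\<nu> * (real k * pi / a)^2)"

definition Lop :: "real \<Rightarrow> real \<Rightarrow> real \<Rightarrow> real \<Rightarrow> real \<Rightarrow> complex \<Rightarrow> int \<times> int \<Rightarrow>
    coef \<times> coef \<times> complex \<times> coef \<Rightarrow> coef \<times> coef \<times> coef" where
  "Lop a \<nu> \<alpha> \<beta> \<gamma> lam \<zeta> X = (case X of (u, v, p0, t) \<Rightarrow>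
     let \<xi> = of_int (fst \<zeta>) :: complex; \<eta> = of_int (snd \<zeta>) :: complex;
         Pt = prim a t; Pd = prim a (\<lambda>k. \<i> * \<xi> * u k + \<i> * \<eta> * v k) in
     ((\<lambda>k. if k = 0 then 0 else symb a \<nu> lam \<zeta> k * u k + \<i> * \<xi> * p0 * one_c a k
              - of_real \<alpha> * v k + \<i> * \<xi> * of_real \<beta> * Pt k),
      (\<lambda>k. if k = 0 then 0 else symb a \<nu> lam \<zeta> k * v k + \<i> * \<eta> * p0 * one_c a k
              + of_real \<alpha> * u k + \<i> * \<eta> * of_real \<beta> * Pt k),
      (\<lambda>k. if k = 0 then 0 else symb a \<nu> lam \<zeta> k * t k - of_real \<gamma> * Pd k)))"

(* (H^s_zeta)^2_div : int_0^a (xi u + eta v) dz = 0 *)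
definition Hdiv :: "real \<Rightarrow> real \<Rightarrow> real \<Rightarrow> int \<times> int \<Rightarrow> (coef \<times> coef) set" where
  "Hdiv a \<nu> s \<zeta> = {(u, v). u \<in> Hs \<nu> s \<zeta> \<and> v \<in> Hs \<nu> s \<zeta> \<and>
      (\<Sum>k. (of_int (fst \<zeta>) * u k + of_int (snd \<zeta>) * v k) * one_c a k) = 0}"

definition Dom :: "real \<Rightarrow> real \<Rightarrow> real \<Rightarrow> int \<times> int \<Rightarrow> (coef \<times> coef \<times> complex \<times> coef) set" where
  "Dom a \<nu> s \<zeta> = {(u, v, p0, t). (u, v) \<in> Hdiv a \<nu> s \<zeta> \<and> t \<in> Hs \<nu> s \<zeta>}"

definition Tgt :: "real \<Rightarrow> real \<Rightarrow> int \<times> int \<Rightarrow> (coef \<times> coef \<times> coef) set" where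
  "Tgt \<nu> s \<zeta> = {(f, g, h). f \<in> Hs \<nu> s \<zeta> \<and> g \<in> Hs \<nu> s \<zeta> \<and> h \<in> Hs \<nu> s \<zeta>}"

definition nrm2 :: "real \<Rightarrow> real \<Rightarrow> int \<times> int \<Rightarrow> coef \<times> coef \<Rightarrow> real" where
  "nrm2 \<nu> s \<zeta> Y = sqrt ((nrm \<nu> s \<zeta> (fst Y))^2 + (nrm \<nu> s \<zeta> (snd Y))^2)"

definition nrm3 :: "real \<Rightarrow> real \<Rightarrow> int \<times> int \<Rightarrow> coef \<times> coef \<times> coef \<Rightarrow> real" where
  "nrm3 \<nu> s \<zeta> F = (case F of (f, g, h) \<Rightarrow>
     sqrt ((nrm \<nu> s \<zeta> f)^2 + (nrm \<nu> s \<zeta> g)^2 + (nrm \<nu> s \<zeta> h)^2))"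

definition nrmD :: "real \<Rightarrow> real \<Rightarrow> int \<times> int \<Rightarrow> coef \<times> coef \<times> complex \<times> coef \<Rightarrow> real" where
  "nrmD \<nu> s \<zeta> X = (case X of (u, v, p0, t) \<Rightarrow>
     sqrt ((nrm \<nu> s \<zeta> u)^2 + (nrm \<nu> s \<zeta> v)^2 + (cmod p0)^2 + (nrm \<nu> s \<zeta> t)^2))"

definition subD :: "coef \<times> coef \<times> complex \<times> coef \<Rightarrow> coef \<times> coef \<times> complex \<times> coef \<Rightarrow> coef \<times> coef \<times> complex \<times> coef" where
  "subD X X' = (case X of (u, v, p, t) \<Rightarrow> case X' of (u', v', p', t') \<Rightarrow>
     (\<lambda>k. u k - u' k, \<lambda>k. v k - v' k, p - p', \<lambda>k. t k - t' k))"

definition sub3 :: "coef \<times> coef \<times> coef \<Rightarrow> coef \<times> coef \<times> coef \<Rightarrow> coef \<times> coef \<times> coef" where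
  "sub3 F F' = (case F of (f, g, h) \<Rightarrow> case F' of (f', g', h') \<Rightarrow>
     (\<lambda>k. f k - f' k, \<lambda>k. g k - g' k, \<lambda>k. h k - h' k))"

definition bz :: "int \<times> int \<Rightarrow> real" where
  "bz \<zeta> = 1 + zabs \<zeta>"

definition bw2 :: "complex \<Rightarrow> int \<times> int \<Rightarrow> real" where
  "bw2 lam \<zeta> = cmod lam + (bz \<zeta>)^2"

definition Ms :: "real \<Rightarrow> complex \<Rightarrow> int \<times> int \<Rightarrow> real" where
  "Ms s lam \<zeta> = sqrt (\<Sum>k. 1 / (real (Suc k) ^ 2 * (real (Suc k) ^ 4 + (bw2 lam \<zeta>)^2)
                                   * (real (Suc k) ^ 2 + (bz \<zeta>)^2) powr s))"

end

theory Submission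
  imports Defs "HOL-Library.Diagonal_Subsequence"
begin

text \<open>
Write the operator as $L_0 - R$, where $R$ collects the Coriolis and buoyancy terms. $L_0$ is inverted
by hand: dividing by the symbol $D_k$ gives $Y = D^{-1} f - i\zeta p_0 D^{-1} 1$, and the divergence
constraint determines $p_0$ because the numbers $D_k$ stay in a sector, so that $|\sum_k 1_k^2 / D_k|$ is
bounded below by $c / \<langle>\<omega>\<rangle>^2$. The two terms are $Y_2$ and $Y_1$, and the estimates for $L_0$ follow.
Since $R$ is bounded from $H^{\sigma+1}$ to $H^\sigma$, one order below $L_0$, it is a small perturbation for large
$\<langle>\<omega>\<rangle>$; on the remaining bounded set of parameters the same a priori bound follows from compactness
and injectivity, and surjectivity propagates along $\lambda + s$, $s \ge 0$, which stays in the spectral set.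

Injectivity: a kernel element is regular enough (after one bootstrap step if $\sigma < -1/2$) for its
sine series to solve the system classically, and multiplying it by $e^{i(\xi x + \eta y)}$ yields an eigenfunction
of the variational problem, so $\lambda$ would belong to $V_P$.
\<close>

section \<open>Weighted square-summable sequences\<close>

text \<open>The obstacle is the boundary: the constant function 1 does not vanish at z = 0, a, so
  its sine coefficients decay only like 1/k and it lies in H^s only for s < 1/2. Hence the range of
  \<sigma>: 1 must pair with H^(\<sigma>+1), and 1/D must lie in H^(\<sigma>+2), which asks for
  \<sigma>+2 < 5/2. The weights M_s bound the norms of 1/D. The primitive has the same defect; it is
  treated as a Hilbert-Schmidt matrix, whose norm carries a factor 1/(1+|\<zeta>|) that absorbs the
  factors \<xi>, \<eta> in R. The value \<sigma> = -1/2 falls between the two regularity arguments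
  for the kernel: \<sigma>+2 > 3/2 fails, and so does \<sigma>+3 < 5/2, which the bootstrap needs
  for 1/D. The continuation moves \<lambda> instead of scaling R because injectivity is known on the
  whole spectral set, but only for the given \<alpha>, \<beta>, \<gamma>. For the eigenfunction,
  truncated sine series violate the mean divergence constraint; a vanishing change of the first
  coefficient restores it. The test slot passes to the limit in L^1, where vertical primitives are
  continuous.\<close>

definition l2s :: "(nat \<Rightarrow> real) \<Rightarrow> coef \<Rightarrow> bool" where
  "l2s w f \<longleftrightarrow> summable (\<lambda>k. w k * (cmod (f k))\<^sup>2)"

text \<open>The weight is arbitrary, so that H^s, its dual and the rows of a matrix are instances of
  one theory. The value of a divergent infinite sum is unspecified, hence \<open>l2n\<close> has a
  meaning only together with \<open>l2s\<close>.\<close>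

definition l2n :: "(nat \<Rightarrow> real) \<Rightarrow> coef \<Rightarrow> real" where
  "l2n w f = sqrt (\<Sum>k. w k * (cmod (f k))\<^sup>2)"

lemma l2n_nonneg: "(\<And>k. w k \<ge> 0) \<Longrightarrow> l2s w f \<Longrightarrow> 0 \<le> l2n w f"
  unfolding l2n_def l2s_def by (simp add: suminf_nonneg)

lemma l2n_sq: "(\<And>k. w k \<ge> 0) \<Longrightarrow> l2s w f \<Longrightarrow> (l2n w f)\<^sup>2 = (\<Sum>k. w k * (cmod (f k))\<^sup>2)"
  unfolding l2n_def l2s_def by (simp add: suminf_nonneg)

lemma l2_partial:
  assumes "\<And>k. w k \<ge> 0" "l2s w f"
  shows "(\<Sum>k<n. w k * (cmod (f k))\<^sup>2) \<le> (l2n w f)\<^sup>2"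
  using assms sum_le_suminf[of "\<lambda>k. w k * (cmod (f k))\<^sup>2" "{..<n}"] l2n_sq[of w f]
  by (simp add: l2s_def)

lemma l2_partial_L2_set:
  assumes "\<And>k. w k \<ge> 0" "l2s w f"
  shows "L2_set (\<lambda>k. sqrt (w k) * cmod (f k)) {..<n} \<le> l2n w f"
proof -
  have "L2_set (\<lambda>k. sqrt (w k) * cmod (f k)) {..<n} = sqrt (\<Sum>k<n. w k * (cmod (f k))\<^sup>2)"
    unfolding L2_set_def using assms(1) by (simp add: power_mult_distrib)
  also have "\<dots> \<le> sqrt ((l2n w f)\<^sup>2)" by (intro real_sqrt_le_mono l2_partial assms)
  finally show ?thesis using l2n_nonneg[OF assms] by simp
qed

text \<open>Finite sections suffice because the terms are nonnegative. Later membership proofs use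
  this form to get summability and the norm bound from one estimate.\<close>

lemma l2_of_partial:
  assumes w: "\<And>k. w k \<ge> 0" and B: "B \<ge> 0" "\<And>n. (\<Sum>k<n. w k * (cmod (f k))\<^sup>2) \<le> B\<^sup>2"
  shows "l2s w f \<and> l2n w f \<le> B"
proof -
  have s: "summable (\<lambda>k. w k * (cmod (f k))\<^sup>2)"
    by (rule bounded_imp_summable[where B="B^2"]) (use w B(2)[of "Suc _"] in \<open>auto simp: lessThan_Suc_atMost\<close>)
  moreover have "(\<Sum>k. w k * (cmod (f k))\<^sup>2) \<le> B^2"
    by (rule suminf_le_const[OF s]) (rule B)
  hence "sqrt (\<Sum>k. w k * (cmod (f k))\<^sup>2) \<le> sqrt (B^2)" by (rule real_sqrt_le_mono)
  ultimately show ?thesis using B(1) by (simp add: l2s_def l2n_def)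
qed

lemma l2_of_partial_L2_set:
  assumes w: "\<And>k. w k \<ge> 0" and B: "\<And>n. L2_set (\<lambda>k. sqrt (w k) * cmod (f k)) {..<n} \<le> B"
  shows "l2s w f \<and> l2n w f \<le> B"
proof (rule l2_of_partial[OF w])
  show "0 \<le> B" using order_trans[OF L2_set_nonneg B] .
  fix n have "(L2_set (\<lambda>k. sqrt (w k) * cmod (f k)) {..<n})\<^sup>2 \<le> B\<^sup>2"
    by (rule power_mono[OF B L2_set_nonneg])
  thus "(\<Sum>k<n. w k * (cmod (f k))\<^sup>2) \<le> B\<^sup>2"
    unfolding L2_set_def using w by (simp add: power_mult_distrib sum_nonneg)
qed

lemma l2_add:
  assumes w: "\<And>k. w k \<ge> 0" and fg: "l2s w f" "l2s w g"
  shows "l2s w (\<lambda>k. f k + g k) \<and> l2n w (\<lambda>k. f k + g k) \<le> l2n w f + l2n w g"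
proof (rule l2_of_partial_L2_set[OF w])
  fix n
  have "L2_set (\<lambda>k. sqrt (w k) * cmod (f k + g k)) {..<n} \<le>
     L2_set (\<lambda>k. sqrt (w k) * cmod (f k) + sqrt (w k) * cmod (g k)) {..<n}"
    by (rule L2_set_mono) (use w in \<open>auto simp: norm_triangle_ineq mult_left_mono simp flip: distrib_left\<close>)
  also have "\<dots> \<le> L2_set (\<lambda>k. sqrt (w k) * cmod (f k)) {..<n} + L2_set (\<lambda>k. sqrt (w k) * cmod (g k)) {..<n}"
    by (rule L2_set_triangle_ineq)
  also have "\<dots> \<le> l2n w f + l2n w g"
    using l2_partial_L2_set[OF w fg(1), of n] l2_partial_L2_set[OF w fg(2), of n] by simp
  finally show "L2_set (\<lambda>k. sqrt (w k) * cmod (f k + g k)) {..<n} \<le> l2n w f + l2n w g" .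
qed

lemma l2_dominate:
  assumes w: "\<And>k. w k \<ge> 0" and w': "\<And>k. w' k \<ge> 0" and g: "l2s w' g" and B: "B \<ge> 0"
    and le: "\<And>k. w k * (cmod (f k))\<^sup>2 \<le> B\<^sup>2 * (w' k * (cmod (g k))\<^sup>2)"
  shows "l2s w f \<and> l2n w f \<le> B * l2n w' g"
proof (rule l2_of_partial[OF w])
  show "0 \<le> B * l2n w' g" using B l2n_nonneg[OF w' g] by simp
  fix n
  have "(\<Sum>k<n. w k * (cmod (f k))\<^sup>2) \<le> (\<Sum>k<n. B\<^sup>2 * (w' k * (cmod (g k))\<^sup>2))" by (rule sum_mono) (rule le)
  also have "\<dots> = B^2 * (\<Sum>k<n. (w' k * (cmod (g k))\<^sup>2))" by (simp add: sum_distrib_left)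
  also have "\<dots> \<le> B^2 * (l2n w' g)\<^sup>2" by (intro mult_left_mono l2_partial w' g) auto
  finally show "(\<Sum>k<n. w k * (cmod (f k))\<^sup>2) \<le> (B * l2n w' g)\<^sup>2" by (simp add: power_mult_distrib)
qed

lemma l2_scale:
  assumes w: "\<And>k. w k \<ge> 0" and f: "l2s w f"
  shows "l2s w (\<lambda>k. c * f k) \<and> l2n w (\<lambda>k. c * f k) = cmod c * l2n w f"
proof -
  have *: "(\<lambda>k. w k * (cmod (c * f k))\<^sup>2) = (\<lambda>k. (cmod c)\<^sup>2 * (w k * (cmod (f k))\<^sup>2))"
    by (simp add: norm_mult power_mult_distrib mult_ac)
  show ?thesis using f unfolding l2s_def l2n_def *
    by (auto simp: suminf_mult real_sqrt_mult intro!: summable_mult)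
qed

lemma l2_coord:
  assumes w: "\<And>k. w k \<ge> 0" and f: "l2s w f"
  shows "sqrt (w k) * cmod (f k) \<le> l2n w f"
proof -
  have "sqrt (w k) * cmod (f k) \<le> L2_set (\<lambda>k. sqrt (w k) * cmod (f k)) {..<Suc k}"
    by (rule member_le_L2_set) (use w in auto)
  with l2_partial_L2_set[OF w f, of "Suc k"] show ?thesis by simp
qed

text \<open>Duality of the weights w and 1/w: splitting each product into sqrt(w)|f| and |g|/sqrt(w)
  reduces the pairing to Cauchy-Schwarz on finite sections. There is no conjugation, in accordance
  with the way the divergence constraint is written.\<close>

lemma l2_CS:
  assumes w: "\<And>k. w k > 0" and f: "l2s w f" and g: "l2s (\<lambda>k. 1 / w k) g"
  shows "summable (\<lambda>k. cmod (f k * g k)) \<and> (\<Sum>k. cmod (f k * g k)) \<le> l2n w f * l2n (\<lambda>k. 1 / w k) g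
     \<and> cmod (\<Sum>k. f k * g k) \<le> l2n w f * l2n (\<lambda>k. 1 / w k) g"
proof -
  have w0: "\<And>k. w k \<ge> 0" "\<And>k. 1 / w k \<ge> 0" using w by (auto intro: less_imp_le)
  have P: "(\<Sum>k<n. cmod (f k * g k)) \<le> l2n w f * l2n (\<lambda>k. 1 / w k) g" for n
  proof -
    have "(\<Sum>k<n. cmod (f k * g k)) = (\<Sum>k<n. \<bar>sqrt (w k) * cmod (f k)\<bar> * \<bar>sqrt (1 / w k) * cmod (g k)\<bar>)"
    proof (rule sum.cong[OF refl])
      fix k
      have "sqrt (w k) * sqrt (1 / w k) = 1" using w[of k] by (simp add: real_sqrt_divide)
      thus "cmod (f k * g k) = \<bar>sqrt (w k) * cmod (f k)\<bar> * \<bar>sqrt (1 / w k) * cmod (g k)\<bar>"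
        using w0[of k] by (simp add: norm_mult abs_mult)
    qed
    also have "\<dots> \<le> L2_set (\<lambda>k. sqrt (w k) * cmod (f k)) {..<n} * L2_set (\<lambda>k. sqrt (1 / w k) * cmod (g k)) {..<n}"
      by (rule L2_set_mult_ineq)
    also have "\<dots> \<le> l2n w f * l2n (\<lambda>k. 1 / w k) g"
      by (intro mult_mono l2_partial_L2_set f g w0 l2n_nonneg L2_set_nonneg)
    finally show ?thesis .
  qed
  have s: "summable (\<lambda>k. cmod (f k * g k))"
    by (rule bounded_imp_summable[where B="l2n w f * l2n (\<lambda>k. 1 / w k) g"])
      (use P[of "Suc _"] in \<open>auto simp: lessThan_Suc_atMost\<close>)
  have t: "(\<Sum>k. cmod (f k * g k)) \<le> l2n w f * l2n (\<lambda>k. 1 / w k) g"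
    by (rule suminf_le_const[OF s P])
  show ?thesis using s t summable_norm[OF s] by auto
qed

lemma l2_diff:
  assumes w: "\<And>k. w k \<ge> 0" and fg: "l2s w f" "l2s w g"
  shows "l2s w (\<lambda>k. f k - g k) \<and> l2n w (\<lambda>k. f k - g k) \<le> l2n w f + l2n w g"
  using l2_add[OF w fg(1), of "\<lambda>k. (-1) * g k"] l2_scale[OF w fg(2), of "-1"] by simp

lemma l2_eq_0D:
  assumes w: "\<And>k. w k > 0" and f: "l2s w f" and 0: "l2n w f = 0"
  shows "f k = 0"
  using l2_coord[of w f k] w[of k] assms by (auto simp: less_imp_le mult_le_0_iff)

text \<open>Each coordinate is controlled by the norm, hence is Cauchy. Norm convergence then
  follows on finite sections by letting one of the two indices go to infinity, so that no limit is
  exchanged with an infinite sum.\<close>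

lemma l2_complete:
  assumes w: "\<And>k. w k > 0" and f: "\<And>n. l2s w (f n)"
    and C: "\<And>e. e > 0 \<Longrightarrow> \<exists>N. \<forall>m\<ge>N. \<forall>n\<ge>N. l2n w (\<lambda>k. f m k - f n k) < e"
  shows "\<exists>g. l2s w g \<and> (\<forall>k. (\<lambda>n. f n k) \<longlonglongrightarrow> g k) \<and> (\<lambda>n. l2n w (\<lambda>k. f n k - g k)) \<longlonglongrightarrow> 0"
proof -
  have w0: "\<And>k. w k \<ge> 0" using w by (simp add: less_imp_le)
  have "Cauchy (\<lambda>n. f n k)" for k
  proof (rule CauchyI)
    fix e :: real assume e: "e > 0"
    hence "sqrt (w k) * e > 0" using w[of k] by simp
    from C[OF this] obtain N where N: "\<And>m n. m \<ge> N \<Longrightarrow> n \<ge> N \<Longrightarrow> l2n w (\<lambda>k. f m k - f n k) < sqrt (w k) * e" by blast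
    show "\<exists>M. \<forall>m\<ge>M. \<forall>n\<ge>M. norm (f m k - f n k) < e"
    proof (intro exI[of _ N] allI impI)
      fix m n assume mn: "m \<ge> N" "n \<ge> N"
      have "sqrt (w k) * cmod (f m k - f n k) \<le> l2n w (\<lambda>k. f m k - f n k)"
        by (rule l2_coord[OF w0 l2_diff[OF w0 f[of m] f[of n], THEN conjunct1]])
      also note N[OF mn]
      finally show "norm (f m k - f n k) < e" using w[of k] by simp
    qed
  qed
  hence "\<forall>k. \<exists>l. (\<lambda>n. f n k) \<longlonglongrightarrow> l" by (simp add: Cauchy_convergent_iff convergent_def)
  then obtain g where g: "\<And>k. (\<lambda>n. f n k) \<longlonglongrightarrow> g k" by metis
  have key: "\<exists>N. \<forall>m\<ge>N. l2s w (\<lambda>k. f m k - g k) \<and> l2n w (\<lambda>k. f m k - g k) \<le> e" if e: "e > 0" for e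
  proof -
    from C[OF e] obtain N where N: "\<And>m n. m \<ge> N \<Longrightarrow> n \<ge> N \<Longrightarrow> l2n w (\<lambda>k. f m k - f n k) < e" by blast
    show ?thesis
    proof (intro exI[of _ N] allI impI)
      fix m assume m: "m \<ge> N"
      show "l2s w (\<lambda>k. f m k - g k) \<and> l2n w (\<lambda>k. f m k - g k) \<le> e"
      proof (rule l2_of_partial[OF w0])
        show "e \<ge> 0" using e by simp
        fix j
        have lim: "(\<lambda>n. \<Sum>k<j. w k * (cmod (f m k - f n k))\<^sup>2) \<longlonglongrightarrow> (\<Sum>k<j. w k * (cmod (f m k - g k))\<^sup>2)"
          by (intro tendsto_intros g)
        have "(\<Sum>k<j. w k * (cmod (f m k - f n k))\<^sup>2) \<le> e\<^sup>2" if n: "n \<ge> N" for n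
        proof -
          have s: "l2s w (\<lambda>k. f m k - f n k)" using l2_diff[OF w0 f f] by blast
          have "(\<Sum>k<j. w k * (cmod (f m k - f n k))\<^sup>2) \<le> (l2n w (\<lambda>k. f m k - f n k))\<^sup>2"
            by (rule l2_partial[OF w0 s])
          also have "\<dots> \<le> e^2" using N[OF m n] l2n_nonneg[OF w0 s] by (intro power_mono) auto
          finally show ?thesis .
        qed
        thus "(\<Sum>k<j. w k * (cmod (f m k - g k))\<^sup>2) \<le> e\<^sup>2"
          by (intro LIMSEQ_le_const2[OF lim]) blast
      qed
    qed
  qed
  obtain N where "l2s w (\<lambda>k. f N k - g k)" using key[of 1] by auto
  hence "l2s w g" using l2_diff[OF w0 f[of N], of "\<lambda>k. f N k - g k"] by simp
  moreover have "(\<lambda>n. l2n w (\<lambda>k. f n k - g k)) \<longlonglongrightarrow> 0"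
  proof (rule LIMSEQ_I)
    fix r :: real assume "r > 0"
    then obtain N where N: "\<forall>m\<ge>N. l2s w (\<lambda>k. f m k - g k) \<and> l2n w (\<lambda>k. f m k - g k) \<le> r/2" using key[of "r/2"] by auto
    show "\<exists>no. \<forall>n\<ge>no. norm (l2n w (\<lambda>k. f n k - g k) - 0) < r"
    proof (intro exI[of _ N] allI impI)
      fix n assume "n \<ge> N"
      with N have "l2s w (\<lambda>k. f n k - g k)" "l2n w (\<lambda>k. f n k - g k) \<le> r/2" by auto
      moreover have "0 \<le> l2n w (\<lambda>k. f n k - g k)" using l2n_nonneg[OF w0 calculation(1)] .
      ultimately show "norm (l2n w (\<lambda>k. f n k - g k) - 0) < r" using \<open>r > 0\<close> by simp
    qed
  qed
  ultimately show ?thesis using g by blast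
qed

lemma coordwise_subseq:
  fixes f :: "nat \<Rightarrow> coef"
  assumes "\<And>n k. cmod (f n k) \<le> B k"
  shows "\<exists>r g. strict_mono (r :: nat \<Rightarrow> nat) \<and> (\<forall>k. (\<lambda>n. f (r n) k) \<longlonglongrightarrow> g k)"
proof -
  interpret subseqs "\<lambda>k s. convergent (\<lambda>i. f (s i) k)"
  proof
    fix n and s :: "nat \<Rightarrow> nat" assume "strict_mono s"
    have "\<forall>i. f (s i) n \<in> cball 0 (B n)" using assms by simp
    then obtain l r where "strict_mono (r :: nat \<Rightarrow> nat)" "((\<lambda>i. f (s i) n) \<circ> r) \<longlonglongrightarrow> l"
      using compact_cball[THEN compact_imp_seq_compact, THEN seq_compactE, of "\<lambda>i. f (s i) n"] by metis
    thus "\<exists>r'. strict_mono r' \<and> convergent (\<lambda>i. f ((s \<circ> r') i) n)"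
      by (auto simp: convergent_def o_def)
  qed
  \<comment> \<open>The diagonal sequence is a subsequence of the k-th extraction only from index
    k+1 on; the initial segment is put back afterwards.\<close>
  have "convergent (\<lambda>i. f (diagseq (i + Suc k)) k)" for k
  proof -
    have "convergent (\<lambda>i. f ((diagseq \<circ> (+) (Suc k)) i) k)"
    proof (rule diagseq_holds)
      fix r s :: "nat \<Rightarrow> nat" and n assume "strict_mono r" "convergent (\<lambda>i. f (s i) n)"
      from convergent_subseq_convergent[OF this(2,1)] show "convergent (\<lambda>i. f ((s \<circ> r) i) n)"
        by (simp add: o_def)
    qed
    thus ?thesis by (simp add: o_def add.commute)
  qed
  hence c: "convergent (\<lambda>i. f (diagseq i) k)" for k
    using convergent_ignore_initial_segment[of "\<lambda>i. f (diagseq i) k" "Suc k"] by blast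
  define g where "g k = lim (\<lambda>i. f (diagseq i) k)" for k
  have "(\<lambda>i. f (diagseq i) k) \<longlonglongrightarrow> g k" for k
    using c[of k] unfolding g_def by (simp only: convergent_LIMSEQ_iff)
  thus ?thesis using subseq_diagseq by (intro exI[of _ diagseq] exI[of _ g]) auto
qed

text \<open>Compactness comes from w/w' tending to 0: finitely many coordinates converge after a
  diagonal extraction, and the tail in the weight w is uniformly small by the bound in the weight
  w'.\<close>

lemma l2_Rellich:
  assumes w: "\<And>k. w k > 0" and w': "\<And>k. w' k > 0"
    and ratio: "\<And>e. e > 0 \<Longrightarrow> \<exists>N. \<forall>k\<ge>N. w k \<le> e * w' k"
    and f: "\<And>n. l2s w' (f n)" and B: "\<And>n. l2n w' (f n) \<le> B"
  shows "\<exists>r g. strict_mono (r :: nat \<Rightarrow> nat) \<and> l2s w' g \<and> l2s w g \<and> (\<forall>k. (\<lambda>n. f (r n) k) \<longlonglongrightarrow> g k) \<and>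
     (\<lambda>n. l2n w (\<lambda>k. f (r n) k - g k)) \<longlonglongrightarrow> 0"
proof -
  have w0: "\<And>k. w k \<ge> 0" and w0': "\<And>k. w' k \<ge> 0" using w w' by (auto simp: less_imp_le)
  have B0: "B \<ge> 0" using l2n_nonneg[OF w0' f] B order_trans by blast
  have "cmod (f n k) \<le> B / sqrt (w' k)" for n k
  proof -
    have "sqrt (w' k) * cmod (f n k) \<le> B" using order_trans[OF l2_coord[OF w0' f[of n]] B[of n]] .
    thus ?thesis using w'[of k] by (simp add: pos_le_divide_eq mult.commute)
  qed
  then obtain r g where r: "strict_mono (r :: nat \<Rightarrow> nat)" and g: "\<And>k. (\<lambda>n. f (r n) k) \<longlonglongrightarrow> g k"
    using coordwise_subseq[of f "\<lambda>k. B / sqrt (w' k)"] by blast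
  have g': "l2s w' g \<and> l2n w' g \<le> B"
  proof (rule l2_of_partial[OF w0' B0])
    fix j
    have lim: "(\<lambda>n. \<Sum>k<j. w' k * (cmod (f (r n) k))\<^sup>2) \<longlonglongrightarrow> (\<Sum>k<j. w' k * (cmod (g k))\<^sup>2)"
      by (intro tendsto_intros g)
    have "(\<Sum>k<j. w' k * (cmod (f (r n) k))\<^sup>2) \<le> B\<^sup>2" for n
      using l2_partial[OF w0' f[of "r n"], of j] power_mono[OF B[of "r n"] l2n_nonneg[OF w0' f[of "r n"]], of 2] by linarith
    thus "(\<Sum>k<j. w' k * (cmod (g k))\<^sup>2) \<le> B\<^sup>2"
      by (intro LIMSEQ_le_const2[OF lim]) blast
  qed
  \<comment> \<open>The radius 2B fits the differences of the extracted sequence and its limit, both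
    of which have norm at most B.\<close>
  have tail: "\<exists>N. \<forall>h. l2s w' h \<longrightarrow> l2n w' h \<le> 2*B \<longrightarrow>
      l2s w h \<and> (l2n w h)\<^sup>2 \<le> (\<Sum>k<N. w k * (cmod (h k))\<^sup>2) + e" if e: "e > 0" for e
  proof -
    \<comment> \<open>Since the norm of h is at most 2B, e' times its square stays below e; the
      summand 1 guards against B = 0.\<close>
    define e' where "e' = e / (4*B\<^sup>2 + 1)"
    have e'0: "e' > 0" unfolding e'_def using e by (intro divide_pos_pos) (auto intro: add_nonneg_pos)
    have e'B: "e' * (4*B\<^sup>2) \<le> e"
    proof -
      have "4*B\<^sup>2 + 1 > 0" by (intro add_nonneg_pos) auto
      moreover have "e * (4*B\<^sup>2) \<le> e * (4*B\<^sup>2+1)" using e by simp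
      ultimately show ?thesis unfolding e'_def by (simp add: field_simps)
    qed
    from ratio[OF e'0] obtain N where N: "\<And>k. k \<ge> N \<Longrightarrow> w k \<le> e' * w' k" by blast
    show ?thesis
    proof (intro exI[of _ N] allI impI)
      fix h assume h: "l2s w' h" "l2n w' h \<le> 2*B"
      define Q where "Q = (\<Sum>k<N. w k * (cmod (h k))\<^sup>2) + e"
      have Q0: "Q \<ge> 0" unfolding Q_def using e w0 by (intro add_nonneg_nonneg sum_nonneg) auto
      have "l2s w h \<and> l2n w h \<le> sqrt Q"
      proof (rule l2_of_partial[OF w0])
        show "sqrt Q \<ge> 0" using Q0 by simp
        fix n
        have "(\<Sum>k<n. w k * (cmod (h k))\<^sup>2) \<le> (\<Sum>k<N+n. w k * (cmod (h k))\<^sup>2)"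
          by (rule sum_mono2) (use w0 in auto)
        also have "\<dots> = (\<Sum>k<N. w k * (cmod (h k))\<^sup>2) + (\<Sum>k\<in>{N..<N+n}. w k * (cmod (h k))\<^sup>2)"
          by (subst sum.union_disjoint[symmetric]) (auto intro!: sum.cong)
        also have "(\<Sum>k\<in>{N..<N+n}. w k * (cmod (h k))\<^sup>2) \<le> (\<Sum>k\<in>{N..<N+n}. e' * (w' k * (cmod (h k))\<^sup>2))"
        proof (rule sum_mono)
          fix k assume "k \<in> {N..<N+n}"
          hence "w k * (cmod (h k))\<^sup>2 \<le> (e' * w' k) * (cmod (h k))\<^sup>2" by (intro mult_right_mono N) auto
          thus "w k * (cmod (h k))\<^sup>2 \<le> e' * (w' k * (cmod (h k))\<^sup>2)" by (simp add: mult_ac)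
        qed
        also have "\<dots> \<le> (\<Sum>k<N+n. e' * (w' k * (cmod (h k))\<^sup>2))"
          by (rule sum_mono2) (use w0' e'0 in auto)
        also have "\<dots> = e' * (\<Sum>k<N+n. (w' k * (cmod (h k))\<^sup>2))" by (simp add: sum_distrib_left)
        also have "\<dots> \<le> e' * (l2n w' h)\<^sup>2" by (intro mult_left_mono l2_partial w0' h) (use e'0 in auto)
        also have "\<dots> \<le> e' * (2*B)\<^sup>2" using h l2n_nonneg[OF w0' h(1)] e'0 by (intro mult_left_mono power_mono) auto
        also have "\<dots> \<le> e" using e'B by (simp add: power_mult_distrib)
        finally show "(\<Sum>k<n. w k * (cmod (h k))\<^sup>2) \<le> (sqrt Q)\<^sup>2" using Q0 by (simp add: Q_def)
      qed
      moreover from this have "(l2n w h)\<^sup>2 \<le> (sqrt Q)\<^sup>2" using l2n_nonneg[OF w0, where f=h] by (intro power_mono) auto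
      ultimately show "l2s w h \<and> (l2n w h)\<^sup>2 \<le> (\<Sum>k<N. w k * (cmod (h k))\<^sup>2) + e" using Q0 by (simp add: Q_def)
    qed
  qed
  have d: "l2s w' (\<lambda>k. f (r n) k - g k)" "l2n w' (\<lambda>k. f (r n) k - g k) \<le> 2*B" for n
    using l2_diff[OF w0' f[of "r n"], where g=g] g' B[of "r n"] by auto
  have gw: "l2s w g" using tail[of 1] g' B0 by auto
  have lim2: "(\<lambda>n. (l2n w (\<lambda>k. f (r n) k - g k))\<^sup>2) \<longlonglongrightarrow> 0"
  proof (rule LIMSEQ_I)
    fix e :: real assume e: "e > 0"
    then obtain N where N: "\<forall>h. l2s w' h \<longrightarrow> l2n w' h \<le> 2*B \<longrightarrow>
      l2s w h \<and> (l2n w h)\<^sup>2 \<le> (\<Sum>k<N. w k * (cmod (h k))\<^sup>2) + e/2" using tail[of "e/2"] by auto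
    have "(\<lambda>n. \<Sum>k<N. w k * (cmod (f (r n) k - g k))\<^sup>2) \<longlonglongrightarrow> (\<Sum>k<N. w k * (cmod (g k - g k))\<^sup>2)"
      by (intro tendsto_intros g)
    hence "(\<lambda>n. \<Sum>k<N. w k * (cmod (f (r n) k - g k))\<^sup>2) \<longlonglongrightarrow> 0" by simp
    from LIMSEQ_D[OF this, of "e/2"] e obtain M where M: "\<And>n. n \<ge> M \<Longrightarrow> norm (\<Sum>k<N. w k * (cmod (f (r n) k - g k))\<^sup>2) < e/2" by auto
    show "\<exists>no. \<forall>n\<ge>no. norm ((l2n w (\<lambda>k. f (r n) k - g k))\<^sup>2 - 0) < e"
    proof (intro exI[of _ M] allI impI)
      fix n assume "n \<ge> M"
      from M[OF this] have "(\<Sum>k<N. w k * (cmod (f (r n) k - g k))\<^sup>2) < e/2" by (simp add: abs_less_iff)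
      moreover have "(l2n w (\<lambda>k. f (r n) k - g k))\<^sup>2 \<le> (\<Sum>k<N. w k * (cmod (f (r n) k - g k))\<^sup>2) + e/2"
        using N d[of n] by blast
      ultimately show "norm ((l2n w (\<lambda>k. f (r n) k - g k))\<^sup>2 - 0) < e" by simp
    qed
  qed
  have ds: "l2s w (\<lambda>k. f (r n) k - g k)" for n using tail[of 1] d[of n] by auto
  have "(\<lambda>n. l2n w (\<lambda>k. f (r n) k - g k)) \<longlonglongrightarrow> 0"
    using tendsto_real_sqrt[OF lim2] l2n_nonneg[OF w0 ds] by simp
  thus ?thesis using r g g' gw by blast
qed

text \<open>Hilbert-Schmidt criterion between weighted spaces: \<open>B j\<close> bounds the
  weighted square norm of column j, and the sum of \<open>B j / w' j\<close> bounds the square of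
  the Hilbert-Schmidt norm. Rows are estimated by Cauchy-Schwarz, and the resulting double sum is
  evaluated column by column, the columns being what has explicit bounds for the primitive.\<close>

lemma l2_matrix:
  fixes A :: "nat \<Rightarrow> nat \<Rightarrow> complex"
  assumes w: "\<And>k. w k > 0" and w': "\<And>k. w' k > 0" and f: "l2s w' f"
    and AB: "\<And>j N. (\<Sum>k<N. w k * (cmod (A k j))\<^sup>2) \<le> B j"
    and B: "summable (\<lambda>j. B j / w' j)" "(\<Sum>j. B j / w' j) \<le> c\<^sup>2" and c: "c \<ge> 0"
  shows "(\<forall>k. summable (\<lambda>j. A k j * f j)) \<and> l2s w (\<lambda>k. \<Sum>j. A k j * f j) \<and>
     l2n w (\<lambda>k. \<Sum>j. A k j * f j) \<le> c * l2n w' f"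
proof -
  have w0: "\<And>k. w k \<ge> 0" and w0': "\<And>k. w' k \<ge> 0" "\<And>k. 1 / w' k \<ge> 0"
    using w w' by (auto simp: less_imp_le)
  have A1: "w k * (cmod (A k j))\<^sup>2 \<le> B j" for k j
  proof -
    have "w k * (cmod (A k j))\<^sup>2 \<le> (\<Sum>k<Suc k. w k * (cmod (A k j))\<^sup>2)"
      by (rule member_le_sum[of k]) (use w0 in auto)
    with AB[where N="Suc k" and j=j] show ?thesis by linarith
  qed
  have As: "l2s (\<lambda>j. 1 / w' j) (A k)" for k
    unfolding l2s_def
  proof (rule summable_comparison_test'[where N=0])
    show "summable (\<lambda>j. inverse (w k) * (B j / w' j))" by (rule summable_mult[OF B(1)])
    fix j
    have "(cmod (A k j))\<^sup>2 \<le> inverse (w k) * B j" using A1[of k j] w[of k] by (simp add: field_simps)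
    hence "(cmod (A k j))\<^sup>2 / w' j \<le> inverse (w k) * B j / w' j" using w'[of j] by (intro divide_right_mono) auto
    thus "norm (1 / w' j * (cmod (A k j))\<^sup>2) \<le> inverse (w k) * (B j / w' j)" using w0'[of j] by simp
  qed
  have CS: "summable (\<lambda>j. cmod (f j * A k j)) \<and> (\<Sum>j. cmod (f j * A k j)) \<le> l2n w' f * l2n (\<lambda>j. 1 / w' j) (A k)
     \<and> cmod (\<Sum>j. f j * A k j) \<le> l2n w' f * l2n (\<lambda>j. 1 / w' j) (A k)" for k
    by (rule l2_CS) (fact w' f As)+
  have sum: "summable (\<lambda>j. A k j * f j)" for k
    using CS[of k] unfolding mult.commute[of "f _"] by (blast intro: summable_norm_cancel)
  have bd: "cmod (\<Sum>j. A k j * f j) \<le> l2n w' f * l2n (\<lambda>j. 1 / w' j) (A k)" for k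
    using CS[of k] unfolding mult.commute[of "f _"] by blast
  have "l2s w (\<lambda>k. \<Sum>j. A k j * f j) \<and> l2n w (\<lambda>k. \<Sum>j. A k j * f j) \<le> c * l2n w' f"
  proof (rule l2_of_partial[OF w0])
    show "0 \<le> c * l2n w' f" using c l2n_nonneg[OF w0'(1) f] by simp
    fix n
    have sA: "summable (\<lambda>j. w k * (1 / w' j * (cmod (A k j))\<^sup>2))" for k
      using As[of k] unfolding l2s_def by (rule summable_mult)
    have "(\<Sum>k<n. w k * (cmod (\<Sum>j. A k j * f j))\<^sup>2) \<le> (\<Sum>k<n. (l2n w' f)\<^sup>2 * (w k * (l2n (\<lambda>j. 1 / w' j) (A k))\<^sup>2))"
    proof (rule sum_mono)
      fix k
      have "(cmod (\<Sum>j. A k j * f j))\<^sup>2 \<le> (l2n w' f * l2n (\<lambda>j. 1 / w' j) (A k))\<^sup>2"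
        by (rule power_mono[OF bd]) simp
      hence "w k * (cmod (\<Sum>j. A k j * f j))\<^sup>2 \<le> w k * (l2n w' f * l2n (\<lambda>j. 1 / w' j) (A k))\<^sup>2"
        by (rule mult_left_mono) (rule w0)
      thus "w k * (cmod (\<Sum>j. A k j * f j))\<^sup>2 \<le> (l2n w' f)\<^sup>2 * (w k * (l2n (\<lambda>j. 1 / w' j) (A k))\<^sup>2)"
        by (simp add: power_mult_distrib mult_ac)
    qed
    also have "\<dots> = (l2n w' f)\<^sup>2 * (\<Sum>k<n. w k * (l2n (\<lambda>j. 1 / w' j) (A k))\<^sup>2)" by (simp add: sum_distrib_left)
    also have "(\<Sum>k<n. w k * (l2n (\<lambda>j. 1 / w' j) (A k))\<^sup>2) = (\<Sum>k<n. \<Sum>j. w k * (1 / w' j * (cmod (A k j))\<^sup>2))"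
    proof (rule sum.cong[OF refl])
      fix k
      show "w k * (l2n (\<lambda>j. 1 / w' j) (A k))\<^sup>2 = (\<Sum>j. w k * (1 / w' j * (cmod (A k j))\<^sup>2))"
        unfolding l2n_sq[OF w0'(2) As] by (rule suminf_mult[symmetric]) (use As in \<open>simp add: l2s_def\<close>)
    qed
    \<comment> \<open>Only a finite sum over rows is exchanged with the infinite sum over columns,
      so summability of each row suffices.\<close>
    also have "\<dots> = (\<Sum>j. \<Sum>k<n. w k * (1 / w' j * (cmod (A k j))\<^sup>2))"
      by (rule suminf_sum[symmetric]) (rule sA)
    also have "\<dots> \<le> (\<Sum>j. B j / w' j)"
    proof (rule suminf_le[OF _ summable_sum B(1)])
      show "\<And>k. summable (\<lambda>j. w k * (1 / w' j * (cmod (A k j))\<^sup>2))" by (rule sA)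
      fix j
      have "(\<Sum>k<n. w k * (1 / w' j * (cmod (A k j))\<^sup>2)) = (\<Sum>k<n. w k * (cmod (A k j))\<^sup>2) / w' j"
        by (simp add: sum_divide_distrib)
      also have "\<dots> \<le> B j / w' j" using AB[where N=n and j=j] w'[of j] by (intro divide_right_mono) auto
      finally show "(\<Sum>k<n. w k * (1 / w' j * (cmod (A k j))\<^sup>2)) \<le> B j / w' j" .
    qed
    also have "(\<Sum>j. B j / w' j) \<le> c\<^sup>2" by (rule B)
    also have "(l2n w' f)\<^sup>2 * c\<^sup>2 = (c * l2n w' f)\<^sup>2" by (simp add: power_mult_distrib)
    finally show "(\<Sum>k<n. w k * (cmod (\<Sum>j. A k j * f j))\<^sup>2) \<le> (c * l2n w' f)\<^sup>2"
      by (simp add: mult_left_mono)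
  qed
  with sum show ?thesis by blast
qed

section \<open>Power weights and the lattice sums behind the integration kernel\<close>

lemma powr_ratio_le:
  fixes x y M s :: real
  assumes "x > 0" "y > 0" "M \<ge> 1" "x \<le> M * y" "y \<le> M * x"
  shows "x powr s \<le> M powr \<bar>s\<bar> * y powr s"
proof (cases "s \<ge> 0")
  case True
  have "x powr s \<le> (M * y) powr s" using assms True by (intro powr_mono2) auto
  thus ?thesis using True assms by (simp add: powr_mult)
next
  case False
  have "(M * x) powr s \<le> y powr s" using assms False by (intro powr_mono2') auto
  hence "M powr s * x powr s \<le> y powr s" using assms by (simp add: powr_mult)
  hence "M powr (-s) * (M powr s * x powr s) \<le> M powr (-s) * y powr s" by (intro mult_left_mono) auto
  moreover have "M powr (-s) * (M powr s * x powr s) = x powr s"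
    using assms by (simp add: powr_minus field_simps)
  ultimately show ?thesis using False by simp
qed

lemma zabs2_nonneg: "zabs2 \<zeta> \<ge> 0" by (simp add: zabs2_def)
lemma zabs_nonneg: "zabs \<zeta> \<ge> 0" by (simp add: zabs_def zabs2_nonneg)
lemma zabs_sq: "(zabs \<zeta>)\<^sup>2 = zabs2 \<zeta>" by (simp add: zabs_def zabs2_nonneg)
lemma bz_ge1: "bz \<zeta> \<ge> 1" by (simp add: bz_def zabs_nonneg)
lemma bz_sq_le: "(bz \<zeta>)\<^sup>2 \<le> 2 + 2 * zabs2 \<zeta>"
  using sum_squares_bound[of 1 "zabs \<zeta>"] by (simp add: bz_def power2_sum zabs_sq)
lemma bz_sq_ge: "1 + zabs2 \<zeta> \<le> (bz \<zeta>)\<^sup>2"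
  by (simp add: bz_def power2_sum zabs_sq zabs_nonneg)

lemma wt_pos: "\<nu> > 0 \<Longrightarrow> wt \<nu> s \<zeta> k > 0"
  using zabs2_nonneg[of \<zeta>] by (simp add: wt_def add_pos_nonneg add_nonneg_eq_0_iff add.assoc)
lemma wt_nonneg: "wt \<nu> s \<zeta> k \<ge> 0" by (simp add: wt_def)

text \<open>Passes from the weight of the norm to powers of k^2 + (1+|\<zeta>|)^2, the expression
  occurring in M_s. The constant is independent of \<zeta>; it comes from a two-sided comparison of
  the bases, which covers both signs of s.\<close>

lemma wt_equiv:
  assumes "\<nu> > 0"
  shows "\<exists>C\<ge>1. \<forall>\<zeta> k. wt \<nu> s \<zeta> k \<le> C * ((real k)\<^sup>2 + (bz \<zeta>)\<^sup>2) powr s \<and>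
      ((real k)\<^sup>2 + (bz \<zeta>)\<^sup>2) powr s \<le> C * wt \<nu> s \<zeta> k"
proof -
  \<comment> \<open>The factor 2 pays for (1+|\<zeta>|)^2 \<le> 2 + 2|\<zeta>|^2; the terms \<nu>
    and 1/\<nu> serve the two directions of the comparison.\<close>
  define M where "M = 2 * (1 + \<nu> + 1 / \<nu>)"
  have M1: "M \<ge> 1" "M \<ge> 2" "M \<ge> 2 * \<nu>" "M \<ge> 2/\<nu>" using assms by (auto simp: M_def)
  have Mv: "M * \<nu> \<ge> 2" using mult_right_mono[OF M1(4), of \<nu>] assms by simp
  show ?thesis
  proof (intro exI[of _ "M powr \<bar>s\<bar>"] conjI allI)
    show "1 \<le> M powr \<bar>s\<bar>" using M1 by (simp add: ge_one_powr_ge_zero)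
    fix \<zeta> k
    let ?y = "1 + \<nu> * real k ^ 2 + \<nu> * zabs2 \<zeta>" and ?x = "(real k)\<^sup>2 + (bz \<zeta>)\<^sup>2"
    have y0: "?y > 0" using assms zabs2_nonneg[of \<zeta>] by (intro add_pos_nonneg) auto
    have x0: "?x > 0" using bz_ge1[of \<zeta>] by (intro add_nonneg_pos) auto
    have a: "\<nu> * real k ^ 2 \<le> M * real k ^ 2" using M1 assms by (intro mult_right_mono) auto
    have b: "\<nu> * zabs2 \<zeta> \<le> M * zabs2 \<zeta>" using M1 assms zabs2_nonneg by (intro mult_right_mono) auto
    have "?y \<le> M * (1 + (real k)\<^sup>2 + zabs2 \<zeta>)" using a b M1 by (simp add: distrib_left)
    also have "\<dots> \<le> M * ?x" using bz_sq_ge[of \<zeta>] M1 by (intro mult_left_mono) auto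
    finally have yx: "?y \<le> M * ?x" .
    have c: "real k ^ 2 * 1 \<le> real k ^ 2 * (M * \<nu>)" using Mv by (intro mult_left_mono) auto
    have d: "zabs2 \<zeta> * 2 \<le> zabs2 \<zeta> * (M * \<nu>)" using Mv zabs2_nonneg by (intro mult_left_mono) auto
    have "?x \<le> M * ?y" using c d bz_sq_le[of \<zeta>] M1(2) by (simp add: algebra_simps)
    with yx show "wt \<nu> s \<zeta> k \<le> M powr \<bar>s\<bar> * ?x powr s" "?x powr s \<le> M powr \<bar>s\<bar> * wt \<nu> s \<zeta> k"
      unfolding wt_def using powr_ratio_le x0 y0 M1(1) by auto
  qed
qed

text \<open>Convergence rests on 2\<sigma> - 2 < -1. For \<sigma> > 0 the dependence on x is
  factored out through k^2 + x \<le> 2 k^2 x, valid as both numbers are at least 1; for \<sigma>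
  \<le> 0 the weight is at most x^\<sigma>. The term k = 0 vanishes by the convention for division
  by zero.\<close>

lemma sum_inv_square_weight:
  assumes "\<sigma> < 1/2"
  shows "\<exists>C\<ge>0. \<forall>x\<ge>1. \<forall>N. (\<Sum>k<N. ((real k)\<^sup>2 + x) powr \<sigma> / (real k)\<^sup>2) \<le> C * x powr \<sigma>"
proof -
  define q where "q = max 0 \<sigma>"
  have q: "q \<ge> 0" "q \<ge> \<sigma>" "2 * q - 2 < -1" "q \<le> 1" using assms by (auto simp: q_def)
  have s: "summable (\<lambda>k. real k powr (2*q - 2))" using q by (simp add: summable_real_powr_iff)
  let ?C = "2 * (\<Sum>k. real k powr (2*q - 2))"
  show ?thesis
  proof (intro exI[of _ ?C] conjI allI impI)
    show "0 \<le> ?C" using suminf_nonneg[OF s] by simp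
    fix x :: real and N assume x: "x \<ge> 1"
    have pt: "((real k)\<^sup>2 + x) powr \<sigma> / (real k)\<^sup>2 \<le> (2 * x powr \<sigma>) * real k powr (2*q - 2)" for k
    proof (cases "k = 0")
      case False
      hence k: "real k \<ge> 1" by simp
      hence k2: "(real k)\<^sup>2 \<ge> 1" by simp
      have "((real k)\<^sup>2 + x) powr \<sigma> \<le> x powr \<sigma> * (2 * (real k)\<^sup>2) powr q"
      proof (cases "\<sigma> \<le> 0")
        case True
        hence "q = 0" by (simp add: q_def)
        moreover have "((real k)\<^sup>2 + x) powr \<sigma> \<le> x powr \<sigma>" using True x by (intro powr_mono2') auto
        ultimately show ?thesis using k by simp
      next
        case False
        hence "q = \<sigma>" by (simp add: q_def)
        have "(real k)\<^sup>2 * 1 \<le> (real k)\<^sup>2 * x" by (rule mult_left_mono) (use x in auto)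
        moreover have "1 * x \<le> (real k)\<^sup>2 * x" by (rule mult_right_mono) (use x k2 in auto)
        ultimately have "(real k)\<^sup>2 + x \<le> x * (2 * (real k)\<^sup>2)" by (simp add: algebra_simps)
        hence "((real k)\<^sup>2 + x) powr \<sigma> \<le> (x * (2 * (real k)\<^sup>2)) powr \<sigma>" using False x by (intro powr_mono2) auto
        thus ?thesis using x \<open>q = \<sigma>\<close> by (simp add: powr_mult)
      qed
      also have "(2 * (real k)\<^sup>2) powr q = 2 powr q * real k powr (2*q)"
      proof -
        have "(real k powr 2) powr q = real k powr (2 * q)" by (rule powr_powr)
        hence "((real k)\<^sup>2) powr q = real k powr (2 * q)" using k by simp
        thus ?thesis by (simp add: powr_mult)
      qed
      also have "x powr \<sigma> * (2 powr q * real k powr (2*q)) \<le> x powr \<sigma> * (2 * real k powr (2*q))"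
        using powr_mono[OF q(4), of 2] by (intro mult_left_mono mult_right_mono) auto
      finally have "((real k)\<^sup>2 + x) powr \<sigma> / (real k)\<^sup>2 \<le> x powr \<sigma> * (2 * real k powr (2*q)) / (real k)\<^sup>2"
        by (rule divide_right_mono) auto
      also have "\<dots> = (2 * x powr \<sigma>) * real k powr (2*q - 2)" using k by (simp add: powr_diff)
      finally show ?thesis .
    qed auto
    have "(\<Sum>k<N. ((real k)\<^sup>2 + x) powr \<sigma> / (real k)\<^sup>2) \<le> (\<Sum>k<N. (2 * x powr \<sigma>) * real k powr (2*q - 2))"
      by (rule sum_mono) (rule pt)
    also have "\<dots> = (2 * x powr \<sigma>) * (\<Sum>k<N. real k powr (2*q - 2))" by (simp add: sum_distrib_left)
    also have "\<dots> \<le> (2 * x powr \<sigma>) * (\<Sum>k. real k powr (2*q - 2))"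
      by (intro mult_left_mono sum_le_suminf s) auto
    finally show "(\<Sum>k<N. ((real k)\<^sup>2 + x) powr \<sigma> / (real k)\<^sup>2) \<le> ?C * x powr \<sigma>" by (simp add: mult_ac)
  qed
qed

text \<open>Moving the weight from k to j costs a power of 1+|k-j|, as in Peetre's inequality. For
  negative \<sigma> the loss occurs when j is large compared with k, and there the factor
  k^2/(k+j)^2 of the kernel gives two powers back. This is why \<tau> only has to dominate
  -2\<sigma>-2 and not -2\<sigma>.\<close>

lemma weight_kernel_pointwise:
  fixes x \<sigma> \<tau> :: real
  assumes x: "x \<ge> 1" and k: "k \<ge> 1" and j: "j \<ge> 1" and kj: "k \<noteq> j"
    and t: "\<tau> \<ge> 0" "\<tau> \<ge> 2 * \<sigma>" "\<tau> \<ge> - 2 * \<sigma> - 2"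
  shows "((real k)\<^sup>2 + x) powr \<sigma> * ((real k)\<^sup>2 / ((real k + real j)\<^sup>2 * (real k - real j)\<^sup>2))
    \<le> ((real j)\<^sup>2 + x) powr \<sigma> * ((1 + \<bar>real k - real j\<bar>) powr \<tau> / (real k - real j)\<^sup>2)"
proof -
  define m where "m = \<bar>real k - real j\<bar>"
  have m1: "m \<ge> 1" unfolding m_def using kj by linarith
  have m2: "(real k - real j)\<^sup>2 = m\<^sup>2" by (simp add: m_def)
  have k1: "real k \<ge> 1" and j1: "real j \<ge> 1" using k j by auto
  let ?A = "(real k)\<^sup>2 + x" and ?B = "(real j)\<^sup>2 + x" and ?q = "(real k)\<^sup>2 / (real k + real j)\<^sup>2"
  have pos: "?A > 0" "?B > 0" using x by (auto intro: add_nonneg_pos)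
  have main: "?A powr \<sigma> * ?q \<le> ?B powr \<sigma> * (1 + m) powr \<tau>"
  proof (cases "\<sigma> \<ge> 0")
    case True
    have "real k \<le> real j + m" by (simp add: m_def)
    also have "\<dots> \<le> real j * (1 + m)" using j1 m1 mult_right_mono[of 1 "real j" m] by (simp add: distrib_left)
    finally have "(real k)\<^sup>2 \<le> (real j * (1 + m))\<^sup>2" by (intro power_mono) auto
    moreover have "x * 1 \<le> x * (1+m)\<^sup>2" using x m1 by (intro mult_left_mono) auto
    ultimately have "?A \<le> ?B * (1 + m)\<^sup>2" by (simp add: power_mult_distrib distrib_right)
    hence "?A powr \<sigma> \<le> (?B * (1 + m)\<^sup>2) powr \<sigma>" using pos True by (intro powr_mono2) auto
    also have "\<dots> = ?B powr \<sigma> * ((1 + m) powr 2) powr \<sigma>" using m1 by (simp add: powr_mult)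
    also have "\<dots> = ?B powr \<sigma> * (1 + m) powr (2*\<sigma>)" by (simp add: powr_powr)
    also have "\<dots> \<le> ?B powr \<sigma> * (1 + m) powr \<tau>" using t m1 by (intro mult_left_mono powr_mono) auto
    finally have "?A powr \<sigma> \<le> ?B powr \<sigma> * (1 + m) powr \<tau>" .
    moreover have "?q \<le> 1" using k1 j1 by (simp add: divide_le_eq_1)
    ultimately have "?A powr \<sigma> * ?q \<le> (?B powr \<sigma> * (1 + m) powr \<tau>) * 1" by (intro mult_mono) auto
    thus ?thesis by simp
  next
    case False
    \<comment> \<open>r measures by how much j exceeds k. The loss in the weight and the gain in the
      kernel are both powers of r, and r \<le> 1+|k-j|.\<close>
    define r where "r = max 1 (real j / real k)"
    have r: "r \<ge> 1" "real j \<le> r * real k" using k1 by (auto simp: r_def max_def field_simps)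
    have rm: "r \<le> 1 + m"
    proof -
      have "real j \<le> real k + m" by (simp add: m_def)
      also have "\<dots> \<le> real k * (1 + m)" using k1 m1 mult_right_mono[of 1 "real k" m] by (simp add: distrib_left)
      finally have "real j / real k \<le> 1 + m" using k1 by (simp add: field_simps)
      thus ?thesis using m1 by (simp add: r_def)
    qed
    have "(real j)\<^sup>2 \<le> (r * real k)\<^sup>2" using r by (intro power_mono) auto
    moreover have "x * 1 \<le> x * r\<^sup>2" using x r by (intro mult_left_mono) auto
    ultimately have "?B \<le> ?A * r\<^sup>2" by (simp add: power_mult_distrib algebra_simps)
    hence "(?A * r\<^sup>2) powr \<sigma> \<le> ?B powr \<sigma>" using pos False by (intro powr_mono2') auto
    moreover have "(?A * r\<^sup>2) powr \<sigma> = ?A powr \<sigma> * (r powr 2) powr \<sigma>" using r by (simp add: powr_mult)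
    ultimately have 1: "?A powr \<sigma> * r powr (2*\<sigma>) \<le> ?B powr \<sigma>" by (simp add: powr_powr)
    have "r * real k \<le> real k + real j" using k1 j1 by (auto simp: r_def max_def field_simps)
    hence "real k / (real k + real j) \<le> 1 / r" using r k1 j1 by (simp add: field_simps)
    hence "(real k / (real k + real j))\<^sup>2 \<le> (1/r)\<^sup>2" by (intro power_mono) auto
    moreover have "(1/r)\<^sup>2 = r powr (-2)" using r by (simp add: powr_minus power_divide divide_inverse power_inverse)
    ultimately have 2: "?q \<le> r powr (-2)" by (simp add: power_divide)
    have "?A powr \<sigma> * ?q \<le> ?A powr \<sigma> * r powr (-2)" by (rule mult_left_mono[OF 2]) simp
    also have "\<dots> = (?A powr \<sigma> * r powr (2*\<sigma>)) * r powr (-2*\<sigma> - 2)"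
      using r by (simp add: mult.assoc flip: powr_add)
    also have "\<dots> \<le> ?B powr \<sigma> * (1+m) powr \<tau>"
    proof (rule mult_mono[OF 1])
      have "r powr (-2*\<sigma> - 2) \<le> r powr \<tau>" using r t by (intro powr_mono) auto
      also have "\<dots> \<le> (1+m) powr \<tau>" using r rm t by (intro powr_mono2) auto
      finally show "r powr (-2*\<sigma> - 2) \<le> (1+m) powr \<tau>" .
    qed auto
    finally show ?thesis .
  qed
  have "?A powr \<sigma> * ?q / m\<^sup>2 \<le> ?B powr \<sigma> * (1 + m) powr \<tau> / m\<^sup>2"
    by (rule divide_right_mono[OF main]) simp
  thus ?thesis unfolding m2 by (simp flip: m_def)
qed

text \<open>Each distance |k-j| occurs at most twice, once on either side of j. The indices below j
  are reversed through j - Suc k, and the distance of k from j is this number plus 1.\<close>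

lemma sum_shifted_le:
  fixes h :: "real \<Rightarrow> real"
  assumes h0: "\<And>x. h x \<ge> 0" and s: "summable (\<lambda>m. h (real m))"
  shows "(\<Sum>k<N. h \<bar>real k - real j\<bar>) \<le> 2 * (\<Sum>m. h (real m))"
proof -
  have "(\<Sum>k<N. h \<bar>real k - real j\<bar>) \<le> (\<Sum>k<j+N. h \<bar>real k - real j\<bar>)"
    by (rule sum_mono2) (use h0 in auto)
  also have "\<dots> = (\<Sum>k<j. h \<bar>real k - real j\<bar>) + (\<Sum>k\<in>{j..<j+N}. h \<bar>real k - real j\<bar>)"
    by (subst sum.union_disjoint[symmetric]) (auto intro!: sum.cong)
  also have "(\<Sum>k\<in>{j..<j+N}. h \<bar>real k - real j\<bar>) = (\<Sum>k<N. h (real k))"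
    using sum.shift_bounds_nat_ivl[of "\<lambda>k. h \<bar>real k - real j\<bar>" 0 j N] by (simp add: atLeast0LessThan add.commute)
  also have "\<dots> \<le> (\<Sum>m. h (real m))" by (intro sum_le_suminf s) (use h0 in auto)
  also have "(\<Sum>k<j. h \<bar>real k - real j\<bar>) = (\<Sum>k<j. h (real (j - Suc k) + 1))"
    by (rule sum.cong) (auto simp: of_nat_diff)
  also have "\<dots> = (\<Sum>k<j. h (real (Suc k)))"
    using sum.nat_diff_reindex[of "\<lambda>k. h (real k + 1)" j] by (simp add: add.commute)
  also have "\<dots> \<le> (\<Sum>m. h (real (Suc m)))"
    by (intro sum_le_suminf) (use h0 s in \<open>auto simp: summable_Suc_iff[of "\<lambda>m. h (real m)"] simp del: of_nat_Suc\<close>)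
  also have "\<dots> \<le> (\<Sum>m. h (real m))"
    using suminf_split_head[OF s] h0[of 0] by simp
  finally show ?thesis by simp
qed

text \<open>Both ends of the interval for \<sigma> enter here: the sum of m^(\<tau>-2) converges for
  \<tau> < 1, and \<tau> has to dominate 2\<sigma> and -2\<sigma>-2. The diagonal k = j contributes
  0 by division by zero, in accordance with the diagonal integral in
  \<open>has_integral_cos_sin\<close>.\<close>

lemma sum_kernel_weight:
  assumes "- 3/2 < \<sigma>" "\<sigma> < 1/2"
  shows "\<exists>C\<ge>0. \<forall>x\<ge>1. \<forall>N. \<forall>j\<ge>1. (\<Sum>k<N. ((real k)\<^sup>2 + x) powr \<sigma> *
      ((real k)\<^sup>2 / ((real k + real j)\<^sup>2 * (real k - real j)\<^sup>2))) \<le> C * ((real j)\<^sup>2 + x) powr \<sigma>"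
proof -
  define \<tau> where "\<tau> = max 0 (max (2*\<sigma>) (-2*\<sigma>-2))"
  have t: "\<tau> \<ge> 0" "\<tau> \<ge> 2 * \<sigma>" "\<tau> \<ge> - 2 * \<sigma> - 2" "\<tau> - 2 < -1" "\<tau> \<le> 1" using assms by (auto simp: \<tau>_def)
  define h where "h y = (1 + y) powr \<tau> / y\<^sup>2" for y :: real
  have h0: "h y \<ge> 0" for y by (simp add: h_def)
  have s: "summable (\<lambda>m. h (real m))"
  proof (rule summable_comparison_test'[where N=0])
    show "summable (\<lambda>m. 2 * real m powr (\<tau> - 2))" using t by (intro summable_mult) (simp add: summable_real_powr_iff)
    fix m
    show "norm (h (real m)) \<le> 2 * real m powr (\<tau> - 2)"
    proof (cases "m = 0")
      case False
      have "(1 + real m) powr \<tau> \<le> (2 * real m) powr \<tau>" using False t by (intro powr_mono2) auto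
      also have "\<dots> = 2 powr \<tau> * real m powr \<tau>" by (simp add: powr_mult)
      also have "\<dots> \<le> 2 * real m powr \<tau>" using powr_mono[OF t(5), of 2] by (intro mult_right_mono) auto
      finally have "(1 + real m) powr \<tau> / (real m)\<^sup>2 \<le> 2 * real m powr \<tau> / (real m)\<^sup>2" by (rule divide_right_mono) simp
      thus ?thesis using False by (simp add: h_def powr_diff)
    qed (simp add: h_def)
  qed
  let ?C = "2 * (\<Sum>m. h (real m))"
  show ?thesis
  proof (intro exI[of _ ?C] conjI allI impI)
    show "0 \<le> ?C" using suminf_nonneg[OF s] h0 by simp
    fix x :: real and N j :: nat assume x: "x \<ge> 1" and j: "j \<ge> 1"
    have "(\<Sum>k<N. ((real k)\<^sup>2 + x) powr \<sigma> * ((real k)\<^sup>2 / ((real k + real j)\<^sup>2 * (real k - real j)\<^sup>2)))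
      \<le> (\<Sum>k<N. ((real j)\<^sup>2 + x) powr \<sigma> * h \<bar>real k - real j\<bar>)"
    proof (rule sum_mono)
      fix k
      show "((real k)\<^sup>2 + x) powr \<sigma> * ((real k)\<^sup>2 / ((real k + real j)\<^sup>2 * (real k - real j)\<^sup>2))
        \<le> ((real j)\<^sup>2 + x) powr \<sigma> * h \<bar>real k - real j\<bar>"
        using weight_kernel_pointwise[OF x _ j _ t(1-3), of k] h0[of "\<bar>real k - real j\<bar>"]
        by (cases "k = 0"; cases "k = j") (auto simp: h_def)
    qed
    also have "\<dots> = ((real j)\<^sup>2 + x) powr \<sigma> * (\<Sum>k<N. h \<bar>real k - real j\<bar>)" by (simp add: sum_distrib_left)
    also have "\<dots> \<le> ((real j)\<^sup>2 + x) powr \<sigma> * ?C" by (intro mult_left_mono sum_shifted_le h0 s) auto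
    finally show "(\<Sum>k<N. ((real k)\<^sup>2 + x) powr \<sigma> * ((real k)\<^sup>2 / ((real k + real j)\<^sup>2 * (real k - real j)\<^sup>2)))
      \<le> ?C * ((real j)\<^sup>2 + x) powr \<sigma>" by (simp add: mult.commute)
  qed
qed

section \<open>The primitive in the sine basis\<close>

lemma ek_0: "ek a 0 = (\<lambda>z. 0)" by (simp add: ek_def fun_eq_iff)

lemma has_integral_ek:
  assumes "a > 0" "j \<ge> 1" "z \<ge> 0"
  shows "(ek a j has_integral sqrt (2/a) * (a / (real j * pi)) * (1 - cos (real j * pi * z / a))) {0..z}"
proof -
  have "((\<lambda>z. sqrt (2/a) * sin (real j * pi * z / a)) has_integral
     (- sqrt (2/a) * (a / (real j * pi)) * cos (real j * pi * z / a)) -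
     (- sqrt (2/a) * (a / (real j * pi)) * cos (real j * pi * 0 / a))) {0..z}"
    using assms by (intro fundamental_theorem_of_calculus)
      (auto intro!: derivative_eq_intros simp: has_real_derivative_iff_has_vector_derivative[symmetric] field_simps)
  moreover have "sqrt (2/a) * (a / (real j * pi)) * (1 - cos (real j * pi * z / a)) =
     (- sqrt (2/a) * (a / (real j * pi)) * cos (real j * pi * z / a)) -
     (- sqrt (2/a) * (a / (real j * pi)) * cos (real j * pi * 0 / a))"
    by (simp add: right_diff_distrib)
  ultimately show ?thesis unfolding ek_def by simp
qed

lemma one_c_eq:
  assumes "a > 0" "k \<ge> 1"
  shows "one_c a k = complex_of_real (sqrt (2/a) * (a / (real k * pi)) * (1 - cos (real k * pi)))"
  using integral_unique[OF has_integral_ek[OF assms, of a]] assms by (simp add: one_c_def)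

lemma one_c_0: "one_c a 0 = 0" by (simp add: one_c_def)

lemma one_c_real: "one_c a k = complex_of_real (Re (one_c a k))"
  by (simp add: one_c_def)

lemma one_c_bound:
  assumes "a > 0"
  shows "cmod (one_c a k) \<le> 2 * sqrt (2/a) * (a / pi) / real k"
proof (cases "k = 0")
  case False
  have "\<bar>1 - cos (real k * pi)\<bar> \<le> 2" using cos_ge_minus_one[of "real k * pi"] cos_le_one[of "real k * pi"] by linarith
  hence "\<bar>sqrt (2/a) * (a / (real k * pi))\<bar> * \<bar>1 - cos (real k * pi)\<bar> \<le> \<bar>sqrt (2/a) * (a / (real k * pi))\<bar> * 2"
    by (intro mult_left_mono) auto
  moreover have "cmod (one_c a k) = \<bar>sqrt (2/a) * (a / (real k * pi))\<bar> * \<bar>1 - cos (real k * pi)\<bar>"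
    using False assms by (subst one_c_eq) (auto simp only: norm_of_real abs_mult)
  ultimately show ?thesis using False assms by (simp add: field_simps)
qed (simp add: one_c_0)

lemma one_c_1:
  assumes "a > 0"
  shows "Re (one_c a 1) > 0"
  using assms by (simp add: one_c_eq)

lemma primM_0: "primM a k 0 = 0" by (simp add: primM_def ek_0)

text \<open>k-j and k+j have the same parity, so the two cosines produced by the product formula
  agree at the right end point.\<close>

lemma cos_nat_diff: "cos ((real k - real j) * pi) = cos ((real k + real j) * pi)"
proof -
  have "(real k - real j) * pi = (real k + real j) * pi - 2 * real j * pi" by (simp add: algebra_simps)
  thus ?thesis by (simp only: cos_diff cos_2npi sin_2npi)
qed

text \<open>The product formula turns the integrand into sines of the frequencies k+j and k-j. For k
  = j the stated value is 0 through division by zero, which is the true value, so one formula serves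
  all entries of the matrix of the primitive.\<close>

lemma has_integral_cos_sin:
  assumes a: "a > 0" and kj: "k \<ge> 1" "j \<ge> 1"
  shows "((\<lambda>z. cos (real j * pi * z / a) * sin (real k * pi * z / a)) has_integral
     (a / pi) * (1 - cos ((real k + real j) * pi)) * (real k / ((real k + real j) * (real k - real j)))) {0..a}"
proof (cases "k = j")
  case True
  have "((\<lambda>z. cos (real k * pi * z / a) * sin (real k * pi * z / a)) has_integral
     (a / (2 * real k * pi) * (sin (real k * pi * a / a))\<^sup>2) - (a / (2 * real k * pi) * (sin (real k * pi * 0 / a))\<^sup>2)) {0..a}"
    using a kj by (intro fundamental_theorem_of_calculus)
      (auto intro!: derivative_eq_intros simp: has_real_derivative_iff_has_vector_derivative[symmetric] field_simps power2_eq_square)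
  thus ?thesis using True a by simp
next
  case False
  define p m where "p = real k + real j" and "m = real k - real j"
  have pm: "p \<noteq> 0" "m \<noteq> 0" using False kj by (auto simp: p_def m_def)
  let ?F = "\<lambda>z. - (a / (2*pi)) * (cos (p * pi * z / a) / p + cos (m * pi * z / a) / m)"
  have I: "((\<lambda>z. cos (real j * pi * z / a) * sin (real k * pi * z / a)) has_integral ?F a - ?F 0) {0..a}"
  proof (rule fundamental_theorem_of_calculus)
    fix z assume "z \<in> {0..a}"
    have "(?F has_real_derivative (sin (p * pi * z / a) + sin (m * pi * z / a)) / 2) (at z within {0..a})"
      using a pm by (auto intro!: derivative_eq_intros simp: field_simps)
    also have "(sin (p * pi * z / a) + sin (m * pi * z / a)) / 2 = cos (real j * pi * z / a) * sin (real k * pi * z / a)"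
    proof -
      have "p * pi * z / a = real k * pi * z / a + real j * pi * z / a" "m * pi * z / a = real k * pi * z / a - real j * pi * z / a"
        by (simp_all add: p_def m_def algebra_simps add_divide_distrib diff_divide_distrib)
      thus ?thesis by (simp add: sin_add sin_diff)
    qed
    finally show "(?F has_vector_derivative cos (real j * pi * z / a) * sin (real k * pi * z / a)) (at z within {0..a})"
      by (simp add: has_real_derivative_iff_has_vector_derivative)
  qed (use a in auto)
  have E: "?F a - ?F 0 = (a / pi) * (1 - cos (p * pi)) * (real k / (p * m))"
  proof -
    have "1 / p + 1 / m = 2 * (real k / (p * m))" using pm by (simp add: field_simps) (simp add: p_def m_def)
    moreover have "?F a - ?F 0 = (a / (2*pi)) * (1 - cos (p * pi)) * (1 / p + 1 / m)"
    proof -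
      have ring: "- c * (C * P + C * M) - (- c * (P + M)) = c * (1 - C) * (P + M)" for c C P M :: real
        by (simp add: algebra_simps)
      have "cos (p * pi * a / a) / p = cos (p * pi) * (1/p)" "cos (m * pi * a / a) / m = cos (p * pi) * (1/m)"
        using a cos_nat_diff[of k j, folded p_def m_def] by simp_all
      moreover have "cos (p * pi * 0 / a) / p = 1 / p" "cos (m * pi * 0 / a) / m = 1 / m" by simp_all
      ultimately show ?thesis by (simp only: ring)
    qed
    ultimately show ?thesis by simp
  qed
  show ?thesis using I unfolding E unfolding p_def m_def .
qed

text \<open>The primitive of e_j is a multiple of 1 - cos(j pi z/a). The constant contributes the
  sine coefficients of 1, of size 1/k; the cosine contributes the kernel k/((k+j)(k-j)).\<close>

lemma primM_eq:
  assumes a: "a > 0" and kj: "k \<ge> 1" "j \<ge> 1"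
  shows "primM a k j = (2 / (real j * pi)) * ((a / (real k * pi)) * (1 - cos (real k * pi))
     - (a / pi) * (1 - cos ((real k + real j) * pi)) * (real k / ((real k + real j) * (real k - real j))))"
proof -
  define r where "r = sqrt (2/a)"
  have rr: "r * r = 2 / a" using a by (simp add: r_def)
  define c where "c = a / (real j * pi)"
  let ?I = "r * c * ((r * (a / (real k * pi)) * (1 - cos (real k * pi * a / a))) - r * ((a / pi) * (1 - cos ((real k + real j) * pi)) * (real k / ((real k + real j) * (real k - real j)))))"
  have "((\<lambda>z. r * c * (ek a k z - r * (cos (real j * pi * z / a) * sin (real k * pi * z / a)))) has_integral ?I) {0..a}"
    unfolding r_def by (intro has_integral_mult_right has_integral_diff has_integral_ek has_integral_cos_sin) (use assms in auto)
  hence I: "((\<lambda>z. integral {0..z} (ek a j) * ek a k z) has_integral ?I) {0..a}"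
  proof (rule has_integral_eq[rotated])
    fix z assume that: "z \<in> {0..a}"
    show "r * c * (ek a k z - r * (cos (real j * pi * z / a) * sin (real k * pi * z / a))) = integral {0..z} (ek a j) * ek a k z"
  proof -
    have "integral {0..z} (ek a j) = r * c * (1 - cos (real j * pi * z / a))"
      using integral_unique[OF has_integral_ek[OF a kj(2), of z]] that by (simp add: r_def c_def)
    moreover have "ek a k z = r * sin (real k * pi * z / a)" by (simp add: ek_def r_def)
    ultimately show ?thesis by (simp only:) (simp add: algebra_simps)
  qed
  qed
  have "primM a k j = ?I" unfolding primM_def by (rule integral_unique[OF I])
  also have "\<dots> = (r * r) * c * ((a / (real k * pi)) * (1 - cos (real k * pi)) - (a / pi) * (1 - cos ((real k + real j) * pi)) * (real k / ((real k + real j) * (real k - real j))))"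
    using a by (simp add: algebra_simps)
  also have "(r * r) * c = 2 / (real j * pi)" unfolding rr c_def using a by simp
  finally show ?thesis .
qed

text \<open>The parity factors 1 - cos lie between -2 and 2 and are discarded. What remains is the
  square of the boundary part 1/k plus the square of the kernel, the two shapes handled by
  \<open>sum_inv_square_weight\<close> and \<open>sum_kernel_weight\<close>.\<close>

lemma primM_sq_bound:
  assumes a: "a > 0" and k: "k \<ge> 1"
  shows "(primM a k j)\<^sup>2 \<le> 32 * (a / pi\<^sup>2)\<^sup>2 * (1 / (real j)\<^sup>2 * (1 / (real k)\<^sup>2 + (real k)\<^sup>2 / ((real k + real j)\<^sup>2 * (real k - real j)\<^sup>2)))"
proof (cases "j = 0")
  case False
  define X Y where "X = 1 / real k" and "Y = real k / ((real k + real j) * (real k - real j))"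
  define s t where "s = 1 - cos (real k * pi)" and "t = 1 - cos ((real k + real j) * pi)"
  have st: "\<bar>s\<bar> \<le> 2" "\<bar>t\<bar> \<le> 2"
    using cos_ge_minus_one[of "real k * pi"] cos_le_one[of "real k * pi"]
      cos_ge_minus_one[of "(real k + real j) * pi"] cos_le_one[of "(real k + real j) * pi"] unfolding s_def t_def by linarith+
  have st2: "s\<^sup>2 \<le> 4" "t\<^sup>2 \<le> 4" using power_mono[OF st(1), of 2] power_mono[OF st(2), of 2] by simp_all
  have "primM a k j = (2 * a / pi\<^sup>2) * (1 / real j) * (s * X - t * Y)"
  proof -
    have "primM a k j = (2 / (real j * pi)) * ((a / (real k * pi)) * s - (a / pi) * t * Y)"
      unfolding s_def t_def Y_def using False by (intro primM_eq[OF a k]) simp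
    thus ?thesis by (simp add: X_def divide_inverse power2_eq_square algebra_simps)
  qed
  hence "(primM a k j)\<^sup>2 = (2 * a / pi\<^sup>2)\<^sup>2 * (1 / real j)\<^sup>2 * (s * X - t * Y)\<^sup>2" by (simp only: power_mult_distrib)
  also have "\<dots> \<le> (2 * a / pi\<^sup>2)\<^sup>2 * (1 / real j)\<^sup>2 * (8 * (X\<^sup>2 + Y\<^sup>2))"
  proof (rule mult_left_mono)
    have sq: "(p - q)\<^sup>2 \<le> 2 * p\<^sup>2 + 2 * q\<^sup>2" for p q :: real
      using zero_le_power2[of "p + q"] by (simp add: power2_sum power2_diff)
    have "(s * X - t * Y)\<^sup>2 \<le> 2 * (s\<^sup>2 * X\<^sup>2) + 2 * (t\<^sup>2 * Y\<^sup>2)"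
      using sq[of "s*X" "t*Y"] unfolding power_mult_distrib .
    also have "\<dots> \<le> 2 * (4 * X\<^sup>2) + 2 * (4 * Y\<^sup>2)"
      by (rule add_mono; rule mult_left_mono; (rule mult_right_mono)?; (rule st2 | simp))
    also have "\<dots> = 8 * (X\<^sup>2 + Y\<^sup>2)" by (simp add: distrib_left)
    finally show "(s * X - t * Y)\<^sup>2 \<le> 8 * (X\<^sup>2 + Y\<^sup>2)" .
  qed (intro mult_nonneg_nonneg zero_le_power2)
  finally have main: "(primM a k j)\<^sup>2 \<le> (2 * a / pi\<^sup>2)\<^sup>2 * (1 / real j)\<^sup>2 * (8 * (X\<^sup>2 + Y\<^sup>2))" .
  have A: "(2 * a / pi\<^sup>2)\<^sup>2 = 4 * (a / pi\<^sup>2)\<^sup>2"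
    by (simp only: power_divide power_mult_distrib) simp
  have XY: "X\<^sup>2 = 1 / (real k)\<^sup>2" "Y\<^sup>2 = (real k)\<^sup>2 / ((real k + real j)\<^sup>2 * (real k - real j)\<^sup>2)"
      "(1 / real j)\<^sup>2 = 1 / (real j)\<^sup>2"
    unfolding X_def Y_def by (simp_all only: power_divide power_mult_distrib power_one)
  have ring: "4 * A * J * (8 * S) = 32 * A * (J * S)" for A J S :: real by simp
  show ?thesis by (rule order_trans[OF main]) (simp only: A XY ring order_refl)
next
  case True
  show ?thesis unfolding True primM_0 of_nat_0 zero_power2 div_by_0 mult_zero_left mult_zero_right by (rule order_refl)
qed

text \<open>The gain 1/(1+|\<zeta>|) is the point: in the operator every primitive comes with a
  factor \<xi> or \<eta>, which the gain cancels. With x = (1+|\<zeta>|)^2 the columns are of size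
  x^\<sigma> and (j^2+x)^\<sigma>; division by the source weight (j^2+x)^(\<sigma>+1) leaves 1/x
  times a summable power of j.\<close>

lemma prim_bound:
  assumes a: "a > 0" and nu: "\<nu> > 0" and s: "- 3/2 < \<sigma>" "\<sigma> < 1/2"
  shows "\<exists>C\<ge>0. \<forall>\<zeta> g. g \<in> Hs \<nu> (\<sigma> + 1) \<zeta> \<longrightarrow>
     (\<forall>k. summable (\<lambda>j. complex_of_real (primM a k j) * g j)) \<and> prim a g \<in> Hs \<nu> \<sigma> \<zeta> \<and>
     nrm \<nu> \<sigma> \<zeta> (prim a g) \<le> C / bz \<zeta> * nrm \<nu> (\<sigma> + 1) \<zeta> g"
proof -
  obtain C1 where C1: "C1 \<ge> 1" "\<And>\<zeta> k. wt \<nu> \<sigma> \<zeta> k \<le> C1 * ((real k)\<^sup>2 + (bz \<zeta>)\<^sup>2) powr \<sigma>" using wt_equiv[OF nu] by blast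
  obtain C2 where C2: "C2 \<ge> 1" "\<And>\<zeta> k. ((real k)\<^sup>2 + (bz \<zeta>)\<^sup>2) powr (\<sigma>+1) \<le> C2 * wt \<nu> (\<sigma>+1) \<zeta> k" using wt_equiv[OF nu, of "\<sigma>+1"] by blast
  obtain C3 where C3: "C3 \<ge> 0" "\<And>x N. x \<ge> 1 \<Longrightarrow> (\<Sum>k<N. ((real k)\<^sup>2 + x) powr \<sigma> / (real k)\<^sup>2) \<le> C3 * x powr \<sigma>"
    using sum_inv_square_weight[OF s(2)] by blast
  obtain C4 where C4: "C4 \<ge> 0" "\<And>x N j. x \<ge> 1 \<Longrightarrow> j \<ge> 1 \<Longrightarrow> (\<Sum>k<N. ((real k)\<^sup>2 + x) powr \<sigma> *
      ((real k)\<^sup>2 / ((real k + real j)\<^sup>2 * (real k - real j)\<^sup>2))) \<le> C4 * ((real j)\<^sup>2 + x) powr \<sigma>"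
    using sum_kernel_weight[OF s] by blast
  \<comment> \<open>p is positive only for \<sigma>+1 < 0, when the source weight decays in j;
    summability of j^(2p-2) then amounts to \<sigma> > -3/2.\<close>
  define p where "p = max 0 (-\<sigma>-1)"
  have p: "p \<ge> 0" "p \<ge> -\<sigma>-1" "2*p - 2 < -1" "p \<le> 1" using s by (auto simp: p_def max_def)
  have ps: "summable (\<lambda>j. real j powr (2*p-2))" using p by (simp add: summable_real_powr_iff)
  define K where "K = 32 * (a / pi\<^sup>2)\<^sup>2"
  have K0: "K \<ge> 0" by (simp add: K_def)
  define Q where "Q = K * C1 * C2 * (2 * C3 + C4)"
  have Q0: "Q \<ge> 0" unfolding Q_def using K0 C1(1) C2(1) C3(1) C4(1) by auto
  define c where "c = sqrt (Q * (\<Sum>j. real j powr (2*p-2)))"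
  have S0: "(\<Sum>j. real j powr (2*p-2)) \<ge> 0" using suminf_nonneg[OF ps] by simp
  have c0: "c \<ge> 0" using Q0 S0 by (simp add: c_def)
  show ?thesis
  proof (intro exI[of _ c] conjI allI impI c0)
    fix \<zeta> g assume g: "g \<in> Hs \<nu> (\<sigma> + 1) \<zeta>"
    define x where "x = (bz \<zeta>)\<^sup>2"
    have x1: "x \<ge> 1" using bz_ge1[of \<zeta>] by (simp add: x_def)
    define A where "A k j = (if k = 0 then 0 else complex_of_real (primM a k j))" for k j
    define B where "B j = (if j = 0 then 0 else C1 * K * (1 / (real j)\<^sup>2) * (C3 * x powr \<sigma> + C4 * ((real j)\<^sup>2 + x) powr \<sigma>))" for j
    have AB: "(\<Sum>k<N. wt \<nu> \<sigma> \<zeta> k * (cmod (A k j))\<^sup>2) \<le> B j" for j N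
    proof (cases "j = 0")
      case True
      have "A k 0 = 0" for k by (simp add: A_def primM_0)
      thus ?thesis using True by (simp add: B_def)
    next
      case False
      have "(\<Sum>k<N. wt \<nu> \<sigma> \<zeta> k * (cmod (A k j))\<^sup>2) \<le> (\<Sum>k<N. (C1 * K * (1 / (real j)\<^sup>2)) * (((real k)\<^sup>2 + x) powr \<sigma> / (real k)\<^sup>2 +
         ((real k)\<^sup>2 + x) powr \<sigma> * ((real k)\<^sup>2 / ((real k + real j)\<^sup>2 * (real k - real j)\<^sup>2))))"
      proof (rule sum_mono)
        fix k
        show "wt \<nu> \<sigma> \<zeta> k * (cmod (A k j))\<^sup>2 \<le> (C1 * K * (1 / (real j)\<^sup>2)) * (((real k)\<^sup>2 + x) powr \<sigma> / (real k)\<^sup>2 +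
         ((real k)\<^sup>2 + x) powr \<sigma> * ((real k)\<^sup>2 / ((real k + real j)\<^sup>2 * (real k - real j)\<^sup>2)))"
        proof (cases "k = 0")
          case True thus ?thesis using False C1 K0 by (simp add: A_def)
        next
          case k: False
          hence "(cmod (A k j))\<^sup>2 = (primM a k j)\<^sup>2" by (simp add: A_def)
          also have "\<dots> \<le> K * (1 / (real j)\<^sup>2 * (1 / (real k)\<^sup>2 + (real k)\<^sup>2 / ((real k + real j)\<^sup>2 * (real k - real j)\<^sup>2)))"
            unfolding K_def using k by (intro primM_sq_bound[OF a]) simp
          finally have "wt \<nu> \<sigma> \<zeta> k * (cmod (A k j))\<^sup>2 \<le> (C1 * ((real k)\<^sup>2 + x) powr \<sigma>) * (K * (1 / (real j)\<^sup>2 * (1 / (real k)\<^sup>2 + (real k)\<^sup>2 / ((real k + real j)\<^sup>2 * (real k - real j)\<^sup>2))))"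
            using C1 unfolding x_def by (intro mult_mono) auto
          also have "\<dots> = (C1 * K * (1 / (real j)\<^sup>2)) * (((real k)\<^sup>2 + x) powr \<sigma> * (1 / (real k)\<^sup>2 + (real k)\<^sup>2 / ((real k + real j)\<^sup>2 * (real k - real j)\<^sup>2)))"
            by (simp only: mult_ac)
          finally show ?thesis by (simp add: distrib_left)
        qed
      qed
      also have "\<dots> = (C1 * K * (1 / (real j)\<^sup>2)) * ((\<Sum>k<N. ((real k)\<^sup>2 + x) powr \<sigma> / (real k)\<^sup>2) +
         (\<Sum>k<N. ((real k)\<^sup>2 + x) powr \<sigma> * ((real k)\<^sup>2 / ((real k + real j)\<^sup>2 * (real k - real j)\<^sup>2))))"
        by (simp only: sum_distrib_left[symmetric] sum.distrib)
      also have "\<dots> \<le> (C1 * K * (1 / (real j)\<^sup>2)) * (C3 * x powr \<sigma> + C4 * ((real j)\<^sup>2 + x) powr \<sigma>)"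
        by (intro mult_left_mono add_mono C3(2) C4(2)) (use False C1 K0 x1 in auto)
      also have "\<dots> = B j" using False by (simp add: B_def)
      finally show ?thesis .
    qed
    have Bw: "B j / wt \<nu> (\<sigma>+1) \<zeta> j \<le> (Q / x) * real j powr (2*p-2)" for j
    proof (cases "j = 0")
      case True thus ?thesis by (simp add: B_def)
    next
      case False
      hence j1: "real j \<ge> 1" and j2: "(real j)\<^sup>2 \<ge> 1" by simp_all
      let ?R = "(real j)\<^sup>2 + x"
      have R: "?R \<ge> x" "?R > 0" using x1 j2 by auto
      have "1 / wt \<nu> (\<sigma>+1) \<zeta> j \<le> C2 / ?R powr (\<sigma>+1)"
      proof -
        have *: "1 / w \<le> C / r" if "r \<le> C * w" "0 < w" "0 < r" for w r C :: real using that by (simp add: field_simps)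
        show ?thesis by (rule *) (use C2(2)[where k=j and \<zeta>=\<zeta>] wt_pos[OF nu, of "\<sigma>+1" \<zeta> j] R in \<open>auto simp: x_def\<close>)
      qed
      also have "\<dots> = C2 * ?R powr (-\<sigma>-1)" using powr_minus_divide[of ?R "\<sigma>+1"] by simp
      finally have w: "1 / wt \<nu> (\<sigma>+1) \<zeta> j \<le> C2 * ?R powr (-\<sigma>-1)" .
      have e1: "?R powr \<sigma> * ?R powr (-\<sigma>-1) \<le> 1 / x"
        using R x1 by (simp add: powr_add[symmetric] powr_minus divide_inverse)
      \<comment> \<open>The boundary part x^\<sigma> has no decay in j. For \<sigma>+1 < 0 the
        growing inverse source weight is therefore split into a power of j and a power of x, the
        latter completing x^\<sigma> to 1/x.\<close>
      have e2: "x powr \<sigma> * ?R powr (-\<sigma>-1) \<le> 2 * real j powr (2*p) / x"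
      proof -
        have "?R powr (-\<sigma>-1) \<le> (2 * (real j)\<^sup>2) powr p * x powr (-\<sigma>-1)"
        proof (cases "-\<sigma>-1 \<le> 0")
          case True
          hence "p = 0" by (simp add: p_def)
          moreover have "?R powr (-\<sigma>-1) \<le> x powr (-\<sigma>-1)" using True R x1 by (intro powr_mono2') auto
          ultimately show ?thesis using j1 by simp
        next
          case F: False
          hence pe: "p = -\<sigma>-1" by (simp add: p_def)
          have "(real j)\<^sup>2 * 1 \<le> (real j)\<^sup>2 * x" by (rule mult_left_mono) (use x1 in auto)
          moreover have "1 * x \<le> (real j)\<^sup>2 * x" by (rule mult_right_mono) (use x1 j2 in auto)
          ultimately have "?R \<le> 2 * (real j)\<^sup>2 * x" by simp
          hence "?R powr p \<le> (2 * (real j)\<^sup>2 * x) powr p" using p R by (intro powr_mono2) auto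
          thus ?thesis using x1 by (simp add: powr_mult flip: pe)
        qed
        also have "(2 * (real j)\<^sup>2) powr p = 2 powr p * real j powr (2*p)"
        proof -
          have "(real j powr 2) powr p = real j powr (2 * p)" by (rule powr_powr)
          hence "((real j)\<^sup>2) powr p = real j powr (2 * p)" using j1 by simp
          thus ?thesis by (simp add: powr_mult)
        qed
        also have "(2 powr p * real j powr (2*p)) * x powr (-\<sigma>-1) \<le> (2 * real j powr (2*p)) * x powr (-\<sigma>-1)"
          using powr_mono[OF p(4), of 2] by (intro mult_right_mono) auto
        finally have "x powr \<sigma> * ?R powr (-\<sigma>-1) \<le> x powr \<sigma> * ((2 * real j powr (2*p)) * x powr (-\<sigma>-1))"
          by (rule mult_left_mono) simp
        also have "\<dots> = 2 * real j powr (2*p) * (x powr \<sigma> * x powr (-\<sigma>-1))" by (simp only: mult_ac)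
        also have "x powr \<sigma> * x powr (-\<sigma>-1) = 1 / x" using x1 by (simp add: powr_add[symmetric] powr_minus divide_inverse)
        finally show ?thesis by simp
      qed
      have "B j / wt \<nu> (\<sigma>+1) \<zeta> j = B j * (1 / wt \<nu> (\<sigma>+1) \<zeta> j)" by simp
      also have "\<dots> \<le> B j * (C2 * ?R powr (-\<sigma>-1))"
        using AB[where N=0 and j=j] by (intro mult_left_mono w) simp
      also have "\<dots> = (C1 * K * C2 * (1 / (real j)\<^sup>2)) * (C3 * (x powr \<sigma> * ?R powr (-\<sigma>-1)) + C4 * (?R powr \<sigma> * ?R powr (-\<sigma>-1)))"
        using False by (simp add: B_def algebra_simps)
      also have "\<dots> \<le> (C1 * K * C2 * (1 / (real j)\<^sup>2)) * (C3 * (2 * real j powr (2*p) / x) + C4 * (real j powr (2*p) / x))"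
      proof (intro mult_left_mono add_mono e2)
        have "1 / x \<le> real j powr (2*p) / x" using x1 j1 p by (intro divide_right_mono) (auto simp: ge_one_powr_ge_zero)
        with e1 show "?R powr \<sigma> * ?R powr (-\<sigma>-1) \<le> real j powr (2*p) / x" by linarith
      qed (use C1 C2 C3 C4 K0 in auto)
      also have "\<dots> = Q / x * (real j powr (2*p) / (real j)\<^sup>2)"
      proof -
        have ring: "(A * (1/J)) * (c * (2 * P / y) + d * (P / y)) = (A * (2 * c + d)) / y * (P / J)" if "J > 0" "y > 0"
          for A J c P y d :: real using that by (simp add: field_simps)
        have QQ: "Q = (C1 * K * C2) * (2 * C3 + C4)" by (simp add: Q_def)
        show ?thesis unfolding QQ by (rule ring) (use False x1 in auto)
      qed
      also have "real j powr (2*p) / (real j)\<^sup>2 = real j powr (2*p-2)" using j1 by (simp add: powr_diff)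
      finally show ?thesis .
    qed
    have Bpos: "B j / wt \<nu> (\<sigma>+1) \<zeta> j \<ge> 0" for j
      using AB[where N=0 and j=j] wt_nonneg[of \<nu> "\<sigma>+1" \<zeta> j] by simp
    have Bs: "summable (\<lambda>j. B j / wt \<nu> (\<sigma>+1) \<zeta> j)"
      by (rule summable_comparison_test'[where N=0, OF summable_mult[OF ps, of "Q/x"]]) (simp only: real_norm_def abs_of_nonneg[OF Bpos] Bw)
    have Bsum: "(\<Sum>j. B j / wt \<nu> (\<sigma>+1) \<zeta> j) \<le> (c / bz \<zeta>)\<^sup>2"
    proof -
      have "(\<Sum>j. B j / wt \<nu> (\<sigma>+1) \<zeta> j) \<le> (\<Sum>j. (Q/x) * real j powr (2*p-2))"
        by (rule suminf_le[OF Bw Bs summable_mult[OF ps]])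
      also have "\<dots> = (Q/x) * (\<Sum>j. real j powr (2*p-2))" by (rule suminf_mult[OF ps])
      also have "\<dots> = (c / bz \<zeta>)\<^sup>2" using Q0 S0 by (simp add: c_def x_def power_divide)
      finally show ?thesis .
    qed
    have gs: "l2s (wt \<nu> (\<sigma>+1) \<zeta>) g" using g by (simp add: Hs_def l2s_def)
    have M: "(\<forall>k. summable (\<lambda>j. A k j * g j)) \<and> l2s (wt \<nu> \<sigma> \<zeta>) (\<lambda>k. \<Sum>j. A k j * g j) \<and>
     l2n (wt \<nu> \<sigma> \<zeta>) (\<lambda>k. \<Sum>j. A k j * g j) \<le> c / bz \<zeta> * l2n (wt \<nu> (\<sigma>+1) \<zeta>) g"
      by (rule l2_matrix[where B=B]) (use wt_pos[OF nu] gs AB Bs Bsum c0 bz_ge1[of \<zeta>] in \<open>auto\<close>)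
    have Ap: "(\<lambda>k. \<Sum>j. A k j * g j) = prim a g" by (auto simp: A_def prim_def)
    have p0: "primM a 0 j = 0" for j by (simp add: primM_def ek_0)
    have sm: "summable (\<lambda>j. complex_of_real (primM a k j) * g j)" for k
      using M by (cases "k = 0") (auto simp: A_def p0 dest: spec[of _ k])
    show "summable (\<lambda>j. complex_of_real (primM a k j) * g j)" for k by (rule sm)
    show "prim a g \<in> Hs \<nu> \<sigma> \<zeta>" using M unfolding Ap by (simp add: Hs_def l2s_def prim_def)
    show "nrm \<nu> \<sigma> \<zeta> (prim a g) \<le> c / bz \<zeta> * nrm \<nu> (\<sigma> + 1) \<zeta> g"
      using M unfolding Ap by (simp add: nrm_def l2n_def)
  qed
qed

section \<open>Sobolev norms and the weights $M_s$\<close>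

lemma Hs_iff: "f \<in> Hs \<nu> s \<zeta> \<longleftrightarrow> f 0 = 0 \<and> l2s (wt \<nu> s \<zeta>) f"
  by (simp add: Hs_def l2s_def)

lemma nrm_eq: "nrm \<nu> s \<zeta> f = l2n (wt \<nu> s \<zeta>) f"
  by (simp add: nrm_def l2n_def)

lemma Hs_add:
  assumes "f \<in> Hs \<nu> s \<zeta>" "g \<in> Hs \<nu> s \<zeta>"
  shows "(\<lambda>k. f k + g k) \<in> Hs \<nu> s \<zeta> \<and> nrm \<nu> s \<zeta> (\<lambda>k. f k + g k) \<le> nrm \<nu> s \<zeta> f + nrm \<nu> s \<zeta> g"
  using l2_add[where w="wt \<nu> s \<zeta>" and f=f and g=g, OF wt_nonneg] assms by (simp add: Hs_iff nrm_eq)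

lemma Hs_diff:
  assumes "f \<in> Hs \<nu> s \<zeta>" "g \<in> Hs \<nu> s \<zeta>"
  shows "(\<lambda>k. f k - g k) \<in> Hs \<nu> s \<zeta> \<and> nrm \<nu> s \<zeta> (\<lambda>k. f k - g k) \<le> nrm \<nu> s \<zeta> f + nrm \<nu> s \<zeta> g"
  using l2_diff[where w="wt \<nu> s \<zeta>" and f=f and g=g, OF wt_nonneg] assms by (simp add: Hs_iff nrm_eq)

lemma Hs_scale:
  assumes "f \<in> Hs \<nu> s \<zeta>"
  shows "(\<lambda>k. c * f k) \<in> Hs \<nu> s \<zeta> \<and> nrm \<nu> s \<zeta> (\<lambda>k. c * f k) = cmod c * nrm \<nu> s \<zeta> f"
  using l2_scale[where w="wt \<nu> s \<zeta>" and f=f and c=c, OF wt_nonneg] assms by (simp add: Hs_iff nrm_eq)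

lemma Hs_zero: "(\<lambda>k. 0) \<in> Hs \<nu> s \<zeta>" "nrm \<nu> s \<zeta> (\<lambda>k. 0) = 0"
  by (simp_all add: Hs_def nrm_def)

lemma nrm_nonneg: "f \<in> Hs \<nu> s \<zeta> \<Longrightarrow> nrm \<nu> s \<zeta> f \<ge> 0"
  using l2n_nonneg[where w="wt \<nu> s \<zeta>" and f=f, OF wt_nonneg] by (simp add: Hs_iff nrm_eq)

lemma Hs_dominate:
  assumes g: "g \<in> Hs \<nu> s' \<zeta>" and f0: "f 0 = 0" and B: "B \<ge> 0"
    and le: "\<And>k. k \<ge> 1 \<Longrightarrow> wt \<nu> s \<zeta> k * (cmod (f k))\<^sup>2 \<le> B\<^sup>2 * (wt \<nu> s' \<zeta> k * (cmod (g k))\<^sup>2)"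
  shows "f \<in> Hs \<nu> s \<zeta> \<and> nrm \<nu> s \<zeta> f \<le> B * nrm \<nu> s' \<zeta> g"
proof -
  have "wt \<nu> s \<zeta> k * (cmod (f k))\<^sup>2 \<le> B\<^sup>2 * (wt \<nu> s' \<zeta> k * (cmod (g k))\<^sup>2)" for k
    by (cases "k = 0") (use f0 le[of k] wt_nonneg in auto)
  thus ?thesis using l2_dominate[where w="wt \<nu> s \<zeta>" and w'="wt \<nu> s' \<zeta>" and f=f and g=g and B=B, OF wt_nonneg wt_nonneg] g f0 B by (simp add: Hs_iff nrm_eq)
qed

lemma Hs_coord_tendsto_0:
  assumes nu: "\<nu> > 0" and f: "\<And>n. f n \<in> Hs \<nu> s \<zeta>" and lim: "(\<lambda>n. nrm \<nu> s \<zeta> (f n)) \<longlonglongrightarrow> 0"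
  shows "(\<lambda>n. f n k) \<longlonglongrightarrow> 0"
proof -
  have le: "cmod (f n k) \<le> (1 / sqrt (wt \<nu> s \<zeta> k)) * nrm \<nu> s \<zeta> (f n)" for n
  proof -
    have "sqrt (wt \<nu> s \<zeta> k) * cmod (f n k) \<le> nrm \<nu> s \<zeta> (f n)"
      using l2_coord[where w="wt \<nu> s \<zeta>" and f="f n" and k=k, OF wt_nonneg] f[of n] by (simp add: Hs_iff nrm_eq)
    thus ?thesis using wt_pos[OF nu, of s \<zeta> k] by (simp add: field_simps)
  qed
  show ?thesis
    by (rule Lim_null_comparison[OF always_eventually tendsto_mult_right_zero[OF lim, of "1 / sqrt (wt \<nu> s \<zeta> k)"]]) (rule allI, rule le)
qed

lemma wt_base_ge1: "\<nu> > 0 \<Longrightarrow> 1 + \<nu> * real k ^ 2 + \<nu> * zabs2 \<zeta> \<ge> 1"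
  using zabs2_nonneg[of \<zeta>] by simp

lemma wt_mono: "\<nu> > 0 \<Longrightarrow> s \<le> s' \<Longrightarrow> wt \<nu> s \<zeta> k \<le> wt \<nu> s' \<zeta> k"
  unfolding wt_def by (intro powr_mono wt_base_ge1)

lemma wt_add: "\<nu> > 0 \<Longrightarrow> wt \<nu> (s + s') \<zeta> k = wt \<nu> s \<zeta> k * wt \<nu> s' \<zeta> k"
  using wt_base_ge1[of \<nu> k \<zeta>] unfolding wt_def by (subst powr_add) auto

lemma wt_1: "\<nu> > 0 \<Longrightarrow> wt \<nu> 1 \<zeta> k = 1 + \<nu> * real k ^ 2 + \<nu> * zabs2 \<zeta>"
  using wt_base_ge1[of \<nu> k \<zeta>] unfolding wt_def by (subst powr_one) auto

lemma wt_2: "\<nu> > 0 \<Longrightarrow> wt \<nu> 2 \<zeta> k = (1 + \<nu> * real k ^ 2 + \<nu> * zabs2 \<zeta>)\<^sup>2"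
  using wt_base_ge1[of \<nu> k \<zeta>] unfolding wt_def by (subst powr_numeral) auto

lemma wt_minus: "wt \<nu> (- s) \<zeta> k = 1 / wt \<nu> s \<zeta> k"
  unfolding wt_def by (rule powr_minus_divide)

lemma Hs_mono:
  assumes nu: "\<nu> > 0" and "s \<le> s'" "f \<in> Hs \<nu> s' \<zeta>"
  shows "f \<in> Hs \<nu> s \<zeta> \<and> nrm \<nu> s \<zeta> f \<le> nrm \<nu> s' \<zeta> f"
  using Hs_dominate[where g=f and f=f and s=s and s'=s' and B=1 and \<nu>=\<nu> and \<zeta>=\<zeta>] assms wt_mono[OF nu assms(2)]
  by (simp add: Hs_iff mult_right_mono)

lemma Hs_multiplier:
  assumes g: "g \<in> Hs \<nu> s' \<zeta>" and B: "B \<ge> 0"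
    and le: "\<And>k. k \<ge> 1 \<Longrightarrow> wt \<nu> s \<zeta> k * (cmod (m k))\<^sup>2 \<le> B\<^sup>2 * wt \<nu> s' \<zeta> k"
  shows "(\<lambda>k. m k * g k) \<in> Hs \<nu> s \<zeta> \<and> nrm \<nu> s \<zeta> (\<lambda>k. m k * g k) \<le> B * nrm \<nu> s' \<zeta> g"
proof (rule Hs_dominate[OF g _ B])
  show "m 0 * g 0 = 0" using g by (simp add: Hs_iff)
  fix k :: nat assume "k \<ge> 1"
  from mult_right_mono[OF le[OF this], of "(cmod (g k))\<^sup>2"]
  show "wt \<nu> s \<zeta> k * (cmod (m k * g k))\<^sup>2 \<le> B\<^sup>2 * (wt \<nu> s' \<zeta> k * (cmod (g k))\<^sup>2)"
    by (simp add: norm_mult power_mult_distrib mult_ac)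
qed

text \<open>The dual norm belongs to the same family because \<open>wt\<close> at -s is the inverse
  of \<open>wt\<close> at s. This pairing gives a sense to the constraint sum and bounds the
  pressure.\<close>

lemma Hs_pairing:
  assumes nu: "\<nu> > 0" and f: "f \<in> Hs \<nu> s \<zeta>" and g: "g \<in> Hs \<nu> (-s) \<zeta>"
  shows "summable (\<lambda>k. f k * g k) \<and> cmod (\<Sum>k. f k * g k) \<le> nrm \<nu> s \<zeta> f * nrm \<nu> (-s) \<zeta> g"
proof -
  have e: "wt \<nu> (-s) \<zeta> = (\<lambda>k. 1 / wt \<nu> s \<zeta> k)" by (simp add: fun_eq_iff wt_minus)
  have "summable (\<lambda>k. cmod (f k * g k)) \<and> (\<Sum>k. cmod (f k * g k)) \<le> l2n (wt \<nu> s \<zeta>) f * l2n (\<lambda>k. 1 / wt \<nu> s \<zeta> k) g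
     \<and> cmod (\<Sum>k. f k * g k) \<le> l2n (wt \<nu> s \<zeta>) f * l2n (\<lambda>k. 1 / wt \<nu> s \<zeta> k) g"
    by (rule l2_CS) (use wt_pos[OF nu] f g in \<open>auto simp: Hs_iff e\<close>)
  thus ?thesis unfolding nrm_eq e by (blast intro: summable_norm_cancel)
qed

lemma nrm3_bounds:
  assumes "(f, g, h) \<in> Tgt \<nu> s \<zeta>"
  shows "nrm \<nu> s \<zeta> f \<le> nrm3 \<nu> s \<zeta> (f, g, h)" "nrm \<nu> s \<zeta> g \<le> nrm3 \<nu> s \<zeta> (f, g, h)"
    "nrm \<nu> s \<zeta> h \<le> nrm3 \<nu> s \<zeta> (f, g, h)"
    "nrm3 \<nu> s \<zeta> (f, g, h) \<le> nrm \<nu> s \<zeta> f + nrm \<nu> s \<zeta> g + nrm \<nu> s \<zeta> h" "0 \<le> nrm3 \<nu> s \<zeta> (f, g, h)"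
proof -
  have n: "nrm \<nu> s \<zeta> f \<ge> 0" "nrm \<nu> s \<zeta> g \<ge> 0" "nrm \<nu> s \<zeta> h \<ge> 0"
    using assms by (auto simp: Tgt_def nrm_nonneg)
  show "nrm \<nu> s \<zeta> f \<le> nrm3 \<nu> s \<zeta> (f, g, h)" "nrm \<nu> s \<zeta> g \<le> nrm3 \<nu> s \<zeta> (f, g, h)"
    "nrm \<nu> s \<zeta> h \<le> nrm3 \<nu> s \<zeta> (f, g, h)" "0 \<le> nrm3 \<nu> s \<zeta> (f, g, h)"
    by (auto simp: nrm3_def intro!: real_le_rsqrt)
  have gen: "sqrt (x\<^sup>2 + y\<^sup>2 + z\<^sup>2) \<le> x + y + z" if "x \<ge> 0" "y \<ge> 0" "z \<ge> 0" for x y z :: real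
    using that by (intro real_le_lsqrt) (auto simp: power2_eq_square algebra_simps)
  show "nrm3 \<nu> s \<zeta> (f, g, h) \<le> nrm \<nu> s \<zeta> f + nrm \<nu> s \<zeta> g + nrm \<nu> s \<zeta> h"
    using gen[OF n] by (simp add: nrm3_def)
qed

lemma nrm2_le:
  assumes "f \<in> Hs \<nu> s \<zeta>" "g \<in> Hs \<nu> s \<zeta>"
  shows "nrm2 \<nu> s \<zeta> (f, g) \<le> nrm \<nu> s \<zeta> f + nrm \<nu> s \<zeta> g"
proof -
  have gen: "sqrt (x\<^sup>2 + y\<^sup>2) \<le> x + y" if "x \<ge> 0" "y \<ge> 0" for x y :: real
    using that by (intro real_le_lsqrt) (auto simp: power2_eq_square algebra_simps)
  show ?thesis using gen[OF nrm_nonneg[OF assms(1)] nrm_nonneg[OF assms(2)]] by (simp add: nrm2_def)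
qed

text \<open>With W = \<langle>\<omega>\<rangle>^2 one has (1+|\<zeta>|)^2 \<le> W, so every factor
  of a term is compared with a power of k^2 + W. The outcome is the size of M_s in terms of W alone,
  as the perturbation argument needs it. Starting the sum at 0 is harmless, the term there being 1/0
  = 0.\<close>

lemma Ms_summable_bound:
  assumes "s > - 5/2"
  shows "\<exists>C>0. \<forall>lam \<zeta>. summable (\<lambda>k. 1 / (real k ^ 2 * (real k ^ 4 + (bw2 lam \<zeta>)^2) * (real k ^ 2 + (bz \<zeta>)^2) powr s)) \<and>
    (Ms s lam \<zeta>)\<^sup>2 = (\<Sum>k. 1 / (real k ^ 2 * (real k ^ 4 + (bw2 lam \<zeta>)^2) * (real k ^ 2 + (bz \<zeta>)^2) powr s)) \<and>
    0 < Ms s lam \<zeta> \<and> (Ms s lam \<zeta>)\<^sup>2 \<le> C * bw2 lam \<zeta> powr (max 0 (-s) - 2)"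
proof -
  define q where "q = max 0 (-s)"
  have q: "q \<ge> 0" "q \<ge> -s" "q < 5/2" using assms by (auto simp: q_def)
  \<comment> \<open>The part of the exponent that a negative power of W cannot absorb is put on k; q
    < 5/2 is what makes k^(2r-2) summable.\<close>
  define r where "r = max 0 (q - 2)"
  have r: "r \<ge> 0" "r \<ge> q - 2" "2*r - 2 < -1" "r \<le> 1" using q by (auto simp: r_def max_def)
  have rs: "summable (\<lambda>k. real k powr (2*r - 2))" using r by (simp add: summable_real_powr_iff)
  define C where "C = 4 * (\<Sum>k. real k powr (2*r - 2)) + 1"
  have C0: "C > 0" using suminf_nonneg[OF rs] by (simp add: C_def)
  show ?thesis
  proof (intro exI[of _ C] conjI allI C0)
    fix lam \<zeta>
    define W b where "W = bw2 lam \<zeta>" and "b = (bz \<zeta>)\<^sup>2"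
    have b1: "b \<ge> 1" using bz_ge1[of \<zeta>] by (simp add: b_def)
    have Wb: "W \<ge> b" by (simp add: W_def b_def bw2_def)
    have W1: "W \<ge> 1" using b1 Wb by simp
    let ?m = "\<lambda>k. 1 / (real k ^ 2 * (real k ^ 4 + W^2) * (real k ^ 2 + b) powr s)"
    have m0: "?m k \<ge> 0" for k by simp
    have mle: "?m k \<le> (4 * W powr (q-2)) * real k powr (2*r-2)" for k
    proof (cases "k = 0")
      case False
      define x where "x = (real k)\<^sup>2"
      have x1: "x \<ge> 1" using False by (simp add: x_def)
      have x4: "real k ^ 4 = x\<^sup>2" by (simp add: x_def)
      have e1: "1 / (x + b) powr s \<le> (x + W) powr q"
      proof -
        have "1 / (x + b) powr s = (x + b) powr (-s)" by (simp add: powr_minus_divide)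
        also have "\<dots> \<le> (x + b) powr q" using x1 b1 q by (intro powr_mono) auto
        also have "\<dots> \<le> (x + W) powr q" using x1 b1 Wb q by (intro powr_mono2) auto
        finally show ?thesis .
      qed
      have e2: "1 / (x\<^sup>2 + W\<^sup>2) \<le> 2 * (x + W) powr (-2)"
      proof -
        have "(x + W)\<^sup>2 \<le> 2 * (x\<^sup>2 + W\<^sup>2)" using zero_le_power2[of "x - W"] by (simp add: power2_sum power2_diff)
        moreover have "(x+W)\<^sup>2 > 0" "x\<^sup>2 + W\<^sup>2 > 0" using x1 W1 by (auto intro: add_pos_pos)
        ultimately have "1 / (x\<^sup>2 + W\<^sup>2) \<le> 2 / (x + W)\<^sup>2" by (simp add: field_simps)
        moreover have "(x + W) powr (-2) = 1 / (x+W)\<^sup>2" using x1 W1 by (simp add: powr_minus divide_inverse)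
        ultimately show ?thesis by simp
      qed
      have e3: "(x + W) powr (q - 2) \<le> 2 * x powr r * W powr (q-2)"
      proof (cases "q \<le> 2")
        case True
        hence "r = 0" by (simp add: r_def)
        moreover have "(x + W) powr (q - 2) \<le> W powr (q-2)" using True x1 W1 by (intro powr_mono2') auto
        moreover have "W powr (q-2) \<le> 2 * W powr (q-2)" by simp
        ultimately have "(x + W) powr (q - 2) \<le> 2 * W powr (q-2)" by (blast intro: order_trans)
        thus ?thesis using x1 \<open>r = 0\<close> by simp
      next
        case False
        hence rq: "r = q - 2" by (simp add: r_def)
        have "x * 1 \<le> x * W" by (rule mult_left_mono) (use W1 x1 in auto)
        moreover have "1 * W \<le> x * W" by (rule mult_right_mono) (use W1 x1 in auto)
        ultimately have "x + W \<le> 2 * x * W" by simp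
        hence "(x + W) powr r \<le> (2 * x * W) powr r" using r x1 W1 by (intro powr_mono2) auto
        also have "\<dots> = 2 powr r * (x powr r * W powr r)" using x1 W1 by (simp add: powr_mult)
        also have "\<dots> \<le> 2 * (x powr r * W powr r)" using powr_mono[OF r(4), of 2] by (intro mult_right_mono) auto
        finally show ?thesis by (simp add: rq mult_ac)
      qed
      have "?m k = (1/x) * ((1 / (x\<^sup>2 + W\<^sup>2)) * (1 / (x + b) powr s))" by (simp add: x_def[symmetric] x4)
      also have "\<dots> \<le> (1/x) * ((2 * (x + W) powr (-2)) * (x + W) powr q)"
        using x1 by (intro mult_left_mono mult_mono e1 e2) auto
      also have "(2 * (x + W) powr (-2)) * (x + W) powr q = 2 * (x + W) powr (q - 2)"
        by (simp add: powr_add[symmetric])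
      also have "(1/x) * (2 * (x + W) powr (q - 2)) \<le> (1/x) * (2 * (2 * x powr r * W powr (q-2)))"
        using x1 e3 by (intro mult_left_mono) auto
      also have "\<dots> = (4 * W powr (q-2)) * (x powr r * x powr (-1))"
        using x1 by (simp add: powr_minus divide_inverse)
      also have "x powr r * x powr (-1) = x powr (r - 1)" by (simp only: powr_add[symmetric]) simp
      also have "\<dots> = real k powr (2*r-2)"
      proof -
        have "(real k powr 2) powr (r-1) = real k powr (2 * (r-1))" by (rule powr_powr)
        thus ?thesis using False by (simp add: x_def algebra_simps)
      qed
      finally show ?thesis .
    qed simp
    have ms: "summable ?m"
      by (rule summable_comparison_test'[where N=0, OF summable_mult[OF rs, of "4 * W powr (q-2)"]]) (use mle m0 in auto)
    have m_sum: "(\<Sum>k. ?m k) \<le> C * W powr (q-2)"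
    proof -
      have "(\<Sum>k. ?m k) \<le> (\<Sum>k. (4 * W powr (q-2)) * real k powr (2*r-2))"
        by (rule suminf_le[OF mle ms summable_mult[OF rs]])
      also have "\<dots> = (4 * W powr (q-2)) * (\<Sum>k. real k powr (2*r-2))" by (rule suminf_mult[OF rs])
      also have "\<dots> \<le> C * W powr (q-2)" by (simp add: C_def algebra_simps)
      finally show ?thesis .
    qed
    have sh: "(\<Sum>k. ?m (Suc k)) = (\<Sum>k. ?m k)" using suminf_split_head[OF ms] by simp
    have pos: "(\<Sum>k. ?m k) > 0"
    proof (rule suminf_pos2[OF ms m0])
      show "0 < ?m 1" using W1 b1 by (auto intro!: divide_pos_pos mult_pos_pos add_pos_pos)
    qed
    have M2: "(Ms s lam \<zeta>)\<^sup>2 = (\<Sum>k. ?m k)" using pos sh by (simp add: Ms_def W_def[symmetric] b_def[symmetric])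
    have Mpos: "Ms s lam \<zeta> > 0" using pos sh by (simp add: Ms_def W_def[symmetric] b_def[symmetric])
    show "summable (\<lambda>k. 1 / (real k ^ 2 * (real k ^ 4 + (bw2 lam \<zeta>)^2) * (real k ^ 2 + (bz \<zeta>)^2) powr s))"
      using ms by (simp add: W_def b_def)
    show "(Ms s lam \<zeta>)\<^sup>2 = (\<Sum>k. 1 / (real k ^ 2 * (real k ^ 4 + (bw2 lam \<zeta>)^2) * (real k ^ 2 + (bz \<zeta>)^2) powr s))"
      using M2 by (simp add: W_def b_def)
    show "0 < Ms s lam \<zeta>" by (rule Mpos)
    show "(Ms s lam \<zeta>)\<^sup>2 \<le> C * bw2 lam \<zeta> powr (max 0 (-s) - 2)"
      using m_sum M2 by (simp add: W_def q_def)
  qed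
qed

lemma bw2_ge1: "bw2 lam \<zeta> \<ge> 1"
proof -
  have "(bz \<zeta>)\<^sup>2 \<ge> 1" using bz_ge1[of \<zeta>] by simp
  thus ?thesis unfolding bw2_def using norm_ge_zero[of lam] by linarith
qed

text \<open>The negative power on the right makes the lower-order part a small perturbation for large $\<langle>\<omega>\<rangle>$.\<close>

lemma Ms_product_small:
  assumes s: "- 3/2 < \<sigma>" "\<sigma> < 1/2"
  shows "\<exists>C>0. \<forall>lam \<zeta>. bw2 lam \<zeta> * Ms \<sigma> lam \<zeta> * Ms (-\<sigma>-1) lam \<zeta> \<le> C * bw2 lam \<zeta> powr (-1/4)"
proof -
  obtain C1 where C1: "C1 > 0" "\<And>lam \<zeta>. 0 < Ms \<sigma> lam \<zeta>" "\<And>lam \<zeta>. (Ms \<sigma> lam \<zeta>)\<^sup>2 \<le> C1 * bw2 lam \<zeta> powr (max 0 (-\<sigma>) - 2)"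
    using Ms_summable_bound[of \<sigma>] s by auto
  obtain C2 where C2: "C2 > 0" "\<And>lam \<zeta>. 0 < Ms (-\<sigma>-1) lam \<zeta>" "\<And>lam \<zeta>. (Ms (-\<sigma>-1) lam \<zeta>)\<^sup>2 \<le> C2 * bw2 lam \<zeta> powr (max 0 (\<sigma>+1) - 2)"
  proof -
    have e: "-(-\<sigma>-1) = \<sigma>+1" by simp
    have "-\<sigma>-1 > -5/2" using s by simp
    from Ms_summable_bound[OF this, unfolded e] show ?thesis using that by blast
  qed
  show ?thesis
  proof (intro exI[of _ "sqrt (C1 * C2)"] conjI allI)
    show "0 < sqrt (C1 * C2)" using C1 C2 by simp
    fix lam \<zeta>
    define W where "W = bw2 lam \<zeta>"
    have W1: "W \<ge> 1" by (simp add: W_def bw2_ge1)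
    have "(W * Ms \<sigma> lam \<zeta> * Ms (-\<sigma>-1) lam \<zeta>)\<^sup>2 = W\<^sup>2 * ((Ms \<sigma> lam \<zeta>)\<^sup>2 * (Ms (-\<sigma>-1) lam \<zeta>)\<^sup>2)"
      by (simp add: power_mult_distrib mult_ac)
    also have "\<dots> \<le> W\<^sup>2 * ((C1 * W powr (max 0 (-\<sigma>) - 2)) * (C2 * W powr (max 0 (\<sigma>+1) - 2)))"
      unfolding W_def using C1(1) C2(1) by (intro mult_left_mono mult_mono C1(3) C2(3)) auto
    also have "\<dots> = C1 * C2 * (W powr 2 * (W powr (max 0 (-\<sigma>) - 2) * W powr (max 0 (\<sigma>+1) - 2)))"
      using W1 by (simp add: mult_ac)
    also have "W powr 2 * (W powr (max 0 (-\<sigma>) - 2) * W powr (max 0 (\<sigma>+1) - 2)) = W powr (2 + (max 0 (-\<sigma>) - 2 + (max 0 (\<sigma>+1) - 2)))"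
      by (simp only: powr_add)
    \<comment> \<open>The exponent is max(0,-\<sigma>) + max(0,\<sigma>+1) - 2, which equals
      \<sigma>-1, -1 or -\<sigma>-2 for \<sigma> \<ge> 0, -1 \<le> \<sigma> \<le> 0 and \<sigma>
      \<le> -1. Each value is below -1/2 on the interval allowed for \<sigma>.\<close>
    also have "\<dots> \<le> W powr (-1/2)"
    proof (rule powr_mono[OF _ W1])
      show "2 + (max 0 (-\<sigma>) - 2 + (max 0 (\<sigma>+1) - 2)) \<le> -1/2"
        using s unfolding max_def by (auto; argo)
    qed
    also have "W powr (-1/2) = (W powr (-1/4))\<^sup>2" by (simp add: power2_eq_square powr_add[symmetric])
    also have "C1 * C2 * (W powr (-1/4))\<^sup>2 = (sqrt (C1 * C2) * W powr (-1/4))\<^sup>2" using C1 C2 by (simp add: power_mult_distrib)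
    finally have "(W * Ms \<sigma> lam \<zeta> * Ms (-\<sigma>-1) lam \<zeta>)\<^sup>2 \<le> (sqrt (C1 * C2) * W powr (-1/4))\<^sup>2"
      using C1 C2 by (simp add: mult_left_mono)
    thus "bw2 lam \<zeta> * Ms \<sigma> lam \<zeta> * Ms (-\<sigma>-1) lam \<zeta> \<le> sqrt (C1 * C2) * bw2 lam \<zeta> powr (-1/4)"
      unfolding W_def by (rule power2_le_imp_le) (use C1 C2 in auto)
  qed
qed

section \<open>The leading part of the operator\<close>

text \<open>No case distinction at k = 0 is made: \<open>one_c\<close> and the coefficients of all
  arguments in the domain vanish there.\<close>

definition L0 :: "real \<Rightarrow> real \<Rightarrow> complex \<Rightarrow> int \<times> int \<Rightarrow> coef \<times> coef \<times> complex \<times> coef \<Rightarrow> coef \<times> coef \<times> coef" where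
  "L0 a \<nu> lam \<zeta> X = (case X of (u, v, p0, t) \<Rightarrow>
     (\<lambda>k. symb a \<nu> lam \<zeta> k * u k + \<i> * of_int (fst \<zeta>) * p0 * one_c a k,
      \<lambda>k. symb a \<nu> lam \<zeta> k * v k + \<i> * of_int (snd \<zeta>) * p0 * one_c a k,
      \<lambda>k. symb a \<nu> lam \<zeta> k * t k))"

definition Rop :: "real \<Rightarrow> real \<Rightarrow> real \<Rightarrow> real \<Rightarrow> int \<times> int \<Rightarrow> coef \<times> coef \<times> complex \<times> coef \<Rightarrow> coef \<times> coef \<times> coef" where
  "Rop a \<alpha> \<beta> \<gamma> \<zeta> X = (case X of (u, v, p0, t) \<Rightarrow>
     (\<lambda>k. of_real \<alpha> * v k - \<i> * of_int (fst \<zeta>) * of_real \<beta> * prim a t k,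
      \<lambda>k. - of_real \<alpha> * u k - \<i> * of_int (snd \<zeta>) * of_real \<beta> * prim a t k,
      \<lambda>k. of_real \<gamma> * prim a (\<lambda>k. \<i> * of_int (fst \<zeta>) * u k + \<i> * of_int (snd \<zeta>) * v k) k))"

lemma prim_at_0: "prim a g 0 = 0" by (simp add: prim_def)

lemma Lop_eq_L0_Rop:
  assumes "u 0 = 0" "v 0 = 0" "t 0 = 0"
  shows "Lop a \<nu> \<alpha> \<beta> \<gamma> lam \<zeta> (u, v, p0, t) = sub3 (L0 a \<nu> lam \<zeta> (u, v, p0, t)) (Rop a \<alpha> \<beta> \<gamma> \<zeta> (u, v, p0, t))"
  using assms by (auto simp: Lop_def L0_def Rop_def sub3_def Let_def fun_eq_iff one_c_0 prim_at_0 algebra_simps)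

text \<open>D = A - m1 + i m2 with m1 \<le> \<delta>1 |m2|: a loss in the real part is paid for by
  the imaginary part, so A, m1 and m2 cannot cancel. The last bound replaces |D| by an expression
  that is real-linear once the sign of Im D is fixed; it can be summed over k because Im D_k = Im
  \<lambda> for all k.\<close>

lemma sector_bound:
  assumes A: "A \<ge> 0" and d: "\<delta>1 > 0" and m: "\<bar>m2\<bar> \<ge> m1 / \<delta>1" and D: "Re D = A - m1" "Im D = m2"
  shows "A \<le> (1 + \<delta>1) * cmod D" "\<bar>m1\<bar> \<le> (1 + \<delta>1) * cmod D" "\<bar>m2\<bar> \<le> cmod D"
    "cmod D \<le> (1 + \<delta>1) * (Re D + (1 + \<delta>1) * \<bar>Im D\<bar>)"
proof -
  have m1: "m1 \<le> \<delta>1 * \<bar>m2\<bar>" using m d by (simp add: field_simps)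
  have n: "\<bar>A - m1\<bar> \<le> cmod D" "\<bar>m2\<bar> \<le> cmod D" using abs_Re_le_cmod[of D] abs_Im_le_cmod[of D] D by auto
  have dn: "\<delta>1 * \<bar>m2\<bar> \<le> \<delta>1 * cmod D" using n d by (intro mult_left_mono) auto
  show "\<bar>m2\<bar> \<le> cmod D" by (rule n)
  have e: "(1 + \<delta>1) * cmod D = cmod D + \<delta>1 * cmod D" by (simp add: algebra_simps)
  have d0: "0 \<le> \<delta>1 * cmod D" using d by simp
  show "A \<le> (1 + \<delta>1) * cmod D" "\<bar>m1\<bar> \<le> (1 + \<delta>1) * cmod D" unfolding e using n m1 dn d0 A by linarith+
  define P where "P = \<delta>1 * \<bar>m2\<bar>"
  have P0: "P \<ge> 0" using d by (simp add: P_def)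
  have c: "cmod D \<le> \<bar>A - m1\<bar> + \<bar>m2\<bar>" using cmod_le[of D] D by simp
  have E: "Re D + (1 + \<delta>1) * \<bar>Im D\<bar> = (A - m1 + P) + \<bar>m2\<bar>" using D by (simp add: P_def algebra_simps)
  have X: "A - m1 + P \<ge> 0" using m1 A by (simp add: P_def)
  show "cmod D \<le> (1 + \<delta>1) * (Re D + (1 + \<delta>1) * \<bar>Im D\<bar>)"
  proof (cases "A - m1 \<ge> 0")
    case True
    have "cmod D \<le> (A - m1 + P) + \<bar>m2\<bar>" using c True P0 by linarith
    also have "\<dots> \<le> (1 + \<delta>1) * ((A - m1 + P) + \<bar>m2\<bar>)"
      using mult_right_mono[of 1 "1 + \<delta>1" "(A - m1 + P) + \<bar>m2\<bar>"] X d by simp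
    finally show ?thesis unfolding E .
  next
    case False
    have "cmod D \<le> P + \<bar>m2\<bar>" using c False X by linarith
    also have "\<dots> = (1 + \<delta>1) * \<bar>m2\<bar>" by (simp add: P_def algebra_simps)
    also have "\<dots> \<le> (1 + \<delta>1) * ((A - m1 + P) + \<bar>m2\<bar>)" using X d by (intro mult_left_mono) auto
    finally show ?thesis unfolding E .
  qed
qed

lemma zabs2_ge1: "\<zeta> \<noteq> (0,0) \<Longrightarrow> zabs2 \<zeta> \<ge> 1"
proof -
  assume z: "\<zeta> \<noteq> (0,0)"
  obtain x y where xy: "\<zeta> = (x, y)" by (cases \<zeta>)
  have "x\<^sup>2 + y\<^sup>2 > 0" using z xy by (simp add: sum_power2_gt_zero_iff)
  hence "real_of_int 1 \<le> real_of_int (x\<^sup>2 + y\<^sup>2)" by (simp only: of_int_le_iff)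
  thus ?thesis by (simp add: zabs2_def xy)
qed

lemma zabs_ge1: "\<zeta> \<noteq> (0,0) \<Longrightarrow> zabs \<zeta> \<ge> 1"
  using zabs2_ge1[of \<zeta>] by (simp add: zabs_def)

lemma fst_le_zabs: "cmod (of_int (fst \<zeta>)) \<le> zabs \<zeta>" "cmod (of_int (snd \<zeta>)) \<le> zabs \<zeta>"
  by (auto simp: zabs_def zabs2_def intro!: real_le_rsqrt)

lemma zabs_le_bz: "zabs \<zeta> \<le> bz \<zeta>" by (simp add: bz_def)

lemma one_c_Hs:
  assumes a: "a > 0" and nu: "\<nu> > 0" and s: "s < 1/2"
  shows "one_c a \<in> Hs \<nu> s \<zeta>"
proof -
  obtain C1 where C1: "C1 \<ge> 1" "\<And>\<zeta> k. wt \<nu> s \<zeta> k \<le> C1 * ((real k)\<^sup>2 + (bz \<zeta>)\<^sup>2) powr s" using wt_equiv[OF nu] by blast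
  obtain C2 where C2: "C2 \<ge> 0" "\<And>x N. x \<ge> 1 \<Longrightarrow> (\<Sum>k<N. ((real k)\<^sup>2 + x) powr s / (real k)\<^sup>2) \<le> C2 * x powr s"
    using sum_inv_square_weight[OF s] by blast
  define c where "c = 2 * sqrt (2/a) * (a / pi)"
  have c0: "c \<ge> 0" using a by (simp add: c_def)
  have pt: "wt \<nu> s \<zeta> k * (cmod (one_c a k))\<^sup>2 \<le> C1 * c\<^sup>2 * (((real k)\<^sup>2 + (bz \<zeta>)\<^sup>2) powr s / (real k)\<^sup>2)" for k
  proof -
    have "(cmod (one_c a k))\<^sup>2 \<le> (c / real k)\<^sup>2" using one_c_bound[OF a, of k] unfolding c_def by (intro power_mono) auto
    hence "wt \<nu> s \<zeta> k * (cmod (one_c a k))\<^sup>2 \<le> (C1 * ((real k)\<^sup>2 + (bz \<zeta>)\<^sup>2) powr s) * (c / real k)\<^sup>2"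
      using C1 wt_nonneg by (intro mult_mono) auto
    thus ?thesis by (simp add: power_divide mult_ac)
  qed
  have b1: "(bz \<zeta>)\<^sup>2 \<ge> 1" using bz_ge1[of \<zeta>] by simp
  define B where "B = C1 * c\<^sup>2 * (C2 * ((bz \<zeta>)\<^sup>2) powr s)"
  have B0: "B \<ge> 0" using C1 C2 by (simp add: B_def)
  have "l2s (wt \<nu> s \<zeta>) (one_c a) \<and> l2n (wt \<nu> s \<zeta>) (one_c a) \<le> sqrt B"
  proof (rule l2_of_partial[OF wt_nonneg])
    fix n
    have "(\<Sum>k<n. wt \<nu> s \<zeta> k * (cmod (one_c a k))\<^sup>2) \<le> (\<Sum>k<n. C1 * c\<^sup>2 * (((real k)\<^sup>2 + (bz \<zeta>)\<^sup>2) powr s / (real k)\<^sup>2))"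
      by (rule sum_mono) (rule pt)
    also have "\<dots> = C1 * c\<^sup>2 * (\<Sum>k<n. (((real k)\<^sup>2 + (bz \<zeta>)\<^sup>2) powr s / (real k)\<^sup>2))" by (simp only: sum_distrib_left)
    also have "\<dots> \<le> B" unfolding B_def using C1 by (intro mult_left_mono C2(2) b1) auto
    finally show "(\<Sum>k<n. wt \<nu> s \<zeta> k * (cmod (one_c a k))\<^sup>2) \<le> (sqrt B)\<^sup>2" using B0 by simp
  qed (use B0 in simp)
  thus ?thesis by (simp add: Hs_iff one_c_0)
qed

section \<open>Sector bounds on the symbol, uniform in \<lambda>, \<zeta> and k\<close>

locale prim_eq =
  fixes a \<nu> \<alpha> \<beta> \<gamma> \<delta>1 \<delta>2 \<sigma> :: real
  assumes a: "a > 0" and nu: "\<nu> > 0" and d1: "\<delta>1 > 0" and d2: "\<delta>2 < \<nu> / 2" and sg: "- 3/2 < \<sigma>" "\<sigma> < 1/2"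
begin

definition good :: "complex \<Rightarrow> int \<times> int \<Rightarrow> bool" where
  "good lam \<zeta> \<longleftrightarrow> lam \<in> Sset \<delta>1 \<delta>2 \<and> \<zeta> \<noteq> (0,0)"

text \<open>Since |\<zeta>| \<ge> 1, half of \<nu>|\<zeta>|^2 absorbs \<delta>2 < \<nu>/2, and the
  part A of Re D left after removing \<mu>1 is nonnegative and elliptic; \<open>sector_bound\<close>
  then excludes cancellation. A single constant serves all comparisons, and later proofs select the
  ones they use.\<close>

lemma D_bounds:
  "\<exists>K\<ge>1. \<forall>lam \<zeta> k. good lam \<zeta> \<longrightarrow>
     1 + \<nu> * real k ^ 2 + \<nu> * zabs2 \<zeta> \<le> K * cmod (symb a \<nu> lam \<zeta> k) \<and>
     bw2 lam \<zeta> \<le> K * cmod (symb a \<nu> lam \<zeta> k) \<and>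
     cmod (symb a \<nu> lam \<zeta> k) \<le> K * (bw2 lam \<zeta> + real k ^ 2) \<and>
     cmod (symb a \<nu> lam \<zeta> k) \<le> K * (Re (symb a \<nu> lam \<zeta> k) + (1 + \<delta>1) * \<bar>Im (symb a \<nu> lam \<zeta> k)\<bar>)"
proof -
  \<comment> \<open>One half of the horizontal part \<nu>|\<zeta>|^2 is spent on \<delta>2, the
    other half is kept; the vertical part is kept whole.\<close>
  define c0 where "c0 = min (\<nu>/2) (\<nu> * (pi/a)\<^sup>2)"
  have c0: "c0 > 0" "c0 \<le> \<nu>/2" "c0 \<le> \<nu> * (pi/a)\<^sup>2" using nu a by (auto simp: c0_def)
  define T where "T = (1 + \<delta>1) / c0"
  have T0: "T > 0" using c0 d1 by (simp add: T_def)
  define K1 K2 K3 where "K1 = (1 + \<nu>) * T" and "K2 = (\<bar>\<delta>2\<bar> + 4) * T + (2 + \<delta>1)" and "K3 = 1 + \<nu> + \<nu> * (pi/a)\<^sup>2"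
  define K where "K = 1 + K1 + K2 + K3 + (1 + \<delta>1)"
  have Kp: "K1 \<ge> 0" "K2 \<ge> 0" "K3 \<ge> 0" using T0 nu d1 by (auto simp: K1_def K2_def K3_def)
  have KK: "K \<ge> 1" "K \<ge> K1" "K \<ge> K2" "K \<ge> K3" "K \<ge> 1 + \<delta>1" using Kp d1 by (auto simp: K_def)
  show ?thesis
  proof (intro exI[of _ K] conjI allI impI KK(1))
    fix lam \<zeta> k assume g: "good lam \<zeta>"
    then obtain m1 m2 where lam: "lam = Complex (- \<delta>2 - m1) m2" "\<bar>m2\<bar> \<ge> m1 / \<delta>1" by (auto simp: good_def Sset_def)
    have Z: "zabs2 \<zeta> \<ge> 1" using g zabs2_ge1 by (simp add: good_def)
    define D where "D = symb a \<nu> lam \<zeta> k"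
    define A where "A = - \<delta>2 + \<nu> * zabs2 \<zeta> + \<nu> * (real k * pi / a)\<^sup>2"
    have "Re D = A - m1" "Im D = m2" by (simp_all add: D_def symb_def lam A_def)
    have A1: "c0 * (zabs2 \<zeta> + real k ^ 2) \<le> A"
    proof -
      have "c0 * zabs2 \<zeta> \<le> (\<nu>/2) * zabs2 \<zeta>" using c0 Z by (intro mult_right_mono) auto
      moreover have "(\<nu>/2) * 1 \<le> (\<nu>/2) * zabs2 \<zeta>" using nu Z by (intro mult_left_mono) auto
      moreover have "c0 * real k ^ 2 \<le> (\<nu> * (pi/a)\<^sup>2) * real k ^ 2" using c0 by (intro mult_right_mono) auto
      moreover have "(\<nu> * (pi/a)\<^sup>2) * real k ^ 2 = \<nu> * (real k * pi / a)\<^sup>2" by (simp add: power_divide power_mult_distrib)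
      moreover have "c0 * (zabs2 \<zeta> + real k ^ 2) = c0 * zabs2 \<zeta> + c0 * real k ^ 2" by (simp add: distrib_left)
      ultimately show ?thesis using d2 unfolding A_def by linarith
    qed
    have A0: "A \<ge> 0" using A1 c0 Z by (meson add_nonneg_nonneg mult_nonneg_nonneg order_trans less_imp_le zero_le_power2 zero_le_one)
    note sb = sector_bound[OF A0 d1 lam(2) \<open>Re D = A - m1\<close> \<open>Im D = m2\<close>]
    have "c0 * (zabs2 \<zeta> + real k ^ 2) \<le> (1 + \<delta>1) * cmod D" using A1 sb(1) by linarith
    hence zk: "zabs2 \<zeta> + real k ^ 2 \<le> T * cmod D" using c0 by (simp add: T_def field_simps)
    have z1: "zabs2 \<zeta> \<le> T * cmod D" using zk zero_le_power2[of "real k"] by linarith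
    have n0: "cmod D \<ge> 0" by simp
    have "1 + \<nu> * real k ^ 2 + \<nu> * zabs2 \<zeta> \<le> zabs2 \<zeta> + \<nu> * (zabs2 \<zeta> + real k ^ 2)" using Z by (simp add: algebra_simps)
    also have "\<dots> \<le> T * cmod D + \<nu> * (T * cmod D)" using zk z1 nu by (intro add_mono mult_left_mono) auto
    also have "\<dots> = K1 * cmod D" by (simp add: K1_def algebra_simps)
    also have "\<dots> \<le> K * cmod D" by (rule mult_right_mono[OF KK(2) n0])
    finally show "1 + \<nu> * real k ^ 2 + \<nu> * zabs2 \<zeta> \<le> K * cmod (symb a \<nu> lam \<zeta> k)" by (simp add: D_def)
    have l: "cmod lam \<le> \<bar>\<delta>2\<bar> + \<bar>m1\<bar> + \<bar>m2\<bar>" using cmod_le[of lam] by (simp add: lam)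
    have b4: "(bz \<zeta>)\<^sup>2 \<le> 4 * zabs2 \<zeta>" using bz_sq_le[of \<zeta>] Z by linarith
    have dd: "\<bar>\<delta>2\<bar> * 1 \<le> \<bar>\<delta>2\<bar> * zabs2 \<zeta>" using Z by (intro mult_left_mono) auto
    have "bw2 lam \<zeta> \<le> \<bar>\<delta>2\<bar> * zabs2 \<zeta> + \<bar>m1\<bar> + \<bar>m2\<bar> + 4 * zabs2 \<zeta>" using l b4 dd by (simp add: bw2_def)
    also have "\<dots> \<le> \<bar>\<delta>2\<bar> * (T * cmod D) + (1 + \<delta>1) * cmod D + cmod D + 4 * (T * cmod D)"
      using z1 sb by (intro add_mono mult_left_mono) auto
    also have "\<dots> = K2 * cmod D" by (simp add: K2_def algebra_simps)
    also have "\<dots> \<le> K * cmod D" by (rule mult_right_mono[OF KK(3) n0])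
    finally show "bw2 lam \<zeta> \<le> K * cmod (symb a \<nu> lam \<zeta> k)" by (simp add: D_def)
    have W0: "bw2 lam \<zeta> + real k ^ 2 \<ge> 0" using bw2_ge1[of lam \<zeta>] by (intro add_nonneg_nonneg) auto
    have zW: "zabs2 \<zeta> \<le> bw2 lam \<zeta> + real k ^ 2" "cmod lam \<le> bw2 lam \<zeta> + real k ^ 2" "real k ^ 2 \<le> bw2 lam \<zeta> + real k ^ 2"
      using bz_sq_ge[of \<zeta>] bw2_ge1[of lam \<zeta>] zero_le_power2[of "real k"] norm_ge_zero[of lam] zero_le_power2[of "bz \<zeta>"] unfolding bw2_def by linarith+
    have "cmod D \<le> cmod lam + cmod (of_real (\<nu> * zabs2 \<zeta>)) + cmod (of_real (\<nu> * (real k * pi / a)\<^sup>2))"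
      unfolding D_def symb_def by (intro order_trans[OF norm_triangle_ineq] add_mono order_refl)
    also have "\<dots> = cmod lam + \<nu> * zabs2 \<zeta> + (\<nu> * (pi/a)\<^sup>2) * real k ^ 2"
      using nu zabs2_nonneg by (simp only: norm_of_real) (simp add: power_divide power_mult_distrib abs_mult)
    also have "\<dots> \<le> 1 * (bw2 lam \<zeta> + real k ^ 2) + \<nu> * (bw2 lam \<zeta> + real k ^ 2) + (\<nu> * (pi/a)\<^sup>2) * (bw2 lam \<zeta> + real k ^ 2)"
      using nu zW by (intro add_mono mult_left_mono) auto
    also have "\<dots> = K3 * (bw2 lam \<zeta> + real k ^ 2)" unfolding K3_def by (simp only: distrib_right)
    also have "\<dots> \<le> K * (bw2 lam \<zeta> + real k ^ 2)" by (rule mult_right_mono[OF KK(4) W0])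
    finally show "cmod (symb a \<nu> lam \<zeta> k) \<le> K * (bw2 lam \<zeta> + real k ^ 2)" by (simp add: D_def)
    have e0: "Re D + (1 + \<delta>1) * \<bar>Im D\<bar> \<ge> 0"
    proof -
      have "0 \<le> (1 + \<delta>1) * (Re D + (1 + \<delta>1) * \<bar>Im D\<bar>)" using sb(4) n0 by linarith
      thus ?thesis using d1 by (simp add: zero_le_mult_iff)
    qed
    have "cmod D \<le> K * (Re D + (1 + \<delta>1) * \<bar>Im D\<bar>)"
      using sb(4) mult_right_mono[OF KK(5) e0] by linarith
    thus "cmod (symb a \<nu> lam \<zeta> k) \<le> K * (Re (symb a \<nu> lam \<zeta> k) + (1 + \<delta>1) * \<bar>Im (symb a \<nu> lam \<zeta> k)\<bar>)"
      by (simp add: D_def)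
  qed
qed

lemma symb_nz: assumes "good lam \<zeta>" shows "symb a \<nu> lam \<zeta> k \<noteq> 0"
proof -
  obtain K where "bw2 lam \<zeta> \<le> K * cmod (symb a \<nu> lam \<zeta> k)" using D_bounds assms by blast
  thus ?thesis using bw2_ge1[of lam \<zeta>] by auto
qed

text \<open>This is the origin of the weights M_s: as |1_k| is at most of order 1/k and |D_k|^2 is
  at least of order k^4 + \<langle>\<omega>\<rangle>^4, the squared norm is dominated term by term
  by M_(-s)^2. The limit 5/2 is the 1/2 of the constant function plus the two derivatives gained by
  1/D.\<close>

lemma one_over_D:
  assumes s: "s < 5/2"
  shows "\<exists>C\<ge>0. \<forall>lam \<zeta>. good lam \<zeta> \<longrightarrow> (\<lambda>k. one_c a k / symb a \<nu> lam \<zeta> k) \<in> Hs \<nu> s \<zeta> \<and>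
     nrm \<nu> s \<zeta> (\<lambda>k. one_c a k / symb a \<nu> lam \<zeta> k) \<le> C * Ms (-s) lam \<zeta>"
proof -
  obtain K where K: "K \<ge> 1" "\<And>lam \<zeta> k. good lam \<zeta> \<Longrightarrow> 1 + \<nu> * real k ^ 2 + \<nu> * zabs2 \<zeta> \<le> K * cmod (symb a \<nu> lam \<zeta> k)"
    "\<And>lam \<zeta> k. good lam \<zeta> \<Longrightarrow> bw2 lam \<zeta> \<le> K * cmod (symb a \<nu> lam \<zeta> k)" using D_bounds by blast
  obtain C1 where C1: "C1 \<ge> 1" "\<And>\<zeta> k. wt \<nu> s \<zeta> k \<le> C1 * ((real k)\<^sup>2 + (bz \<zeta>)\<^sup>2) powr s" using wt_equiv[OF nu] by blast
  define c where "c = 2 * sqrt (2/a) * (a / pi)"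
  \<comment> \<open>E adds the constants of the two bounds k^4 \<le> (K/\<nu>)^2 |D|^2 and W^2 \<le>
    K^2 |D|^2.\<close>
  define E where "E = (K/\<nu>)\<^sup>2 + K\<^sup>2"
  have E0: "E > 0" using K(1) unfolding E_def by (intro add_nonneg_pos) auto
  define B where "B = C1 * c\<^sup>2 * E"
  have B0: "B \<ge> 0" using C1 E0 by (simp add: B_def)
  have "-s > -5/2" using s by simp
  from Ms_summable_bound[OF this] have M: "\<And>lam \<zeta>. summable (\<lambda>k. 1 / (real k ^ 2 * (real k ^ 4 + (bw2 lam \<zeta>)^2) * (real k ^ 2 + (bz \<zeta>)^2) powr (-s)))"
    "\<And>lam \<zeta>. (Ms (-s) lam \<zeta>)\<^sup>2 = (\<Sum>k. 1 / (real k ^ 2 * (real k ^ 4 + (bw2 lam \<zeta>)^2) * (real k ^ 2 + (bz \<zeta>)^2) powr (-s)))"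
    "\<And>lam \<zeta>. 0 < Ms (-s) lam \<zeta>" by blast+
  show ?thesis
  proof (intro exI[of _ "sqrt B"] conjI allI impI)
    show "0 \<le> sqrt B" using B0 by simp
    fix lam \<zeta> assume g: "good lam \<zeta>"
    define W b where "W = bw2 lam \<zeta>" and "b = (bz \<zeta>)\<^sup>2"
    have W1: "W \<ge> 1" by (simp add: W_def bw2_ge1)
    let ?m = "\<lambda>k. 1 / (real k ^ 2 * (real k ^ 4 + W^2) * (real k ^ 2 + b) powr (-s))"
    have M': "summable ?m" "(Ms (-s) lam \<zeta>)\<^sup>2 = (\<Sum>k. ?m k)" using M by (simp_all add: W_def b_def)
    have pt: "wt \<nu> s \<zeta> k * (cmod (one_c a k / symb a \<nu> lam \<zeta> k))\<^sup>2 \<le> B * ?m k" for k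
    proof (cases "k = 0")
      case False
      define n where "n = cmod (symb a \<nu> lam \<zeta> k)"
      have n0: "n > 0" using symb_nz[OF g] by (simp add: n_def)
      have Z0: "zabs2 \<zeta> \<ge> 0" by (rule zabs2_nonneg)
      have "\<nu> * real k ^ 2 \<le> K * n" using K(2)[OF g, of k] Z0 nu mult_nonneg_nonneg[of \<nu> "zabs2 \<zeta>"] unfolding n_def by linarith
      hence "real k ^ 2 \<le> K / \<nu> * n" using nu by (simp add: field_simps)
      hence "(real k ^ 2)\<^sup>2 \<le> (K / \<nu> * n)\<^sup>2" by (intro power_mono) auto
      moreover have "W\<^sup>2 \<le> (K * n)\<^sup>2" using K(3)[OF g, of k] W1 unfolding n_def W_def by (intro power_mono) auto
      moreover have "(real k ^ 2)\<^sup>2 = real k ^ 4" by simp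
      ultimately have "real k ^ 4 + W\<^sup>2 \<le> E * n\<^sup>2" unfolding E_def power_mult_distrib distrib_right by linarith
      moreover have kw: "real k ^ 4 + W\<^sup>2 > 0" using W1 by (intro add_nonneg_pos) auto
      ultimately have e2: "1 / n\<^sup>2 \<le> E / (real k ^ 4 + W\<^sup>2)" using n0 by (simp add: field_simps)
      have "(cmod (one_c a k))\<^sup>2 \<le> (c / real k)\<^sup>2" using one_c_bound[OF a, of k] unfolding c_def by (intro power_mono) auto
      hence e1: "(cmod (one_c a k))\<^sup>2 \<le> c\<^sup>2 / (real k)\<^sup>2" by (simp add: power_divide)
      have "wt \<nu> s \<zeta> k * (cmod (one_c a k / symb a \<nu> lam \<zeta> k))\<^sup>2 = wt \<nu> s \<zeta> k * ((cmod (one_c a k))\<^sup>2 * (1 / n\<^sup>2))"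
        by (simp add: n_def norm_divide power_divide)
      also have "\<dots> \<le> (C1 * (real k ^ 2 + b) powr s) * ((c\<^sup>2 / (real k)\<^sup>2) * (E / (real k ^ 4 + W\<^sup>2)))"
        using C1 wt_nonneg e1 e2 unfolding b_def by (intro mult_mono) auto
      also have "(real k ^ 2 + b) powr s = 1 / (real k ^ 2 + b) powr (-s)" using powr_minus_divide[of "real k ^ 2 + b" "-s"] by simp
      also have "(C1 * (1 / (real k ^ 2 + b) powr (-s))) * ((c\<^sup>2 / (real k)\<^sup>2) * (E / (real k ^ 4 + W\<^sup>2))) = B * ?m k"
        by (simp add: B_def mult_ac)
      finally show ?thesis .
    qed (simp add: one_c_0)
    have s: "summable (\<lambda>k. wt \<nu> s \<zeta> k * (cmod (one_c a k / symb a \<nu> lam \<zeta> k))\<^sup>2)"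
      by (rule summable_comparison_test'[where N=0, OF summable_mult[OF M'(1), of B]]) (use pt wt_nonneg in \<open>auto simp: abs_mult\<close>)
    show "(\<lambda>k. one_c a k / symb a \<nu> lam \<zeta> k) \<in> Hs \<nu> s \<zeta>" using s by (simp add: Hs_def one_c_0)
    have "(\<Sum>k. wt \<nu> s \<zeta> k * (cmod (one_c a k / symb a \<nu> lam \<zeta> k))\<^sup>2) \<le> (\<Sum>k. B * ?m k)"
      by (rule suminf_le[OF pt s summable_mult[OF M'(1)]])
    also have "\<dots> = B * (Ms (-s) lam \<zeta>)\<^sup>2" unfolding M'(2) by (rule suminf_mult[OF M'(1)])
    finally have "nrm \<nu> s \<zeta> (\<lambda>k. one_c a k / symb a \<nu> lam \<zeta> k) \<le> sqrt (B * (Ms (-s) lam \<zeta>)\<^sup>2)"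
      unfolding nrm_def by (rule real_sqrt_le_mono)
    thus "nrm \<nu> s \<zeta> (\<lambda>k. one_c a k / symb a \<nu> lam \<zeta> k) \<le> sqrt B * Ms (-s) lam \<zeta>"
      using M(3)[of lam \<zeta>] by (simp add: real_sqrt_mult)
  qed
qed

end

section \<open>Inversion of the leading part: the scalar sum and the pressure\<close>

context prim_eq
begin

text \<open>The terms are complex and could cancel. All D_k share the imaginary part Im \<lambda>,
  so one real functional Re S - e Im S makes every term nonnegative, by the sector bound. Keeping
  only k = 1, where the coefficient of 1 is nonzero, leaves a multiple of 1/|D_1|, and |D_1| is at
  most of order \<langle>\<omega>\<rangle>^2.\<close>

lemma S_lower:
  "\<exists>c>0. \<forall>lam \<zeta>. good lam \<zeta> \<longrightarrow> summable (\<lambda>k. one_c a k * (one_c a k / symb a \<nu> lam \<zeta> k)) \<and>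
     c / bw2 lam \<zeta> \<le> cmod (\<Sum>k. one_c a k * (one_c a k / symb a \<nu> lam \<zeta> k))"
proof -
  obtain K where K: "K \<ge> 1"
    "\<And>lam \<zeta> k. good lam \<zeta> \<Longrightarrow> cmod (symb a \<nu> lam \<zeta> k) \<le> K * (bw2 lam \<zeta> + real k ^ 2)"
    "\<And>lam \<zeta> k. good lam \<zeta> \<Longrightarrow> cmod (symb a \<nu> lam \<zeta> k) \<le> K * (Re (symb a \<nu> lam \<zeta> k) + (1 + \<delta>1) * \<bar>Im (symb a \<nu> lam \<zeta> k)\<bar>)"
    using D_bounds by blast
  obtain C where C: "\<And>lam \<zeta>. good lam \<zeta> \<Longrightarrow> (\<lambda>k. one_c a k / symb a \<nu> lam \<zeta> k) \<in> Hs \<nu> 0 \<zeta>"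
    using one_over_D[of 0] by auto
  define r where "r k = Re (one_c a k)" for k
  have r1: "r 1 > 0" unfolding r_def by (rule one_c_1[OF a])
  define c where "c = (r 1)\<^sup>2 / (K * K * 2 * (2 + \<delta>1))"
  have c0: "c > 0" unfolding c_def using r1 K(1) d1 by (intro divide_pos_pos mult_pos_pos zero_less_power) auto
  show ?thesis
  proof (intro exI[of _ c] conjI allI impI c0)
    fix lam \<zeta> assume g: "good lam \<zeta>"
    let ?y = "\<lambda>k. one_c a k * (one_c a k / symb a \<nu> lam \<zeta> k)"
    \<comment> \<open>The exponent is written -0 so that the pairing of H^0 with its dual applies
      literally.\<close>
    have "(\<lambda>k. one_c a k / symb a \<nu> lam \<zeta> k) \<in> Hs \<nu> (-0) \<zeta>" using C[OF g] by simp
    from Hs_pairing[OF nu one_c_Hs[OF a nu] this] show sy: "summable ?y" by simp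
    define S where "S = (\<Sum>k. ?y k)"
    have yS: "?y sums S" unfolding S_def by (rule summable_sums[OF sy])
    \<comment> \<open>Inverting D reverses the sign of its imaginary part, hence the minus sign in
      front of e below; the factor 1+\<delta>1 is the one of \<open>sector_bound\<close>.\<close>
    define e where "e = (1 + \<delta>1) * sgn (Im lam)"
    have lS: "(\<lambda>k. Re (?y k) - e * Im (?y k)) sums (Re S - e * Im S)"
      by (intro sums_diff sums_mult sums_Re[OF yS] sums_Im[OF yS])
    have ly: "Re (?y k) - e * Im (?y k) = (r k)\<^sup>2 * ((Re (symb a \<nu> lam \<zeta> k) + (1 + \<delta>1) * \<bar>Im (symb a \<nu> lam \<zeta> k)\<bar>) / (cmod (symb a \<nu> lam \<zeta> k))\<^sup>2)" for k
    proof -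
      define D where "D = symb a \<nu> lam \<zeta> k"
      have y: "?y k = of_real ((r k)\<^sup>2) * inverse D"
        unfolding D_def r_def by (subst (1 2) one_c_real) (simp add: power2_eq_square divide_inverse mult_ac)
      have iD: "Re (inverse D) = Re D / (cmod D)\<^sup>2" "Im (inverse D) = - Im D / (cmod D)\<^sup>2"
        by (simp_all add: cmod_power2)
      have imD: "Im D = Im lam" by (simp add: D_def symb_def)
      have sg: "e * Im D = (1 + \<delta>1) * \<bar>Im D\<bar>" unfolding imD e_def by (simp add: abs_sgn mult.commute)
      have "Re (?y k) - e * Im (?y k) = (r k)\<^sup>2 * Re (inverse D) - e * ((r k)\<^sup>2 * Im (inverse D))"
        unfolding y by (simp only: Re_complex_of_real Im_complex_of_real times_complex.simps) simp
      also have "\<dots> = (r k)\<^sup>2 * ((Re D + e * Im D) / (cmod D)\<^sup>2)"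
        unfolding iD by (simp add: add_divide_distrib distrib_left)
      finally show ?thesis unfolding sg by (simp add: D_def)
    qed
    have low: "(r k)\<^sup>2 / (K * cmod (symb a \<nu> lam \<zeta> k)) \<le> Re (?y k) - e * Im (?y k)" for k
    proof -
      define n where "n = cmod (symb a \<nu> lam \<zeta> k)"
      define q where "q = Re (symb a \<nu> lam \<zeta> k) + (1 + \<delta>1) * \<bar>Im (symb a \<nu> lam \<zeta> k)\<bar>"
      have n0: "n > 0" using symb_nz[OF g] by (simp add: n_def)
      have "n \<le> K * q" using K(3)[OF g, of k] by (simp add: n_def q_def)
      hence "1 / (K * n) \<le> q / n\<^sup>2" using n0 K(1) by (simp add: field_simps power2_eq_square)
      hence "(r k)\<^sup>2 * (1 / (K * n)) \<le> (r k)\<^sup>2 * (q / n\<^sup>2)" by (rule mult_left_mono) simp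
      thus ?thesis unfolding ly by (simp add: n_def q_def)
    qed
    have pos: "0 \<le> Re (?y k) - e * Im (?y k)" for k
      by (rule order_trans[OF _ low]) (use K(1) in auto)
    have "(r 1)\<^sup>2 / (K * cmod (symb a \<nu> lam \<zeta> 1)) \<le> Re S - e * Im S"
    proof -
      have "Re (?y 1) - e * Im (?y 1) \<le> (\<Sum>k. Re (?y k) - e * Im (?y k))"
        using sum_le_suminf[OF sums_summable[OF lS], of "{1}"] pos by simp
      thus ?thesis using low[of 1] sums_unique[OF lS] by linarith
    qed
    also have "Re S - e * Im S \<le> (2 + \<delta>1) * cmod S"
    proof -
      have "\<bar>e\<bar> \<le> 1 + \<delta>1" using d1 by (simp add: e_def abs_mult abs_sgn_eq)
      hence "\<bar>e * Im S\<bar> \<le> (1 + \<delta>1) * cmod S" unfolding abs_mult using d1 abs_Im_le_cmod by (intro mult_mono) auto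
      hence "- (e * Im S) \<le> (1 + \<delta>1) * cmod S" by linarith
      moreover have "Re S \<le> cmod S" by (rule complex_Re_le_cmod)
      moreover have "(2 + \<delta>1) * cmod S = cmod S + (1 + \<delta>1) * cmod S" by (simp add: algebra_simps)
      ultimately show ?thesis by linarith
    qed
    finally have 1: "(r 1)\<^sup>2 / (K * cmod (symb a \<nu> lam \<zeta> 1)) \<le> (2 + \<delta>1) * cmod S" .
    define W where "W = bw2 lam \<zeta>"
    have W1: "W \<ge> 1" by (simp add: W_def bw2_ge1)
    have "cmod (symb a \<nu> lam \<zeta> 1) \<le> K * (W + 1)" using K(2)[OF g, of 1] by (simp add: W_def)
    also have "\<dots> \<le> K * (2 * W)" using W1 K(1) by (intro mult_left_mono) auto
    finally have n: "cmod (symb a \<nu> lam \<zeta> 1) \<le> K * (2 * W)" .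
    have "(r 1)\<^sup>2 / (K * (K * (2 * W))) \<le> (r 1)\<^sup>2 / (K * cmod (symb a \<nu> lam \<zeta> 1))"
      using n K(1) W1 symb_nz[OF g, of 1] by (intro divide_left_mono mult_left_mono mult_pos_pos) auto
    with 1 have "(r 1)\<^sup>2 / (K * (K * (2 * W))) \<le> (2 + \<delta>1) * cmod S" by linarith
    moreover have "x / d \<le> s" if "x \<le> d * s" "d > 0" for x d s :: real
      using that by (simp add: pos_divide_le_eq mult.commute)
    ultimately have "(r 1)\<^sup>2 / (K * (K * (2 * W))) / (2 + \<delta>1) \<le> cmod S" using d1 by fastforce
    moreover have "(r 1)\<^sup>2 / (K * (K * (2 * W))) / (2 + \<delta>1) = c / W" by (simp add: c_def mult_ac)
    ultimately show "c / bw2 lam \<zeta> \<le> cmod (\<Sum>k. ?y k)" by (simp add: W_def S_def)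
  qed
qed

text \<open>The multiplier 1/D can be spent on two derivatives, on \<langle>\<omega>\<rangle>^2, or
  half on each. The mixed choice yields the factor \<langle>\<omega>\<rangle>^(-1), weakened here to
  \<open>bw2\<close> to the power -1/4 so that it matches the decay obtained for the pressure part
  in \<open>Ms_product_small\<close>.\<close>

lemma invD:
  "\<exists>C\<ge>1. \<forall>lam \<zeta> f. good lam \<zeta> \<longrightarrow> f \<in> Hs \<nu> \<sigma> \<zeta> \<longrightarrow>
     (\<lambda>k. 1 / symb a \<nu> lam \<zeta> k * f k) \<in> Hs \<nu> (\<sigma> + 2) \<zeta> \<and>
     nrm \<nu> (\<sigma> + 2) \<zeta> (\<lambda>k. 1 / symb a \<nu> lam \<zeta> k * f k) \<le> C * nrm \<nu> \<sigma> \<zeta> f \<and>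
     bw2 lam \<zeta> * nrm \<nu> \<sigma> \<zeta> (\<lambda>k. 1 / symb a \<nu> lam \<zeta> k * f k) \<le> C * nrm \<nu> \<sigma> \<zeta> f \<and>
     nrm \<nu> (\<sigma> + 1) \<zeta> (\<lambda>k. 1 / symb a \<nu> lam \<zeta> k * f k) \<le> C * bw2 lam \<zeta> powr (-1/4) * nrm \<nu> \<sigma> \<zeta> f"
proof -
  obtain K where K: "K \<ge> 1" "\<And>lam \<zeta> k. good lam \<zeta> \<Longrightarrow> 1 + \<nu> * real k ^ 2 + \<nu> * zabs2 \<zeta> \<le> K * cmod (symb a \<nu> lam \<zeta> k)"
    "\<And>lam \<zeta> k. good lam \<zeta> \<Longrightarrow> bw2 lam \<zeta> \<le> K * cmod (symb a \<nu> lam \<zeta> k)" using D_bounds by blast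
  show ?thesis
  proof (intro exI[of _ K] allI impI)
    show "1 \<le> K \<and> (\<forall>lam \<zeta> f. good lam \<zeta> \<longrightarrow> f \<in> Hs \<nu> \<sigma> \<zeta> \<longrightarrow>
     (\<lambda>k. 1 / symb a \<nu> lam \<zeta> k * f k) \<in> Hs \<nu> (\<sigma> + 2) \<zeta> \<and>
     nrm \<nu> (\<sigma> + 2) \<zeta> (\<lambda>k. 1 / symb a \<nu> lam \<zeta> k * f k) \<le> K * nrm \<nu> \<sigma> \<zeta> f \<and>
     bw2 lam \<zeta> * nrm \<nu> \<sigma> \<zeta> (\<lambda>k. 1 / symb a \<nu> lam \<zeta> k * f k) \<le> K * nrm \<nu> \<sigma> \<zeta> f \<and>
     nrm \<nu> (\<sigma> + 1) \<zeta> (\<lambda>k. 1 / symb a \<nu> lam \<zeta> k * f k) \<le> K * bw2 lam \<zeta> powr (-1/4) * nrm \<nu> \<sigma> \<zeta> f)"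
    proof (intro conjI allI impI K(1))
      fix lam \<zeta> f assume g: "good lam \<zeta>" and f: "f \<in> Hs \<nu> \<sigma> \<zeta>"
      define W where "W = bw2 lam \<zeta>"
      have W1: "W \<ge> 1" by (simp add: W_def bw2_ge1)
      let ?n = "\<lambda>k. cmod (symb a \<nu> lam \<zeta> k)" and ?y = "\<lambda>k. 1 + \<nu> * real k ^ 2 + \<nu> * zabs2 \<zeta>"
      have n0: "?n k > 0" for k using symb_nz[OF g] by simp
      have y1: "?y k \<ge> 1" for k by (rule wt_base_ge1[OF nu])
      have m: "(cmod (1 / symb a \<nu> lam \<zeta> k))\<^sup>2 = 1 / (?n k)\<^sup>2" for k by (simp add: norm_divide power_divide)
      have y2: "(?y k)\<^sup>2 \<le> K\<^sup>2 * (?n k)\<^sup>2" for k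
        using power_mono[OF K(2)[OF g, of k], of 2] y1[of k] by (simp add: power_mult_distrib)
      have W2: "W\<^sup>2 \<le> K\<^sup>2 * (?n k)\<^sup>2" for k
        using power_mono[OF K(3)[OF g, of k], of 2] W1 by (simp add: power_mult_distrib W_def)
      have yW: "W * ?y k \<le> K\<^sup>2 * (?n k)\<^sup>2" for k
        using mult_mono[OF K(3)[OF g, of k] K(2)[OF g, of k]] y1[of k] K(1) by (simp add: W_def power2_eq_square mult_ac)
      have A: "(\<lambda>k. 1 / symb a \<nu> lam \<zeta> k * f k) \<in> Hs \<nu> (\<sigma> + 2) \<zeta> \<and>
        nrm \<nu> (\<sigma> + 2) \<zeta> (\<lambda>k. 1 / symb a \<nu> lam \<zeta> k * f k) \<le> K * nrm \<nu> \<sigma> \<zeta> f"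
      proof (rule Hs_multiplier[OF f])
        fix k :: nat
        have "(?y k)\<^sup>2 * (1 / (?n k)\<^sup>2) \<le> K\<^sup>2" using y2[of k] n0[of k] by (simp add: field_simps)
        from mult_left_mono[OF this wt_nonneg[of \<nu> \<sigma> \<zeta> k]]
        show "wt \<nu> (\<sigma> + 2) \<zeta> k * (cmod (1 / symb a \<nu> lam \<zeta> k))\<^sup>2 \<le> K\<^sup>2 * wt \<nu> \<sigma> \<zeta> k"
          unfolding m wt_add[OF nu] wt_2[OF nu] by (simp add: mult_ac)
      qed (use K(1) in simp)
      thus "(\<lambda>k. 1 / symb a \<nu> lam \<zeta> k * f k) \<in> Hs \<nu> (\<sigma> + 2) \<zeta>"
        "nrm \<nu> (\<sigma> + 2) \<zeta> (\<lambda>k. 1 / symb a \<nu> lam \<zeta> k * f k) \<le> K * nrm \<nu> \<sigma> \<zeta> f" by auto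
      have "nrm \<nu> \<sigma> \<zeta> (\<lambda>k. 1 / symb a \<nu> lam \<zeta> k * f k) \<le> (K / W) * nrm \<nu> \<sigma> \<zeta> f"
      proof (rule Hs_multiplier[OF f, THEN conjunct2])
        fix k :: nat
        have "1 / (?n k)\<^sup>2 \<le> (K / W)\<^sup>2" using W2[of k] n0[of k] W1 by (simp add: power_divide field_simps)
        from mult_left_mono[OF this wt_nonneg[of \<nu> \<sigma> \<zeta> k]]
        show "wt \<nu> \<sigma> \<zeta> k * (cmod (1 / symb a \<nu> lam \<zeta> k))\<^sup>2 \<le> (K / W)\<^sup>2 * wt \<nu> \<sigma> \<zeta> k"
          unfolding m by (simp add: mult_ac)
      qed (use K(1) W1 in simp)
      thus "bw2 lam \<zeta> * nrm \<nu> \<sigma> \<zeta> (\<lambda>k. 1 / symb a \<nu> lam \<zeta> k * f k) \<le> K * nrm \<nu> \<sigma> \<zeta> f"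
        using W1 by (simp add: W_def[symmetric] field_simps)
      show "nrm \<nu> (\<sigma> + 1) \<zeta> (\<lambda>k. 1 / symb a \<nu> lam \<zeta> k * f k) \<le> K * bw2 lam \<zeta> powr (-1/4) * nrm \<nu> \<sigma> \<zeta> f"
      proof (rule Hs_multiplier[OF f, THEN conjunct2])
        fix k :: nat
        have "?y k * (1 / (?n k)\<^sup>2) \<le> K\<^sup>2 / W" using yW[of k] n0[of k] W1 by (simp add: field_simps)
        also have "\<dots> = K\<^sup>2 * W powr (-1)" using W1 by (simp add: powr_minus divide_inverse)
        also have "\<dots> \<le> K\<^sup>2 * W powr (-1/2)" using W1 by (intro mult_left_mono powr_mono) auto
        also have "W powr (-1/2) = (W powr (-1/4))\<^sup>2" by (simp add: power2_eq_square powr_add[symmetric])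
        also have "K\<^sup>2 * (W powr (-1/4))\<^sup>2 = (K * W powr (-1/4))\<^sup>2" by (simp add: power_mult_distrib)
        finally have "?y k * (1 / (?n k)\<^sup>2) \<le> (K * bw2 lam \<zeta> powr (-1/4))\<^sup>2" by (simp add: W_def)
        from mult_left_mono[OF this wt_nonneg[of \<nu> \<sigma> \<zeta> k]]
        show "wt \<nu> (\<sigma> + 1) \<zeta> k * (cmod (1 / symb a \<nu> lam \<zeta> k))\<^sup>2 \<le> (K * bw2 lam \<zeta> powr (-1/4))\<^sup>2 * wt \<nu> \<sigma> \<zeta> k"
          unfolding m wt_add[OF nu] wt_1[OF nu] by (simp add: mult_ac)
      qed (use K(1) in simp)
    qed
  qed
qed

lemma Hs_lin2:
  assumes "f \<in> Hs \<nu> s \<zeta>" "g \<in> Hs \<nu> s \<zeta>"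
  shows "(\<lambda>k. c * f k + d * g k) \<in> Hs \<nu> s \<zeta> \<and> nrm \<nu> s \<zeta> (\<lambda>k. c * f k + d * g k) \<le> cmod c * nrm \<nu> s \<zeta> f + cmod d * nrm \<nu> s \<zeta> g"
  using Hs_add[of "\<lambda>k. c * f k" \<nu> s \<zeta> "\<lambda>k. d * g k"] Hs_scale[OF assms(1), of c] Hs_scale[OF assms(2), of d] by simp

text \<open>Multiplying the formulas for u and v by 1_k and summing separates the data from p0,
  whose factor is -i|\<zeta>|^2 times the scalar sum. With left-hand side 0 this determines the
  pressure; it serves both the estimate and the existence proof.\<close>

lemma p0_formula:
  assumes g: "good lam \<zeta>" and F: "f \<in> Hs \<nu> \<sigma> \<zeta>" "h \<in> Hs \<nu> \<sigma> \<zeta>"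
    and oD: "(\<lambda>k. one_c a k / symb a \<nu> lam \<zeta> k) \<in> Hs \<nu> (-\<sigma>) \<zeta>"
    and S: "summable (\<lambda>k. one_c a k * (one_c a k / symb a \<nu> lam \<zeta> k))"
    and u: "\<And>k. u k = 1 / symb a \<nu> lam \<zeta> k * f k - \<i> * of_int (fst \<zeta>) * p0 * (one_c a k / symb a \<nu> lam \<zeta> k)"
    and v: "\<And>k. v k = 1 / symb a \<nu> lam \<zeta> k * h k - \<i> * of_int (snd \<zeta>) * p0 * (one_c a k / symb a \<nu> lam \<zeta> k)"
  shows "(\<lambda>k. (of_int (fst \<zeta>) * u k + of_int (snd \<zeta>) * v k) * one_c a k) sums
     ((\<Sum>k. (of_int (fst \<zeta>) * f k + of_int (snd \<zeta>) * h k) * (one_c a k / symb a \<nu> lam \<zeta> k))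
      - \<i> * of_real (zabs2 \<zeta>) * p0 * (\<Sum>k. one_c a k * (one_c a k / symb a \<nu> lam \<zeta> k)))"
proof -
  let ?D = "symb a \<nu> lam \<zeta>"
  have sm: "summable (\<lambda>k. (of_int (fst \<zeta>) * f k + of_int (snd \<zeta>) * h k) * (one_c a k / ?D k))"
    using Hs_pairing[OF nu Hs_lin2[OF F, THEN conjunct1] oD] by blast
  have z: "complex_of_real (zabs2 \<zeta>) = of_int (fst \<zeta>) * of_int (fst \<zeta>) + of_int (snd \<zeta>) * of_int (snd \<zeta>)"
    by (simp add: zabs2_def power2_eq_square)
  have "(of_int (fst \<zeta>) * u k + of_int (snd \<zeta>) * v k) * one_c a k =
     (of_int (fst \<zeta>) * f k + of_int (snd \<zeta>) * h k) * (one_c a k / ?D k)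
      - \<i> * of_real (zabs2 \<zeta>) * p0 * (one_c a k * (one_c a k / ?D k))" for k
    unfolding u v z by (simp add: divide_inverse) (simp add: algebra_simps)
  thus ?thesis by (simp only:) (intro sums_diff sums_mult summable_sums sm S)
qed

end

section \<open>Triples of data and their linear combinations\<close>

definition N3 :: "real \<Rightarrow> real \<Rightarrow> int \<times> int \<Rightarrow> coef \<times> coef \<times> coef \<Rightarrow> real" where
  "N3 \<nu> s \<zeta> F = nrm \<nu> s \<zeta> (fst F) + nrm \<nu> s \<zeta> (fst (snd F)) + nrm \<nu> s \<zeta> (snd (snd F))"

text \<open>Sums, differences and multiples are all two-term combinations, a multiple having second
  coefficient 0. The companion norm \<open>N3\<close> adds the component norms: it is comparable to
  the l^2 combination within a factor 3 and keeps linear estimates additive.\<close>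

definition lin3 :: "complex \<Rightarrow> coef \<times> coef \<times> coef \<Rightarrow> complex \<Rightarrow> coef \<times> coef \<times> coef \<Rightarrow> coef \<times> coef \<times> coef" where
  "lin3 c F d G = (\<lambda>k. c * fst F k + d * fst G k, \<lambda>k. c * fst (snd F) k + d * fst (snd G) k,
     \<lambda>k. c * snd (snd F) k + d * snd (snd G) k)"

definition linD :: "complex \<Rightarrow> coef \<times> coef \<times> complex \<times> coef \<Rightarrow> complex \<Rightarrow> coef \<times> coef \<times> complex \<times> coef \<Rightarrow> coef \<times> coef \<times> complex \<times> coef" where
  "linD c X d X' = (case X of (u, v, p, t) \<Rightarrow> case X' of (u', v', p', t') \<Rightarrow>
     (\<lambda>k. c * u k + d * u' k, \<lambda>k. c * v k + d * v' k, c * p + d * p', \<lambda>k. c * t k + d * t' k))"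

lemma sub3_lin3: "sub3 F G = lin3 1 F (-1) G"
  by (cases F; cases G) (simp add: sub3_def lin3_def)

lemma subD_linD: "subD X X' = linD 1 X (-1) X'"
  by (cases X; cases X') (simp add: subD_def linD_def)

lemma Tgt_iff: "F \<in> Tgt \<nu> s \<zeta> \<longleftrightarrow> fst F \<in> Hs \<nu> s \<zeta> \<and> fst (snd F) \<in> Hs \<nu> s \<zeta> \<and> snd (snd F) \<in> Hs \<nu> s \<zeta>"
  by (cases F) (simp add: Tgt_def)

lemma N3_nonneg: "F \<in> Tgt \<nu> s \<zeta> \<Longrightarrow> N3 \<nu> s \<zeta> F \<ge> 0"
  by (simp add: Tgt_iff N3_def nrm_nonneg)

lemma Tgt_lin3:
  assumes "F \<in> Tgt \<nu> s \<zeta>" "G \<in> Tgt \<nu> s \<zeta>"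
  shows "lin3 c F d G \<in> Tgt \<nu> s \<zeta> \<and> N3 \<nu> s \<zeta> (lin3 c F d G) \<le> cmod c * N3 \<nu> s \<zeta> F + cmod d * N3 \<nu> s \<zeta> G"
proof -
  have A: "fst F \<in> Hs \<nu> s \<zeta>" "fst (snd F) \<in> Hs \<nu> s \<zeta>" "snd (snd F) \<in> Hs \<nu> s \<zeta>"
     "fst G \<in> Hs \<nu> s \<zeta>" "fst (snd G) \<in> Hs \<nu> s \<zeta>" "snd (snd G) \<in> Hs \<nu> s \<zeta>" using assms by (auto simp: Tgt_iff)
  have L: "(\<lambda>k. c * f k + d * g k) \<in> Hs \<nu> s \<zeta> \<and> nrm \<nu> s \<zeta> (\<lambda>k. c * f k + d * g k) \<le> cmod c * nrm \<nu> s \<zeta> f + cmod d * nrm \<nu> s \<zeta> g"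
    if "f \<in> Hs \<nu> s \<zeta>" "g \<in> Hs \<nu> s \<zeta>" for f g
    using Hs_add[of "\<lambda>k. c * f k" \<nu> s \<zeta> "\<lambda>k. d * g k"] Hs_scale[OF that(1), of c] Hs_scale[OF that(2), of d] by simp
  show ?thesis using L[OF A(1,4)] L[OF A(2,5)] L[OF A(3,6)] by (simp add: Tgt_iff N3_def lin3_def algebra_simps)
qed

lemma nrm3_le_N3: "F \<in> Tgt \<nu> s \<zeta> \<Longrightarrow> nrm3 \<nu> s \<zeta> F \<le> N3 \<nu> s \<zeta> F"
  using nrm3_bounds(4)[of "fst F" "fst (snd F)" "snd (snd F)"] by (simp add: N3_def)

lemma N3_le_nrm3: "F \<in> Tgt \<nu> s \<zeta> \<Longrightarrow> N3 \<nu> s \<zeta> F \<le> 3 * nrm3 \<nu> s \<zeta> F"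
proof -
  assume "F \<in> Tgt \<nu> s \<zeta>"
  hence F: "(fst F, fst (snd F), snd (snd F)) \<in> Tgt \<nu> s \<zeta>" by simp
  show ?thesis using nrm3_bounds(1)[OF F] nrm3_bounds(2)[OF F] nrm3_bounds(3)[OF F] by (simp add: N3_def)
qed

lemma N3_zero: "N3 \<nu> s \<zeta> (\<lambda>k. 0, \<lambda>k. 0, \<lambda>k. 0) = 0" "(\<lambda>k. 0, \<lambda>k. 0, \<lambda>k. 0) \<in> Tgt \<nu> s \<zeta>"
  by (simp_all add: N3_def Hs_zero Tgt_iff)

lemma N3_eq_0D:
  assumes nu: "\<nu> > 0" and "F \<in> Tgt \<nu> s \<zeta>" "N3 \<nu> s \<zeta> F = 0"
  shows "F = (\<lambda>k. 0, \<lambda>k. 0, \<lambda>k. 0)"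
proof -
  have z: "f = (\<lambda>k. 0)" if "f \<in> Hs \<nu> s \<zeta>" "nrm \<nu> s \<zeta> f = 0" for f
    using l2_eq_0D[of "wt \<nu> s \<zeta>" f] wt_pos[OF nu] that by (auto simp: Hs_iff nrm_eq fun_eq_iff)
  have A: "fst F \<in> Hs \<nu> s \<zeta>" "fst (snd F) \<in> Hs \<nu> s \<zeta>" "snd (snd F) \<in> Hs \<nu> s \<zeta>" using assms by (auto simp: Tgt_iff)
  have "nrm \<nu> s \<zeta> (fst F) = 0" "nrm \<nu> s \<zeta> (fst (snd F)) = 0" "nrm \<nu> s \<zeta> (snd (snd F)) = 0"
    using nrm_nonneg[OF A(1)] nrm_nonneg[OF A(2)] nrm_nonneg[OF A(3)] assms(3) by (auto simp: N3_def)
  from z[OF A(1) this(1)] z[OF A(2) this(2)] z[OF A(3) this(3)] show ?thesis by (cases F) auto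
qed

lemma L0_linD: "L0 a \<nu> lam \<zeta> (linD c X d X') = lin3 c (L0 a \<nu> lam \<zeta> X) d (L0 a \<nu> lam \<zeta> X')"
  by (cases X; cases X') (simp add: L0_def linD_def lin3_def fun_eq_iff algebra_simps)

lemma Dom_iff: "(u, v, p0, t) \<in> Dom a \<nu> s \<zeta> \<longleftrightarrow> u \<in> Hs \<nu> s \<zeta> \<and> v \<in> Hs \<nu> s \<zeta> \<and> t \<in> Hs \<nu> s \<zeta> \<and>
    (\<Sum>k. (of_int (fst \<zeta>) * u k + of_int (snd \<zeta>) * v k) * one_c a k) = 0"
  by (auto simp: Dom_def Hdiv_def)

context prim_eq
begin

text \<open>The estimates (a) to (d) as a predicate in the constant C and the size n of the data.
  They are established with n the norm of \<open>L0\<close> at the solution, and passing to the norm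
  of \<open>Lop\<close> only requires comparing the products C n.\<close>

definition est :: "real \<Rightarrow> complex \<Rightarrow> int \<times> int \<Rightarrow> coef \<Rightarrow> coef \<Rightarrow> complex \<Rightarrow> coef \<Rightarrow> real \<Rightarrow> bool" where
  "est C lam \<zeta> u v p0 t n \<longleftrightarrow> (\<exists>u1 v1 u2 v2.
           u1 \<in> Hs \<nu> (\<sigma> + 2) \<zeta> \<and> v1 \<in> Hs \<nu> (\<sigma> + 2) \<zeta> \<and>
           u2 \<in> Hs \<nu> (\<sigma> + 2) \<zeta> \<and> v2 \<in> Hs \<nu> (\<sigma> + 2) \<zeta> \<and>
           (\<forall>k. u k = u1 k + u2 k \<and> v k = v1 k + v2 k) \<and>
           zabs \<zeta> * cmod p0 \<le> C * bw2 lam \<zeta> * Ms \<sigma> lam \<zeta> * n \<and>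
           Ms (- \<sigma> - 2) lam \<zeta> / Ms (- \<sigma>) lam \<zeta> * nrm2 \<nu> \<sigma> \<zeta> (u1, v1)
             + nrm2 \<nu> (\<sigma> + 2) \<zeta> (u1, v1)
             \<le> C * bw2 lam \<zeta> * Ms \<sigma> lam \<zeta> * Ms (- \<sigma> - 2) lam \<zeta> * n \<and>
           bw2 lam \<zeta> * nrm2 \<nu> \<sigma> \<zeta> (u2, v2) + nrm2 \<nu> (\<sigma> + 2) \<zeta> (u2, v2) \<le> C * n \<and>
           bw2 lam \<zeta> * nrm \<nu> \<sigma> \<zeta> t + nrm \<nu> (\<sigma> + 2) \<zeta> t \<le> C * n)"

lemma Ms_pos: "s > -5/2 \<Longrightarrow> Ms s lam \<zeta> > 0"
  using Ms_summable_bound[of s] by blast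

lemma est_mono:
  assumes e: "est C lam \<zeta> u v p0 t n" and C: "C * n \<le> C' * n'"
  shows "est C' lam \<zeta> u v p0 t n'"
proof -
  have W: "bw2 lam \<zeta> > 0" using bw2_ge1[of lam \<zeta>] by simp
  have M: "Ms \<sigma> lam \<zeta> > 0" "Ms (-\<sigma>-2) lam \<zeta> > 0" using sg by (auto intro!: Ms_pos)
  have "C * bw2 lam \<zeta> * Ms \<sigma> lam \<zeta> * n = (bw2 lam \<zeta> * Ms \<sigma> lam \<zeta>) * (C * n)" by simp
  also have "\<dots> \<le> (bw2 lam \<zeta> * Ms \<sigma> lam \<zeta>) * (C' * n')" using C W M by (intro mult_left_mono) auto
  finally have 1: "C * bw2 lam \<zeta> * Ms \<sigma> lam \<zeta> * n \<le> C' * bw2 lam \<zeta> * Ms \<sigma> lam \<zeta> * n'" by (simp add: mult_ac)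
  have "C * bw2 lam \<zeta> * Ms \<sigma> lam \<zeta> * Ms (- \<sigma> - 2) lam \<zeta> * n = (C * bw2 lam \<zeta> * Ms \<sigma> lam \<zeta> * n) * Ms (- \<sigma> - 2) lam \<zeta>" by simp
  also have "\<dots> \<le> (C' * bw2 lam \<zeta> * Ms \<sigma> lam \<zeta> * n') * Ms (- \<sigma> - 2) lam \<zeta>" using 1 M by (intro mult_right_mono) auto
  finally have 2: "C * bw2 lam \<zeta> * Ms \<sigma> lam \<zeta> * Ms (- \<sigma> - 2) lam \<zeta> * n \<le> C' * bw2 lam \<zeta> * Ms \<sigma> lam \<zeta> * Ms (- \<sigma> - 2) lam \<zeta> * n'"
    by (simp add: mult_ac)
  from e obtain u1 v1 u2 v2 where E: "u1 \<in> Hs \<nu> (\<sigma> + 2) \<zeta>" "v1 \<in> Hs \<nu> (\<sigma> + 2) \<zeta>"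
           "u2 \<in> Hs \<nu> (\<sigma> + 2) \<zeta>" "v2 \<in> Hs \<nu> (\<sigma> + 2) \<zeta>"
           "(\<forall>k. u k = u1 k + u2 k \<and> v k = v1 k + v2 k)"
           "zabs \<zeta> * cmod p0 \<le> C * bw2 lam \<zeta> * Ms \<sigma> lam \<zeta> * n"
           "Ms (- \<sigma> - 2) lam \<zeta> / Ms (- \<sigma>) lam \<zeta> * nrm2 \<nu> \<sigma> \<zeta> (u1, v1)
             + nrm2 \<nu> (\<sigma> + 2) \<zeta> (u1, v1)
             \<le> C * bw2 lam \<zeta> * Ms \<sigma> lam \<zeta> * Ms (- \<sigma> - 2) lam \<zeta> * n"
           "bw2 lam \<zeta> * nrm2 \<nu> \<sigma> \<zeta> (u2, v2) + nrm2 \<nu> (\<sigma> + 2) \<zeta> (u2, v2) \<le> C * n"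
           "bw2 lam \<zeta> * nrm \<nu> \<sigma> \<zeta> t + nrm \<nu> (\<sigma> + 2) \<zeta> t \<le> C * n"
    unfolding est_def by blast
  show ?thesis unfolding est_def
    by (intro exI[of _ u1] exI[of _ v1] exI[of _ u2] exI[of _ v2] conjI E(1-5)
        order_trans[OF E(6) 1] order_trans[OF E(7) 2] order_trans[OF E(8) C] order_trans[OF E(9) C])
qed

lemma L0_components:
  assumes g: "good lam \<zeta>" and L: "L0 a \<nu> lam \<zeta> (u, v, p0, t) = (f, h, q)"
  shows "u k = 1 / symb a \<nu> lam \<zeta> k * f k - \<i> * of_int (fst \<zeta>) * p0 * (one_c a k / symb a \<nu> lam \<zeta> k)"
    "v k = 1 / symb a \<nu> lam \<zeta> k * h k - \<i> * of_int (snd \<zeta>) * p0 * (one_c a k / symb a \<nu> lam \<zeta> k)"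
    "t k = 1 / symb a \<nu> lam \<zeta> k * q k"
proof -
  have *: "x = 1 / D * (D * x + y * z) - y * (z / D)" if "D \<noteq> 0" for x y z D :: complex
    using that by (simp add: field_simps)
  have F: "f = (\<lambda>k. symb a \<nu> lam \<zeta> k * u k + \<i> * of_int (fst \<zeta>) * p0 * one_c a k)"
    "h = (\<lambda>k. symb a \<nu> lam \<zeta> k * v k + \<i> * of_int (snd \<zeta>) * p0 * one_c a k)" "q = (\<lambda>k. symb a \<nu> lam \<zeta> k * t k)"
    using L by (simp_all add: L0_def)
  show "u k = 1 / symb a \<nu> lam \<zeta> k * f k - \<i> * of_int (fst \<zeta>) * p0 * (one_c a k / symb a \<nu> lam \<zeta> k)"
    "v k = 1 / symb a \<nu> lam \<zeta> k * h k - \<i> * of_int (snd \<zeta>) * p0 * (one_c a k / symb a \<nu> lam \<zeta> k)"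
    unfolding F by (rule *[OF symb_nz[OF g]])+
  show "t k = 1 / symb a \<nu> lam \<zeta> k * q k" unfolding F using symb_nz[OF g, of k] by simp
qed

text \<open>The pressure is bounded by duality: the data are paired with 1/D in H^(-\<sigma>), which
  brings M_\<sigma>, and the lower bound of the scalar sum brings \<langle>\<omega>\<rangle>^2. Y1
  is a multiple of 1/D, whose norms in H^\<sigma> and H^(\<sigma>+2) are of size M_(-\<sigma>) and
  M_(-\<sigma>-2); this explains the quotient in (b). The additional decay in H^(\<sigma>+1) is what
  will make R small.\<close>

lemma L0_estimate:
  "\<exists>C\<ge>1. \<forall>lam \<zeta> u v p0 t. good lam \<zeta> \<longrightarrow> (u, v, p0, t) \<in> Dom a \<nu> (\<sigma> + 2) \<zeta> \<longrightarrow>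
      L0 a \<nu> lam \<zeta> (u, v, p0, t) \<in> Tgt \<nu> \<sigma> \<zeta> \<longrightarrow>
      est C lam \<zeta> u v p0 t (N3 \<nu> \<sigma> \<zeta> (L0 a \<nu> lam \<zeta> (u, v, p0, t))) \<and>
      nrm \<nu> (\<sigma>+1) \<zeta> u + nrm \<nu> (\<sigma>+1) \<zeta> v + nrm \<nu> (\<sigma>+1) \<zeta> t
        \<le> C * bw2 lam \<zeta> powr (-1/4) * N3 \<nu> \<sigma> \<zeta> (L0 a \<nu> lam \<zeta> (u, v, p0, t))"
proof -
  obtain Ca where Ca: "Ca \<ge> 0" "\<And>lam \<zeta>. good lam \<zeta> \<Longrightarrow> (\<lambda>k. one_c a k / symb a \<nu> lam \<zeta> k) \<in> Hs \<nu> (-\<sigma>) \<zeta> \<and>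
     nrm \<nu> (-\<sigma>) \<zeta> (\<lambda>k. one_c a k / symb a \<nu> lam \<zeta> k) \<le> Ca * Ms \<sigma> lam \<zeta>"
    using one_over_D[of "-\<sigma>"] sg by auto
  obtain C0 where C0: "C0 \<ge> 0" "\<And>lam \<zeta>. good lam \<zeta> \<Longrightarrow> (\<lambda>k. one_c a k / symb a \<nu> lam \<zeta> k) \<in> Hs \<nu> \<sigma> \<zeta> \<and>
     nrm \<nu> \<sigma> \<zeta> (\<lambda>k. one_c a k / symb a \<nu> lam \<zeta> k) \<le> C0 * Ms (-\<sigma>) lam \<zeta>"
    using one_over_D[of "\<sigma>"] sg by auto
  have m1: "-(\<sigma>+1) = -\<sigma>-1" "-(\<sigma>+2) = -\<sigma>-2" by auto
  have sgs: "\<sigma> + 1 < 5/2" "\<sigma> + 2 < 5/2" using sg by auto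
  obtain C1 where C1: "C1 \<ge> 0" "\<And>lam \<zeta>. good lam \<zeta> \<Longrightarrow> (\<lambda>k. one_c a k / symb a \<nu> lam \<zeta> k) \<in> Hs \<nu> (\<sigma>+1) \<zeta> \<and>
     nrm \<nu> (\<sigma>+1) \<zeta> (\<lambda>k. one_c a k / symb a \<nu> lam \<zeta> k) \<le> C1 * Ms (-\<sigma>-1) lam \<zeta>"
    using one_over_D[OF sgs(1), unfolded m1] by blast
  obtain C2 where C2: "C2 \<ge> 0" "\<And>lam \<zeta>. good lam \<zeta> \<Longrightarrow> (\<lambda>k. one_c a k / symb a \<nu> lam \<zeta> k) \<in> Hs \<nu> (\<sigma>+2) \<zeta> \<and>
     nrm \<nu> (\<sigma>+2) \<zeta> (\<lambda>k. one_c a k / symb a \<nu> lam \<zeta> k) \<le> C2 * Ms (-\<sigma>-2) lam \<zeta>"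
    using one_over_D[OF sgs(2), unfolded m1] by blast
  obtain Ci where Ci: "Ci \<ge> 1" "\<And>lam \<zeta> f. good lam \<zeta> \<Longrightarrow> f \<in> Hs \<nu> \<sigma> \<zeta> \<Longrightarrow>
     (\<lambda>k. 1 / symb a \<nu> lam \<zeta> k * f k) \<in> Hs \<nu> (\<sigma> + 2) \<zeta>"
     "\<And>lam \<zeta> f. good lam \<zeta> \<Longrightarrow> f \<in> Hs \<nu> \<sigma> \<zeta> \<Longrightarrow>
     nrm \<nu> (\<sigma> + 2) \<zeta> (\<lambda>k. 1 / symb a \<nu> lam \<zeta> k * f k) \<le> Ci * nrm \<nu> \<sigma> \<zeta> f"
     "\<And>lam \<zeta> f. good lam \<zeta> \<Longrightarrow> f \<in> Hs \<nu> \<sigma> \<zeta> \<Longrightarrow>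
     bw2 lam \<zeta> * nrm \<nu> \<sigma> \<zeta> (\<lambda>k. 1 / symb a \<nu> lam \<zeta> k * f k) \<le> Ci * nrm \<nu> \<sigma> \<zeta> f"
     "\<And>lam \<zeta> f. good lam \<zeta> \<Longrightarrow> f \<in> Hs \<nu> \<sigma> \<zeta> \<Longrightarrow>
     nrm \<nu> (\<sigma> + 1) \<zeta> (\<lambda>k. 1 / symb a \<nu> lam \<zeta> k * f k) \<le> Ci * bw2 lam \<zeta> powr (-1/4) * nrm \<nu> \<sigma> \<zeta> f"
    using invD by blast
  obtain c where c': "c > 0 \<and> (\<forall>lam \<zeta>. good lam \<zeta> \<longrightarrow> summable (\<lambda>k. one_c a k * (one_c a k / symb a \<nu> lam \<zeta> k)) \<and>
     c / bw2 lam \<zeta> \<le> cmod (\<Sum>k. one_c a k * (one_c a k / symb a \<nu> lam \<zeta> k)))"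
    using S_lower by (rule exE)
  note c = c'[THEN conjunct1] c'[THEN conjunct2, rule_format, THEN conjunct1] c'[THEN conjunct2, rule_format, THEN conjunct2]
  obtain Cp where Cp: "Cp > 0" "\<And>lam \<zeta>. bw2 lam \<zeta> * Ms \<sigma> lam \<zeta> * Ms (-\<sigma>-1) lam \<zeta> \<le> Cp * bw2 lam \<zeta> powr (-1/4)"
    using Ms_product_small[OF sg] by blast
  \<comment> \<open>The constant of (a): the duality bound divided by the lower bound of the scalar
    sum.\<close>
  define P where "P = Ca / c"
  have P0: "P \<ge> 0" using Ca(1) c(1) by (simp add: P_def)
  define Cb where "Cb = 2 * (C0 + C2) * P"
  define Cq where "Cq = 2 * (P * C1 * Cp) + Ci"
  have Cbq: "Cb \<ge> 0" "Cq \<ge> 0" using P0 C0(1) C1(1) C2(1) Ci(1) Cp(1) by (auto simp: Cb_def Cq_def)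
  define C where "C = P + Cb + 2 * Ci + Cq"
  have CC: "C \<ge> 1" "C \<ge> P" "C \<ge> Cb" "C \<ge> 2 * Ci" "C \<ge> Cq" using P0 Cbq Ci(1) by (auto simp: C_def)
  show ?thesis
  proof (intro exI[of _ C] conjI[OF CC(1)] allI impI)
    fix lam \<zeta> u v p0 t
    assume g: "good lam \<zeta>" and X: "(u, v, p0, t) \<in> Dom a \<nu> (\<sigma> + 2) \<zeta>" and T: "L0 a \<nu> lam \<zeta> (u, v, p0, t) \<in> Tgt \<nu> \<sigma> \<zeta>"
    obtain f h q where L: "L0 a \<nu> lam \<zeta> (u, v, p0, t) = (f, h, q)" by (cases "L0 a \<nu> lam \<zeta> (u, v, p0, t)")
    have F: "f \<in> Hs \<nu> \<sigma> \<zeta>" "h \<in> Hs \<nu> \<sigma> \<zeta>" "q \<in> Hs \<nu> \<sigma> \<zeta>" using T by (auto simp: L Tgt_iff)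
    note Fn = nrm_nonneg[OF F(1)] nrm_nonneg[OF F(2)] nrm_nonneg[OF F(3)]
    define n where "n = N3 \<nu> \<sigma> \<zeta> (f, h, q)"
    have n: "n = nrm \<nu> \<sigma> \<zeta> f + nrm \<nu> \<sigma> \<zeta> h + nrm \<nu> \<sigma> \<zeta> q" by (simp add: n_def N3_def)
    have n0: "n \<ge> 0" using Fn n by simp
    define W Z where "W = bw2 lam \<zeta>" and "Z = zabs \<zeta>"
    have W1: "W \<ge> 1" by (simp add: W_def bw2_ge1)
    have Z1: "Z \<ge> 1" using g zabs_ge1 by (simp add: good_def Z_def)
    have M: "Ms \<sigma> lam \<zeta> > 0" "Ms (-\<sigma>) lam \<zeta> > 0" "Ms (-\<sigma>-1) lam \<zeta> > 0" "Ms (-\<sigma>-2) lam \<zeta> > 0" using sg by (auto intro!: Ms_pos)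
    note comp = L0_components[OF g L]
    let ?o = "\<lambda>k. one_c a k / symb a \<nu> lam \<zeta> k"
    define S where "S = (\<Sum>k. one_c a k * ?o k)"
    define m where "m = (\<Sum>k. (of_int (fst \<zeta>) * f k + of_int (snd \<zeta>) * h k) * ?o k)"
    have "(\<lambda>k. (of_int (fst \<zeta>) * u k + of_int (snd \<zeta>) * v k) * one_c a k) sums (m - \<i> * of_real (zabs2 \<zeta>) * p0 * S)"
      unfolding m_def S_def using p0_formula[OF g F(1,2) Ca(2)[OF g, THEN conjunct1] c(2)[OF g] comp(1,2)] .
    hence "m - \<i> * of_real (zabs2 \<zeta>) * p0 * S = 0" using X by (simp add: Dom_iff sums_iff)
    hence "m = \<i> * of_real (zabs2 \<zeta>) * p0 * S" by simp
    hence "cmod m = zabs2 \<zeta> * cmod p0 * cmod S" using zabs2_nonneg by (simp add: norm_mult)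
    \<comment> \<open>Of the two factors |\<zeta>| one stays with p0; the other cancels against the
      factor |\<zeta>| in the bound of m.\<close>
    hence mS: "cmod m = Z * (Z * cmod p0) * cmod S" by (simp add: Z_def zabs_sq[symmetric] power2_eq_square mult_ac)
    have m_le: "cmod m \<le> Z * (Ca * Ms \<sigma> lam \<zeta> * n)"
    proof -
      have l: "(\<lambda>k. of_int (fst \<zeta>) * f k + of_int (snd \<zeta>) * h k) \<in> Hs \<nu> \<sigma> \<zeta> \<and> nrm \<nu> \<sigma> \<zeta> (\<lambda>k. of_int (fst \<zeta>) * f k + of_int (snd \<zeta>) * h k)
         \<le> cmod (of_int (fst \<zeta>)) * nrm \<nu> \<sigma> \<zeta> f + cmod (of_int (snd \<zeta>)) * nrm \<nu> \<sigma> \<zeta> h"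
        by (rule Hs_lin2[OF F(1,2)])
      note l[THEN conjunct2]
      also have "cmod (of_int (fst \<zeta>)) * nrm \<nu> \<sigma> \<zeta> f + cmod (of_int (snd \<zeta>)) * nrm \<nu> \<sigma> \<zeta> h \<le> Z * nrm \<nu> \<sigma> \<zeta> f + Z * nrm \<nu> \<sigma> \<zeta> h"
        unfolding Z_def using Fn by (intro add_mono mult_right_mono fst_le_zabs)
      also have "\<dots> \<le> Z * n" using n Fn Z1 by (simp add: distrib_left)
      finally have ln: "nrm \<nu> \<sigma> \<zeta> (\<lambda>k. of_int (fst \<zeta>) * f k + of_int (snd \<zeta>) * h k) \<le> Z * n" .
      have "cmod m \<le> nrm \<nu> \<sigma> \<zeta> (\<lambda>k. of_int (fst \<zeta>) * f k + of_int (snd \<zeta>) * h k) * nrm \<nu> (-\<sigma>) \<zeta> ?o"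
        unfolding m_def using Hs_pairing[OF nu l[THEN conjunct1] Ca(2)[OF g, THEN conjunct1]] by blast
      also have "\<dots> \<le> (Z * n) * (Ca * Ms \<sigma> lam \<zeta>)"
        using ln Ca(2)[OF g] Z1 n0 nrm_nonneg[OF Ca(2)[OF g, THEN conjunct1]] by (intro mult_mono) auto
      finally show ?thesis by (simp add: mult_ac)
    qed
    have p_le: "Z * cmod p0 \<le> P * W * Ms \<sigma> lam \<zeta> * n"
    proof -
      have "Z * (Z * cmod p0) * (c / W) \<le> Z * (Z * cmod p0) * cmod S"
        using c(3)[OF g] Z1 unfolding S_def W_def by (intro mult_left_mono) auto
      also have "\<dots> \<le> Z * (Ca * Ms \<sigma> lam \<zeta> * n)" using m_le mS by simp
      finally have "Z * (Z * cmod p0) * (c / W) \<le> Z * (Ca * Ms \<sigma> lam \<zeta> * n)" .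
      moreover have "x \<le> B * W / c" if "Z * x * (c / W) \<le> Z * B" for x B
      proof -
        have "Z * (x * (c / W)) \<le> Z * B" using that by (simp only: mult.assoc)
        hence "x * (c / W) \<le> B" by (rule mult_left_le_imp_le) (use Z1 in simp)
        hence "x * c \<le> B * W" using W1 by (simp add: pos_divide_le_eq)
        thus ?thesis using c(1) by (simp add: pos_le_divide_eq)
      qed
      ultimately have "Z * cmod p0 \<le> Ca * Ms \<sigma> lam \<zeta> * n * W / c" by blast
      thus ?thesis by (simp add: P_def mult_ac)
    qed
    have pk: "cmod (\<i> * of_int (fst \<zeta>) * p0) \<le> Z * cmod p0" "cmod (\<i> * of_int (snd \<zeta>) * p0) \<le> Z * cmod p0"
      using fst_le_zabs[of \<zeta>] by (auto simp: norm_mult Z_def intro!: mult_right_mono)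
    \<comment> \<open>Q bounds |\<xi> p0| and |\<eta> p0| alike, so every norm of u1 and v1 is at
      most Q times the norm of 1/D.\<close>
    define Q where "Q = P * W * Ms \<sigma> lam \<zeta> * n"
    have Q0: "Q \<ge> 0" using P0 W1 M n0 by (simp add: Q_def)
    have pQ: "cmod (- (\<i> * of_int (fst \<zeta>) * p0)) \<le> Q" "cmod (- (\<i> * of_int (snd \<zeta>) * p0)) \<le> Q"
      using pk p_le by (auto simp: Q_def)
    define u1 v1 u2 v2 where "u1 = (\<lambda>k. - (\<i> * of_int (fst \<zeta>) * p0) * ?o k)" and "v1 = (\<lambda>k. - (\<i> * of_int (snd \<zeta>) * p0) * ?o k)"
      and "u2 = (\<lambda>k. 1 / symb a \<nu> lam \<zeta> k * f k)" and "v2 = (\<lambda>k. 1 / symb a \<nu> lam \<zeta> k * h k)"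
    have sc: "(\<lambda>k. d * ?o k) \<in> Hs \<nu> s \<zeta> \<and> nrm \<nu> s \<zeta> (\<lambda>k. d * ?o k) \<le> Q * B"
      if "cmod d \<le> Q" "?o \<in> Hs \<nu> s \<zeta> \<and> nrm \<nu> s \<zeta> ?o \<le> B" for d s B
      using Hs_scale[of ?o \<nu> s \<zeta> d] that nrm_nonneg[of ?o \<nu> s \<zeta>] Q0 mult_mono[of "cmod d" Q "nrm \<nu> s \<zeta> ?o" B] by auto
    have split: "u k = u1 k + u2 k" "v k = v1 k + v2 k" for k
      unfolding u1_def v1_def u2_def v2_def comp(1,2)[of k] by simp_all
    have trunc_freq: "t = (\<lambda>k. 1 / symb a \<nu> lam \<zeta> k * q k)" using comp(3) by auto
    note u1s = sc[OF pQ(1) C0(2)[OF g], folded u1_def] sc[OF pQ(1) C1(2)[OF g], folded u1_def] sc[OF pQ(1) C2(2)[OF g], folded u1_def]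
    note v1s = sc[OF pQ(2) C0(2)[OF g], folded v1_def] sc[OF pQ(2) C1(2)[OF g], folded v1_def] sc[OF pQ(2) C2(2)[OF g], folded v1_def]
    have nu2: "nrm2 \<nu> \<sigma> \<zeta> (u1, v1) \<le> 2 * (Q * (C0 * Ms (-\<sigma>) lam \<zeta>))"
      using nrm2_le[of u1 \<nu> \<sigma> \<zeta> v1] u1s(1) v1s(1) by auto
    have nu22: "nrm2 \<nu> (\<sigma>+2) \<zeta> (u1, v1) \<le> 2 * (Q * (C2 * Ms (-\<sigma>-2) lam \<zeta>))"
      using nrm2_le[of u1 \<nu> "\<sigma>+2" \<zeta> v1] u1s(3) v1s(3) by auto
    have b: "Ms (- \<sigma> - 2) lam \<zeta> / Ms (- \<sigma>) lam \<zeta> * nrm2 \<nu> \<sigma> \<zeta> (u1, v1) + nrm2 \<nu> (\<sigma> + 2) \<zeta> (u1, v1)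
             \<le> Cb * W * Ms \<sigma> lam \<zeta> * Ms (- \<sigma> - 2) lam \<zeta> * n"
    proof -
      have "Ms (- \<sigma> - 2) lam \<zeta> / Ms (- \<sigma>) lam \<zeta> * nrm2 \<nu> \<sigma> \<zeta> (u1, v1) \<le> Ms (- \<sigma> - 2) lam \<zeta> / Ms (- \<sigma>) lam \<zeta> * (2 * (Q * (C0 * Ms (-\<sigma>) lam \<zeta>)))"
        using nu2 M by (intro mult_left_mono) auto
      also have "\<dots> = 2 * Q * C0 * Ms (- \<sigma> - 2) lam \<zeta>" using M by simp
      finally have "Ms (- \<sigma> - 2) lam \<zeta> / Ms (- \<sigma>) lam \<zeta> * nrm2 \<nu> \<sigma> \<zeta> (u1, v1) + nrm2 \<nu> (\<sigma> + 2) \<zeta> (u1, v1)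
        \<le> 2 * Q * C0 * Ms (- \<sigma> - 2) lam \<zeta> + 2 * (Q * (C2 * Ms (-\<sigma>-2) lam \<zeta>))" using nu22 by linarith
      also have "\<dots> = Cb * W * Ms \<sigma> lam \<zeta> * Ms (- \<sigma> - 2) lam \<zeta> * n" by (simp add: Cb_def Q_def algebra_simps)
      finally show ?thesis .
    qed
    note i = Ci(2)[OF g F(1), folded u2_def] Ci(2)[OF g F(2), folded v2_def] Ci(2)[OF g F(3), folded trunc_freq]
      Ci(3)[OF g F(1), folded u2_def] Ci(3)[OF g F(2), folded v2_def] Ci(3)[OF g F(3), folded trunc_freq]
      Ci(4)[OF g F(1), folded u2_def] Ci(4)[OF g F(2), folded v2_def] Ci(4)[OF g F(3), folded trunc_freq]
      Ci(5)[OF g F(1), folded u2_def] Ci(5)[OF g F(2), folded v2_def] Ci(5)[OF g F(3), folded trunc_freq]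
    have sm: "w \<in> Hs \<nu> \<sigma> \<zeta> \<and> w \<in> Hs \<nu> (\<sigma>+1) \<zeta>" if "w \<in> Hs \<nu> (\<sigma>+2) \<zeta>" for w
      using Hs_mono[OF nu _ that, of \<sigma>] Hs_mono[OF nu _ that, of "\<sigma>+1"] by auto
    have cc: "bw2 lam \<zeta> * nrm2 \<nu> \<sigma> \<zeta> (u2, v2) + nrm2 \<nu> (\<sigma> + 2) \<zeta> (u2, v2) \<le> 2 * Ci * n"
    proof -
      have "bw2 lam \<zeta> * nrm2 \<nu> \<sigma> \<zeta> (u2, v2) \<le> bw2 lam \<zeta> * (nrm \<nu> \<sigma> \<zeta> u2 + nrm \<nu> \<sigma> \<zeta> v2)"
        using nrm2_le[of u2 \<nu> \<sigma> \<zeta> v2] sm[OF i(1)] sm[OF i(2)] W1 by (intro mult_left_mono) (auto simp: W_def)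
      also have "\<dots> \<le> Ci * nrm \<nu> \<sigma> \<zeta> f + Ci * nrm \<nu> \<sigma> \<zeta> h" using i(7,8) by (simp add: distrib_left)
      finally have "bw2 lam \<zeta> * nrm2 \<nu> \<sigma> \<zeta> (u2, v2) \<le> Ci * nrm \<nu> \<sigma> \<zeta> f + Ci * nrm \<nu> \<sigma> \<zeta> h" .
      moreover have "nrm2 \<nu> (\<sigma> + 2) \<zeta> (u2, v2) \<le> Ci * nrm \<nu> \<sigma> \<zeta> f + Ci * nrm \<nu> \<sigma> \<zeta> h"
        using nrm2_le[OF i(1,2)] i(4,5) by linarith
      moreover have "Ci * nrm \<nu> \<sigma> \<zeta> f + Ci * nrm \<nu> \<sigma> \<zeta> h \<le> Ci * n"
        using n Fn Ci(1) by (simp add: distrib_left)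
      ultimately show ?thesis by linarith
    qed
    have Cin: "Ci * nrm \<nu> \<sigma> \<zeta> q \<le> Ci * n" using n Fn Ci(1) by (intro mult_left_mono) auto
    have dd: "bw2 lam \<zeta> * nrm \<nu> \<sigma> \<zeta> t + nrm \<nu> (\<sigma> + 2) \<zeta> t \<le> 2 * Ci * n"
      using i(9) i(6) Cin by linarith
    have e: "est C lam \<zeta> u v p0 t n"
      unfolding est_def
    proof (rule exI[of _ u1], rule exI[of _ v1], rule exI[of _ u2], rule exI[of _ v2], intro conjI allI split)
      show "u1 \<in> Hs \<nu> (\<sigma> + 2) \<zeta>" "v1 \<in> Hs \<nu> (\<sigma> + 2) \<zeta>" using u1s(3) v1s(3) by auto
      show "u2 \<in> Hs \<nu> (\<sigma> + 2) \<zeta>" "v2 \<in> Hs \<nu> (\<sigma> + 2) \<zeta>" using i by auto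
      have WM: "W * Ms \<sigma> lam \<zeta> * n \<ge> 0" "W * Ms \<sigma> lam \<zeta> * Ms (- \<sigma> - 2) lam \<zeta> * n \<ge> 0" using W1 M n0 by auto
      have "P * W * Ms \<sigma> lam \<zeta> * n \<le> C * bw2 lam \<zeta> * Ms \<sigma> lam \<zeta> * n"
        using mult_right_mono[OF CC(2) WM(1)] by (simp add: W_def mult_ac)
      thus "zabs \<zeta> * cmod p0 \<le> C * bw2 lam \<zeta> * Ms \<sigma> lam \<zeta> * n" using p_le by (simp add: Z_def)
      have "Cb * W * Ms \<sigma> lam \<zeta> * Ms (- \<sigma> - 2) lam \<zeta> * n \<le> C * bw2 lam \<zeta> * Ms \<sigma> lam \<zeta> * Ms (- \<sigma> - 2) lam \<zeta> * n"
        using mult_right_mono[OF CC(3) WM(2)] by (simp add: W_def mult_ac)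
      thus "Ms (- \<sigma> - 2) lam \<zeta> / Ms (- \<sigma>) lam \<zeta> * nrm2 \<nu> \<sigma> \<zeta> (u1, v1) + nrm2 \<nu> (\<sigma> + 2) \<zeta> (u1, v1)
        \<le> C * bw2 lam \<zeta> * Ms \<sigma> lam \<zeta> * Ms (- \<sigma> - 2) lam \<zeta> * n" using b by linarith
      show "bw2 lam \<zeta> * nrm2 \<nu> \<sigma> \<zeta> (u2, v2) + nrm2 \<nu> (\<sigma> + 2) \<zeta> (u2, v2) \<le> C * n"
        "bw2 lam \<zeta> * nrm \<nu> \<sigma> \<zeta> t + nrm \<nu> (\<sigma> + 2) \<zeta> t \<le> C * n"
        using cc dd mult_right_mono[OF CC(4) n0] by linarith+
    qed
    define w where "w = bw2 lam \<zeta> powr (-1/4)"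
    have w0: "w \<ge> 0" by (simp add: w_def)
    have un: "nrm \<nu> (\<sigma>+1) \<zeta> u \<le> Q * (C1 * Ms (-\<sigma>-1) lam \<zeta>) + Ci * w * nrm \<nu> \<sigma> \<zeta> f"
    proof -
      have "u = (\<lambda>k. u1 k + u2 k)" using split by auto
      thus ?thesis using Hs_add[of u1 \<nu> "\<sigma>+1" \<zeta> u2] u1s(2) i(10) sm[OF i(1)] by (auto simp: w_def)
    qed
    have vn: "nrm \<nu> (\<sigma>+1) \<zeta> v \<le> Q * (C1 * Ms (-\<sigma>-1) lam \<zeta>) + Ci * w * nrm \<nu> \<sigma> \<zeta> h"
    proof -
      have "v = (\<lambda>k. v1 k + v2 k)" using split by auto
      thus ?thesis using Hs_add[of v1 \<nu> "\<sigma>+1" \<zeta> v2] v1s(2) i(11) sm[OF i(2)] by (auto simp: w_def)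
    qed
    \<comment> \<open>Q contains \<langle>\<omega>\<rangle>^2 M_\<sigma>; together with
      M_(-\<sigma>-1) this is the product controlled by \<open>Ms_product_small\<close>.\<close>
    have "Q * (C1 * Ms (-\<sigma>-1) lam \<zeta>) = P * C1 * n * (W * Ms \<sigma> lam \<zeta> * Ms (-\<sigma>-1) lam \<zeta>)" by (simp add: Q_def mult_ac)
    also have "\<dots> \<le> P * C1 * n * (Cp * w)" using P0 C1(1) n0 Cp(2)[of lam \<zeta>] by (intro mult_left_mono) (auto simp: W_def w_def)
    finally have Qw: "Q * (C1 * Ms (-\<sigma>-1) lam \<zeta>) \<le> (P * C1 * Cp) * w * n" by (simp add: mult_ac)
    have tn: "nrm \<nu> (\<sigma>+1) \<zeta> t \<le> Ci * w * nrm \<nu> \<sigma> \<zeta> q" using i(12) by (simp add: w_def)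
    have "nrm \<nu> (\<sigma>+1) \<zeta> u + nrm \<nu> (\<sigma>+1) \<zeta> v + nrm \<nu> (\<sigma>+1) \<zeta> t \<le> 2 * ((P * C1 * Cp) * w * n) + (Ci * w * nrm \<nu> \<sigma> \<zeta> f + Ci * w * nrm \<nu> \<sigma> \<zeta> h + Ci * w * nrm \<nu> \<sigma> \<zeta> q)"
      using un vn tn Qw by linarith
    also have "(Ci * w * nrm \<nu> \<sigma> \<zeta> f + Ci * w * nrm \<nu> \<sigma> \<zeta> h + Ci * w * nrm \<nu> \<sigma> \<zeta> q) = Ci * w * n" by (simp add: n algebra_simps)
    also have "2 * ((P * C1 * Cp) * w * n) + Ci * w * n = Cq * (w * n)" by (simp add: Cq_def algebra_simps)
    also have "\<dots> \<le> C * (w * n)" using CC(5) w0 n0 by (intro mult_right_mono) auto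
    finally have "nrm \<nu> (\<sigma>+1) \<zeta> u + nrm \<nu> (\<sigma>+1) \<zeta> v + nrm \<nu> (\<sigma>+1) \<zeta> t \<le> C * bw2 lam \<zeta> powr (-1/4) * n" by (simp add: w_def mult_ac)
    with e show "est C lam \<zeta> u v p0 t (N3 \<nu> \<sigma> \<zeta> (L0 a \<nu> lam \<zeta> (u, v, p0, t))) \<and>
      nrm \<nu> (\<sigma>+1) \<zeta> u + nrm \<nu> (\<sigma>+1) \<zeta> v + nrm \<nu> (\<sigma>+1) \<zeta> t
        \<le> C * bw2 lam \<zeta> powr (-1/4) * N3 \<nu> \<sigma> \<zeta> (L0 a \<nu> lam \<zeta> (u, v, p0, t))" by (simp add: L n_def)
  qed
qed

end

section \<open>The lower-order part\<close>

lemma Hs_complete: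
  assumes nu: "\<nu> > 0" and f: "\<And>n. f n \<in> Hs \<nu> s \<zeta>"
    and C: "\<And>e. e > 0 \<Longrightarrow> \<exists>N. \<forall>m\<ge>N. \<forall>n\<ge>N. nrm \<nu> s \<zeta> (\<lambda>k. f m k - f n k) < e"
  shows "\<exists>g\<in>Hs \<nu> s \<zeta>. (\<lambda>n. nrm \<nu> s \<zeta> (\<lambda>k. f n k - g k)) \<longlonglongrightarrow> 0"
proof -
  have f': "l2s (wt \<nu> s \<zeta>) (f n)" "f n 0 = 0" for n using f[of n] by (auto simp: Hs_iff)
  have "\<exists>g. l2s (wt \<nu> s \<zeta>) g \<and> (\<forall>k. (\<lambda>n. f n k) \<longlonglongrightarrow> g k) \<and> (\<lambda>n. l2n (wt \<nu> s \<zeta>) (\<lambda>k. f n k - g k)) \<longlonglongrightarrow> 0"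
    by (rule l2_complete[OF wt_pos[OF nu] f'(1) C[unfolded nrm_eq]])
  then obtain g where g: "l2s (wt \<nu> s \<zeta>) g" "\<And>k. (\<lambda>n. f n k) \<longlonglongrightarrow> g k" "(\<lambda>n. nrm \<nu> s \<zeta> (\<lambda>k. f n k - g k)) \<longlonglongrightarrow> 0"
    unfolding nrm_eq by blast
  have "g 0 = 0" using g(2)[of 0] f'(2) LIMSEQ_unique[of "\<lambda>n. f n 0" "g 0" 0] by simp
  with g show ?thesis by (auto simp: Hs_iff)
qed

text \<open>Banach's fixed point theorem, with completeness inherited componentwise. The factor 1/2
  is fixed because both applications, the perturbation for large \<langle>\<omega>\<rangle> and the
  short step in \<lambda>, are arranged to produce it.\<close>

lemma Tgt_fixpoint:
  assumes nu: "\<nu> > 0" and \<Phi>: "\<And>F. F \<in> Tgt \<nu> s \<zeta> \<Longrightarrow> \<Phi> F \<in> Tgt \<nu> s \<zeta>"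
    and con: "\<And>F G. F \<in> Tgt \<nu> s \<zeta> \<Longrightarrow> G \<in> Tgt \<nu> s \<zeta> \<Longrightarrow> N3 \<nu> s \<zeta> (sub3 (\<Phi> F) (\<Phi> G)) \<le> 1/2 * N3 \<nu> s \<zeta> (sub3 F G)"
  shows "\<exists>F\<in>Tgt \<nu> s \<zeta>. \<Phi> F = F"
proof -
  define M where "M = Tgt \<nu> s \<zeta>"
  \<comment> \<open>The value 0 outside M is a default: nonnegativity and symmetry are required for
    all arguments, not only for points of M.\<close>
  define d where "d F G = (if F \<in> M \<and> G \<in> M then N3 \<nu> s \<zeta> (sub3 F G) else 0)" for F G
  have dM: "sub3 F G \<in> Tgt \<nu> s \<zeta>" if "F \<in> M" "G \<in> M" for F G
    using that Tgt_lin3[of F \<nu> s \<zeta> G 1 "-1"] by (simp add: sub3_lin3 M_def)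
  have comm: "N3 \<nu> s \<zeta> (sub3 F G) = N3 \<nu> s \<zeta> (sub3 G F)" for F G
    by (cases F; cases G) (simp add: N3_def sub3_def nrm_def norm_minus_commute)
  interpret Metric_space M d
  proof
    show "0 \<le> d F G" for F G using N3_nonneg[OF dM] by (simp add: d_def)
    show "d F G = d G F" for F G by (simp add: d_def comm)
    show "(d F G = 0) = (F = G)" if "F \<in> M" "G \<in> M" for F G
    proof
      assume "d F G = 0"
      hence "sub3 F G = (\<lambda>k. 0, \<lambda>k. 0, \<lambda>k. 0)" using that N3_eq_0D[OF nu dM[OF that]] by (simp add: d_def)
      thus "F = G" by (cases F; cases G) (auto simp: sub3_def fun_eq_iff)
    next
      assume "F = G"
      hence "sub3 F G = (\<lambda>k. 0, \<lambda>k. 0, \<lambda>k. 0)" by (cases F; cases G) (simp add: sub3_def)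
      thus "d F G = 0" by (simp add: d_def N3_zero)
    qed
    show "d F H \<le> d F G + d G H" if "F \<in> M" "G \<in> M" "H \<in> M" for F G H
    proof -
      have "sub3 F H = lin3 1 (sub3 F G) 1 (sub3 G H)" by (cases F; cases G; cases H) (simp add: sub3_def lin3_def)
      thus ?thesis using Tgt_lin3[OF dM[OF that(1,2)] dM[OF that(2,3)], of 1 1] that by (simp add: d_def)
    qed
  qed
  have mc: "mcomplete"
    unfolding mcomplete_def
  proof (intro allI impI)
    fix F assume F: "MCauchy F"
    hence FM: "F n \<in> M" for n by (auto simp: MCauchy_def)
    have FT: "fst (F n) \<in> Hs \<nu> s \<zeta>" "fst (snd (F n)) \<in> Hs \<nu> s \<zeta>" "snd (snd (F n)) \<in> Hs \<nu> s \<zeta>" for n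
      using FM[of n] by (auto simp: M_def Tgt_iff)
    have cau: "\<exists>N. \<forall>n n'. N \<le> n \<longrightarrow> N \<le> n' \<longrightarrow> N3 \<nu> s \<zeta> (sub3 (F n) (F n')) < e" if "e > 0" for e
      using F that FM by (auto simp: MCauchy_def d_def)
    have nn: "nrm \<nu> s \<zeta> (\<lambda>k. fst (F m) k - fst (F n) k) \<le> N3 \<nu> s \<zeta> (sub3 (F m) (F n))"
      "nrm \<nu> s \<zeta> (\<lambda>k. fst (snd (F m)) k - fst (snd (F n)) k) \<le> N3 \<nu> s \<zeta> (sub3 (F m) (F n))"
      "nrm \<nu> s \<zeta> (\<lambda>k. snd (snd (F m)) k - snd (snd (F n)) k) \<le> N3 \<nu> s \<zeta> (sub3 (F m) (F n))" for m n
      using nrm_nonneg[OF Hs_diff[OF FT(1)[of m] FT(1)[of n], THEN conjunct1]]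
        nrm_nonneg[OF Hs_diff[OF FT(2)[of m] FT(2)[of n], THEN conjunct1]]
        nrm_nonneg[OF Hs_diff[OF FT(3)[of m] FT(3)[of n], THEN conjunct1]]
      by (auto simp: N3_def sub3_def split: prod.split)
    have c: "\<exists>N. \<forall>m\<ge>N. \<forall>n\<ge>N. nrm \<nu> s \<zeta> (\<lambda>k. p (F m) k - p (F n) k) < e"
      if "e > 0" "\<And>m n. nrm \<nu> s \<zeta> (\<lambda>k. p (F m) k - p (F n) k) \<le> N3 \<nu> s \<zeta> (sub3 (F m) (F n))" for e and p :: "coef \<times> coef \<times> coef \<Rightarrow> coef"
      using cau[OF that(1)] that(2) by (meson le_less_trans)
    obtain f where f: "f \<in> Hs \<nu> s \<zeta>" "(\<lambda>n. nrm \<nu> s \<zeta> (\<lambda>k. fst (F n) k - f k)) \<longlonglongrightarrow> 0"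
      using Hs_complete[OF nu FT(1) c[of _ fst]] nn(1) by blast
    obtain g where g: "g \<in> Hs \<nu> s \<zeta>" "(\<lambda>n. nrm \<nu> s \<zeta> (\<lambda>k. fst (snd (F n)) k - g k)) \<longlonglongrightarrow> 0"
      using Hs_complete[OF nu FT(2) c[of _ "\<lambda>F. fst (snd F)"]] nn(2) by blast
    obtain h where h: "h \<in> Hs \<nu> s \<zeta>" "(\<lambda>n. nrm \<nu> s \<zeta> (\<lambda>k. snd (snd (F n)) k - h k)) \<longlonglongrightarrow> 0"
      using Hs_complete[OF nu FT(3) c[of _ "\<lambda>F. snd (snd F)"]] nn(3) by blast
    have lM: "(f, g, h) \<in> M" using f g h by (simp add: M_def Tgt_iff)
    have "(\<lambda>n. N3 \<nu> s \<zeta> (sub3 (F n) (f, g, h))) = (\<lambda>n. nrm \<nu> s \<zeta> (\<lambda>k. fst (F n) k - f k) + nrm \<nu> s \<zeta> (\<lambda>k. fst (snd (F n)) k - g k)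
        + nrm \<nu> s \<zeta> (\<lambda>k. snd (snd (F n)) k - h k))"
      by (auto simp: N3_def sub3_def split: prod.split)
    hence "(\<lambda>n. N3 \<nu> s \<zeta> (sub3 (F n) (f, g, h))) \<longlonglongrightarrow> 0 + 0 + 0" using f(2) g(2) h(2) by (simp only: tendsto_add)
    hence "(\<lambda>n. d (F n) (f, g, h)) \<longlonglongrightarrow> 0" using FM lM by (simp add: d_def)
    hence "\<forall>\<epsilon>>0. \<forall>\<^sub>F n in sequentially. d (F n) (f, g, h) < \<epsilon>" by (simp add: order_tendsto_iff)
    hence "limitin mtopology F (f, g, h) sequentially" using FM lM by (simp add: limitin_metric)
    thus "\<exists>x. limitin mtopology F x sequentially" by blast
  qed
  have ne: "M \<noteq> {}" using N3_zero(2)[of \<nu> s \<zeta>] unfolding M_def by blast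
  have fn: "\<Phi> \<in> M \<rightarrow> M" using \<Phi> by (auto simp: M_def)
  have cn: "d (\<Phi> F) (\<Phi> G) \<le> 1/2 * d F G" if "F \<in> M" "G \<in> M" for F G
    using con that \<Phi> by (simp add: d_def M_def)
  have half: "(1/2::real) < 1" by simp
  obtain F where "F \<in> M" "\<Phi> F = F"
    using Banach_fixedpoint_thm[OF mc ne fn half cn] by blast
  thus ?thesis unfolding M_def by blast
qed

section \<open>Mapping properties of R, and of the leading part at fixed parameters\<close>

context prim_eq
begin

abbreviation Hs1 :: "int \<times> int \<Rightarrow> coef \<times> coef \<times> complex \<times> coef \<Rightarrow> bool" where
  "Hs1 \<zeta> X \<equiv> fst X \<in> Hs \<nu> (\<sigma>+1) \<zeta> \<and> fst (snd X) \<in> Hs \<nu> (\<sigma>+1) \<zeta> \<and> snd (snd (snd X)) \<in> Hs \<nu> (\<sigma>+1) \<zeta>"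

definition N1 :: "int \<times> int \<Rightarrow> coef \<times> coef \<times> complex \<times> coef \<Rightarrow> real" where
  "N1 \<zeta> X = nrm \<nu> (\<sigma>+1) \<zeta> (fst X) + nrm \<nu> (\<sigma>+1) \<zeta> (fst (snd X)) + nrm \<nu> (\<sigma>+1) \<zeta> (snd (snd (snd X)))"

text \<open>Splitting the defining series is legitimate because they converge separately on
  H^(\<sigma>+1); this convergence is part of \<open>prim_bound\<close>.\<close>

lemma prim_lin:
  assumes f: "f \<in> Hs \<nu> (\<sigma>+1) \<zeta>" and g: "g \<in> Hs \<nu> (\<sigma>+1) \<zeta>"
  shows "prim a (\<lambda>k. c * f k + d * g k) = (\<lambda>k. c * prim a f k + d * prim a g k)"
proof
  fix k
  obtain C where "\<forall>\<zeta> g. g \<in> Hs \<nu> (\<sigma> + 1) \<zeta> \<longrightarrow> (\<forall>k. summable (\<lambda>j. complex_of_real (primM a k j) * g j))"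
    using prim_bound[OF a nu sg] by blast
  hence s: "summable (\<lambda>j. complex_of_real (primM a k j) * f j)" "summable (\<lambda>j. complex_of_real (primM a k j) * g j)"
    using f g by blast+
  have "(\<lambda>j. c * (complex_of_real (primM a k j) * f j) + d * (complex_of_real (primM a k j) * g j)) sums
    (c * (\<Sum>j. complex_of_real (primM a k j) * f j) + d * (\<Sum>j. complex_of_real (primM a k j) * g j))"
    by (intro sums_add sums_mult summable_sums s)
  hence "(\<Sum>j. complex_of_real (primM a k j) * (c * f j + d * g j)) =
    c * (\<Sum>j. complex_of_real (primM a k j) * f j) + d * (\<Sum>j. complex_of_real (primM a k j) * g j)"
    by (intro sums_unique[symmetric]) (simp add: algebra_simps)
  thus "prim a (\<lambda>k. c * f k + d * g k) k = c * prim a f k + d * prim a g k" by (simp add: prim_def)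
qed

text \<open>The factors \<xi>, \<eta> in front of or inside a primitive are at most 1+|\<zeta>| and
  cancel the gain in \<open>prim_bound\<close>; the Coriolis terms use the embedding of
  H^(\<sigma>+1) into H^\<sigma>. The constant is thus uniform in \<zeta>, as the perturbation
  argument requires.\<close>

lemma Rop_bound:
  "\<exists>C\<ge>0. \<forall>\<zeta> X. Hs1 \<zeta> X \<longrightarrow> Rop a \<alpha> \<beta> \<gamma> \<zeta> X \<in> Tgt \<nu> \<sigma> \<zeta> \<and> N3 \<nu> \<sigma> \<zeta> (Rop a \<alpha> \<beta> \<gamma> \<zeta> X) \<le> C * N1 \<zeta> X"
proof -
  obtain Cp where Cp: "Cp \<ge> 0" "\<And>\<zeta> g. g \<in> Hs \<nu> (\<sigma> + 1) \<zeta> \<Longrightarrow> prim a g \<in> Hs \<nu> \<sigma> \<zeta>"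
     "\<And>\<zeta> g. g \<in> Hs \<nu> (\<sigma> + 1) \<zeta> \<Longrightarrow> nrm \<nu> \<sigma> \<zeta> (prim a g) \<le> Cp / bz \<zeta> * nrm \<nu> (\<sigma> + 1) \<zeta> g"
    using prim_bound[OF a nu sg] by blast
  define C where "C = \<bar>\<alpha>\<bar> + 2 * \<bar>\<beta>\<bar> * Cp + \<bar>\<gamma>\<bar> * Cp"
  have C0: "C \<ge> 0" using Cp(1) by (simp add: C_def)
  show ?thesis
  proof (intro exI[of _ C] conjI[OF C0] allI impI)
    fix \<zeta> X assume X: "Hs1 \<zeta> X"
    obtain u v p t where XX: "X = (u, v, p, t)" by (cases X)
    have H: "u \<in> Hs \<nu> (\<sigma>+1) \<zeta>" "v \<in> Hs \<nu> (\<sigma>+1) \<zeta>" "t \<in> Hs \<nu> (\<sigma>+1) \<zeta>" using X by (auto simp: XX)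
    note Hn = nrm_nonneg[OF H(1)] nrm_nonneg[OF H(2)] nrm_nonneg[OF H(3)]
    have H0: "u \<in> Hs \<nu> \<sigma> \<zeta> \<and> nrm \<nu> \<sigma> \<zeta> u \<le> nrm \<nu> (\<sigma>+1) \<zeta> u" "v \<in> Hs \<nu> \<sigma> \<zeta> \<and> nrm \<nu> \<sigma> \<zeta> v \<le> nrm \<nu> (\<sigma>+1) \<zeta> v"
      using Hs_mono[OF nu _ H(1), of \<sigma>] Hs_mono[OF nu _ H(2), of \<sigma>] by auto
    have b0: "bz \<zeta> > 0" using bz_ge1[of \<zeta>] by simp
    have zb: "cmod (of_int (fst \<zeta>)) \<le> bz \<zeta>" "cmod (of_int (snd \<zeta>)) \<le> bz \<zeta>"
      using fst_le_zabs[of \<zeta>] zabs_le_bz[of \<zeta>] by linarith+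
    have pt: "cmod (\<i> * z * of_real \<beta>) * nrm \<nu> \<sigma> \<zeta> (prim a t) \<le> \<bar>\<beta>\<bar> * Cp * nrm \<nu> (\<sigma>+1) \<zeta> t" if "cmod z \<le> bz \<zeta>" for z
    proof -
      have "cmod (\<i> * z * of_real \<beta>) * nrm \<nu> \<sigma> \<zeta> (prim a t) \<le> (bz \<zeta> * \<bar>\<beta>\<bar>) * (Cp / bz \<zeta> * nrm \<nu> (\<sigma>+1) \<zeta> t)"
        using that Cp(3)[OF H(3)] b0 nrm_nonneg[OF Cp(2)[OF H(3)]]
        by (intro mult_mono) (auto simp: norm_mult intro!: mult_right_mono)
      also have "\<dots> = \<bar>\<beta>\<bar> * Cp * nrm \<nu> (\<sigma>+1) \<zeta> t" using b0 by simp
      finally show ?thesis .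
    qed
    let ?w = "\<lambda>k. \<i> * of_int (fst \<zeta>) * u k + \<i> * of_int (snd \<zeta>) * v k"
    have w: "?w \<in> Hs \<nu> (\<sigma>+1) \<zeta> \<and> nrm \<nu> (\<sigma>+1) \<zeta> ?w \<le> cmod (\<i> * of_int (fst \<zeta>)) * nrm \<nu> (\<sigma>+1) \<zeta> u + cmod (\<i> * of_int (snd \<zeta>)) * nrm \<nu> (\<sigma>+1) \<zeta> v"
      by (rule Hs_lin2[OF H(1,2)])
    have wn: "nrm \<nu> (\<sigma>+1) \<zeta> ?w \<le> bz \<zeta> * (nrm \<nu> (\<sigma>+1) \<zeta> u + nrm \<nu> (\<sigma>+1) \<zeta> v)"
    proof -
      have "cmod (\<i> * of_int (fst \<zeta>)) * nrm \<nu> (\<sigma>+1) \<zeta> u + cmod (\<i> * of_int (snd \<zeta>)) * nrm \<nu> (\<sigma>+1) \<zeta> v \<le> bz \<zeta> * nrm \<nu> (\<sigma>+1) \<zeta> u + bz \<zeta> * nrm \<nu> (\<sigma>+1) \<zeta> v"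
        using zb Hn by (intro add_mono mult_right_mono) (auto simp: norm_mult)
      with w[THEN conjunct2] show ?thesis by (simp add: distrib_left)
    qed
    have pw: "nrm \<nu> \<sigma> \<zeta> (prim a ?w) \<le> Cp * (nrm \<nu> (\<sigma>+1) \<zeta> u + nrm \<nu> (\<sigma>+1) \<zeta> v)"
    proof -
      have "nrm \<nu> \<sigma> \<zeta> (prim a ?w) \<le> Cp / bz \<zeta> * nrm \<nu> (\<sigma>+1) \<zeta> ?w" by (rule Cp(3)[OF w[THEN conjunct1]])
      also have "\<dots> \<le> Cp / bz \<zeta> * (bz \<zeta> * (nrm \<nu> (\<sigma>+1) \<zeta> u + nrm \<nu> (\<sigma>+1) \<zeta> v))" using wn Cp(1) b0 by (intro mult_left_mono) auto
      also have "\<dots> = Cp * (nrm \<nu> (\<sigma>+1) \<zeta> u + nrm \<nu> (\<sigma>+1) \<zeta> v)" using b0 by simp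
      finally show ?thesis .
    qed
    let ?r1 = "\<lambda>k. of_real \<alpha> * v k + (- (\<i> * of_int (fst \<zeta>) * of_real \<beta>)) * prim a t k"
    let ?r2 = "\<lambda>k. (- of_real \<alpha>) * u k + (- (\<i> * of_int (snd \<zeta>) * of_real \<beta>)) * prim a t k"
    let ?r3 = "\<lambda>k. of_real \<gamma> * prim a ?w k"
    have R: "Rop a \<alpha> \<beta> \<gamma> \<zeta> X = (?r1, ?r2, ?r3)" by (simp add: XX Rop_def)
    note r1 = Hs_lin2[OF H0(2)[THEN conjunct1] Cp(2)[OF H(3)], of "of_real \<alpha>" "- (\<i> * of_int (fst \<zeta>) * of_real \<beta>)"]
    note r2 = Hs_lin2[OF H0(1)[THEN conjunct1] Cp(2)[OF H(3)], of "- of_real \<alpha>" "- (\<i> * of_int (snd \<zeta>) * of_real \<beta>)"]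
    note r3 = Hs_scale[OF Cp(2)[OF w[THEN conjunct1]], of "of_real \<gamma>"]
    show "Rop a \<alpha> \<beta> \<gamma> \<zeta> X \<in> Tgt \<nu> \<sigma> \<zeta> \<and> N3 \<nu> \<sigma> \<zeta> (Rop a \<alpha> \<beta> \<gamma> \<zeta> X) \<le> C * N1 \<zeta> X"
    proof
      show "Rop a \<alpha> \<beta> \<gamma> \<zeta> X \<in> Tgt \<nu> \<sigma> \<zeta>" unfolding R Tgt_iff using r1 r2 r3 by simp
      have e1: "nrm \<nu> \<sigma> \<zeta> ?r1 \<le> \<bar>\<alpha>\<bar> * nrm \<nu> (\<sigma>+1) \<zeta> v + \<bar>\<beta>\<bar> * Cp * nrm \<nu> (\<sigma>+1) \<zeta> t"
        using r1[THEN conjunct2] pt[OF zb(1)] mult_left_mono[OF H0(2)[THEN conjunct2], of "\<bar>\<alpha>\<bar>"] unfolding norm_minus_cancel norm_of_real by linarith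
      have e2: "nrm \<nu> \<sigma> \<zeta> ?r2 \<le> \<bar>\<alpha>\<bar> * nrm \<nu> (\<sigma>+1) \<zeta> u + \<bar>\<beta>\<bar> * Cp * nrm \<nu> (\<sigma>+1) \<zeta> t"
        using r2[THEN conjunct2] pt[OF zb(2)] mult_left_mono[OF H0(1)[THEN conjunct2], of "\<bar>\<alpha>\<bar>"] unfolding norm_minus_cancel norm_of_real by linarith
      have e3: "nrm \<nu> \<sigma> \<zeta> ?r3 \<le> \<bar>\<gamma>\<bar> * (Cp * (nrm \<nu> (\<sigma>+1) \<zeta> u + nrm \<nu> (\<sigma>+1) \<zeta> v))"
        using r3[THEN conjunct2] mult_left_mono[OF pw, of "\<bar>\<gamma>\<bar>"] unfolding norm_of_real by linarith
      have "N3 \<nu> \<sigma> \<zeta> (Rop a \<alpha> \<beta> \<gamma> \<zeta> X) = nrm \<nu> \<sigma> \<zeta> ?r1 + nrm \<nu> \<sigma> \<zeta> ?r2 + nrm \<nu> \<sigma> \<zeta> ?r3" unfolding R N3_def by simp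
      also have "\<dots> \<le> (\<bar>\<alpha>\<bar> + \<bar>\<gamma>\<bar> * Cp) * (nrm \<nu> (\<sigma>+1) \<zeta> u + nrm \<nu> (\<sigma>+1) \<zeta> v) + 2 * \<bar>\<beta>\<bar> * Cp * nrm \<nu> (\<sigma>+1) \<zeta> t"
        using e1 e2 e3 by (simp add: algebra_simps)
      also have "\<dots> \<le> C * (nrm \<nu> (\<sigma>+1) \<zeta> u + nrm \<nu> (\<sigma>+1) \<zeta> v) + C * nrm \<nu> (\<sigma>+1) \<zeta> t"
        using Hn Cp(1) by (intro add_mono mult_right_mono) (auto simp: C_def)
      also have "\<dots> = C * N1 \<zeta> X" by (simp add: N1_def XX algebra_simps)
      finally show "N3 \<nu> \<sigma> \<zeta> (Rop a \<alpha> \<beta> \<gamma> \<zeta> X) \<le> C * N1 \<zeta> X" .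
    qed
  qed
qed

lemma Rop_linD:
  assumes "Hs1 \<zeta> X" "Hs1 \<zeta> X'"
  shows "Rop a \<alpha> \<beta> \<gamma> \<zeta> (linD c X d X') = lin3 c (Rop a \<alpha> \<beta> \<gamma> \<zeta> X) d (Rop a \<alpha> \<beta> \<gamma> \<zeta> X')"
proof -
  obtain u v p t where X: "X = (u, v, p, t)" by (cases X)
  obtain u' v' p' t' where X': "X' = (u', v', p', t')" by (cases X')
  let ?x = "\<i> * of_int (fst \<zeta>) :: complex" and ?y = "\<i> * of_int (snd \<zeta>) :: complex"
  have H: "u \<in> Hs \<nu> (\<sigma>+1) \<zeta>" "v \<in> Hs \<nu> (\<sigma>+1) \<zeta>" "t \<in> Hs \<nu> (\<sigma>+1) \<zeta>" "u' \<in> Hs \<nu> (\<sigma>+1) \<zeta>" "v' \<in> Hs \<nu> (\<sigma>+1) \<zeta>" "t' \<in> Hs \<nu> (\<sigma>+1) \<zeta>"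
    using assms by (auto simp: X X')
  have 1: "prim a (\<lambda>k. c * t k + d * t' k) = (\<lambda>k. c * prim a t k + d * prim a t' k)" by (rule prim_lin[OF H(3,6)])
  have e: "(\<lambda>k. ?x * (c * u k + d * u' k) + ?y * (c * v k + d * v' k)) = (\<lambda>k. c * (?x * u k + ?y * v k) + d * (?x * u' k + ?y * v' k))"
    by (simp add: fun_eq_iff algebra_simps)
  have 2: "prim a (\<lambda>k. ?x * (c * u k + d * u' k) + ?y * (c * v k + d * v' k)) =
     (\<lambda>k. c * prim a (\<lambda>k. ?x * u k + ?y * v k) k + d * prim a (\<lambda>k. ?x * u' k + ?y * v' k) k)"
    unfolding e by (rule prim_lin[OF Hs_lin2[OF H(1,2), THEN conjunct1] Hs_lin2[OF H(4,5), THEN conjunct1]])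
  show ?thesis unfolding X X' linD_def lin3_def Rop_def prod.case fst_conv snd_conv 1 2 by (simp add: fun_eq_iff algebra_simps)
qed

lemma Dom_Hs1: "X \<in> Dom a \<nu> (\<sigma>+2) \<zeta> \<Longrightarrow> Hs1 \<zeta> X"
  by (cases X) (auto simp: Dom_iff intro: Hs_mono[OF nu, of "\<sigma>+1" "\<sigma>+2", THEN conjunct1])

text \<open>Linearity of the constraint is not formal, since a divergent sum has no usable value.
  The sums converge because \<sigma>+2 > 0 places u and v in H^0, where they pair with the constant
  function.\<close>

lemma Dom_linD:
  assumes "X \<in> Dom a \<nu> (\<sigma>+2) \<zeta>" "X' \<in> Dom a \<nu> (\<sigma>+2) \<zeta>"
  shows "linD c X d X' \<in> Dom a \<nu> (\<sigma>+2) \<zeta>"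
proof -
  obtain u v p t where X: "X = (u, v, p, t)" by (cases X)
  obtain u' v' p' t' where X': "X' = (u', v', p', t')" by (cases X')
  let ?x = "of_int (fst \<zeta>) :: complex" and ?y = "of_int (snd \<zeta>) :: complex"
  note D = assms[unfolded X X' Dom_iff]
  have o: "one_c a \<in> Hs \<nu> (-0) \<zeta>" using one_c_Hs[OF a nu, of 0 \<zeta>] by simp
  have H0: "f \<in> Hs \<nu> 0 \<zeta>" if "f \<in> Hs \<nu> (\<sigma>+2) \<zeta>" for f using Hs_mono[OF nu _ that, of 0] sg by simp
  have s: "(\<lambda>k. (?x * f k + ?y * g k) * one_c a k) sums (\<Sum>k. (?x * f k + ?y * g k) * one_c a k)" if "f \<in> Hs \<nu> (\<sigma>+2) \<zeta>" "g \<in> Hs \<nu> (\<sigma>+2) \<zeta>" for f g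
    by (rule summable_sums, rule Hs_pairing[OF nu Hs_lin2[OF H0[OF that(1)] H0[OF that(2)], THEN conjunct1] o, THEN conjunct1])
  have "(\<lambda>k. c * ((?x * u k + ?y * v k) * one_c a k) + d * ((?x * u' k + ?y * v' k) * one_c a k)) sums (c * 0 + d * 0)"
    using s[of u v] s[of u' v'] D by (intro sums_add sums_mult) auto
  moreover have "(\<lambda>k. c * ((?x * u k + ?y * v k) * one_c a k) + d * ((?x * u' k + ?y * v' k) * one_c a k)) =
     (\<lambda>k. (?x * (c * u k + d * u' k) + ?y * (c * v k + d * v' k)) * one_c a k)"
    by (simp add: fun_eq_iff algebra_simps)
  ultimately have "(\<Sum>k. (?x * (c * u k + d * u' k) + ?y * (c * v k + d * v' k)) * one_c a k) = 0"
    by (simp add: sums_iff)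
  thus ?thesis unfolding X X' linD_def prod.case Dom_iff using D Hs_lin2 by simp
qed

lemma Lop_alt:
  assumes "X \<in> Dom a \<nu> (\<sigma>+2) \<zeta>"
  shows "Lop a \<nu> \<alpha> \<beta> \<gamma> lam \<zeta> X = lin3 1 (L0 a \<nu> lam \<zeta> X) (-1) (Rop a \<alpha> \<beta> \<gamma> \<zeta> X)"
proof -
  obtain u v p t where X: "X = (u, v, p, t)" by (cases X)
  show ?thesis unfolding sub3_lin3[symmetric] X by (rule Lop_eq_L0_Rop) (use assms in \<open>auto simp: X Dom_iff Hs_iff\<close>)
qed

lemma Lop_linD:
  assumes "X \<in> Dom a \<nu> (\<sigma>+2) \<zeta>" "X' \<in> Dom a \<nu> (\<sigma>+2) \<zeta>"
  shows "Lop a \<nu> \<alpha> \<beta> \<gamma> lam \<zeta> (linD c X d X') = lin3 c (Lop a \<nu> \<alpha> \<beta> \<gamma> lam \<zeta> X) d (Lop a \<nu> \<alpha> \<beta> \<gamma> lam \<zeta> X')"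
  unfolding Lop_alt[OF Dom_linD[OF assms]] Lop_alt[OF assms(1)] Lop_alt[OF assms(2)] L0_linD Rop_linD[OF Dom_Hs1[OF assms(1)] Dom_Hs1[OF assms(2)]]
  by (simp add: lin3_def fun_eq_iff algebra_simps)

text \<open>\<lambda> and \<zeta> are fixed here and the bound may depend on them; it serves only to
  show that the operator maps into H^\<sigma> and is continuous.\<close>

lemma symb_mult:
  assumes g: "good lam \<zeta>"
  shows "\<exists>B\<ge>0. \<forall>f\<in>Hs \<nu> (\<sigma>+2) \<zeta>. (\<lambda>k. symb a \<nu> lam \<zeta> k * f k) \<in> Hs \<nu> \<sigma> \<zeta> \<and>
     nrm \<nu> \<sigma> \<zeta> (\<lambda>k. symb a \<nu> lam \<zeta> k * f k) \<le> B * nrm \<nu> (\<sigma>+2) \<zeta> f"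
proof -
  obtain K where K: "K \<ge> 1" "\<And>k. cmod (symb a \<nu> lam \<zeta> k) \<le> K * (bw2 lam \<zeta> + real k ^ 2)"
    using D_bounds g by blast
  define B where "B = K * (bw2 lam \<zeta> + 1 / \<nu>)"
  have W1: "bw2 lam \<zeta> \<ge> 1" by (rule bw2_ge1)
  have B0: "B \<ge> 0" using K(1) W1 nu by (simp add: B_def)
  show ?thesis
  proof (intro exI[of _ B] conjI[OF B0] ballI)
    fix f assume f: "f \<in> Hs \<nu> (\<sigma>+2) \<zeta>"
    show "(\<lambda>k. symb a \<nu> lam \<zeta> k * f k) \<in> Hs \<nu> \<sigma> \<zeta> \<and>
      nrm \<nu> \<sigma> \<zeta> (\<lambda>k. symb a \<nu> lam \<zeta> k * f k) \<le> B * nrm \<nu> (\<sigma>+2) \<zeta> f"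
    proof (rule Hs_multiplier[OF f B0])
      fix k :: nat
      let ?y = "1 + \<nu> * real k ^ 2 + \<nu> * zabs2 \<zeta>"
      have y1: "?y \<ge> 1" by (rule wt_base_ge1[OF nu])
      have "real k ^ 2 = 1 / \<nu> * (\<nu> * real k ^ 2)" using nu by simp
      also have "\<dots> \<le> 1 / \<nu> * ?y" using nu zabs2_nonneg[of \<zeta>] by (intro mult_left_mono) auto
      finally have "bw2 lam \<zeta> + real k ^ 2 \<le> bw2 lam \<zeta> * ?y + 1 / \<nu> * ?y"
        using mult_left_mono[OF y1, of "bw2 lam \<zeta>"] W1 by linarith
      hence "K * (bw2 lam \<zeta> + real k ^ 2) \<le> K * (bw2 lam \<zeta> * ?y + 1 / \<nu> * ?y)" using K(1) by (intro mult_left_mono) auto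
      also have "\<dots> = B * ?y" unfolding B_def by (simp only: distrib_right distrib_left mult.assoc)
      finally have "cmod (symb a \<nu> lam \<zeta> k) \<le> B * ?y" using K(2)[of k] by linarith
      hence "(cmod (symb a \<nu> lam \<zeta> k))\<^sup>2 \<le> (B * ?y)\<^sup>2" by (intro power_mono) auto
      from mult_left_mono[OF this wt_nonneg[of \<nu> \<sigma> \<zeta> k]]
      show "wt \<nu> \<sigma> \<zeta> k * (cmod (symb a \<nu> lam \<zeta> k))\<^sup>2 \<le> B\<^sup>2 * wt \<nu> (\<sigma> + 2) \<zeta> k"
        unfolding wt_add[OF nu] wt_2[OF nu] power_mult_distrib by (simp add: mult_ac)
    qed
  qed
qed

lemma L0_bound:
  assumes g: "good lam \<zeta>"
  shows "\<exists>B\<ge>0. \<forall>u v p t. (u, v, p, t) \<in> Dom a \<nu> (\<sigma>+2) \<zeta> \<longrightarrow> L0 a \<nu> lam \<zeta> (u, v, p, t) \<in> Tgt \<nu> \<sigma> \<zeta> \<and>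
    N3 \<nu> \<sigma> \<zeta> (L0 a \<nu> lam \<zeta> (u, v, p, t)) \<le> B * (nrm \<nu> (\<sigma>+2) \<zeta> u + nrm \<nu> (\<sigma>+2) \<zeta> v + cmod p + nrm \<nu> (\<sigma>+2) \<zeta> t)"
proof -
  obtain B where B: "B \<ge> 0" "\<And>f. f \<in> Hs \<nu> (\<sigma>+2) \<zeta> \<Longrightarrow> (\<lambda>k. symb a \<nu> lam \<zeta> k * f k) \<in> Hs \<nu> \<sigma> \<zeta>"
     "\<And>f. f \<in> Hs \<nu> (\<sigma>+2) \<zeta> \<Longrightarrow> nrm \<nu> \<sigma> \<zeta> (\<lambda>k. symb a \<nu> lam \<zeta> k * f k) \<le> B * nrm \<nu> (\<sigma>+2) \<zeta> f"
    using symb_mult[OF g] by blast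
  have o: "one_c a \<in> Hs \<nu> \<sigma> \<zeta>" by (rule one_c_Hs[OF a nu sg(2)])
  define O1 where "O1 = 2 * zabs \<zeta> * nrm \<nu> \<sigma> \<zeta> (one_c a)"
  have O0: "O1 \<ge> 0" using nrm_nonneg[OF o] zabs_nonneg by (simp add: O1_def)
  show ?thesis
  proof (intro exI[of _ "B + O1"] conjI[OF add_nonneg_nonneg[OF B(1) O0]] allI impI)
    fix u v p t assume X: "(u, v, p, t) \<in> Dom a \<nu> (\<sigma>+2) \<zeta>"
    hence H: "u \<in> Hs \<nu> (\<sigma>+2) \<zeta>" "v \<in> Hs \<nu> (\<sigma>+2) \<zeta>" "t \<in> Hs \<nu> (\<sigma>+2) \<zeta>" by (auto simp: Dom_iff)
    note Hn = nrm_nonneg[OF H(1)] nrm_nonneg[OF H(2)] nrm_nonneg[OF H(3)]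
    have on: "(\<lambda>k. \<i> * z * p * one_c a k) \<in> Hs \<nu> \<sigma> \<zeta> \<and> nrm \<nu> \<sigma> \<zeta> (\<lambda>k. \<i> * z * p * one_c a k) \<le> O1 / 2 * cmod p"
      if "cmod z \<le> zabs \<zeta>" for z
    proof -
      have "cmod z * (cmod p * nrm \<nu> \<sigma> \<zeta> (one_c a)) \<le> zabs \<zeta> * (cmod p * nrm \<nu> \<sigma> \<zeta> (one_c a))"
        using that nrm_nonneg[OF o] by (intro mult_right_mono) auto
      thus ?thesis using Hs_scale[OF o, of "\<i> * z * p"] by (simp add: norm_mult O1_def mult_ac)
    qed
    note a1 = Hs_add[OF B(2)[OF H(1)] on[OF fst_le_zabs(1), THEN conjunct1]]
    note a2 = Hs_add[OF B(2)[OF H(2)] on[OF fst_le_zabs(2), THEN conjunct1]]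
    have T: "L0 a \<nu> lam \<zeta> (u, v, p, t) \<in> Tgt \<nu> \<sigma> \<zeta>"
      unfolding L0_def Tgt_iff using a1 a2 B(2)[OF H(3)] by simp
    have "N3 \<nu> \<sigma> \<zeta> (L0 a \<nu> lam \<zeta> (u, v, p, t)) \<le> (B * nrm \<nu> (\<sigma>+2) \<zeta> u + O1 / 2 * cmod p) + (B * nrm \<nu> (\<sigma>+2) \<zeta> v + O1 / 2 * cmod p) + B * nrm \<nu> (\<sigma>+2) \<zeta> t"
      unfolding N3_def L0_def prod.case fst_conv snd_conv
      by (intro add_mono order_trans[OF a1[THEN conjunct2]] order_trans[OF a2[THEN conjunct2]] B(3) H
           on[OF fst_le_zabs(1), THEN conjunct2] on[OF fst_le_zabs(2), THEN conjunct2])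
    also have "\<dots> = B * (nrm \<nu> (\<sigma>+2) \<zeta> u + nrm \<nu> (\<sigma>+2) \<zeta> v + nrm \<nu> (\<sigma>+2) \<zeta> t) + O1 * cmod p" by (simp add: distrib_left)
    also have "\<dots> \<le> (B + O1) * (nrm \<nu> (\<sigma>+2) \<zeta> u + nrm \<nu> (\<sigma>+2) \<zeta> v + nrm \<nu> (\<sigma>+2) \<zeta> t) + (B + O1) * cmod p"
      using B(1) O0 Hn by (intro add_mono mult_right_mono) auto
    also have "\<dots> = (B + O1) * (nrm \<nu> (\<sigma>+2) \<zeta> u + nrm \<nu> (\<sigma>+2) \<zeta> v + cmod p + nrm \<nu> (\<sigma>+2) \<zeta> t)" by (simp add: distrib_left)
    finally show "L0 a \<nu> lam \<zeta> (u, v, p, t) \<in> Tgt \<nu> \<sigma> \<zeta> \<and>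
      N3 \<nu> \<sigma> \<zeta> (L0 a \<nu> lam \<zeta> (u, v, p, t)) \<le> (B + O1) * (nrm \<nu> (\<sigma>+2) \<zeta> u + nrm \<nu> (\<sigma>+2) \<zeta> v + cmod p + nrm \<nu> (\<sigma>+2) \<zeta> t)"
      using T by blast
  qed
qed

lemma L0_Tgt: "good lam \<zeta> \<Longrightarrow> X \<in> Dom a \<nu> (\<sigma>+2) \<zeta> \<Longrightarrow> L0 a \<nu> lam \<zeta> X \<in> Tgt \<nu> \<sigma> \<zeta>"
  using L0_bound[of lam \<zeta>] by (cases X) blast

text \<open>\<open>p0_formula\<close> read backwards: p0 is the value that makes the constraint sum
  vanish, available because |\<zeta>| and the scalar sum are nonzero; u, v and t are then
  forced.\<close>

lemma L0_onto:
  assumes g: "good lam \<zeta>" and F: "F \<in> Tgt \<nu> \<sigma> \<zeta>"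
  shows "\<exists>X\<in>Dom a \<nu> (\<sigma>+2) \<zeta>. L0 a \<nu> lam \<zeta> X = F"
proof -
  obtain f h q where FF: "F = (f, h, q)" by (cases F)
  have H: "f \<in> Hs \<nu> \<sigma> \<zeta>" "h \<in> Hs \<nu> \<sigma> \<zeta>" "q \<in> Hs \<nu> \<sigma> \<zeta>" using F by (auto simp: FF Tgt_iff)
  let ?o = "\<lambda>k. one_c a k / symb a \<nu> lam \<zeta> k"
  have sgs: "-\<sigma> < 5/2" "\<sigma>+2 < 5/2" using sg by auto
  have o1: "?o \<in> Hs \<nu> (-\<sigma>) \<zeta>" using one_over_D[OF sgs(1)] g by blast
  have o2: "?o \<in> Hs \<nu> (\<sigma>+2) \<zeta>" using one_over_D[OF sgs(2)] g by blast
  obtain c where c: "c > 0 \<and> (\<forall>lam \<zeta>. good lam \<zeta> \<longrightarrow> summable (\<lambda>k. one_c a k * (one_c a k / symb a \<nu> lam \<zeta> k)) \<and>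
     c / bw2 lam \<zeta> \<le> cmod (\<Sum>k. one_c a k * (one_c a k / symb a \<nu> lam \<zeta> k)))"
    using S_lower by (rule exE)
  note cS = c[THEN conjunct2, rule_format, OF g]
  define S where "S = (\<Sum>k. one_c a k * ?o k)"
  have "c / bw2 lam \<zeta> > 0" using c bw2_ge1[of lam \<zeta>] by (intro divide_pos_pos) auto
  hence S0: "S \<noteq> 0" using cS unfolding S_def by auto
  define m where "m = (\<Sum>k. (of_int (fst \<zeta>) * f k + of_int (snd \<zeta>) * h k) * ?o k)"
  have Z0: "zabs2 \<zeta> \<noteq> 0" using g zabs2_ge1[of \<zeta>] by (auto simp: good_def)
  define p0 where "p0 = m / (\<i> * of_real (zabs2 \<zeta>) * S)"
  define u where "u = (\<lambda>k. 1 / symb a \<nu> lam \<zeta> k * f k - \<i> * of_int (fst \<zeta>) * p0 * ?o k)"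
  define v where "v = (\<lambda>k. 1 / symb a \<nu> lam \<zeta> k * h k - \<i> * of_int (snd \<zeta>) * p0 * ?o k)"
  define t where "t = (\<lambda>k. 1 / symb a \<nu> lam \<zeta> k * q k)"
  have iD: "(\<lambda>k. 1 / symb a \<nu> lam \<zeta> k * f k) \<in> Hs \<nu> (\<sigma>+2) \<zeta>" if "f \<in> Hs \<nu> \<sigma> \<zeta>" for f
    using invD g that by blast
  have uvt: "u \<in> Hs \<nu> (\<sigma>+2) \<zeta>" "v \<in> Hs \<nu> (\<sigma>+2) \<zeta>" "t \<in> Hs \<nu> (\<sigma>+2) \<zeta>"
    unfolding u_def v_def t_def
    by (intro Hs_diff[THEN conjunct1] Hs_scale[THEN conjunct1] iD H o2)+
  have "(\<lambda>k. (of_int (fst \<zeta>) * u k + of_int (snd \<zeta>) * v k) * one_c a k) sums (m - \<i> * of_real (zabs2 \<zeta>) * p0 * S)"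
    unfolding m_def S_def by (rule p0_formula[OF g H(1,2) o1 cS[THEN conjunct1]]) (simp_all only: u_def v_def)
  also have "m - \<i> * of_real (zabs2 \<zeta>) * p0 * S = 0" using S0 Z0 by (simp add: p0_def)
  finally have "(\<Sum>k. (of_int (fst \<zeta>) * u k + of_int (snd \<zeta>) * v k) * one_c a k) = 0" by (simp add: sums_iff)
  hence D: "(u, v, p0, t) \<in> Dom a \<nu> (\<sigma>+2) \<zeta>" using uvt by (simp add: Dom_iff)
  have *: "D * (1 / D * x - y * (z / D)) + y * z = x" "D * (1 / D * x) = x" if "D \<noteq> 0" for x y z D :: complex
    using that by (simp_all add: field_simps)
  have "L0 a \<nu> lam \<zeta> (u, v, p0, t) = F"
    unfolding L0_def FF prod.case u_def v_def t_def *[OF symb_nz[OF g]] by simp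
  with D show ?thesis by blast
qed

end

section \<open>Smallness of R and tools for the compactness argument\<close>

context prim_eq
begin

text \<open>Keeps limits of admissible parameters admissible, so that injectivity is available at
  the limit.\<close>

lemma Sset_closed: "closed (Sset \<delta>1 \<delta>2)"
proof -
  have "Sset \<delta>1 \<delta>2 = {z. (- \<delta>2 - Re z) / \<delta>1 \<le> \<bar>Im z\<bar>}"
  proof (intro set_eqI iffI)
    fix z assume "z \<in> {z. (- \<delta>2 - Re z) / \<delta>1 \<le> \<bar>Im z\<bar>}"
    hence "z = Complex (- \<delta>2 - (- \<delta>2 - Re z)) (Im z) \<and> \<bar>Im z\<bar> \<ge> (- \<delta>2 - Re z) / \<delta>1" by (simp add: complex_eq_iff)
    thus "z \<in> Sset \<delta>1 \<delta>2" unfolding Sset_def by blast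
  qed (auto simp: Sset_def)
  moreover have "closed {z. (- \<delta>2 - Re z) / \<delta>1 \<le> \<bar>Im z\<bar>}"
    by (intro closed_Collect_le continuous_intros) (use d1 in auto)
  ultimately show ?thesis by simp
qed

text \<open>Moving to the right decreases \<mu>1 and keeps \<mu>2, which only relaxes the sector
  condition.\<close>

lemma Sset_shift:
  assumes "lam \<in> Sset \<delta>1 \<delta>2" "h \<ge> 0"
  shows "lam + of_real h \<in> Sset \<delta>1 \<delta>2"
proof -
  obtain m1 m2 where lam: "lam = Complex (- \<delta>2 - m1) m2" "\<bar>m2\<bar> \<ge> m1 / \<delta>1" using assms(1) by (auto simp: Sset_def)
  have "(m1 - h) / \<delta>1 \<le> m1 / \<delta>1" using assms(2) d1 by (simp add: divide_right_mono)
  hence "lam + of_real h = Complex (- \<delta>2 - (m1 - h)) m2 \<and> \<bar>m2\<bar> \<ge> (m1 - h) / \<delta>1" using lam by (simp add: complex_eq_iff)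
  thus ?thesis unfolding Sset_def by blast
qed

text \<open>R is controlled by the H^(\<sigma>+1) norm, and on the domain this norm is controlled by
  L0 with a negative power of \<langle>\<omega>\<rangle>. The second bound forgets that power; it
  fixes the step length of the continuation in \<lambda>.\<close>

lemma R_small:
  "\<exists>\<kappa>\<ge>1. \<forall>lam \<zeta> X. good lam \<zeta> \<longrightarrow> X \<in> Dom a \<nu> (\<sigma>+2) \<zeta> \<longrightarrow>
     N3 \<nu> \<sigma> \<zeta> (Rop a \<alpha> \<beta> \<gamma> \<zeta> X) \<le> \<kappa> * bw2 lam \<zeta> powr (-1/4) * N3 \<nu> \<sigma> \<zeta> (L0 a \<nu> lam \<zeta> X) \<and>
     N1 \<zeta> X \<le> \<kappa> * N3 \<nu> \<sigma> \<zeta> (L0 a \<nu> lam \<zeta> X)"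
proof -
  obtain C where C: "C \<ge> 1" "\<And>lam \<zeta> u v p0 t. good lam \<zeta> \<Longrightarrow> (u, v, p0, t) \<in> Dom a \<nu> (\<sigma> + 2) \<zeta> \<Longrightarrow>
      L0 a \<nu> lam \<zeta> (u, v, p0, t) \<in> Tgt \<nu> \<sigma> \<zeta> \<Longrightarrow> nrm \<nu> (\<sigma>+1) \<zeta> u + nrm \<nu> (\<sigma>+1) \<zeta> v + nrm \<nu> (\<sigma>+1) \<zeta> t
        \<le> C * bw2 lam \<zeta> powr (-1/4) * N3 \<nu> \<sigma> \<zeta> (L0 a \<nu> lam \<zeta> (u, v, p0, t))"
    using L0_estimate by blast
  obtain CR where CR: "CR \<ge> 0" "\<And>\<zeta> X. Hs1 \<zeta> X \<Longrightarrow> N3 \<nu> \<sigma> \<zeta> (Rop a \<alpha> \<beta> \<gamma> \<zeta> X) \<le> CR * N1 \<zeta> X"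
    using Rop_bound by blast
  define \<kappa> where "\<kappa> = CR * C + C"
  have k: "\<kappa> \<ge> 1" "\<kappa> \<ge> CR * C" "\<kappa> \<ge> C"
  proof -
    have "0 \<le> CR * C" using C(1) CR(1) by (intro mult_nonneg_nonneg) auto
    thus "\<kappa> \<ge> 1" "\<kappa> \<ge> CR * C" "\<kappa> \<ge> C" unfolding \<kappa>_def using C(1) by linarith+
  qed
  show ?thesis
  proof (intro exI[of _ \<kappa>] conjI[OF k(1)] allI impI)
    fix lam \<zeta> X assume g: "good lam \<zeta>" and X: "X \<in> Dom a \<nu> (\<sigma>+2) \<zeta>"
    obtain u v p t where XX: "X = (u, v, p, t)" by (cases X)
    define w n where "w = bw2 lam \<zeta> powr (-1/4)" and "n = N3 \<nu> \<sigma> \<zeta> (L0 a \<nu> lam \<zeta> X)"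
    have n0: "n \<ge> 0" unfolding n_def by (rule N3_nonneg[OF L0_Tgt[OF g X]])
    have w0: "w \<ge> 0" "w \<le> 1" using bw2_ge1[of lam \<zeta>] powr_mono[of "-1/4" 0 "bw2 lam \<zeta>"] by (auto simp: w_def)
    have 1: "N1 \<zeta> X \<le> C * w * n"
      using C(2)[OF g X[unfolded XX] L0_Tgt[OF g X, unfolded XX]] by (simp add: N1_def XX w_def n_def)
    have "N3 \<nu> \<sigma> \<zeta> (Rop a \<alpha> \<beta> \<gamma> \<zeta> X) \<le> CR * N1 \<zeta> X" by (rule CR(2)[OF Dom_Hs1[OF X]])
    also have "\<dots> \<le> CR * (C * w * n)" by (rule mult_left_mono[OF 1 CR(1)])
    also have "\<dots> = (CR * C) * (w * n)" by simp
    also have "\<dots> \<le> \<kappa> * (w * n)" using k w0 n0 by (intro mult_right_mono) auto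
    finally have 2: "N3 \<nu> \<sigma> \<zeta> (Rop a \<alpha> \<beta> \<gamma> \<zeta> X) \<le> \<kappa> * (w * n)" .
    have "C * (w * n) \<le> \<kappa> * (1 * n)" using k w0 n0 C(1) by (intro mult_mono) (auto intro: mult_right_mono)
    with 1 have "N1 \<zeta> X \<le> \<kappa> * n" by simp
    with 2 show "N3 \<nu> \<sigma> \<zeta> (Rop a \<alpha> \<beta> \<gamma> \<zeta> X) \<le> \<kappa> * bw2 lam \<zeta> powr (-1/4) * N3 \<nu> \<sigma> \<zeta> (L0 a \<nu> lam \<zeta> X) \<and>
     N1 \<zeta> X \<le> \<kappa> * N3 \<nu> \<sigma> \<zeta> (L0 a \<nu> lam \<zeta> X)" by (simp add: w_def n_def)
  qed
qed

lemma R_half: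
  "\<exists>W0. \<forall>lam \<zeta> X. good lam \<zeta> \<longrightarrow> bw2 lam \<zeta> \<ge> W0 \<longrightarrow> X \<in> Dom a \<nu> (\<sigma>+2) \<zeta> \<longrightarrow>
     N3 \<nu> \<sigma> \<zeta> (Rop a \<alpha> \<beta> \<gamma> \<zeta> X) \<le> 1/2 * N3 \<nu> \<sigma> \<zeta> (L0 a \<nu> lam \<zeta> X)"
proof -
  obtain \<kappa> where k: "\<kappa> \<ge> 1" "\<And>lam \<zeta> X. good lam \<zeta> \<Longrightarrow> X \<in> Dom a \<nu> (\<sigma>+2) \<zeta> \<Longrightarrow>
     N3 \<nu> \<sigma> \<zeta> (Rop a \<alpha> \<beta> \<gamma> \<zeta> X) \<le> \<kappa> * bw2 lam \<zeta> powr (-1/4) * N3 \<nu> \<sigma> \<zeta> (L0 a \<nu> lam \<zeta> X)"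
    using R_small by blast
  show ?thesis
  \<comment> \<open>The threshold is the solution W of \<kappa> W^(-1/4) = 1/2.\<close>
  proof (intro exI[of _ "(2*\<kappa>) powr 4"] allI impI)
    fix lam \<zeta> X assume g: "good lam \<zeta>" and W: "(2*\<kappa>) powr 4 \<le> bw2 lam \<zeta>" and X: "X \<in> Dom a \<nu> (\<sigma>+2) \<zeta>"
    have "bw2 lam \<zeta> powr (-1/4) \<le> ((2*\<kappa>) powr 4) powr (-1/4)" using W k(1) by (intro powr_mono2') auto
    also have "\<dots> = (2*\<kappa>) powr (-1)" by (subst powr_powr) simp
    also have "\<dots> = 1 / (2*\<kappa>)" using k(1) by (intro powr_neg_one) auto
    finally have "\<kappa> * bw2 lam \<zeta> powr (-1/4) \<le> \<kappa> * (1 / (2*\<kappa>))" using k(1) by (intro mult_left_mono) auto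
    also have "\<dots> = 1/2" using k(1) by simp
    finally have "\<kappa> * bw2 lam \<zeta> powr (-1/4) * N3 \<nu> \<sigma> \<zeta> (L0 a \<nu> lam \<zeta> X) \<le> 1/2 * N3 \<nu> \<sigma> \<zeta> (L0 a \<nu> lam \<zeta> X)"
      by (rule mult_right_mono) (rule N3_nonneg[OF L0_Tgt[OF g X]])
    with k(2)[OF g X] show "N3 \<nu> \<sigma> \<zeta> (Rop a \<alpha> \<beta> \<gamma> \<zeta> X) \<le> 1/2 * N3 \<nu> \<sigma> \<zeta> (L0 a \<nu> lam \<zeta> X)" by linarith
  qed
qed

lemma Rop_Tgt: "X \<in> Dom a \<nu> (\<sigma>+2) \<zeta> \<Longrightarrow> Rop a \<alpha> \<beta> \<gamma> \<zeta> X \<in> Tgt \<nu> \<sigma> \<zeta>"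
  using Rop_bound Dom_Hs1 by blast

lemma Lop_Tgt: "good lam \<zeta> \<Longrightarrow> X \<in> Dom a \<nu> (\<sigma>+2) \<zeta> \<Longrightarrow> Lop a \<nu> \<alpha> \<beta> \<gamma> lam \<zeta> X \<in> Tgt \<nu> \<sigma> \<zeta>"
  using Tgt_lin3[OF L0_Tgt Rop_Tgt] by (simp add: Lop_alt)

lemma L0_le:
  assumes g: "good lam \<zeta>" and X: "X \<in> Dom a \<nu> (\<sigma>+2) \<zeta>"
  shows "N3 \<nu> \<sigma> \<zeta> (L0 a \<nu> lam \<zeta> X) \<le> N3 \<nu> \<sigma> \<zeta> (Lop a \<nu> \<alpha> \<beta> \<gamma> lam \<zeta> X) + N3 \<nu> \<sigma> \<zeta> (Rop a \<alpha> \<beta> \<gamma> \<zeta> X)"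
proof -
  have "L0 a \<nu> lam \<zeta> X = lin3 1 (Lop a \<nu> \<alpha> \<beta> \<gamma> lam \<zeta> X) 1 (Rop a \<alpha> \<beta> \<gamma> \<zeta> X)"
    by (simp add: Lop_alt[OF X] lin3_def)
  with Tgt_lin3[OF Lop_Tgt[OF g X] Rop_Tgt[OF X], of 1 1] show ?thesis by simp
qed

text \<open>For fixed \<zeta> and bounded \<lambda>, \<open>bw2\<close> ranges over a bounded
  interval of numbers at least 1. Taking the absolute value of the exponent gives a bound that is
  valid whatever its sign.\<close>

lemma Ms_bounded:
  assumes "s > - 5/2"
  shows "\<exists>B\<ge>0. \<forall>lam. cmod lam \<le> \<Lambda> \<longrightarrow> Ms s lam \<zeta> \<le> B"
proof -
  obtain C where C: "C > 0" "\<And>lam. (Ms s lam \<zeta>)\<^sup>2 \<le> C * bw2 lam \<zeta> powr (max 0 (-s) - 2)"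
    using Ms_summable_bound[OF assms] by blast
  define V where "V = \<bar>\<Lambda>\<bar> + (bz \<zeta>)\<^sup>2"
  define q where "q = \<bar>max 0 (-s) - 2\<bar>"
  show ?thesis
  proof (intro exI[of _ "sqrt (C * V powr q)"] conjI allI impI)
    show "0 \<le> sqrt (C * V powr q)" using C(1) by simp
    fix lam assume l: "cmod lam \<le> \<Lambda>"
    have W: "1 \<le> bw2 lam \<zeta>" "bw2 lam \<zeta> \<le> V" using bw2_ge1[of lam \<zeta>] l by (auto simp: bw2_def V_def)
    have "bw2 lam \<zeta> powr (max 0 (-s) - 2) \<le> bw2 lam \<zeta> powr q" using W by (intro powr_mono) (auto simp: q_def)
    also have "\<dots> \<le> V powr q" using W by (intro powr_mono2) (auto simp: q_def)
    finally have "(Ms s lam \<zeta>)\<^sup>2 \<le> C * V powr q" using C(2)[of lam] C(1) by (meson mult_left_mono less_imp_le order_trans)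
    thus "Ms s lam \<zeta> \<le> sqrt (C * V powr q)" by (rule real_le_rsqrt)
  qed
qed

lemma est_bounds:
  assumes e: "est C lam \<zeta> u v p0 t n" and z: "\<zeta> \<noteq> (0,0)"
  shows "cmod p0 \<le> C * bw2 lam \<zeta> * Ms \<sigma> lam \<zeta> * n"
    "nrm \<nu> (\<sigma>+2) \<zeta> u \<le> C * bw2 lam \<zeta> * Ms \<sigma> lam \<zeta> * Ms (- \<sigma> - 2) lam \<zeta> * n + C * n"
    "nrm \<nu> (\<sigma>+2) \<zeta> v \<le> C * bw2 lam \<zeta> * Ms \<sigma> lam \<zeta> * Ms (- \<sigma> - 2) lam \<zeta> * n + C * n"
    "t \<in> Hs \<nu> (\<sigma>+2) \<zeta> \<Longrightarrow> nrm \<nu> (\<sigma>+2) \<zeta> t \<le> C * n"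
proof -
  from e obtain u1 v1 u2 v2 where E: "u1 \<in> Hs \<nu> (\<sigma> + 2) \<zeta>" "v1 \<in> Hs \<nu> (\<sigma> + 2) \<zeta>"
           "u2 \<in> Hs \<nu> (\<sigma> + 2) \<zeta>" "v2 \<in> Hs \<nu> (\<sigma> + 2) \<zeta>"
           "(\<forall>k. u k = u1 k + u2 k \<and> v k = v1 k + v2 k)"
           "zabs \<zeta> * cmod p0 \<le> C * bw2 lam \<zeta> * Ms \<sigma> lam \<zeta> * n"
           "Ms (- \<sigma> - 2) lam \<zeta> / Ms (- \<sigma>) lam \<zeta> * nrm2 \<nu> \<sigma> \<zeta> (u1, v1)
             + nrm2 \<nu> (\<sigma> + 2) \<zeta> (u1, v1)
             \<le> C * bw2 lam \<zeta> * Ms \<sigma> lam \<zeta> * Ms (- \<sigma> - 2) lam \<zeta> * n"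
           "bw2 lam \<zeta> * nrm2 \<nu> \<sigma> \<zeta> (u2, v2) + nrm2 \<nu> (\<sigma> + 2) \<zeta> (u2, v2) \<le> C * n"
           "bw2 lam \<zeta> * nrm \<nu> \<sigma> \<zeta> t + nrm \<nu> (\<sigma> + 2) \<zeta> t \<le> C * n"
    unfolding est_def by blast
  have W: "bw2 lam \<zeta> > 0" using bw2_ge1[of lam \<zeta>] by simp
  have M: "Ms (-\<sigma>) lam \<zeta> > 0" "Ms (-\<sigma>-2) lam \<zeta> > 0" using sg by (auto intro!: Ms_pos)
  have "1 * cmod p0 \<le> zabs \<zeta> * cmod p0" using zabs_ge1[OF z] by (intro mult_right_mono) auto
  thus "cmod p0 \<le> C * bw2 lam \<zeta> * Ms \<sigma> lam \<zeta> * n" using E(6) by simp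
  have p: "0 \<le> nrm2 \<nu> s \<zeta> y" for s y by (simp add: nrm2_def)
  have a: "nrm2 \<nu> (\<sigma> + 2) \<zeta> (u1, v1) \<le> C * bw2 lam \<zeta> * Ms \<sigma> lam \<zeta> * Ms (- \<sigma> - 2) lam \<zeta> * n"
    using E(7) mult_nonneg_nonneg[OF divide_nonneg_nonneg[OF less_imp_le[OF M(2)] less_imp_le[OF M(1)]] p[of \<sigma> "(u1, v1)"]] by linarith
  have b: "nrm2 \<nu> (\<sigma> + 2) \<zeta> (u2, v2) \<le> C * n"
    using E(8) mult_nonneg_nonneg[OF less_imp_le[OF W] p[of \<sigma> "(u2, v2)"]] by linarith
  have le: "nrm \<nu> (\<sigma>+2) \<zeta> f \<le> nrm2 \<nu> (\<sigma> + 2) \<zeta> (f, g)" "nrm \<nu> (\<sigma>+2) \<zeta> g \<le> nrm2 \<nu> (\<sigma> + 2) \<zeta> (f, g)" for f g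
    by (auto simp: nrm2_def intro: real_le_rsqrt)
  have "u = (\<lambda>k. u1 k + u2 k)" "v = (\<lambda>k. v1 k + v2 k)" using E(5) by auto
  thus "nrm \<nu> (\<sigma>+2) \<zeta> u \<le> C * bw2 lam \<zeta> * Ms \<sigma> lam \<zeta> * Ms (- \<sigma> - 2) lam \<zeta> * n + C * n"
    "nrm \<nu> (\<sigma>+2) \<zeta> v \<le> C * bw2 lam \<zeta> * Ms \<sigma> lam \<zeta> * Ms (- \<sigma> - 2) lam \<zeta> * n + C * n"
    using Hs_add[OF E(1,3)] Hs_add[OF E(2,4)] le[of u1 v1] le[of u2 v2] a b le(2)[of v1 u1] le(2)[of v2 u2] by auto
  assume "t \<in> Hs \<nu> (\<sigma>+2) \<zeta>"
  hence "nrm \<nu> \<sigma> \<zeta> t \<ge> 0" using Hs_mono[OF nu, of \<sigma> "\<sigma>+2" t \<zeta>] nrm_nonneg by auto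
  thus "nrm \<nu> (\<sigma>+2) \<zeta> t \<le> C * n" using E(9) mult_nonneg_nonneg[OF less_imp_le[OF W]] by (smt (verit))
qed

text \<open>The two weights differ by the factor 1 + \<nu> k^2 + \<nu>|\<zeta>|^2, which tends to
  infinity with k; hence the embedding is compact for each fixed \<zeta>.\<close>

lemma Rellich:
  assumes f: "\<And>n. f n \<in> Hs \<nu> (\<sigma>+2) \<zeta>" and B: "\<And>n. nrm \<nu> (\<sigma>+2) \<zeta> (f n) \<le> B"
  shows "\<exists>r g. strict_mono (r :: nat \<Rightarrow> nat) \<and> g \<in> Hs \<nu> (\<sigma>+2) \<zeta> \<and> (\<lambda>n. nrm \<nu> (\<sigma>+1) \<zeta> (\<lambda>k. f (r n) k - g k)) \<longlonglongrightarrow> 0"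
proof -
  have ratio: "\<exists>N. \<forall>k\<ge>N. wt \<nu> (\<sigma>+1) \<zeta> k \<le> e * wt \<nu> (\<sigma>+2) \<zeta> k" if e: "e > 0" for e
  proof -
    obtain N :: nat where N: "real N > 1 / (e * \<nu>)" using reals_Archimedean2 by blast
    show ?thesis
    proof (intro exI[of _ "N + 1"] allI impI)
      fix k assume k: "N + 1 \<le> k"
      have "real k \<le> real k ^ 2" using k by (simp add: power2_eq_square)
      hence "1 / (e * \<nu>) \<le> real k ^ 2" using N k by linarith
      hence "1 \<le> e * (\<nu> * real k ^ 2)" using e nu by (simp add: field_simps)
      also have "\<dots> \<le> e * (1 + \<nu> * real k ^ 2 + \<nu> * zabs2 \<zeta>)" using e nu zabs2_nonneg[of \<zeta>] by (intro mult_left_mono) auto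
      finally have "1 * wt \<nu> (\<sigma>+1) \<zeta> k \<le> e * (1 + \<nu> * real k ^ 2 + \<nu> * zabs2 \<zeta>) * wt \<nu> (\<sigma>+1) \<zeta> k"
        by (rule mult_right_mono) (rule wt_nonneg)
      also have "\<dots> = e * wt \<nu> (\<sigma>+1+1) \<zeta> k" unfolding wt_add[OF nu, of "\<sigma>+1" 1] wt_1[OF nu] by (simp add: mult_ac)
      finally show "wt \<nu> (\<sigma>+1) \<zeta> k \<le> e * wt \<nu> (\<sigma>+2) \<zeta> k" by (simp add: add.assoc)
    qed
  qed
  have f': "l2s (wt \<nu> (\<sigma>+2) \<zeta>) (f n)" "f n 0 = 0" "l2n (wt \<nu> (\<sigma>+2) \<zeta>) (f n) \<le> B" for n using f[of n] B[of n] by (auto simp: Hs_iff nrm_eq)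
  obtain r g where r: "strict_mono (r :: nat \<Rightarrow> nat)" "l2s (wt \<nu> (\<sigma>+2) \<zeta>) g" "\<And>k. (\<lambda>n. f (r n) k) \<longlonglongrightarrow> g k"
     "(\<lambda>n. l2n (wt \<nu> (\<sigma>+1) \<zeta>) (\<lambda>k. f (r n) k - g k)) \<longlonglongrightarrow> 0"
    using l2_Rellich[of "wt \<nu> (\<sigma>+1) \<zeta>" "wt \<nu> (\<sigma>+2) \<zeta>" f B] wt_pos[OF nu] ratio f' by blast
  have "g 0 = 0" using r(3)[of 0] f'(2) LIMSEQ_unique[of "\<lambda>n. f (r n) 0" "g 0" 0] by simp
  with r show ?thesis unfolding nrm_eq by (auto simp: Hs_iff)
qed

end

section \<open>A priori estimate and continuation in the spectral parameter\<close>

context prim_eq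
begin

text \<open>If no constant worked, normalisation would give Y_n with L0 Y_n of norm 1 and L Y_n
  tending to 0. The estimates for L0 bound Y_n in H^(\<sigma>+2), so a subsequence converges in
  H^(\<sigma>+1), along with parameters and pressures. Its limit lies in the kernel of the limit
  operator and vanishes. Then R Y_n tends to 0, because R is continuous on H^(\<sigma>+1), and this
  contradicts 1 \<le> |L Y_n| + |R Y_n|.\<close>

lemma apriori_compact:
  assumes inj: "\<And>lam X. good lam \<zeta> \<Longrightarrow> X \<in> Dom a \<nu> (\<sigma>+2) \<zeta> \<Longrightarrow>
      Lop a \<nu> \<alpha> \<beta> \<gamma> lam \<zeta> X = (\<lambda>k. 0, \<lambda>k. 0, \<lambda>k. 0) \<Longrightarrow> X = (\<lambda>k. 0, \<lambda>k. 0, 0, \<lambda>k. 0)"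
    and z: "\<zeta> \<noteq> (0,0)"
  shows "\<exists>C\<ge>0. \<forall>lam X. lam \<in> Sset \<delta>1 \<delta>2 \<longrightarrow> cmod lam \<le> \<Lambda> \<longrightarrow> X \<in> Dom a \<nu> (\<sigma>+2) \<zeta> \<longrightarrow>
     N3 \<nu> \<sigma> \<zeta> (L0 a \<nu> lam \<zeta> X) \<le> C * N3 \<nu> \<sigma> \<zeta> (Lop a \<nu> \<alpha> \<beta> \<gamma> lam \<zeta> X)"
proof (rule ccontr)
  assume neg: "\<not> ?thesis"
  have "\<forall>n. \<exists>lam X. lam \<in> Sset \<delta>1 \<delta>2 \<and> cmod lam \<le> \<Lambda> \<and> X \<in> Dom a \<nu> (\<sigma>+2) \<zeta> \<and>
     N3 \<nu> \<sigma> \<zeta> (L0 a \<nu> lam \<zeta> X) > real (Suc n) * N3 \<nu> \<sigma> \<zeta> (Lop a \<nu> \<alpha> \<beta> \<gamma> lam \<zeta> X)"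
  proof
    fix n
    have "\<not> (\<forall>lam X. lam \<in> Sset \<delta>1 \<delta>2 \<longrightarrow> cmod lam \<le> \<Lambda> \<longrightarrow> X \<in> Dom a \<nu> (\<sigma>+2) \<zeta> \<longrightarrow>
     N3 \<nu> \<sigma> \<zeta> (L0 a \<nu> lam \<zeta> X) \<le> real (Suc n) * N3 \<nu> \<sigma> \<zeta> (Lop a \<nu> \<alpha> \<beta> \<gamma> lam \<zeta> X))"
      using neg of_nat_0_le_iff[of "Suc n"] by blast
    thus "\<exists>lam X. lam \<in> Sset \<delta>1 \<delta>2 \<and> cmod lam \<le> \<Lambda> \<and> X \<in> Dom a \<nu> (\<sigma>+2) \<zeta> \<and>
     N3 \<nu> \<sigma> \<zeta> (L0 a \<nu> lam \<zeta> X) > real (Suc n) * N3 \<nu> \<sigma> \<zeta> (Lop a \<nu> \<alpha> \<beta> \<gamma> lam \<zeta> X)"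
      by (simp only: not_all not_imp not_le)
  qed
  then obtain l X where lX: "\<And>n. l n \<in> Sset \<delta>1 \<delta>2" "\<And>n. cmod (l n) \<le> \<Lambda>" "\<And>n. X n \<in> Dom a \<nu> (\<sigma>+2) \<zeta>"
     "\<And>n. N3 \<nu> \<sigma> \<zeta> (L0 a \<nu> (l n) \<zeta> (X n)) > real (Suc n) * N3 \<nu> \<sigma> \<zeta> (Lop a \<nu> \<alpha> \<beta> \<gamma> (l n) \<zeta> (X n))"
    by metis
  have gl: "good (l n) \<zeta>" for n using lX(1) z by (simp add: good_def)
  define m where "m n = N3 \<nu> \<sigma> \<zeta> (L0 a \<nu> (l n) \<zeta> (X n))" for n
  have LT: "Lop a \<nu> \<alpha> \<beta> \<gamma> (l n) \<zeta> (X n) \<in> Tgt \<nu> \<sigma> \<zeta>" for n by (rule Lop_Tgt[OF gl lX(3)])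
  have m0: "m n > 0" for n
    using lX(4)[of n] mult_nonneg_nonneg[OF of_nat_0_le_iff[of "Suc n"] N3_nonneg[OF LT[of n]]] unfolding m_def by linarith
  \<comment> \<open>Multiplication by 1/m n, written as a two-term combination with second
    coefficient 0.\<close>
  define Y where "Y n = linD (of_real (1 / m n)) (X n) 0 (X n)" for n
  have YD: "Y n \<in> Dom a \<nu> (\<sigma>+2) \<zeta>" for n unfolding Y_def by (rule Dom_linD[OF lX(3) lX(3)])
  have sc: "N3 \<nu> \<sigma> \<zeta> (lin3 (of_real (1 / m n)) F 0 F) = 1 / m n * N3 \<nu> \<sigma> \<zeta> F" if "F \<in> Tgt \<nu> \<sigma> \<zeta>" for F n
  proof -
    have F: "fst F \<in> Hs \<nu> \<sigma> \<zeta>" "fst (snd F) \<in> Hs \<nu> \<sigma> \<zeta>" "snd (snd F) \<in> Hs \<nu> \<sigma> \<zeta>" using that by (auto simp: Tgt_iff)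
    have c: "cmod (of_real (1 / m n)) = 1 / m n" using m0[of n] by (simp only: norm_of_real) simp
    note e = Hs_scale[OF F(1), of "of_real (1 / m n)", THEN conjunct2] Hs_scale[OF F(2), of "of_real (1 / m n)", THEN conjunct2]
       Hs_scale[OF F(3), of "of_real (1 / m n)", THEN conjunct2]
    show ?thesis unfolding N3_def lin3_def fst_conv snd_conv mult_zero_left add_0_right e c by (simp only: distrib_left)
  qed
  have LY1: "N3 \<nu> \<sigma> \<zeta> (L0 a \<nu> (l n) \<zeta> (Y n)) = 1" for n
    unfolding Y_def L0_linD using sc[OF L0_Tgt[OF gl lX(3)], of n n] m0[of n] unfolding m_def by simp
  have LYs: "N3 \<nu> \<sigma> \<zeta> (Lop a \<nu> \<alpha> \<beta> \<gamma> (l n) \<zeta> (Y n)) \<le> 1 / real (Suc n)" for n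
  proof -
    define x where "x = N3 \<nu> \<sigma> \<zeta> (Lop a \<nu> \<alpha> \<beta> \<gamma> (l n) \<zeta> (X n))"
    have "N3 \<nu> \<sigma> \<zeta> (Lop a \<nu> \<alpha> \<beta> \<gamma> (l n) \<zeta> (Y n)) = 1 / m n * x"
      unfolding Y_def Lop_linD[OF lX(3) lX(3)] x_def by (rule sc[OF LT])
    moreover have "real (Suc n) * x < m n" using lX(4)[of n] by (simp add: x_def m_def)
    hence "1 / m n * x \<le> 1 / real (Suc n)" using m0[of n] by (simp add: field_simps)
    ultimately show ?thesis by simp
  qed
  have LY0: "(\<lambda>n. N3 \<nu> \<sigma> \<zeta> (Lop a \<nu> \<alpha> \<beta> \<gamma> (l n) \<zeta> (Y n))) \<longlonglongrightarrow> 0"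
  proof (rule tendsto_sandwich[OF _ _ tendsto_const])
    show "(\<lambda>n. 1 / real (Suc n)) \<longlonglongrightarrow> 0" using LIMSEQ_inverse_real_of_nat by (simp add: inverse_eq_divide)
  qed (use LYs N3_nonneg[OF Lop_Tgt[OF gl YD]] in auto)
  define u v p t where "u n = fst (Y n)" and "v n = fst (snd (Y n))" and "p n = fst (snd (snd (Y n)))" and "t n = snd (snd (snd (Y n)))" for n
  have Yn: "Y n = (u n, v n, p n, t n)" for n by (simp add: u_def v_def p_def t_def)
  have H: "u n \<in> Hs \<nu> (\<sigma>+2) \<zeta>" "v n \<in> Hs \<nu> (\<sigma>+2) \<zeta>" "t n \<in> Hs \<nu> (\<sigma>+2) \<zeta>" for n
    using YD[of n] unfolding Yn Dom_iff by auto
  obtain C0 where C0: "C0 \<ge> 1" "\<And>lam \<zeta> u v p0 t. good lam \<zeta> \<Longrightarrow> (u, v, p0, t) \<in> Dom a \<nu> (\<sigma> + 2) \<zeta> \<Longrightarrow>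
      L0 a \<nu> lam \<zeta> (u, v, p0, t) \<in> Tgt \<nu> \<sigma> \<zeta> \<Longrightarrow> est C0 lam \<zeta> u v p0 t (N3 \<nu> \<sigma> \<zeta> (L0 a \<nu> lam \<zeta> (u, v, p0, t)))"
    using L0_estimate by blast
  have est: "est C0 (l n) \<zeta> (u n) (v n) (p n) (t n) 1" for n
    using C0(2)[OF gl[of n] YD[of n, unfolded Yn] L0_Tgt[OF gl[of n] YD[of n], unfolded Yn]] LY1[of n, unfolded Yn] by simp
  have sgs: "\<sigma> > - 5/2" "-\<sigma>-2 > -5/2" using sg by auto
  obtain B1 where B1: "B1 \<ge> 0" "\<And>lam. cmod lam \<le> \<Lambda> \<Longrightarrow> Ms \<sigma> lam \<zeta> \<le> B1" using Ms_bounded[OF sgs(1)] by blast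
  obtain B2 where B2: "B2 \<ge> 0" "\<And>lam. cmod lam \<le> \<Lambda> \<Longrightarrow> Ms (-\<sigma>-2) lam \<zeta> \<le> B2" using Ms_bounded[OF sgs(2)] by blast
  define V where "V = \<Lambda> + (bz \<zeta>)\<^sup>2"
  have WV: "0 \<le> bw2 (l n) \<zeta>" "bw2 (l n) \<zeta> \<le> V" for n using lX(2)[of n] bw2_ge1[of "l n" \<zeta>] by (auto simp: V_def bw2_def)
  have V0: "V \<ge> 0" using WV[of 0] by linarith
  have Mn: "0 \<le> Ms \<sigma> (l n) \<zeta>" "0 \<le> Ms (-\<sigma>-2) (l n) \<zeta>" for n using less_imp_le[OF Ms_pos[OF sgs(1)]] less_imp_le[OF Ms_pos[OF sgs(2)]] by blast+
  define BB where "BB = C0 * V * B1 * B2 * 1 + C0 * 1"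
  have b1: "C0 * bw2 (l n) \<zeta> * Ms \<sigma> (l n) \<zeta> \<le> C0 * V * B1" for n
    using C0(1) WV[of n] V0 Mn[of n] B1(2)[OF lX(2)[of n]] by (intro mult_mono) auto
  have b2: "C0 * bw2 (l n) \<zeta> * Ms \<sigma> (l n) \<zeta> * Ms (-\<sigma>-2) (l n) \<zeta> \<le> C0 * V * B1 * B2" for n
    using WV[of n] B1(2)[OF lX(2)[of n]] C0(1) V0 Mn[of n] B2(2)[OF lX(2)[of n]] B1(1) by (intro mult_mono) auto
  have bp: "cmod (p n) \<le> C0 * V * B1" for n using est_bounds(1)[OF est z, of n] b1[of n] by linarith
  have bu: "nrm \<nu> (\<sigma>+2) \<zeta> (u n) \<le> BB" for n using est_bounds(2)[OF est z, of n] b2[of n] unfolding BB_def by linarith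
  have bv: "nrm \<nu> (\<sigma>+2) \<zeta> (v n) \<le> BB" for n using est_bounds(3)[OF est z, of n] b2[of n] unfolding BB_def by linarith
  have bt: "nrm \<nu> (\<sigma>+2) \<zeta> (t n) \<le> C0 * 1" for n by (rule est_bounds(4)[OF est z H(3)])
  obtain r1 U where r1: "strict_mono (r1 :: nat \<Rightarrow> nat)" "U \<in> Hs \<nu> (\<sigma>+2) \<zeta>" "(\<lambda>n. nrm \<nu> (\<sigma>+1) \<zeta> (\<lambda>k. u (r1 n) k - U k)) \<longlonglongrightarrow> 0"
    using Rellich[of u, OF H(1) bu] by blast
  obtain r2 V' where r2: "strict_mono (r2 :: nat \<Rightarrow> nat)" "V' \<in> Hs \<nu> (\<sigma>+2) \<zeta>" "(\<lambda>n. nrm \<nu> (\<sigma>+1) \<zeta> (\<lambda>k. v (r1 (r2 n)) k - V' k)) \<longlonglongrightarrow> 0"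
    using Rellich[of "\<lambda>n. v (r1 n)", OF H(2) bv] by blast
  obtain r3 T where r3: "strict_mono (r3 :: nat \<Rightarrow> nat)" "T \<in> Hs \<nu> (\<sigma>+2) \<zeta>" "(\<lambda>n. nrm \<nu> (\<sigma>+1) \<zeta> (\<lambda>k. t (r1 (r2 (r3 n))) k - T k)) \<longlonglongrightarrow> 0"
    using Rellich[of "\<lambda>n. t (r1 (r2 n))", OF H(3) bt] by blast
  \<comment> \<open>The scalars left over, parameters and pressures, stay in a compact set; this is
    where closedness of the spectral set enters.\<close>
  have "compact ((Sset \<delta>1 \<delta>2 \<inter> cball 0 \<Lambda>) \<times> cball (0::complex) (C0 * V * B1))"
    by (intro compact_Times closed_Int_compact Sset_closed compact_cball)
  moreover have "\<forall>n. (l (r1 (r2 (r3 n))), p (r1 (r2 (r3 n)))) \<in> (Sset \<delta>1 \<delta>2 \<inter> cball 0 \<Lambda>) \<times> cball 0 (C0 * V * B1)"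
    using lX(1,2) bp by simp
  ultimately obtain lp r4 where r4: "lp \<in> (Sset \<delta>1 \<delta>2 \<inter> cball 0 \<Lambda>) \<times> cball (0::complex) (C0 * V * B1)" "strict_mono (r4 :: nat \<Rightarrow> nat)"
     "((\<lambda>n. (l (r1 (r2 (r3 n))), p (r1 (r2 (r3 n))))) \<circ> r4) \<longlonglongrightarrow> lp"
    by (rule compact_imp_seq_compact[THEN seq_compactE])
  obtain lam P where lp: "lp = (lam, P)" by (cases lp)
  have gll: "good lam \<zeta>" using r4(1) z by (simp add: lp good_def)
  define R where "R n = r1 (r2 (r3 (r4 n)))" for n
  have sm: "strict_mono R" using r1(1) r2(1) r3(1) r4(2) by (simp add: R_def strict_mono_def)
  have lR: "(\<lambda>n. l (R n)) \<longlonglongrightarrow> lam" using tendsto_fst[OF r4(3)] by (simp add: o_def lp R_def)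
  have pR: "(\<lambda>n. p (R n)) \<longlonglongrightarrow> P" using tendsto_snd[OF r4(3)] by (simp add: o_def lp R_def)
  have uR: "(\<lambda>n. nrm \<nu> (\<sigma>+1) \<zeta> (\<lambda>k. u (R n) k - U k)) \<longlonglongrightarrow> 0"
    using LIMSEQ_subseq_LIMSEQ[OF r1(3), of "\<lambda>n. r2 (r3 (r4 n))"] r2(1) r3(1) r4(2) by (simp add: o_def R_def strict_mono_def)
  have vR: "(\<lambda>n. nrm \<nu> (\<sigma>+1) \<zeta> (\<lambda>k. v (R n) k - V' k)) \<longlonglongrightarrow> 0"
    using LIMSEQ_subseq_LIMSEQ[OF r2(3), of "\<lambda>n. r3 (r4 n)"] r3(1) r4(2) by (simp add: o_def R_def strict_mono_def)
  have tR: "(\<lambda>n. nrm \<nu> (\<sigma>+1) \<zeta> (\<lambda>k. t (R n) k - T k)) \<longlonglongrightarrow> 0"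
    using LIMSEQ_subseq_LIMSEQ[OF r3(3), of r4] r4(2) by (simp add: o_def R_def)
  have H1: "f \<in> Hs \<nu> (\<sigma>+1) \<zeta>" if "f \<in> Hs \<nu> (\<sigma>+2) \<zeta>" for f using Hs_mono[OF nu _ that, of "\<sigma>+1"] by simp
  note dH = Hs_diff[OF H1[OF H(1)] H1[OF r1(2)], THEN conjunct1] Hs_diff[OF H1[OF H(2)] H1[OF r2(2)], THEN conjunct1]
     Hs_diff[OF H1[OF H(3)] H1[OF r3(2)], THEN conjunct1]
  have coo: "(\<lambda>n. f n k) \<longlonglongrightarrow> g k" if "(\<lambda>n. nrm \<nu> (\<sigma>+1) \<zeta> (\<lambda>k. f n k - g k)) \<longlonglongrightarrow> 0" "\<And>n. (\<lambda>k. f n k - g k) \<in> Hs \<nu> (\<sigma>+1) \<zeta>" for f g k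
    using Hs_coord_tendsto_0[OF nu that(2) that(1), of k] by (rule LIM_zero_cancel)
  have uk: "(\<lambda>n. u (R n) k) \<longlonglongrightarrow> U k" for k by (rule coo[OF uR dH(1)])
  have vk: "(\<lambda>n. v (R n) k) \<longlonglongrightarrow> V' k" for k by (rule coo[OF vR dH(2)])
  have tk: "(\<lambda>n. t (R n) k) \<longlonglongrightarrow> T k" for k by (rule coo[OF tR dH(3)])
  let ?x = "of_int (fst \<zeta>) :: complex" and ?y = "of_int (snd \<zeta>) :: complex"
  \<comment> \<open>-(\<sigma>+1) < 1/2 is the lower bound on \<sigma>. It makes the constraint
    continuous on H^(\<sigma>+1), the only topology in which the subsequence converges.\<close>
  have o: "one_c a \<in> Hs \<nu> (-(\<sigma>+1)) \<zeta>" using sg by (intro one_c_Hs[OF a nu]) auto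
  have constr: "(\<Sum>k. (?x * U k + ?y * V' k) * one_c a k) = 0"
  proof -
    define e where "e n = cmod ?x * nrm \<nu> (\<sigma>+1) \<zeta> (\<lambda>k. u (R n) k - U k) + cmod ?y * nrm \<nu> (\<sigma>+1) \<zeta> (\<lambda>k. v (R n) k - V' k)" for n
    have e0: "e \<longlonglongrightarrow> 0" unfolding e_def using tendsto_add[OF tendsto_mult_right_zero[OF uR] tendsto_mult_right_zero[OF vR]] by simp
    have bd: "cmod (\<Sum>k. (?x * U k + ?y * V' k) * one_c a k) \<le> e n * nrm \<nu> (-(\<sigma>+1)) \<zeta> (one_c a)" for n
    proof -
      let ?f = "\<lambda>k. ?x * (u (R n) k - U k) + ?y * (v (R n) k - V' k)"
      have f: "?f \<in> Hs \<nu> (\<sigma>+1) \<zeta> \<and> nrm \<nu> (\<sigma>+1) \<zeta> ?f \<le> e n" unfolding e_def by (rule Hs_lin2[OF dH(1) dH(2)])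
      have s1: "(\<lambda>k. (?x * u (R n) k + ?y * v (R n) k) * one_c a k) sums 0"
        using Hs_pairing[OF nu Hs_lin2[OF H1[OF H(1)] H1[OF H(2)], THEN conjunct1] o] YD[of "R n"] unfolding Yn Dom_iff sums_iff by blast
      have s2: "(\<lambda>k. (?x * U k + ?y * V' k) * one_c a k) sums (\<Sum>k. (?x * U k + ?y * V' k) * one_c a k)"
        using Hs_pairing[OF nu Hs_lin2[OF H1[OF r1(2)] H1[OF r2(2)], THEN conjunct1] o] by (blast intro: summable_sums)
      have "(\<lambda>k. ?f k * one_c a k) sums (0 - (\<Sum>k. (?x * U k + ?y * V' k) * one_c a k))"
        using sums_diff[OF s1 s2] by (simp add: algebra_simps)
      hence "cmod (\<Sum>k. (?x * U k + ?y * V' k) * one_c a k) = cmod (\<Sum>k. ?f k * one_c a k)" by (simp add: sums_iff)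
      also have "\<dots> \<le> nrm \<nu> (\<sigma>+1) \<zeta> ?f * nrm \<nu> (-(\<sigma>+1)) \<zeta> (one_c a)"
        using Hs_pairing[OF nu f[THEN conjunct1] o] by blast
      also have "\<dots> \<le> e n * nrm \<nu> (-(\<sigma>+1)) \<zeta> (one_c a)" using f nrm_nonneg[OF o] by (intro mult_right_mono) auto
      finally show ?thesis .
    qed
    have "(\<lambda>n. e n * nrm \<nu> (-(\<sigma>+1)) \<zeta> (one_c a)) \<longlonglongrightarrow> 0" by (rule tendsto_mult_left_zero[OF e0])
    from LIMSEQ_le_const[OF this] bd have "cmod (\<Sum>k. (?x * U k + ?y * V' k) * one_c a k) \<le> 0" by blast
    thus ?thesis by simp
  qed
  define Xl where "Xl = (U, V', P, T)"
  have XlD: "Xl \<in> Dom a \<nu> (\<sigma>+2) \<zeta>" unfolding Xl_def Dom_iff using r1(2) r2(2) r3(2) constr by simp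
  obtain CR where CR: "CR \<ge> 0" "\<And>\<zeta> X. Hs1 \<zeta> X \<Longrightarrow> N3 \<nu> \<sigma> \<zeta> (Rop a \<alpha> \<beta> \<gamma> \<zeta> X) \<le> CR * N1 \<zeta> X" using Rop_bound by blast
  have dD: "linD 1 (Y (R n)) (-1) Xl \<in> Dom a \<nu> (\<sigma>+2) \<zeta>" for n by (rule Dom_linD[OF YD XlD])
  have N10: "(\<lambda>n. N1 \<zeta> (linD 1 (Y (R n)) (-1) Xl)) \<longlonglongrightarrow> 0"
    using tendsto_add[OF tendsto_add[OF uR vR] tR] by (simp add: N1_def linD_def Yn Xl_def)
  have Rd: "(\<lambda>n. N3 \<nu> \<sigma> \<zeta> (Rop a \<alpha> \<beta> \<gamma> \<zeta> (linD 1 (Y (R n)) (-1) Xl))) \<longlonglongrightarrow> 0"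
    by (rule tendsto_sandwich[OF _ _ tendsto_const tendsto_mult_right_zero[OF N10, of CR]])
      (use CR(2)[OF Dom_Hs1[OF dD]] N3_nonneg[OF Rop_Tgt[OF dD]] in auto)
  \<comment> \<open>q ranges over the three component maps, so the three equations are treated at
    once.\<close>
  have cN: "(\<lambda>n. q (F n) k) \<longlonglongrightarrow> 0" if "\<And>n. F n \<in> Tgt \<nu> \<sigma> \<zeta>" "(\<lambda>n. N3 \<nu> \<sigma> \<zeta> (F n)) \<longlonglongrightarrow> 0" "q \<in> {fst, \<lambda>F. fst (snd F), \<lambda>F. snd (snd F)}"
    for F :: "nat \<Rightarrow> coef \<times> coef \<times> coef" and q k
  proof -
    have q1: "q (F n) \<in> Hs \<nu> \<sigma> \<zeta>" for n using that(1)[of n] that(3) by (auto simp: Tgt_iff)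
    have T3: "fst (F n) \<in> Hs \<nu> \<sigma> \<zeta>" "fst (snd (F n)) \<in> Hs \<nu> \<sigma> \<zeta>" "snd (snd (F n)) \<in> Hs \<nu> \<sigma> \<zeta>" for n using that(1)[of n] by (auto simp: Tgt_iff)
    have "nrm \<nu> \<sigma> \<zeta> (q (F n)) \<le> N3 \<nu> \<sigma> \<zeta> (F n)" for n
      using that(3) nrm_nonneg[OF T3(1)[of n]] nrm_nonneg[OF T3(2)[of n]] nrm_nonneg[OF T3(3)[of n]] by (auto simp: N3_def)
    hence "(\<lambda>n. nrm \<nu> \<sigma> \<zeta> (q (F n))) \<longlonglongrightarrow> 0"
      by (intro tendsto_sandwich[OF _ _ tendsto_const that(2)]) (use nrm_nonneg[OF q1] in auto)
    from Hs_coord_tendsto_0[OF nu q1 this] show ?thesis .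
  qed
  have symbR: "(\<lambda>n. symb a \<nu> (l (R n)) \<zeta> k) \<longlonglongrightarrow> symb a \<nu> lam \<zeta> k" for k unfolding symb_def by (intro tendsto_intros lR)
  have LR0: "(\<lambda>n. N3 \<nu> \<sigma> \<zeta> (Lop a \<nu> \<alpha> \<beta> \<gamma> (l (R n)) \<zeta> (Y (R n)))) \<longlonglongrightarrow> 0"
    using LIMSEQ_subseq_LIMSEQ[OF LY0 sm] by (simp add: o_def)
  \<comment> \<open>The limit equation is identified coordinate by coordinate: L0 acts diagonally
    apart from the pressure, with convergent coefficients, while R converges in norm and L itself
    tends to 0.\<close>
  have zero: "q (Lop a \<nu> \<alpha> \<beta> \<gamma> lam \<zeta> Xl) k = 0" if q: "q \<in> {fst, \<lambda>F. fst (snd F), \<lambda>F. snd (snd F)}" for q k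
  proof -
    have qL: "q (lin3 c F d G) k = c * q F k + d * q G k" for c F d G using q by (auto simp: lin3_def)
    have 1: "(\<lambda>n. q (L0 a \<nu> (l (R n)) \<zeta> (Y (R n))) k) \<longlonglongrightarrow> q (L0 a \<nu> lam \<zeta> Xl) k"
      using q unfolding Yn Xl_def L0_def by (auto intro!: tendsto_intros symbR uk vk tk pR)
    have 2: "(\<lambda>n. q (Rop a \<alpha> \<beta> \<gamma> \<zeta> (Y (R n))) k) \<longlonglongrightarrow> q (Rop a \<alpha> \<beta> \<gamma> \<zeta> Xl) k"
    proof (rule LIM_zero_cancel)
      have "(\<lambda>n. q (Rop a \<alpha> \<beta> \<gamma> \<zeta> (linD 1 (Y (R n)) (-1) Xl)) k) \<longlonglongrightarrow> 0" by (rule cN[OF Rop_Tgt[OF dD] Rd q])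
      thus "(\<lambda>n. q (Rop a \<alpha> \<beta> \<gamma> \<zeta> (Y (R n))) k - q (Rop a \<alpha> \<beta> \<gamma> \<zeta> Xl) k) \<longlonglongrightarrow> 0"
        unfolding Rop_linD[OF Dom_Hs1[OF YD] Dom_Hs1[OF XlD]] qL by simp
    qed
    have "(\<lambda>n. q (Lop a \<nu> \<alpha> \<beta> \<gamma> (l (R n)) \<zeta> (Y (R n))) k) \<longlonglongrightarrow> q (Lop a \<nu> \<alpha> \<beta> \<gamma> lam \<zeta> Xl) k"
      unfolding Lop_alt[OF YD] Lop_alt[OF XlD] qL by (intro tendsto_intros 1 2)
    moreover have "(\<lambda>n. q (Lop a \<nu> \<alpha> \<beta> \<gamma> (l (R n)) \<zeta> (Y (R n))) k) \<longlonglongrightarrow> 0" by (rule cN[OF Lop_Tgt[OF gl YD] LR0 q])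
    ultimately show ?thesis by (rule LIMSEQ_unique)
  qed
  have "Lop a \<nu> \<alpha> \<beta> \<gamma> lam \<zeta> Xl = (\<lambda>k. 0, \<lambda>k. 0, \<lambda>k. 0)"
    using zero[of fst] zero[of "\<lambda>F. fst (snd F)"] zero[of "\<lambda>F. snd (snd F)"] by (auto intro!: prod_eqI)
  from inj[OF gll XlD this] have X0: "Xl = (\<lambda>k. 0, \<lambda>k. 0, 0, \<lambda>k. 0)" .
  have "linD 1 (Y (R n)) (-1) Xl = Y (R n)" for n unfolding X0 linD_def Yn by simp
  with Rd have RY: "(\<lambda>n. N3 \<nu> \<sigma> \<zeta> (Rop a \<alpha> \<beta> \<gamma> \<zeta> (Y (R n)))) \<longlonglongrightarrow> 0" by simp
  have "(\<lambda>n. N3 \<nu> \<sigma> \<zeta> (Lop a \<nu> \<alpha> \<beta> \<gamma> (l (R n)) \<zeta> (Y (R n))) + N3 \<nu> \<sigma> \<zeta> (Rop a \<alpha> \<beta> \<gamma> \<zeta> (Y (R n)))) \<longlonglongrightarrow> 0 + 0"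
    by (intro tendsto_add LR0 RY)
  moreover have "1 \<le> N3 \<nu> \<sigma> \<zeta> (Lop a \<nu> \<alpha> \<beta> \<gamma> (l (R n)) \<zeta> (Y (R n))) + N3 \<nu> \<sigma> \<zeta> (Rop a \<alpha> \<beta> \<gamma> \<zeta> (Y (R n)))" for n
    using L0_le[OF gl[of "R n"] YD[of "R n"]] LY1[of "R n"] by simp
  ultimately have "(1::real) \<le> 0 + 0" by (intro LIMSEQ_le_const) auto
  thus False by simp
qed

end

lemma nrmD_ge:
  assumes "(u, v, p, t) = X" "u \<in> Hs \<nu> s \<zeta>" "v \<in> Hs \<nu> s \<zeta>" "t \<in> Hs \<nu> s \<zeta>"
  shows "nrm \<nu> s \<zeta> u + nrm \<nu> s \<zeta> v + cmod p + nrm \<nu> s \<zeta> t \<le> 4 * nrmD \<nu> s \<zeta> X"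
proof -
  have "nrm \<nu> s \<zeta> u \<le> nrmD \<nu> s \<zeta> X" "nrm \<nu> s \<zeta> v \<le> nrmD \<nu> s \<zeta> X" "cmod p \<le> nrmD \<nu> s \<zeta> X" "nrm \<nu> s \<zeta> t \<le> nrmD \<nu> s \<zeta> X"
    using assms(1)[symmetric] by (auto simp: nrmD_def intro!: real_le_rsqrt)
  thus ?thesis by linarith
qed

text \<open>Injectivity is isolated as an assumption because it comes from another world, the
  variational eigenvalue problem. Its proof moreover uses the locale \<open>prim_eq\<close> at the
  exponent \<sigma>+1, where injectivity is not assumed.\<close>

locale prim_eq_inj = prim_eq +
  assumes inj: "\<And>lam \<zeta> X. good lam \<zeta> \<Longrightarrow> X \<in> Dom a \<nu> (\<sigma>+2) \<zeta> \<Longrightarrow>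
      Lop a \<nu> \<alpha> \<beta> \<gamma> lam \<zeta> X = (\<lambda>k. 0, \<lambda>k. 0, \<lambda>k. 0) \<Longrightarrow> X = (\<lambda>k. 0, \<lambda>k. 0, 0, \<lambda>k. 0)"
begin

text \<open>For large \<langle>\<omega>\<rangle> the term R is absorbed into L0 with constant 2.
  Otherwise |\<lambda>| is bounded and \<zeta> runs through a finite set, so finitely many constants
  of the compactness argument suffice.\<close>

lemma apriori:
  "\<exists>C\<ge>1. \<forall>lam \<zeta> X. good lam \<zeta> \<longrightarrow> X \<in> Dom a \<nu> (\<sigma>+2) \<zeta> \<longrightarrow>
     N3 \<nu> \<sigma> \<zeta> (L0 a \<nu> lam \<zeta> X) \<le> C * N3 \<nu> \<sigma> \<zeta> (Lop a \<nu> \<alpha> \<beta> \<gamma> lam \<zeta> X)"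
proof -
  obtain W0 where W0: "\<And>lam \<zeta> X. good lam \<zeta> \<Longrightarrow> bw2 lam \<zeta> \<ge> W0 \<Longrightarrow> X \<in> Dom a \<nu> (\<sigma>+2) \<zeta> \<Longrightarrow>
     N3 \<nu> \<sigma> \<zeta> (Rop a \<alpha> \<beta> \<gamma> \<zeta> X) \<le> 1/2 * N3 \<nu> \<sigma> \<zeta> (L0 a \<nu> lam \<zeta> X)"
    using R_half by blast
  \<comment> \<open>The box contains every nonzero \<zeta> with 1+|\<zeta>| \<le> W0, and only these
    are left when \<open>bw2\<close> is below W0.\<close>
  define Fin where "Fin = {-\<lceil>W0\<rceil>..\<lceil>W0\<rceil>} \<times> {-\<lceil>W0\<rceil>..\<lceil>W0\<rceil>} - {(0,0)}"
  have fin: "finite Fin" by (simp add: Fin_def)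
  have "\<forall>\<zeta>\<in>Fin. \<exists>C\<ge>0. \<forall>lam X. lam \<in> Sset \<delta>1 \<delta>2 \<longrightarrow> cmod lam \<le> W0 \<longrightarrow> X \<in> Dom a \<nu> (\<sigma>+2) \<zeta> \<longrightarrow>
     N3 \<nu> \<sigma> \<zeta> (L0 a \<nu> lam \<zeta> X) \<le> C * N3 \<nu> \<sigma> \<zeta> (Lop a \<nu> \<alpha> \<beta> \<gamma> lam \<zeta> X)"
  proof
    fix \<zeta> assume "\<zeta> \<in> Fin"
    hence "\<zeta> \<noteq> (0,0)" by (simp add: Fin_def)
    thus "\<exists>C\<ge>0. \<forall>lam X. lam \<in> Sset \<delta>1 \<delta>2 \<longrightarrow> cmod lam \<le> W0 \<longrightarrow> X \<in> Dom a \<nu> (\<sigma>+2) \<zeta> \<longrightarrow>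
     N3 \<nu> \<sigma> \<zeta> (L0 a \<nu> lam \<zeta> X) \<le> C * N3 \<nu> \<sigma> \<zeta> (Lop a \<nu> \<alpha> \<beta> \<gamma> lam \<zeta> X)"
      by (intro apriori_compact inj)
  qed
  from bchoice[OF this] obtain c where c: "\<And>\<zeta>. \<zeta> \<in> Fin \<Longrightarrow> c \<zeta> \<ge> 0"
     "\<And>\<zeta> lam X. \<zeta> \<in> Fin \<Longrightarrow> lam \<in> Sset \<delta>1 \<delta>2 \<Longrightarrow> cmod lam \<le> W0 \<Longrightarrow> X \<in> Dom a \<nu> (\<sigma>+2) \<zeta> \<Longrightarrow>
     N3 \<nu> \<sigma> \<zeta> (L0 a \<nu> lam \<zeta> X) \<le> c \<zeta> * N3 \<nu> \<sigma> \<zeta> (Lop a \<nu> \<alpha> \<beta> \<gamma> lam \<zeta> X)"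
    by metis
  \<comment> \<open>The 2 covers large \<langle>\<omega>\<rangle>; the sum of the nonnegative
    constants dominates each of them.\<close>
  define C where "C = 2 + (\<Sum>\<zeta>\<in>Fin. c \<zeta>)"
  have C2: "C \<ge> 2" using sum_nonneg[of Fin c] c(1) by (simp add: C_def)
  show ?thesis
  proof (intro exI[of _ C] conjI allI impI)
    show "1 \<le> C" using C2 by simp
    fix lam \<zeta> X assume g: "good lam \<zeta>" and X: "X \<in> Dom a \<nu> (\<sigma>+2) \<zeta>"
    have n0: "N3 \<nu> \<sigma> \<zeta> (Lop a \<nu> \<alpha> \<beta> \<gamma> lam \<zeta> X) \<ge> 0" by (rule N3_nonneg[OF Lop_Tgt[OF g X]])
    show "N3 \<nu> \<sigma> \<zeta> (L0 a \<nu> lam \<zeta> X) \<le> C * N3 \<nu> \<sigma> \<zeta> (Lop a \<nu> \<alpha> \<beta> \<gamma> lam \<zeta> X)"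
    proof (cases "bw2 lam \<zeta> \<ge> W0")
      case True
      have "N3 \<nu> \<sigma> \<zeta> (L0 a \<nu> lam \<zeta> X) \<le> 2 * N3 \<nu> \<sigma> \<zeta> (Lop a \<nu> \<alpha> \<beta> \<gamma> lam \<zeta> X)"
        using L0_le[OF g X] W0[OF g True X] by linarith
      also have "\<dots> \<le> C * N3 \<nu> \<sigma> \<zeta> (Lop a \<nu> \<alpha> \<beta> \<gamma> lam \<zeta> X)" by (rule mult_right_mono[OF C2 n0])
      finally show ?thesis .
    next
      case False
      have b: "bz \<zeta> \<le> (bz \<zeta>)\<^sup>2" using mult_left_mono[OF bz_ge1[of \<zeta>], of "bz \<zeta>"] bz_ge1[of \<zeta>] by (simp add: power2_eq_square)
      have lz: "cmod lam \<le> W0" "bz \<zeta> \<le> W0" using False b bz_ge1[of \<zeta>] norm_ge_zero[of lam] unfolding bw2_def by linarith+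
      have "cmod (of_int (fst \<zeta>)) \<le> W0" "cmod (of_int (snd \<zeta>)) \<le> W0" using fst_le_zabs[of \<zeta>] zabs_le_bz[of \<zeta>] lz by linarith+
      hence "\<bar>real_of_int (fst \<zeta>)\<bar> \<le> W0" "\<bar>real_of_int (snd \<zeta>)\<bar> \<le> W0" by simp_all
      hence "\<bar>fst \<zeta>\<bar> \<le> \<lceil>W0\<rceil>" "\<bar>snd \<zeta>\<bar> \<le> \<lceil>W0\<rceil>" by linarith+
      hence zF: "\<zeta> \<in> Fin" using g by (cases \<zeta>) (auto simp: Fin_def good_def)
      have "c \<zeta> \<le> C" using member_le_sum[OF zF, of c] c(1) fin unfolding C_def by auto
      hence "c \<zeta> * N3 \<nu> \<sigma> \<zeta> (Lop a \<nu> \<alpha> \<beta> \<gamma> lam \<zeta> X) \<le> C * N3 \<nu> \<sigma> \<zeta> (Lop a \<nu> \<alpha> \<beta> \<gamma> lam \<zeta> X)"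
        using n0 by (rule mult_right_mono)
      with c(2)[OF zF _ lz(1) X] g show ?thesis by (auto simp: good_def)
    qed
  qed
qed

section \<open>Surjectivity by continuation in \<lambda>\<close>

definition onto :: "complex \<Rightarrow> int \<times> int \<Rightarrow> bool" where
  "onto lam \<zeta> \<longleftrightarrow> (\<forall>F\<in>Tgt \<nu> \<sigma> \<zeta>. \<exists>X\<in>Dom a \<nu> (\<sigma>+2) \<zeta>. Lop a \<nu> \<alpha> \<beta> \<gamma> lam \<zeta> X = F)"

text \<open>With S a right inverse of L0, the equation L X = F becomes the fixed point problem G = F
  + R S G for G = L0 X. S comes from the axiom of choice and need not be linear: by linearity of L0
  and R, the halving bound applied to S G - S H itself gives the contraction.\<close>

lemma onto_large: "\<exists>W0. \<forall>lam \<zeta>. good lam \<zeta> \<longrightarrow> bw2 lam \<zeta> \<ge> W0 \<longrightarrow> onto lam \<zeta>"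
proof -
  obtain W0 where W0: "\<And>lam \<zeta> X. good lam \<zeta> \<Longrightarrow> bw2 lam \<zeta> \<ge> W0 \<Longrightarrow> X \<in> Dom a \<nu> (\<sigma>+2) \<zeta> \<Longrightarrow>
     N3 \<nu> \<sigma> \<zeta> (Rop a \<alpha> \<beta> \<gamma> \<zeta> X) \<le> 1/2 * N3 \<nu> \<sigma> \<zeta> (L0 a \<nu> lam \<zeta> X)"
    using R_half by blast
  show ?thesis
  proof (intro exI[of _ W0] allI impI)
    fix lam \<zeta> assume g: "good lam \<zeta>" and W: "W0 \<le> bw2 lam \<zeta>"
    have "\<forall>G\<in>Tgt \<nu> \<sigma> \<zeta>. \<exists>X. X \<in> Dom a \<nu> (\<sigma>+2) \<zeta> \<and> L0 a \<nu> lam \<zeta> X = G" using L0_onto[OF g] by blast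
    from bchoice[OF this] obtain S where S: "\<And>G. G \<in> Tgt \<nu> \<sigma> \<zeta> \<Longrightarrow> S G \<in> Dom a \<nu> (\<sigma>+2) \<zeta>" "\<And>G. G \<in> Tgt \<nu> \<sigma> \<zeta> \<Longrightarrow> L0 a \<nu> lam \<zeta> (S G) = G"
      by blast
    show "onto lam \<zeta>" unfolding onto_def
    proof
      fix F assume F: "F \<in> Tgt \<nu> \<sigma> \<zeta>"
      have "\<exists>G\<in>Tgt \<nu> \<sigma> \<zeta>. lin3 1 F 1 (Rop a \<alpha> \<beta> \<gamma> \<zeta> (S G)) = G"
      proof (rule Tgt_fixpoint[OF nu])
        fix G assume G: "G \<in> Tgt \<nu> \<sigma> \<zeta>"
        show "lin3 1 F 1 (Rop a \<alpha> \<beta> \<gamma> \<zeta> (S G)) \<in> Tgt \<nu> \<sigma> \<zeta>" using Tgt_lin3[OF F Rop_Tgt[OF S(1)[OF G]]] by blast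
      next
        fix G H assume G: "G \<in> Tgt \<nu> \<sigma> \<zeta>" and H: "H \<in> Tgt \<nu> \<sigma> \<zeta>"
        note D = Dom_linD[OF S(1)[OF G] S(1)[OF H], of 1 "-1"]
        have "sub3 (lin3 1 F 1 (Rop a \<alpha> \<beta> \<gamma> \<zeta> (S G))) (lin3 1 F 1 (Rop a \<alpha> \<beta> \<gamma> \<zeta> (S H))) = Rop a \<alpha> \<beta> \<gamma> \<zeta> (linD 1 (S G) (-1) (S H))"
          unfolding Rop_linD[OF Dom_Hs1[OF S(1)[OF G]] Dom_Hs1[OF S(1)[OF H]]] by (simp add: sub3_lin3 lin3_def)
        moreover have "L0 a \<nu> lam \<zeta> (linD 1 (S G) (-1) (S H)) = sub3 G H" unfolding L0_linD S(2)[OF G] S(2)[OF H] by (simp add: sub3_lin3)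
        ultimately show "N3 \<nu> \<sigma> \<zeta> (sub3 (lin3 1 F 1 (Rop a \<alpha> \<beta> \<gamma> \<zeta> (S G))) (lin3 1 F 1 (Rop a \<alpha> \<beta> \<gamma> \<zeta> (S H)))) \<le> 1/2 * N3 \<nu> \<sigma> \<zeta> (sub3 G H)"
          using W0[OF g W D] by simp
      qed
      then obtain G where G: "G \<in> Tgt \<nu> \<sigma> \<zeta>" "lin3 1 F 1 (Rop a \<alpha> \<beta> \<gamma> \<zeta> (S G)) = G" by blast
      have "Lop a \<nu> \<alpha> \<beta> \<gamma> lam \<zeta> (S G) = lin3 1 (lin3 1 F 1 (Rop a \<alpha> \<beta> \<gamma> \<zeta> (S G))) (-1) (Rop a \<alpha> \<beta> \<gamma> \<zeta> (S G))"
        unfolding Lop_alt[OF S(1)[OF G(1)]] S(2)[OF G(1)] G(2) ..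
      also have "\<dots> = F" by (simp add: lin3_def)
      finally show "\<exists>X\<in>Dom a \<nu> (\<sigma>+2) \<zeta>. Lop a \<nu> \<alpha> \<beta> \<gamma> lam \<zeta> X = F" using S(1)[OF G(1)] by blast
    qed
  qed
qed

text \<open>\<lambda> multiplies u, v and \<theta> but not p0, so a shift of \<lambda> acts through
  this projection.\<close>

definition uvt :: "coef \<times> coef \<times> complex \<times> coef \<Rightarrow> coef \<times> coef \<times> coef" where
  "uvt X = (fst X, fst (snd X), snd (snd (snd X)))"

lemma uvt_Tgt:
  assumes X: "X \<in> Dom a \<nu> (\<sigma>+2) \<zeta>"
  shows "uvt X \<in> Tgt \<nu> \<sigma> \<zeta> \<and> N3 \<nu> \<sigma> \<zeta> (uvt X) \<le> N1 \<zeta> X"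
proof -
  have H: "fst X \<in> Hs \<nu> (\<sigma>+1) \<zeta>" "fst (snd X) \<in> Hs \<nu> (\<sigma>+1) \<zeta>" "snd (snd (snd X)) \<in> Hs \<nu> (\<sigma>+1) \<zeta>"
    using Dom_Hs1[OF X] by auto
  have s: "\<sigma> \<le> \<sigma> + 1" by simp
  show ?thesis using Hs_mono[OF nu s H(1)] Hs_mono[OF nu s H(2)] Hs_mono[OF nu s H(3)] by (simp add: uvt_def Tgt_iff N3_def N1_def)
qed

lemma Lop_shift:
  assumes X: "X \<in> Dom a \<nu> (\<sigma>+2) \<zeta>"
  shows "Lop a \<nu> \<alpha> \<beta> \<gamma> (lam + of_real h) \<zeta> X = lin3 1 (Lop a \<nu> \<alpha> \<beta> \<gamma> lam \<zeta> X) (of_real h) (uvt X)"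
proof -
  obtain u v p t where XX: "X = (u, v, p, t)" by (cases X)
  show ?thesis unfolding Lop_alt[OF X] by (simp add: XX L0_def symb_def lin3_def uvt_def fun_eq_iff algebra_simps)
qed

text \<open>The equation at \<lambda> is rewritten at \<lambda>+h with right-hand side F +
  h(u,v,\<theta>), a fixed point problem for (u,v,\<theta>) alone. The length h depends only on the
  a priori constants and not on \<lambda> or \<zeta>, so any real shift is covered in finitely many
  steps.\<close>

lemma onto_step: "\<exists>h>0. \<forall>lam \<zeta>. good lam \<zeta> \<longrightarrow> onto (lam + of_real h) \<zeta> \<longrightarrow> onto lam \<zeta>"
proof -
  obtain C where C: "C \<ge> 1" "\<And>lam \<zeta> X. good lam \<zeta> \<Longrightarrow> X \<in> Dom a \<nu> (\<sigma>+2) \<zeta> \<Longrightarrow>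
     N3 \<nu> \<sigma> \<zeta> (L0 a \<nu> lam \<zeta> X) \<le> C * N3 \<nu> \<sigma> \<zeta> (Lop a \<nu> \<alpha> \<beta> \<gamma> lam \<zeta> X)" using apriori by blast
  obtain \<kappa> where k: "\<kappa> \<ge> 1" "\<And>lam \<zeta> X. good lam \<zeta> \<Longrightarrow> X \<in> Dom a \<nu> (\<sigma>+2) \<zeta> \<Longrightarrow> N1 \<zeta> X \<le> \<kappa> * N3 \<nu> \<sigma> \<zeta> (L0 a \<nu> lam \<zeta> X)"
    using R_small by blast
  \<comment> \<open>Chosen so that the contraction factor \<kappa> C h equals 1/2.\<close>
  define h where "h = 1 / (2 * (\<kappa> * C))"
  have kC: "\<kappa> * C > 0" using C(1) k(1) by simp
  have h0: "h > 0" "\<kappa> * C * h = 1/2" using kC C(1) k(1) by (simp_all add: h_def)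
  show ?thesis
  proof (intro exI[of _ h] conjI h0(1) allI impI)
    fix lam \<zeta> assume g: "good lam \<zeta>" and o: "onto (lam + of_real h) \<zeta>"
    define lam' where "lam' = lam + of_real h"
    have g': "good lam' \<zeta>" using g Sset_shift[of lam h] h0(1) by (simp add: good_def lam'_def)
    have lam: "lam = lam' + of_real (- h)" by (simp add: lam'_def)
    have "\<forall>G\<in>Tgt \<nu> \<sigma> \<zeta>. \<exists>X. X \<in> Dom a \<nu> (\<sigma>+2) \<zeta> \<and> Lop a \<nu> \<alpha> \<beta> \<gamma> lam' \<zeta> X = G" using o unfolding onto_def lam'_def by blast
    from bchoice[OF this] obtain S where S: "\<And>G. G \<in> Tgt \<nu> \<sigma> \<zeta> \<Longrightarrow> S G \<in> Dom a \<nu> (\<sigma>+2) \<zeta>" "\<And>G. G \<in> Tgt \<nu> \<sigma> \<zeta> \<Longrightarrow> Lop a \<nu> \<alpha> \<beta> \<gamma> lam' \<zeta> (S G) = G"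
      by blast
    have SL: "N3 \<nu> \<sigma> \<zeta> (sub3 (uvt (S G)) (uvt (S H))) \<le> \<kappa> * C * N3 \<nu> \<sigma> \<zeta> (sub3 G H)" if G: "G \<in> Tgt \<nu> \<sigma> \<zeta>" and H: "H \<in> Tgt \<nu> \<sigma> \<zeta>" for G H
    proof -
      note D = Dom_linD[OF S(1)[OF G] S(1)[OF H], of 1 "-1"]
      have "sub3 (uvt (S G)) (uvt (S H)) = uvt (linD 1 (S G) (-1) (S H))"
        by (cases "S G"; cases "S H") (simp add: sub3_def uvt_def linD_def)
      hence "N3 \<nu> \<sigma> \<zeta> (sub3 (uvt (S G)) (uvt (S H))) \<le> N1 \<zeta> (linD 1 (S G) (-1) (S H))" using uvt_Tgt[OF D] by simp
      also have "\<dots> \<le> \<kappa> * N3 \<nu> \<sigma> \<zeta> (L0 a \<nu> lam' \<zeta> (linD 1 (S G) (-1) (S H)))" by (rule k(2)[OF g' D])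
      also have "\<dots> \<le> \<kappa> * (C * N3 \<nu> \<sigma> \<zeta> (Lop a \<nu> \<alpha> \<beta> \<gamma> lam' \<zeta> (linD 1 (S G) (-1) (S H))))"
        using C(2)[OF g' D] k(1) by (intro mult_left_mono) auto
      also have "Lop a \<nu> \<alpha> \<beta> \<gamma> lam' \<zeta> (linD 1 (S G) (-1) (S H)) = sub3 G H"
        unfolding Lop_linD[OF S(1)[OF G] S(1)[OF H]] S(2)[OF G] S(2)[OF H] by (simp add: sub3_lin3)
      finally show ?thesis by simp
    qed
    show "onto lam \<zeta>" unfolding onto_def
    proof
      fix F assume F: "F \<in> Tgt \<nu> \<sigma> \<zeta>"
      let ?A = "\<lambda>Y. lin3 1 F (of_real h) Y"
      have A: "?A Y \<in> Tgt \<nu> \<sigma> \<zeta>" if "Y \<in> Tgt \<nu> \<sigma> \<zeta>" for Y using Tgt_lin3[OF F that] by blast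
      have "\<exists>Y\<in>Tgt \<nu> \<sigma> \<zeta>. uvt (S (?A Y)) = Y"
      proof (rule Tgt_fixpoint[OF nu])
        fix Y assume "Y \<in> Tgt \<nu> \<sigma> \<zeta>"
        thus "uvt (S (?A Y)) \<in> Tgt \<nu> \<sigma> \<zeta>" using uvt_Tgt[OF S(1)[OF A]] by blast
      next
        fix Y Y' assume Y: "Y \<in> Tgt \<nu> \<sigma> \<zeta>" "Y' \<in> Tgt \<nu> \<sigma> \<zeta>"
        have e: "sub3 (?A Y) (?A Y') = lin3 (of_real h) (sub3 Y Y') 0 (sub3 Y Y')"
          by (cases Y; cases Y') (simp add: sub3_def lin3_def fun_eq_iff algebra_simps)
        have T: "sub3 Y Y' \<in> Tgt \<nu> \<sigma> \<zeta>" unfolding sub3_lin3 using Tgt_lin3[OF Y] by blast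
        have "N3 \<nu> \<sigma> \<zeta> (sub3 (uvt (S (?A Y))) (uvt (S (?A Y')))) \<le> \<kappa> * C * N3 \<nu> \<sigma> \<zeta> (sub3 (?A Y) (?A Y'))"
          by (rule SL[OF A[OF Y(1)] A[OF Y(2)]])
        also have "\<dots> \<le> \<kappa> * C * (h * N3 \<nu> \<sigma> \<zeta> (sub3 Y Y'))"
          unfolding e using Tgt_lin3[OF T T, of "of_real h" 0] h0(1) kC by (intro mult_left_mono) auto
        also have "\<dots> = 1/2 * N3 \<nu> \<sigma> \<zeta> (sub3 Y Y')" using h0(2) by (simp only: mult.assoc[symmetric])
        finally show "N3 \<nu> \<sigma> \<zeta> (sub3 (uvt (S (?A Y))) (uvt (S (?A Y')))) \<le> 1/2 * N3 \<nu> \<sigma> \<zeta> (sub3 Y Y')" .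
      qed
      then obtain Y where Y: "Y \<in> Tgt \<nu> \<sigma> \<zeta>" "uvt (S (?A Y)) = Y" by blast
      have "Lop a \<nu> \<alpha> \<beta> \<gamma> lam \<zeta> (S (?A Y)) = lin3 1 (?A Y) (of_real (-h)) Y"
        unfolding lam Lop_shift[OF S(1)[OF A[OF Y(1)]]] S(2)[OF A[OF Y(1)]] Y(2) ..
      also have "\<dots> = F" by (simp add: lin3_def)
      finally show "\<exists>X\<in>Dom a \<nu> (\<sigma>+2) \<zeta>. Lop a \<nu> \<alpha> \<beta> \<gamma> lam \<zeta> X = F" using S(1)[OF A[OF Y(1)]] by blast
    qed
  qed
qed

text \<open>Solvability is carried back from \<lambda>+nh, which is admissible and has large
  modulus, in n steps of equal length.\<close>

lemma Lop_onto:
  assumes g: "good lam \<zeta>" shows "onto lam \<zeta>"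
proof -
  obtain h where h: "h > 0" "\<And>lam \<zeta>. good lam \<zeta> \<Longrightarrow> onto (lam + of_real h) \<zeta> \<Longrightarrow> onto lam \<zeta>" using onto_step by blast
  obtain W0 where W0: "\<And>lam \<zeta>. good lam \<zeta> \<Longrightarrow> bw2 lam \<zeta> \<ge> W0 \<Longrightarrow> onto lam \<zeta>" using onto_large by blast
  have st: "good lam \<zeta> \<Longrightarrow> onto (lam + of_real (real n * h)) \<zeta> \<Longrightarrow> onto lam \<zeta>" for n lam
  proof (induction n arbitrary: lam)
    case (Suc n)
    have "good (lam + of_real h) \<zeta>" using Suc.prems(1) Sset_shift[of lam h] h(1) by (simp add: good_def)
    moreover have e: "lam + of_real h + of_real (real n * h) = lam + of_real (real (Suc n) * h)" by (simp add: algebra_simps)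
    have "onto (lam + of_real h + of_real (real n * h)) \<zeta>" unfolding e by (rule Suc.prems(2))
    ultimately have "onto (lam + of_real h) \<zeta>" by (rule Suc.IH)
    thus ?case by (rule h(2)[OF Suc.prems(1)])
  qed simp
  obtain n :: nat where n: "real n > (\<bar>W0\<bar> + cmod lam) / h" using reals_Archimedean2 by blast
  hence "\<bar>W0\<bar> + cmod lam < real n * h" using h(1) by (simp add: pos_divide_less_eq)
  moreover have "cmod (of_real (real n * h)) \<le> cmod (lam + of_real (real n * h)) + cmod lam"
    using norm_triangle_ineq4[of "lam + of_real (real n * h)" lam] by simp
  moreover have "cmod (of_real (real n * h)) = real n * h" using h(1) by (simp only: norm_of_real) simp
  ultimately have "W0 \<le> bw2 (lam + of_real (real n * h)) \<zeta>" unfolding bw2_def using zero_le_power2[of "bz \<zeta>"] by linarith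
  moreover have "good (lam + of_real (real n * h)) \<zeta>" using g Sset_shift[of lam "real n * h"] h(1) by (simp add: good_def)
  ultimately show ?thesis using W0 st[OF g] by blast
qed

lemma Lop_bij:
  assumes g: "good lam \<zeta>"
  shows "bij_betw (Lop a \<nu> \<alpha> \<beta> \<gamma> lam \<zeta>) (Dom a \<nu> (\<sigma>+2) \<zeta>) (Tgt \<nu> \<sigma> \<zeta>)"
  unfolding bij_betw_def
proof
  show "inj_on (Lop a \<nu> \<alpha> \<beta> \<gamma> lam \<zeta>) (Dom a \<nu> (\<sigma>+2) \<zeta>)"
  proof (rule inj_onI)
    fix X Y assume D: "X \<in> Dom a \<nu> (\<sigma>+2) \<zeta>" "Y \<in> Dom a \<nu> (\<sigma>+2) \<zeta>" and e: "Lop a \<nu> \<alpha> \<beta> \<gamma> lam \<zeta> X = Lop a \<nu> \<alpha> \<beta> \<gamma> lam \<zeta> Y"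
    have "Lop a \<nu> \<alpha> \<beta> \<gamma> lam \<zeta> (linD 1 X (-1) Y) = (\<lambda>k. 0, \<lambda>k. 0, \<lambda>k. 0)"
      unfolding Lop_linD[OF D] e by (simp add: lin3_def)
    from inj[OF g Dom_linD[OF D] this] show "X = Y" by (cases X; cases Y) (simp add: linD_def fun_eq_iff)
  qed
  show "Lop a \<nu> \<alpha> \<beta> \<gamma> lam \<zeta> ` Dom a \<nu> (\<sigma>+2) \<zeta> = Tgt \<nu> \<sigma> \<zeta>"
  proof
    show "Lop a \<nu> \<alpha> \<beta> \<gamma> lam \<zeta> ` Dom a \<nu> (\<sigma>+2) \<zeta> \<subseteq> Tgt \<nu> \<sigma> \<zeta>" by (intro image_subsetI Lop_Tgt[OF g])
    show "Tgt \<nu> \<sigma> \<zeta> \<subseteq> Lop a \<nu> \<alpha> \<beta> \<gamma> lam \<zeta> ` Dom a \<nu> (\<sigma>+2) \<zeta>"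
    proof
      fix F assume "F \<in> Tgt \<nu> \<sigma> \<zeta>"
      then obtain X where "X \<in> Dom a \<nu> (\<sigma>+2) \<zeta>" "Lop a \<nu> \<alpha> \<beta> \<gamma> lam \<zeta> X = F"
        using Lop_onto[OF g] unfolding onto_def by blast
      thus "F \<in> Lop a \<nu> \<alpha> \<beta> \<gamma> lam \<zeta> ` Dom a \<nu> (\<sigma>+2) \<zeta>" by blast
    qed
  qed
qed

lemma Lop_continuous:
  assumes g: "good lam \<zeta>" and X: "X \<in> Dom a \<nu> (\<sigma>+2) \<zeta>" and e: "e > 0"
  shows "\<exists>d>0. \<forall>X'\<in>Dom a \<nu> (\<sigma>+2) \<zeta>. nrmD \<nu> (\<sigma>+2) \<zeta> (subD X' X) < d \<longrightarrow>
     nrm3 \<nu> \<sigma> \<zeta> (sub3 (Lop a \<nu> \<alpha> \<beta> \<gamma> lam \<zeta> X') (Lop a \<nu> \<alpha> \<beta> \<gamma> lam \<zeta> X)) < e"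
proof -
  obtain B where B: "B \<ge> 0" "\<And>u v p t. (u, v, p, t) \<in> Dom a \<nu> (\<sigma>+2) \<zeta> \<Longrightarrow>
    N3 \<nu> \<sigma> \<zeta> (L0 a \<nu> lam \<zeta> (u, v, p, t)) \<le> B * (nrm \<nu> (\<sigma>+2) \<zeta> u + nrm \<nu> (\<sigma>+2) \<zeta> v + cmod p + nrm \<nu> (\<sigma>+2) \<zeta> t)"
    using L0_bound[OF g] by blast
  obtain CR where CR: "CR \<ge> 0" "\<And>\<zeta> X. Hs1 \<zeta> X \<Longrightarrow> N3 \<nu> \<sigma> \<zeta> (Rop a \<alpha> \<beta> \<gamma> \<zeta> X) \<le> CR * N1 \<zeta> X" using Rop_bound by blast
  \<comment> \<open>The factor 4 compares the sum of four norms with their l^2 combination; the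
    summand 1 keeps K positive when B and CR vanish.\<close>
  define K where "K = (B + CR) * 4 + 1"
  have K0: "K > 0" using B(1) CR(1) by (simp add: K_def)
  show ?thesis
  proof (intro exI[of _ "e / K"] conjI ballI impI)
    show "0 < e / K" using e K0 by simp
    fix X' assume X': "X' \<in> Dom a \<nu> (\<sigma>+2) \<zeta>" and d: "nrmD \<nu> (\<sigma>+2) \<zeta> (subD X' X) < e / K"
    define Y where "Y = linD 1 X' (-1) X"
    have YD: "Y \<in> Dom a \<nu> (\<sigma>+2) \<zeta>" unfolding Y_def by (rule Dom_linD[OF X' X])
    obtain u v p t where Y: "Y = (u, v, p, t)" by (cases Y)
    have H: "u \<in> Hs \<nu> (\<sigma>+2) \<zeta>" "v \<in> Hs \<nu> (\<sigma>+2) \<zeta>" "t \<in> Hs \<nu> (\<sigma>+2) \<zeta>" using YD by (auto simp: Y Dom_iff)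
    define q where "q = nrm \<nu> (\<sigma>+2) \<zeta> u + nrm \<nu> (\<sigma>+2) \<zeta> v + cmod p + nrm \<nu> (\<sigma>+2) \<zeta> t"
    have qd: "q \<le> 4 * nrmD \<nu> (\<sigma>+2) \<zeta> Y" unfolding q_def by (rule nrmD_ge[OF Y[symmetric] H])
    have s: "\<sigma> + 1 \<le> \<sigma> + 2" by simp
    have N1q: "N1 \<zeta> Y \<le> q" unfolding N1_def Y q_def fst_conv snd_conv
      using Hs_mono[OF nu s H(1), THEN conjunct2] Hs_mono[OF nu s H(2), THEN conjunct2] Hs_mono[OF nu s H(3), THEN conjunct2] norm_ge_zero[of p] by linarith
    have L: "sub3 (Lop a \<nu> \<alpha> \<beta> \<gamma> lam \<zeta> X') (Lop a \<nu> \<alpha> \<beta> \<gamma> lam \<zeta> X) = Lop a \<nu> \<alpha> \<beta> \<gamma> lam \<zeta> Y"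
      unfolding Y_def Lop_linD[OF X' X] sub3_lin3 ..
    have "nrm3 \<nu> \<sigma> \<zeta> (Lop a \<nu> \<alpha> \<beta> \<gamma> lam \<zeta> Y) \<le> N3 \<nu> \<sigma> \<zeta> (Lop a \<nu> \<alpha> \<beta> \<gamma> lam \<zeta> Y)" by (rule nrm3_le_N3[OF Lop_Tgt[OF g YD]])
    also have "\<dots> \<le> N3 \<nu> \<sigma> \<zeta> (L0 a \<nu> lam \<zeta> Y) + N3 \<nu> \<sigma> \<zeta> (Rop a \<alpha> \<beta> \<gamma> \<zeta> Y)"
      unfolding Lop_alt[OF YD] using Tgt_lin3[OF L0_Tgt[OF g YD] Rop_Tgt[OF YD], of 1 "-1"] by simp
    also have "\<dots> \<le> B * q + CR * q"
    proof (rule add_mono)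
      show "N3 \<nu> \<sigma> \<zeta> (L0 a \<nu> lam \<zeta> Y) \<le> B * q" using B(2)[OF YD[unfolded Y]] by (simp add: q_def Y)
      show "N3 \<nu> \<sigma> \<zeta> (Rop a \<alpha> \<beta> \<gamma> \<zeta> Y) \<le> CR * q"
        using CR(2)[OF Dom_Hs1[OF YD]] mult_left_mono[OF N1q CR(1)] by linarith
    qed
    also have "\<dots> = (B + CR) * q" by (simp add: algebra_simps)
    also have "\<dots> \<le> (B + CR) * (4 * nrmD \<nu> (\<sigma>+2) \<zeta> Y)" using qd B(1) CR(1) by (intro mult_left_mono) auto
    also have "\<dots> \<le> K * nrmD \<nu> (\<sigma>+2) \<zeta> Y"
    proof -
      have "nrmD \<nu> (\<sigma>+2) \<zeta> Y \<ge> 0" by (simp add: nrmD_def Y)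
      thus ?thesis by (simp add: K_def algebra_simps)
    qed
    also have "\<dots> < K * (e / K)" using d K0 unfolding Y_def subD_linD by (intro mult_strict_left_mono) auto
    also have "\<dots> = e" using K0 by simp
    finally show "nrm3 \<nu> \<sigma> \<zeta> (sub3 (Lop a \<nu> \<alpha> \<beta> \<gamma> lam \<zeta> X') (Lop a \<nu> \<alpha> \<beta> \<gamma> lam \<zeta> X)) < e" unfolding L .
  qed
qed

lemma Lop_estimate:
  "\<exists>C. \<forall>lam \<zeta> u v p0 t. good lam \<zeta> \<longrightarrow> (u, v, p0, t) \<in> Dom a \<nu> (\<sigma> + 2) \<zeta> \<longrightarrow>
      est C lam \<zeta> u v p0 t (nrm3 \<nu> \<sigma> \<zeta> (Lop a \<nu> \<alpha> \<beta> \<gamma> lam \<zeta> (u, v, p0, t)))"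
proof -
  obtain C0 where C0: "C0 \<ge> 1" "\<And>lam \<zeta> u v p0 t. good lam \<zeta> \<Longrightarrow> (u, v, p0, t) \<in> Dom a \<nu> (\<sigma> + 2) \<zeta> \<Longrightarrow>
      L0 a \<nu> lam \<zeta> (u, v, p0, t) \<in> Tgt \<nu> \<sigma> \<zeta> \<Longrightarrow> est C0 lam \<zeta> u v p0 t (N3 \<nu> \<sigma> \<zeta> (L0 a \<nu> lam \<zeta> (u, v, p0, t)))"
    using L0_estimate by blast
  obtain C where C: "C \<ge> 1" "\<And>lam \<zeta> X. good lam \<zeta> \<Longrightarrow> X \<in> Dom a \<nu> (\<sigma>+2) \<zeta> \<Longrightarrow>
     N3 \<nu> \<sigma> \<zeta> (L0 a \<nu> lam \<zeta> X) \<le> C * N3 \<nu> \<sigma> \<zeta> (Lop a \<nu> \<alpha> \<beta> \<gamma> lam \<zeta> X)" using apriori by blast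
  show ?thesis
  proof (intro exI[of _ "C0 * (C * 3)"] allI impI)
    fix lam \<zeta> u v p0 t assume g: "good lam \<zeta>" and X: "(u, v, p0, t) \<in> Dom a \<nu> (\<sigma> + 2) \<zeta>"
    show "est (C0 * (C * 3)) lam \<zeta> u v p0 t (nrm3 \<nu> \<sigma> \<zeta> (Lop a \<nu> \<alpha> \<beta> \<gamma> lam \<zeta> (u, v, p0, t)))"
    proof (rule est_mono[OF C0(2)[OF g X L0_Tgt[OF g X]]])
      have "N3 \<nu> \<sigma> \<zeta> (L0 a \<nu> lam \<zeta> (u, v, p0, t)) \<le> C * N3 \<nu> \<sigma> \<zeta> (Lop a \<nu> \<alpha> \<beta> \<gamma> lam \<zeta> (u, v, p0, t))" by (rule C(2)[OF g X])
      also have "\<dots> \<le> C * (3 * nrm3 \<nu> \<sigma> \<zeta> (Lop a \<nu> \<alpha> \<beta> \<gamma> lam \<zeta> (u, v, p0, t)))"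
        using C(1) by (intro mult_left_mono N3_le_nrm3[OF Lop_Tgt[OF g X]]) auto
      finally have "C0 * N3 \<nu> \<sigma> \<zeta> (L0 a \<nu> lam \<zeta> (u, v, p0, t)) \<le> C0 * (C * (3 * nrm3 \<nu> \<sigma> \<zeta> (Lop a \<nu> \<alpha> \<beta> \<gamma> lam \<zeta> (u, v, p0, t))))"
        using C0(1) by (intro mult_left_mono) auto
      thus "C0 * N3 \<nu> \<sigma> \<zeta> (L0 a \<nu> lam \<zeta> (u, v, p0, t)) \<le> C0 * (C * 3) * nrm3 \<nu> \<sigma> \<zeta> (Lop a \<nu> \<alpha> \<beta> \<gamma> lam \<zeta> (u, v, p0, t))"
        by (simp only: mult.assoc)
    qed
  qed
qed

end

section \<open>Sine series\<close>

lemma integral_series: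
  fixes f :: "nat \<Rightarrow> real \<Rightarrow> complex"
  assumes c: "\<And>k. continuous_on {l..b} (f k)" and M: "\<And>k z. z \<in> {l..b} \<Longrightarrow> cmod (f k z) \<le> M k" and s: "summable M"
  shows "continuous_on {l..b} (\<lambda>z. \<Sum>k. f k z)" "(\<lambda>k. integral {l..b} (f k)) sums integral {l..b} (\<lambda>z. \<Sum>k. f k z)"
proof -
  have u: "uniform_limit {l..b} (\<lambda>n z. \<Sum>k<n. f k z) (\<lambda>z. \<Sum>k. f k z) sequentially"
    by (rule Weierstrass_m_test[OF M s])
  have cn: "continuous_on {l..b} (\<lambda>z. \<Sum>k<n. f k z)" for n by (intro continuous_on_sum c)
  show "continuous_on {l..b} (\<lambda>z. \<Sum>k. f k z)"
    by (rule uniform_limit_theorem[OF _ u]) (use cn in auto)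
  obtain I J where IJ: "\<And>n. ((\<lambda>z. \<Sum>k<n. f k z) has_integral I n) {l..b}" "((\<lambda>z. \<Sum>k. f k z) has_integral J) {l..b}" "I \<longlonglongrightarrow> J"
    using uniform_limit_integral[OF u cn] by auto
  have "I n = (\<Sum>k<n. integral {l..b} (f k))" for n
  proof -
    have "((\<lambda>z. \<Sum>k<n. f k z) has_integral (\<Sum>k<n. integral {l..b} (f k))) {l..b}"
      by (intro has_integral_sum integrable_integral integrable_continuous_interval c) auto
    thus ?thesis using IJ(1)[of n] has_integral_unique by blast
  qed
  hence "I = (\<lambda>n. \<Sum>k<n. integral {l..b} (f k))" by (rule ext)
  hence "(\<lambda>n. \<Sum>k<n. integral {l..b} (f k)) \<longlonglongrightarrow> integral {l..b} (\<lambda>z. \<Sum>k. f k z)"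
    using IJ(3) integral_unique[OF IJ(2)] by (simp only:)
  thus "(\<lambda>k. integral {l..b} (f k)) sums integral {l..b} (\<lambda>z. \<Sum>k. f k z)" by (simp add: sums_def)
qed

text \<open>Orthogonality to all sines makes w = g sin(pi z/a) orthogonal to all powers of cos(pi
  z/a), through the sum of the sines of k+1 and k-1. Since w is a continuous function of x = cos(pi
  z/a), Weierstrass approximation forces the integral of w^2 to vanish; inside the interval the
  factor sin(pi z/a) is positive.\<close>

lemma sine_complete_real:
  fixes g :: "real \<Rightarrow> real"
  assumes a: "a > 0" and g: "continuous_on {0..a} g" and z0: "\<And>k. k \<ge> 1 \<Longrightarrow> integral {0..a} (\<lambda>z. g z * sin (real k * pi * z / a)) = 0"
    and z: "z \<in> {0<..<a}"
  shows "g z = 0"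
proof -
  have ci: "h integrable_on {0..a}" if "continuous_on {0..a} h" for h :: "real \<Rightarrow> real" using that by (rule integrable_continuous_interval)
  \<comment> \<open>k = 0, where the sine vanishes, is included because the step for k = 1 uses
    k-1.\<close>
  have powers: "((\<lambda>z. g z * (sin (real k * pi * z / a) * cos (pi * z / a) ^ n)) has_integral 0) {0..a}" for k n
  proof (induction n arbitrary: k)
    case 0
    have "((\<lambda>z. g z * sin (real k * pi * z / a)) has_integral integral {0..a} (\<lambda>z. g z * sin (real k * pi * z / a))) {0..a}"
      using a by (intro integrable_integral ci continuous_intros g) auto
    thus ?case by (cases "k = 0") (use z0[of k] in auto)
  next
    case (Suc n)
    show ?case
    proof (cases "k = 0")
      case False
      have e: "(\<lambda>z. (1/2) * (g z * (sin (real (k+1) * pi * z / a) * cos (pi * z / a) ^ n) + g z * (sin (real (k-1) * pi * z / a) * cos (pi * z / a) ^ n)))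
         = (\<lambda>z. g z * (sin (real k * pi * z / a) * cos (pi * z / a) ^ Suc n))"
      proof
        fix z
        have "real (k+1) * pi * z / a = real k * pi * z / a + pi * z / a" "real (k-1) * pi * z / a = real k * pi * z / a - pi * z / a"
          using False by (simp_all add: of_nat_diff add_divide_distrib diff_divide_distrib distrib_right left_diff_distrib)
        hence "sin (real (k+1) * pi * z / a) + sin (real (k-1) * pi * z / a) = 2 * (sin (real k * pi * z / a) * cos (pi * z / a))"
          by (simp add: sin_add sin_diff)
        hence "(1/2) * (g z * ((sin (real (k+1) * pi * z / a) + sin (real (k-1) * pi * z / a)) * cos (pi * z / a) ^ n)) = g z * (sin (real k * pi * z / a) * cos (pi * z / a) ^ Suc n)"
          by simp
        thus "(1/2) * (g z * (sin (real (k+1) * pi * z / a) * cos (pi * z / a) ^ n) + g z * (sin (real (k-1) * pi * z / a) * cos (pi * z / a) ^ n))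
         = g z * (sin (real k * pi * z / a) * cos (pi * z / a) ^ Suc n)" by (simp only: distrib_right distrib_left)
      qed
      from has_integral_mult_right[OF has_integral_add[OF Suc.IH[of "k+1"] Suc.IH[of "k-1"]], of "1/2"]
      show ?thesis unfolding e by simp
    qed simp
  qed
  define h where "h x = g (a / pi * arccos x) * sin (arccos x)" for x
  have hc: "continuous_on {-1..1} h"
  proof -
    have "continuous_on {-1..1} (\<lambda>x. a / pi * arccos x)" by (intro continuous_intros) auto
    moreover have "(\<lambda>x. a / pi * arccos x) ` {-1..1} \<subseteq> {0..a}"
    proof
      fix y assume "y \<in> (\<lambda>x. a / pi * arccos x) ` {-1..1}"
      then obtain x where x: "x \<in> {-1..1}" "y = a / pi * arccos x" by auto
      have "0 \<le> arccos x" "arccos x \<le> pi" using x arccos_lbound arccos_ubound by auto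
      hence "a / pi * arccos x \<le> a / pi * pi" using a by (intro mult_left_mono) auto
      thus "y \<in> {0..a}" using x a \<open>0 \<le> arccos x\<close> by simp
    qed
    ultimately have "continuous_on {-1..1} (\<lambda>x. g (a / pi * arccos x))" using g by (rule continuous_on_compose2[rotated 1])
    thus ?thesis unfolding h_def by (intro continuous_intros) auto
  qed
  have hcos: "h (cos (pi * z / a)) = g z * sin (pi * z / a)" if "z \<in> {0..a}" for z
  proof -
    have "pi * z / a \<le> pi" using that a by (simp add: field_simps)
    hence "arccos (cos (pi * z / a)) = pi * z / a" using that a by (intro arccos_cos) auto
    thus ?thesis using a by (simp add: h_def)
  qed
  let ?w = "\<lambda>z. g z * sin (pi * z / a)"
  have wc: "continuous_on {0..a} ?w" using a by (intro continuous_intros g) auto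
  define A where "A = integral {0..a} (\<lambda>z. \<bar>?w z\<bar>)"
  have A0: "A \<ge> 0" unfolding A_def by (intro integral_nonneg ci continuous_intros wc) auto
  \<comment> \<open>p(cos) is orthogonal to w, so the integral of w^2 equals that of w(w - p), which
    is at most e times the integral of |w|.\<close>
  have le: "integral {0..a} (\<lambda>z. (?w z)\<^sup>2) \<le> e * A" if e: "e > 0" for e
  proof -
    obtain p where p: "real_polynomial_function p" "\<And>x. x \<in> {-1..1} \<Longrightarrow> \<bar>h x - p x\<bar> < e"
      using Stone_Weierstrass_real_polynomial_function[OF compact_Icc hc e] by blast
    obtain c n where cn: "p = (\<lambda>x. \<Sum>i\<le>n. c i * x ^ i)" using p(1) unfolding real_polynomial_function_iff_sum by blast
    have pc: "continuous_on {0..a} (\<lambda>z. p (cos (pi * z / a)))" unfolding cn using a by (intro continuous_intros) auto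
    have "integral {0..a} (\<lambda>z. ?w z * p (cos (pi * z / a))) = 0"
    proof -
      have "((\<lambda>z. \<Sum>i\<le>n. c i * (g z * (sin (real 1 * pi * z / a) * cos (pi * z / a) ^ i))) has_integral (\<Sum>i\<le>n. c i * 0)) {0..a}"
      proof (intro has_integral_sum has_integral_mult_right)
        fix i
        show "((\<lambda>z. g z * (sin (real 1 * pi * z / a) * cos (pi * z / a) ^ i)) has_integral 0) {0..a}"
          by (rule powers)
      qed simp
      moreover have "(\<lambda>z. \<Sum>i\<le>n. c i * (g z * (sin (real 1 * pi * z / a) * cos (pi * z / a) ^ i))) = (\<lambda>z. ?w z * p (cos (pi * z / a)))"
        by (simp add: cn sum_distrib_left mult_ac)
      ultimately show ?thesis by (simp add: integral_unique)
    qed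
    hence "integral {0..a} (\<lambda>z. (?w z)\<^sup>2) = integral {0..a} (\<lambda>z. (?w z)\<^sup>2) - integral {0..a} (\<lambda>z. ?w z * p (cos (pi * z / a)))" by simp
    also have "\<dots> = integral {0..a} (\<lambda>z. (?w z)\<^sup>2 - ?w z * p (cos (pi * z / a)))"
      by (intro integral_diff[symmetric] ci continuous_intros wc pc)
    also have "\<dots> \<le> integral {0..a} (\<lambda>z. e * \<bar>?w z\<bar>)"
    proof (rule integral_le)
      fix z assume z: "z \<in> {0..a}"
      have "(?w z)\<^sup>2 - ?w z * p (cos (pi * z / a)) = ?w z * (h (cos (pi * z / a)) - p (cos (pi * z / a)))"
        unfolding hcos[OF z] by (simp add: power2_eq_square right_diff_distrib)
      also have "\<dots> \<le> \<bar>?w z\<bar> * \<bar>h (cos (pi * z / a)) - p (cos (pi * z / a))\<bar>" unfolding abs_mult[symmetric] by (rule abs_ge_self)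
      also have "\<dots> \<le> \<bar>?w z\<bar> * e" using p(2)[of "cos (pi * z / a)"] by (intro mult_left_mono) auto
      finally show "(?w z)\<^sup>2 - ?w z * p (cos (pi * z / a)) \<le> e * \<bar>?w z\<bar>" by (simp only: mult.commute)
    qed (intro ci continuous_intros wc pc)+
    also have "\<dots> = e * A" by (simp add: A_def)
    finally show ?thesis .
  qed
  have "integral {0..a} (\<lambda>z. (?w z)\<^sup>2) \<le> 0"
  proof (rule field_le_epsilon)
    fix e :: real assume e: "e > 0"
    have "integral {0..a} (\<lambda>z. (?w z)\<^sup>2) \<le> (e / (A + 1)) * A" using le[of "e / (A+1)"] e A0 by simp
    also have "\<dots> \<le> e" using A0 e by (simp add: field_simps)
    finally show "integral {0..a} (\<lambda>z. (?w z)\<^sup>2) \<le> 0 + e" by simp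
  qed
  moreover have "integral {0..a} (\<lambda>z. (?w z)\<^sup>2) \<ge> 0" by (intro integral_nonneg ci continuous_intros wc) auto
  ultimately have "integral {0..a} (\<lambda>z. (?w z)\<^sup>2) = 0" by simp
  hence "\<forall>z\<in>{0..a}. (?w z)\<^sup>2 = 0"
    by (subst (asm) integral_eq_0_iff) (use a wc in \<open>auto intro!: continuous_intros\<close>)
  hence "?w z = 0" using z by auto
  moreover have "sin (pi * z / a) > 0" using z a by (intro sin_gt_zero) (auto simp: field_simps)
  ultimately show ?thesis by simp
qed

lemma ek_continuous: "a > 0 \<Longrightarrow> continuous_on S (ek a k)"
  unfolding ek_def by (intro continuous_intros) auto

lemma ek_cont': "a > 0 \<Longrightarrow> continuous_on S (\<lambda>z. complex_of_real (ek a k z))"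
  by (intro continuous_intros ek_continuous)

lemma sine_complete:
  fixes g :: "real \<Rightarrow> complex"
  assumes a: "a > 0" and g: "continuous_on {0..a} g" and z0: "\<And>k. k \<ge> 1 \<Longrightarrow> integral {0..a} (\<lambda>z. g z * of_real (ek a k z)) = 0"
    and z: "z \<in> {0<..<a}"
  shows "g z = 0"
proof -
  have I: "(\<lambda>z. g z * of_real (ek a k z)) integrable_on {0..a}" for k
    by (intro integrable_continuous_interval continuous_intros g ek_cont' a)
  have r: "sqrt (2/a) > 0" using a by simp
  have *: "integral {0..a} (\<lambda>z. (p (g z)) * sin (real k * pi * z / a)) = 0" if k: "k \<ge> 1" and p: "p = Re \<or> p = Im" for p k
  proof -
    have "((\<lambda>z. g z * of_real (ek a k z)) has_integral 0) {0..a}" using integrable_integral[OF I[of k]] z0[OF k] by simp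
    hence "((\<lambda>z. p (g z * of_real (ek a k z))) has_integral p 0) {0..a}"
      using p has_integral_linear[OF _ bounded_linear_Re, of "\<lambda>z. g z * of_real (ek a k z)"]
        has_integral_linear[OF _ bounded_linear_Im, of "\<lambda>z. g z * of_real (ek a k z)"] by (elim disjE) (simp_all only: o_def)
    moreover have "(\<lambda>z. p (g z * of_real (ek a k z))) = (\<lambda>z. sqrt (2/a) * (p (g z) * sin (real k * pi * z / a)))"
      using p by (auto simp: ek_def)
    ultimately have hi: "((\<lambda>z. sqrt (2/a) * (p (g z) * sin (real k * pi * z / a))) has_integral 0) {0..a}" using p by (elim disjE) simp_all
    have sc: "integral S h = 0" if "((\<lambda>z. q * h z) has_integral 0) S" "q \<noteq> 0" for q :: real and h S
      using has_integral_mult_right[OF that(1), of "1/q"] that(2) by (simp add: integral_unique)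
    show ?thesis by (rule sc[OF hi]) (use r in linarith)
  qed
  have "Re (g z) = 0" by (rule sine_complete_real[OF a continuous_on_Re[OF g] *[of _ Re] z]) auto
  moreover have "Im (g z) = 0" by (rule sine_complete_real[OF a continuous_on_Im[OF g] *[of _ Im] z]) auto
  ultimately show ?thesis by (simp add: complex_eq_iff)
qed

text \<open>Absolute convergence of the series and of its first derived series, and no more. The
  second derived series cannot be expected to converge absolutely: the right-hand side of the
  equation is in general nonzero at the boundary, so its sine coefficients decay only like
  1/k.\<close>

definition dec :: "coef \<Rightarrow> bool" where
  "dec c \<longleftrightarrow> c 0 = 0 \<and> summable (\<lambda>k. real k * cmod (c k))"

definition ek1 :: "real \<Rightarrow> nat \<Rightarrow> real \<Rightarrow> real" where
  "ek1 a k z = sqrt (2/a) * (real k * pi / a) * cos (real k * pi * z / a)"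

definition ser :: "real \<Rightarrow> coef \<Rightarrow> real \<Rightarrow> complex" where
  "ser a c z = (\<Sum>k. c k * of_real (ek a k z))"

definition ser1 :: "real \<Rightarrow> coef \<Rightarrow> real \<Rightarrow> complex" where
  "ser1 a c z = (\<Sum>k. c k * of_real (ek1 a k z))"

lemma dec_summable: "dec c \<Longrightarrow> summable (\<lambda>k. cmod (c k))"
proof (rule summable_comparison_test'[where N=1 and g="\<lambda>k. real k * cmod (c k)"])
  fix k :: nat assume "k \<ge> 1"
  thus "norm (cmod (c k)) \<le> real k * cmod (c k)" using mult_right_mono[of 1 "real k" "cmod (c k)"] by simp
qed (simp add: dec_def)

lemma ek_bound: "a > 0 \<Longrightarrow> \<bar>ek a k z\<bar> \<le> sqrt (2/a)"
  using mult_left_mono[OF abs_sin_le_one[of "real k * pi * z / a"], of "sqrt (2/a)"] by (simp add: ek_def abs_mult)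

lemma ek1_bound: "a > 0 \<Longrightarrow> \<bar>ek1 a k z\<bar> \<le> sqrt (2/a) * (pi / a) * real k"
  using mult_left_mono[OF abs_cos_le_one[of "real k * pi * z / a"], of "sqrt (2/a) * (real k * pi / a)"] by (simp add: ek1_def abs_mult mult_ac)

lemma ek_term_bound: "a > 0 \<Longrightarrow> cmod (c k * of_real (ek a k z)) \<le> sqrt (2/a) * cmod (c k)"
  using mult_left_mono[OF ek_bound[of a k z], of "cmod (c k)"] by (simp add: norm_mult mult.commute)

lemma ek1_term_bound: "a > 0 \<Longrightarrow> cmod (c k * of_real (ek1 a k z)) \<le> sqrt (2/a) * (pi / a) * (real k * cmod (c k))"
  using mult_left_mono[OF ek1_bound[of a k z], of "cmod (c k)"] by (simp add: norm_mult mult_ac)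

lemma ek1_cont: "a > 0 \<Longrightarrow> continuous_on S (\<lambda>z. complex_of_real (ek1 a k z))"
  unfolding ek1_def by (intro continuous_intros) auto

lemma ek_deriv: "a > 0 \<Longrightarrow> (ek a k has_real_derivative ek1 a k z) (at z within S)"
  unfolding ek_def ek1_def by (auto intro!: derivative_eq_intros)

lemma ek1_deriv: "a > 0 \<Longrightarrow> (ek1 a k has_real_derivative - (real k * pi / a)\<^sup>2 * ek a k z) (at z within S)"
  unfolding ek_def ek1_def by (auto intro!: derivative_eq_intros simp: power2_eq_square)

lemma ser_summable: "a > 0 \<Longrightarrow> dec c \<Longrightarrow> summable (\<lambda>k. c k * of_real (ek a k z))"
  by (rule summable_comparison_test'[where N=0, OF summable_mult[OF dec_summable, of c "sqrt (2/a)"]]) (auto intro: ek_term_bound)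

lemma dec_summable1: "dec c \<Longrightarrow> summable (\<lambda>k. sqrt (2/a) * (pi / a) * (real k * cmod (c k)))"
  by (intro summable_mult) (simp add: dec_def)

lemma ser_cont:
  assumes "a > 0" "dec c"
  shows "continuous_on {l..b} (ser a c)" "continuous_on {l..b} (ser1 a c)"
proof -
  show "continuous_on {l..b} (ser a c)" unfolding ser_def
    by (rule integral_series(1)[where M="\<lambda>k. sqrt (2/a) * cmod (c k)"])
       (intro continuous_intros ek_continuous assms ek_term_bound summable_mult dec_summable)+
  show "continuous_on {l..b} (ser1 a c)" unfolding ser1_def
    by (rule integral_series(1)[where M="\<lambda>k. sqrt (2/a) * (pi / a) * (real k * cmod (c k))"])
       (intro continuous_on_mult continuous_on_const ek1_cont assms ek1_term_bound dec_summable1)+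
qed

lemma ser_ends: "a > 0 \<Longrightarrow> ser a c 0 = 0" "a > 0 \<Longrightarrow> ser a c a = 0"
  by (simp_all add: ser_def ek_def)

text \<open>The derived series is integrated termwise instead of differentiating the original one;
  its primitive is the original series because every e_k vanishes at 0, and the fundamental theorem
  concludes.\<close>

lemma ser_deriv:
  assumes a: "a > 0" and c: "dec c" and z: "z \<in> {0..a}"
  shows "(ser a c has_vector_derivative ser1 a c z) (at z within {0..a})"
proof -
  have s: "summable (\<lambda>k. sqrt (2/a) * (pi / a) * (real k * cmod (c k)))" using c by (intro summable_mult) (simp add: dec_def)
  have eq: "ser a c y = integral {0..y} (ser1 a c)" if y: "y \<in> {0..a}" for y
  proof -
    have "(\<lambda>k. integral {0..y} (\<lambda>z. c k * of_real (ek1 a k z))) sums integral {0..y} (\<lambda>z. \<Sum>k. c k * of_real (ek1 a k z))"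
      by (rule integral_series(2)[where M="\<lambda>k. sqrt (2/a) * (pi / a) * (real k * cmod (c k))"])
        (intro continuous_on_mult continuous_on_const ek1_cont a ek1_term_bound s)+
    moreover have "integral {0..y} (\<lambda>z. c k * of_real (ek1 a k z)) = c k * of_real (ek a k y)" for k
    proof -
      have "((\<lambda>z. c k * of_real (ek1 a k z)) has_integral (c k * of_real (ek a k y) - c k * of_real (ek a k 0))) {0..y}"
      proof (rule fundamental_theorem_of_calculus)
        fix z assume "z \<in> {0..y}"
        show "((\<lambda>z. c k * of_real (ek a k z)) has_vector_derivative c k * of_real (ek1 a k z)) (at z within {0..y})"
          by (intro has_vector_derivative_mult_right has_vector_derivative_of_real)
             (simp add: ek_deriv[OF a] flip: has_real_derivative_iff_has_vector_derivative)
      qed (use y in auto)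
      moreover have "c k * of_real (ek a k y) - c k * of_real (ek a k 0) = c k * of_real (ek a k y)" by (simp add: ek_def)
      ultimately show ?thesis by (simp only: integral_unique)
    qed
    ultimately have "(\<lambda>k. c k * of_real (ek a k y)) sums integral {0..y} (\<lambda>z. \<Sum>k. c k * of_real (ek1 a k z))" by (simp only:)
    thus ?thesis unfolding ser_def ser1_def[abs_def] by (rule sums_unique[symmetric])
  qed
  have "((\<lambda>y. integral {0..y} (ser1 a c)) has_vector_derivative ser1 a c z) (at z within {0..a})"
    by (rule integral_has_vector_derivative[OF ser_cont(2)[OF a c] z])
  thus ?thesis by (rule has_vector_derivative_transform[OF z eq, rotated])
qed

text \<open>For j different from k, the integrand times the difference of the eigenvalues is the
  derivative of e_j' e_k - e_j e_k', which vanishes at both ends.\<close>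

lemma ek_orth:
  assumes a: "a > 0" and jk: "j \<ge> 1" "k \<ge> 1"
  shows "((\<lambda>z. ek a j z * ek a k z) has_integral (if j = k then 1 else 0)) {0..a}"
proof (cases "j = k")
  case True
  let ?F = "\<lambda>z. z / a - sin (2 * (real k * pi * z / a)) / (2 * real k * pi)"
  have "((\<lambda>z. ek a k z * ek a k z) has_integral (?F a - ?F 0)) {0..a}"
  proof (rule fundamental_theorem_of_calculus)
    fix z
    have "(?F has_real_derivative (1 - cos (2 * (real k * pi * z / a))) / a) (at z within {0..a})"
      using a jk by (auto intro!: derivative_eq_intros simp: field_simps)
    also have "(1 - cos (2 * (real k * pi * z / a))) / a = ek a k z * ek a k z"
    proof -
      have "ek a k z * ek a k z = (sqrt (2/a) * sqrt (2/a)) * (sin (real k * pi * z / a))\<^sup>2" unfolding ek_def power2_eq_square by (simp only: mult_ac)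
      also have "sqrt (2/a) * sqrt (2/a) = 2 / a" using a by simp
      finally show ?thesis using cos_double_sin[of "real k * pi * z / a"] by simp
    qed
    finally show "(?F has_vector_derivative ek a k z * ek a k z) (at z within {0..a})"
      by (simp add: has_real_derivative_iff_has_vector_derivative)
  qed (use a in auto)
  moreover have "sin (2 * (real k * pi)) = 0" using sin_npi[of "2*k"] by (simp add: mult.assoc)
  hence "?F a - ?F 0 = 1" using a by simp
  ultimately show ?thesis using True by simp
next
  case False
  define d where "d = (real k * pi / a)\<^sup>2 - (real j * pi / a)\<^sup>2"
  have "real k * pi / a > 0" "real j * pi / a > 0" using a jk by auto
  hence "real k * pi / a \<noteq> - (real j * pi / a)" by linarith
  hence d0: "d \<noteq> 0" using a False by (simp add: d_def power2_eq_iff)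
  let ?F = "\<lambda>z. ek1 a j z * ek a k z - ek a j z * ek1 a k z"
  have "((\<lambda>z. d * (ek a j z * ek a k z)) has_integral (?F a - ?F 0)) {0..a}"
  proof (rule fundamental_theorem_of_calculus)
    fix z
    have "(?F has_real_derivative (- (real j * pi / a)\<^sup>2 * ek a j z * ek a k z + ek1 a k z * ek1 a j z) -
        (ek1 a j z * ek1 a k z + - (real k * pi / a)\<^sup>2 * ek a k z * ek a j z)) (at z within {0..a})"
      by (intro DERIV_diff DERIV_mult ek_deriv[OF a] ek1_deriv[OF a])
    moreover have "(- x * p * q + r * t) - (t * r + - y * q * p) = (y - x) * (p * q)" for x y p q r t :: real
      by (simp add: algebra_simps)
    ultimately have "(?F has_real_derivative d * (ek a j z * ek a k z)) (at z within {0..a})" unfolding d_def by (simp only:)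
    thus "(?F has_vector_derivative d * (ek a j z * ek a k z)) (at z within {0..a})"
      by (simp add: has_real_derivative_iff_has_vector_derivative)
  qed (use a in auto)
  moreover have "?F a - ?F 0 = 0" using a by (simp add: ek_def)
  ultimately have "((\<lambda>z. d * (ek a j z * ek a k z)) has_integral 0) {0..a}" by simp
  from has_integral_mult_right[OF this, of "1/d"] show ?thesis using d0 False by simp
qed

lemma ser_mult_integral:
  assumes a: "a > 0" and c: "dec c" and h: "continuous_on {0..b} h"
    and H: "\<And>z. z \<in> {0..b} \<Longrightarrow> cmod (h z) \<le> H"
  shows "(\<lambda>j. c j * integral {0..b} (\<lambda>z. of_real (ek a j z) * h z)) sums integral {0..b} (\<lambda>z. ser a c z * h z)"
proof -
  have "(\<lambda>j. integral {0..b} (\<lambda>z. c j * of_real (ek a j z) * h z)) sums integral {0..b} (\<lambda>z. \<Sum>j. c j * of_real (ek a j z) * h z)"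
  proof (rule integral_series(2)[where M="\<lambda>j. (sqrt (2/a) * cmod (c j)) * H"])
    show "continuous_on {0..b} (\<lambda>z. c j * of_real (ek a j z) * h z)" for j by (intro continuous_intros ek_continuous a h)
    show "cmod (c j * of_real (ek a j z) * h z) \<le> (sqrt (2/a) * cmod (c j)) * H" if "z \<in> {0..b}" for j z
      using mult_mono[OF ek_term_bound[OF a, of c j z] H[OF that]] a by (simp add: norm_mult)
    show "summable (\<lambda>j. (sqrt (2/a) * cmod (c j)) * H)" by (intro summable_mult2 summable_mult dec_summable c)
  qed
  moreover have "(\<Sum>j. c j * of_real (ek a j z) * h z) = ser a c z * h z" for z
    unfolding ser_def by (rule suminf_mult2[OF ser_summable[OF a c], symmetric])
  moreover have "integral {0..b} (\<lambda>z. c j * of_real (ek a j z) * h z) = c j * integral {0..b} (\<lambda>z. of_real (ek a j z) * h z)" for j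
    by (simp only: mult.assoc integral_mult_right)
  ultimately show ?thesis by (simp only:)
qed

lemma ser_coef:
  assumes a: "a > 0" and c: "dec c" and k: "k \<ge> 1"
  shows "integral {0..a} (\<lambda>z. ser a c z * of_real (ek a k z)) = c k"
proof -
  have "(\<lambda>j. c j * integral {0..a} (\<lambda>z. of_real (ek a j z) * of_real (ek a k z))) sums integral {0..a} (\<lambda>z. ser a c z * of_real (ek a k z))"
    by (rule ser_mult_integral[OF a c ek_cont'[OF a], where H="sqrt (2/a)"]) (use ek_bound[OF a] in auto)
  moreover have "c j * integral {0..a} (\<lambda>z. of_real (ek a j z) * of_real (ek a k z)) = (if j = k then c k else 0)" for j
  proof (cases "j = 0")
    case False
    have "((\<lambda>z. complex_of_real (ek a j z * ek a k z)) has_integral of_real (if j = k then 1 else 0)) {0..a}"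
      using has_integral_linear[OF ek_orth[OF a _ k, of j] bounded_linear_of_real] False by (simp add: o_def)
    hence "integral {0..a} (\<lambda>z. complex_of_real (ek a j z) * of_real (ek a k z)) = of_real (if j = k then 1 else 0)"
      by (simp add: integral_unique)
    thus ?thesis by simp
  qed (use c k in \<open>auto simp: dec_def\<close>)
  ultimately have "(\<lambda>j. if j = k then c k else 0) sums integral {0..a} (\<lambda>z. ser a c z * of_real (ek a k z))" by (simp only:)
  thus ?thesis by (rule sums_unique2[OF _ sums_single[of k "\<lambda>_. c k"]])
qed

lemma integral_of_real:
  "h integrable_on S \<Longrightarrow> integral S (\<lambda>z. complex_of_real (h z)) = of_real (integral S h)"
  using integral_unique[OF has_integral_linear[OF integrable_integral, where h="complex_of_real"]] by (simp add: o_def bounded_linear_of_real)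

lemma ser_integral:
  assumes a: "a > 0" and c: "dec c"
  shows "(\<lambda>j. c j * of_real (integral {0..z} (ek a j))) sums integral {0..z} (ser a c)"
proof -
  have "(\<lambda>j. c j * integral {0..z} (\<lambda>y. of_real (ek a j y) * 1)) sums integral {0..z} (\<lambda>y. ser a c y * 1)"
    by (rule ser_mult_integral[OF a c, where H=1]) auto
  moreover have "integral {0..z} (\<lambda>y. complex_of_real (ek a j y) * 1) = of_real (integral {0..z} (ek a j))" for j
    using integral_of_real[of "ek a j" "{0..z}"] by (simp add: integrable_continuous_interval ek_continuous a)
  ultimately show ?thesis by simp
qed

lemma ser_one:
  assumes a: "a > 0" and c: "dec c"
  shows "(\<lambda>j. c j * one_c a j) sums integral {0..a} (ser a c)"
proof -
  have "c j * of_real (integral {0..a} (ek a j)) = c j * one_c a j" for j using c by (simp add: one_c_def dec_def)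
  thus ?thesis using ser_integral[OF a c, of a] by (simp only:)
qed

lemma one_coef:
  assumes a: "a > 0" and k: "k \<ge> 1"
  shows "integral {0..a} (\<lambda>z. complex_of_real (ek a k z)) = one_c a k"
  using integral_of_real[of "ek a k" "{0..a}"] k by (simp add: integrable_continuous_interval ek_continuous a one_c_def)

lemma integral_0z_cont:
  assumes "continuous_on {0..a} (f :: real \<Rightarrow> complex)"
  shows "continuous_on {0..a} (\<lambda>z. integral {0..z} f)"
  by (rule indefinite_integral_continuous_1[OF integrable_continuous_interval[OF assms]])

text \<open>Connects \<open>prim\<close>, a matrix acting on coefficients, with the actual primitive
  of the summed series.\<close>

lemma prim_coef:
  assumes a: "a > 0" and c: "dec c" and k: "k \<ge> 1"
  shows "integral {0..a} (\<lambda>z. integral {0..z} (ser a c) * of_real (ek a k z)) = prim a c k"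
proof -
  have ic: "continuous_on {0..a} (\<lambda>z. integral {0..z} (ek a j))" for j
    by (intro indefinite_integral_continuous_1 integrable_continuous_interval ek_continuous a)
  have ib: "\<bar>integral {0..z} (ek a j)\<bar> \<le> sqrt (2/a) * a" if "z \<in> {0..a}" for j z
  proof -
    have "norm (integral {0..z} (ek a j)) \<le> integral {0..z} (\<lambda>_. sqrt (2/a))"
      by (rule integral_norm_bound_integral) (use ek_bound[OF a] in \<open>auto intro!: integrable_continuous_interval ek_continuous a\<close>)
    also have "\<dots> = z * sqrt (2/a)" using that by simp
    also have "\<dots> \<le> a * sqrt (2/a)" using that a by (intro mult_right_mono) auto
    finally show ?thesis by (simp add: mult.commute)
  qed
  let ?f = "\<lambda>j z. c j * (of_real (integral {0..z} (ek a j)) * of_real (ek a k z))"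
  have "(\<lambda>j. integral {0..a} (?f j)) sums integral {0..a} (\<lambda>z. \<Sum>j. ?f j z)"
  proof (rule integral_series(2)[where M="\<lambda>j. cmod (c j) * (sqrt (2/a) * a * sqrt (2/a))"])
    show "continuous_on {0..a} (?f j)" for j by (intro continuous_intros ic ek_continuous a)
    show "cmod (?f j z) \<le> cmod (c j) * (sqrt (2/a) * a * sqrt (2/a))" if "z \<in> {0..a}" for j z
      unfolding norm_mult norm_of_real by (intro mult_left_mono mult_mono ib that ek_bound a) (use a in auto)
    show "summable (\<lambda>j. cmod (c j) * (sqrt (2/a) * a * sqrt (2/a)))" by (intro summable_mult2 dec_summable c)
  qed
  moreover have "integral {0..a} (?f j) = of_real (primM a k j) * c j" for j
  proof -
    have "(\<lambda>z. integral {0..z} (ek a j) * ek a k z) integrable_on {0..a}"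
      by (intro integrable_continuous_interval continuous_intros ic ek_continuous a)
    from has_integral_linear[OF integrable_integral[OF this] bounded_linear_of_real]
    have "((\<lambda>z. complex_of_real (integral {0..z} (ek a j)) * of_real (ek a k z)) has_integral of_real (primM a k j)) {0..a}"
      by (simp add: o_def primM_def)
    from integral_unique[OF has_integral_mult_right[OF this, of "c j"]] show ?thesis by (simp only: mult.commute)
  qed
  moreover have "(\<Sum>j. ?f j z) = integral {0..z} (ser a c) * of_real (ek a k z)" for z
    using sums_mult2[OF ser_integral[OF a c, of z], of "of_real (ek a k z)"] by (simp add: sums_iff mult.assoc)
  ultimately have "(\<lambda>j. of_real (primM a k j) * c j) sums integral {0..a} (\<lambda>z. integral {0..z} (ser a c) * of_real (ek a k z))"
    by (simp only:)
  thus ?thesis using k by (simp add: prim_def sums_iff)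
qed

lemma ser_ode:
  assumes a: "a > 0" and c: "dec c" and G: "continuous_on {0..a} (G :: real \<Rightarrow> complex)"
    and coef: "\<And>k. k \<ge> 1 \<Longrightarrow> integral {0..a} (\<lambda>z. G z * of_real (ek a k z)) = - of_real ((real k * pi / a)\<^sup>2) * c k"
    and z: "z \<in> {0..a}"
  shows "(ser1 a c has_vector_derivative G z) (at z within {0..a})"
proof -
  define H where "H z = integral {0..z} G" for z
  have Hd: "(H has_vector_derivative G z) (at z within {0..a})" if "z \<in> {0..a}" for z
    unfolding H_def[abs_def] by (rule integral_has_vector_derivative[OF G that])
  have Hc: "continuous_on {0..a} H" unfolding H_def[abs_def] by (rule integral_0z_cont[OF G])
  \<comment> \<open>The slope is fixed by the boundary condition Q(a) = 0.\<close>
  define d where "d = - integral {0..a} H / of_real a"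
  define Q where "Q z = integral {0..z} H + d * of_real z" for z
  have Qd: "(Q has_vector_derivative H z + d) (at z within {0..a})" if "z \<in> {0..a}" for z
  proof -
    have "((\<lambda>z. integral {0..z} H + d * of_real z) has_vector_derivative H z + d * of_real 1) (at z within {0..a})"
      by (intro has_vector_derivative_add integral_has_vector_derivative[OF Hc that] has_vector_derivative_mult_right
         has_vector_derivative_of_real DERIV_ident)
    thus ?thesis by (simp add: Q_def[abs_def])
  qed
  have Q0: "Q 0 = 0" "Q a = 0" using a by (auto simp: Q_def d_def)
  have Qc: "continuous_on {0..a} Q" unfolding Q_def by (intro continuous_intros integral_0z_cont[OF Hc])
  have Qk: "integral {0..a} (\<lambda>z. Q z * of_real (ek a k z)) = c k" if k: "k \<ge> 1" for k
  proof -
    let ?e = "\<lambda>z. complex_of_real (ek a k z)" and ?e1 = "\<lambda>z. complex_of_real (ek1 a k z)"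
    \<comment> \<open>Green's formula: Q' e_k - Q e_k' has derivative G e_k + \<kappa> Q e_k and
      vanishes at both ends.\<close>
    let ?F = "\<lambda>z. (H z + d) * ?e z - Q z * ?e1 z"
    define \<kappa> where "\<kappa> = (real k * pi / a)\<^sup>2"
    have k0: "\<kappa> > 0" using a k by (simp add: \<kappa>_def)
    have "((\<lambda>z. G z * ?e z + of_real \<kappa> * (Q z * ?e z)) has_integral ?F a - ?F 0) {0..a}"
    proof (rule fundamental_theorem_of_calculus)
      fix z assume z: "z \<in> {0..a}"
      have ed: "(?e has_vector_derivative ?e1 z) (at z within {0..a})"
        by (rule has_vector_derivative_of_real[OF ek_deriv[OF a]])
      have ed1: "(?e1 has_vector_derivative of_real (- \<kappa> * ek a k z)) (at z within {0..a})"
        unfolding \<kappa>_def by (rule has_vector_derivative_of_real[OF ek1_deriv[OF a]])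
      have Hd': "((\<lambda>z. H z + d) has_vector_derivative G z) (at z within {0..a})"
        using has_vector_derivative_add[OF Hd[OF z] has_vector_derivative_const[of d]] by simp
      have "(?F has_vector_derivative ((H z + d) * ?e1 z + G z * ?e z) - (Q z * of_real (- \<kappa> * ek a k z) + (H z + d) * ?e1 z)) (at z within {0..a})"
        by (intro has_vector_derivative_diff has_vector_derivative_mult Hd' ed ed1 Qd z)
      thus "(?F has_vector_derivative G z * ?e z + of_real \<kappa> * (Q z * ?e z)) (at z within {0..a})"
        by (simp add: algebra_simps)
    qed (use a in auto)
    moreover have "?F a - ?F 0 = 0" using Q0 a by (simp add: ek_def)
    ultimately have "integral {0..a} (\<lambda>z. G z * ?e z + of_real \<kappa> * (Q z * ?e z)) = 0" by (simp add: integral_unique)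
    moreover have "integral {0..a} (\<lambda>z. G z * ?e z + of_real \<kappa> * (Q z * ?e z)) = integral {0..a} (\<lambda>z. G z * ?e z) + of_real \<kappa> * integral {0..a} (\<lambda>z. Q z * ?e z)"
      by (subst integral_add) (auto intro!: integrable_continuous_interval continuous_intros G Qc ek_continuous a)
    ultimately have "of_real \<kappa> * integral {0..a} (\<lambda>z. Q z * ?e z) = of_real \<kappa> * c k" using coef[OF k] by (simp add: \<kappa>_def add_eq_0_iff)
    thus ?thesis using k0 by simp
  qed
  have eq: "ser a c y = Q y" if y: "y \<in> {0..a}" for y
  proof (cases "y \<in> {0<..<a}")
    case True
    have "ser a c y - Q y = 0"
    proof (rule sine_complete[OF a _ _ True])
      show "continuous_on {0..a} (\<lambda>y. ser a c y - Q y)" by (intro continuous_intros ser_cont[OF a c] Qc)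
      fix k :: nat assume k: "k \<ge> 1"
      have "integral {0..a} (\<lambda>z. ser a c z * of_real (ek a k z) - Q z * of_real (ek a k z)) = c k - c k"
        by (subst integral_diff) (auto simp: ser_coef[OF a c k] Qk[OF k] intro!: integrable_continuous_interval continuous_intros ser_cont[OF a c] Qc ek_continuous a)
      thus "integral {0..a} (\<lambda>z. (ser a c z - Q z) * of_real (ek a k z)) = 0" by (simp add: left_diff_distrib)
    qed
    thus ?thesis by simp
  next
    case False
    hence "y = 0 \<or> y = a" using y by auto
    thus ?thesis using Q0 ser_ends[OF a] by auto
  qed
  have "ser1 a c y = H y + d" if y: "y \<in> {0..a}" for y
  proof (rule vector_derivative_unique_within)
    show "(ser a c has_vector_derivative ser1 a c y) (at y within {0..a})" by (rule ser_deriv[OF a c y])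
    show "(ser a c has_vector_derivative H y + d) (at y within {0..a})"
      by (rule has_vector_derivative_transform[OF y _ Qd[OF y]]) (use eq in auto)
    show "at y within {0..a} \<noteq> bot" using y a by (simp add: at_within_Icc_at_right trivial_limit_within islimpt_Icc)
  qed
  note eq1 = this
  have Hd1: "((\<lambda>z. H z + d) has_vector_derivative G z) (at z within {0..a})"
    using has_vector_derivative_add[OF Hd[OF z] has_vector_derivative_const[of d]] by simp
  show ?thesis by (rule has_vector_derivative_transform[OF z eq1 Hd1])
qed

text \<open>Cauchy-Schwarz in additive form: k|f_k| is at most w|f_k|^2 + k^2/w. The first terms sum
  to the squared norm, the second are of order k^(2-2s), summable for s > 3/2.\<close>

lemma Hs_dec:
  assumes nu: "\<nu> > 0" and f: "f \<in> Hs \<nu> s \<zeta>" and s: "s > 3/2"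
  shows "dec f"
proof -
  have "summable (\<lambda>k. real k * cmod (f k))"
  proof (rule summable_comparison_test'[where N=1])
    show "summable (\<lambda>k. wt \<nu> s \<zeta> k * (cmod (f k))\<^sup>2 + \<nu> powr (-s) * real k powr (2 - 2 * s))"
      using f s by (intro summable_add summable_mult) (auto simp: Hs_def summable_real_powr_iff)
    fix k :: nat assume k: "k \<ge> 1"
    define w where "w = wt \<nu> s \<zeta> k"
    have w0: "w > 0" unfolding w_def by (rule wt_pos[OF nu])
    have "(\<nu> * real k ^ 2) powr s \<le> w"
      unfolding w_def wt_def using nu s k zabs2_nonneg[of \<zeta>] by (intro powr_mono2) auto
    moreover have "(\<nu> * real k ^ 2) powr s = \<nu> powr s * real k powr (2 * s)"
    proof -
      have "(real k powr 2) powr s = real k powr (2 * s)" by (rule powr_powr)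
      hence "(real k ^ 2) powr s = real k powr (2 * s)" using k by simp
      thus ?thesis using nu by (simp add: powr_mult)
    qed
    ultimately have wl: "\<nu> powr s * real k powr (2 * s) \<le> w" by simp
    have p0: "\<nu> powr s * real k powr (2 * s) > 0" using nu k by simp
    have "(real k)\<^sup>2 / w \<le> (real k)\<^sup>2 / (\<nu> powr s * real k powr (2 * s))"
      using wl p0 w0 by (intro divide_left_mono) auto
    also have "\<dots> = \<nu> powr (-s) * real k powr (2 - 2 * s)"
    proof -
      have "real k powr (2 - 2 * s) = (real k)\<^sup>2 / real k powr (2 * s)" using k by (simp add: powr_diff)
      moreover have "\<nu> powr (-s) = 1 / \<nu> powr s" by (rule powr_minus_divide)
      ultimately show ?thesis by simp
    qed
    finally have 1: "(real k)\<^sup>2 / w \<le> \<nu> powr (-s) * real k powr (2 - 2 * s)" .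
    have am: "x * y \<le> x\<^sup>2 / w + w * y\<^sup>2" if "x \<ge> 0" "y \<ge> 0" for x y :: real
    proof -
      have "0 \<le> (x / sqrt w - sqrt w * y)\<^sup>2" by simp
      also have "\<dots> = x\<^sup>2 / w + w * y\<^sup>2 - 2 * (x * y)" using w0 by (simp add: power2_diff power_divide power_mult_distrib)
      finally have "2 * (x * y) \<le> x\<^sup>2 / w + w * y\<^sup>2" by simp
      moreover have "0 \<le> x * y" using that by simp
      ultimately show ?thesis by linarith
    qed
    have "real k * cmod (f k) \<le> (real k)\<^sup>2 / w + w * (cmod (f k))\<^sup>2" by (rule am) auto
    thus "norm (real k * cmod (f k)) \<le> wt \<nu> s \<zeta> k * (cmod (f k))\<^sup>2 + \<nu> powr (-s) * real k powr (2 - 2 * s)"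
      using 1 by (simp add: w_def)
  qed
  thus ?thesis using f by (simp add: dec_def Hs_def)
qed

section \<open>Fourier modes as limits of smooth fields\<close>

definition wave :: "pt \<Rightarrow> pt \<Rightarrow> complex" where
  "wave q p = exp (\<i> * of_real (inner q p))"

text \<open>Combinations of complex exponentials on R^3. Partial derivatives only change the
  amplitudes, so smoothness of all orders is one induction.\<close>

definition wave_sum :: "'j set \<Rightarrow> ('j \<Rightarrow> complex) \<Rightarrow> ('j \<Rightarrow> pt) \<Rightarrow> pt \<Rightarrow> complex" where
  "wave_sum J A q p = (\<Sum>j\<in>J. A j * wave (q j) p)"

lemma wave_deriv: "(wave q has_derivative (\<lambda>d. \<i> * of_real (inner q d) * wave q p)) (at p)"
proof -
  have 1: "((\<lambda>p. \<i> * complex_of_real (inner q p)) has_derivative (\<lambda>d. \<i> * of_real (inner q d))) (at p)"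
    by (intro has_derivative_mult_right has_derivative_of_real has_derivative_inner_right has_derivative_ident)
  have 2: "(exp has_derivative (\<lambda>x. exp (\<i> * complex_of_real (inner q p)) * x)) (at (\<i> * complex_of_real (inner q p)))"
    using DERIV_exp[of "\<i> * complex_of_real (inner q p)"] by (simp add: has_field_derivative_def)
  show ?thesis unfolding wave_def[abs_def] using has_derivative_compose[OF 1 2] by (simp add: mult.commute)
qed

lemma wave_sum_deriv: "(wave_sum J A q has_derivative (\<lambda>d. \<Sum>j\<in>J. A j * (\<i> * of_real (inner (q j) d) * wave (q j) p))) (at p)"
  unfolding wave_sum_def[abs_def] by (intro has_derivative_sum has_derivative_mult_right wave_deriv)

lemma pd_wave_sum: "pd (wave_sum J A q) d = wave_sum J (\<lambda>j. A j * (\<i> * of_real (inner (q j) d))) q"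
proof
  fix p
  show "pd (wave_sum J A q) d p = wave_sum J (\<lambda>j. A j * (\<i> * of_real (inner (q j) d))) q p"
    unfolding pd_def frechet_derivative_at[OF wave_sum_deriv, symmetric] by (simp add: wave_sum_def mult_ac)
qed

lemma Ck_wave_sum: "Ck n (wave_sum J A q)"
proof (induction n arbitrary: A)
  case 0
  show ?case unfolding Ck.simps wave_sum_def[abs_def] wave_def by (intro continuous_intros)
next
  case (Suc n)
  show ?case unfolding Ck.simps pd_wave_sum using Suc.IH differentiableI[OF wave_sum_deriv] by blast
qed

lemma smooth_wave_sum: "smooth (wave_sum J A q)" by (simp add: smooth_def Ck_wave_sum)

definition Ef :: "int \<times> int \<Rightarrow> pt \<Rightarrow> complex" where
  "Ef \<zeta> p = cis (of_int (fst \<zeta>) * fst p + of_int (snd \<zeta>) * fst (snd p))"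

definition trunc :: "real \<Rightarrow> int \<times> int \<Rightarrow> coef \<Rightarrow> nat \<Rightarrow> pt \<Rightarrow> complex" where
  "trunc a \<zeta> c N p = Ef \<zeta> p * (\<Sum>k<N. c k * of_real (ek a k (snd (snd p))))"

text \<open>A sine is a difference of two exponentials; the Boolean selects the sign of the vertical
  frequency k pi/a.\<close>

definition trunc_freq :: "real \<Rightarrow> int \<times> int \<Rightarrow> nat \<times> bool \<Rightarrow> pt" where
  "trunc_freq a \<zeta> j = (of_int (fst \<zeta>), of_int (snd \<zeta>), (if snd j then 1 else -1) * (real (fst j) * pi / a))"

definition trunc_amp :: "real \<Rightarrow> coef \<Rightarrow> nat \<times> bool \<Rightarrow> complex" where
  "trunc_amp a c j = c (fst j) * of_real (sqrt (2/a)) / (2 * \<i>) * (if snd j then 1 else -1)"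

lemma wave_trunc_freq: "wave (trunc_freq a \<zeta> (k, b)) p = Ef \<zeta> p * cis ((if b then 1 else -1) * (real k * pi * snd (snd p) / a))"
proof -
  have "inner (trunc_freq a \<zeta> (k, b)) p = (of_int (fst \<zeta>) * fst p + of_int (snd \<zeta>) * fst (snd p)) + (if b then 1 else -1) * (real k * pi * snd (snd p) / a)"
    by (cases p) (simp add: trunc_freq_def)
  thus ?thesis unfolding wave_def Ef_def cis_mult by (simp only: cis_conv_exp)
qed

lemma sin_cos_cis: "complex_of_real (sin t) = (cis t - cis (- t)) / (2 * \<i>)" "complex_of_real (cos t) = (cis t + cis (- t)) / 2"
proof -
  have "cis t - cis (- t) = complex_of_real (sin t) * (2 * \<i>)" "cis t + cis (- t) = complex_of_real (cos t) * 2" by (simp_all add: complex_eq_iff)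
  thus "complex_of_real (sin t) = (cis t - cis (- t)) / (2 * \<i>)" "complex_of_real (cos t) = (cis t + cis (- t)) / 2"
    by (simp_all only: nonzero_mult_div_cancel_right[of "2 * \<i>"] nonzero_mult_div_cancel_right[of "2::complex"] mult_eq_0_iff complex_i_not_zero zero_neq_numeral[symmetric] simp_thms)
qed

lemma trunc_wave_sum: "trunc a \<zeta> c N = wave_sum ({..<N} \<times> UNIV) (trunc_amp a c) (trunc_freq a \<zeta>)"
proof
  fix p
  have e: "c k * of_real (ek a k z) = c k * of_real (sqrt (2/a)) / (2 * \<i>) * cis (real k * pi * z / a) - c k * of_real (sqrt (2/a)) / (2 * \<i>) * cis (- (real k * pi * z / a))" for k z
    unfolding ek_def of_real_mult sin_cos_cis by (simp add: algebra_simps diff_divide_distrib)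
  have "wave_sum ({..<N} \<times> UNIV) (trunc_amp a c) (trunc_freq a \<zeta>) p = (\<Sum>k<N. \<Sum>b\<in>UNIV. trunc_amp a c (k, b) * wave (trunc_freq a \<zeta> (k, b)) p)"
    unfolding wave_sum_def by (subst sum.cartesian_product) (simp add: case_prod_unfold)
  also have "\<dots> = (\<Sum>k<N. Ef \<zeta> p * (c k * of_real (ek a k (snd (snd p)))))"
    unfolding wave_trunc_freq e by (simp add: UNIV_bool trunc_amp_def algebra_simps)
  finally show "trunc a \<zeta> c N p = wave_sum ({..<N} \<times> UNIV) (trunc_amp a c) (trunc_freq a \<zeta>) p" by (simp add: trunc_def sum_distrib_left)
qed

lemma grad_trunc: "grad (trunc a \<zeta> c N) p = (\<i> * of_int (fst \<zeta>) * trunc a \<zeta> c N p, \<i> * of_int (snd \<zeta>) * trunc a \<zeta> c N p,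
   Ef \<zeta> p * (\<Sum>k<N. c k * of_real (ek1 a k (snd (snd p)))))"
proof -
  have x: "pd (trunc a \<zeta> c N) dX p = \<i> * of_int (fst \<zeta>) * trunc a \<zeta> c N p"
    unfolding trunc_wave_sum pd_wave_sum wave_sum_def by (simp add: sum_distrib_left trunc_freq_def dX_def mult_ac)
  have y: "pd (trunc a \<zeta> c N) dY p = \<i> * of_int (snd \<zeta>) * trunc a \<zeta> c N p"
    unfolding trunc_wave_sum pd_wave_sum wave_sum_def by (simp add: sum_distrib_left trunc_freq_def dY_def mult_ac)
  have e: "c k * of_real (ek1 a k z) = c k * of_real (sqrt (2/a)) / (2 * \<i>) * (\<i> * of_real (real k * pi / a)) * cis (real k * pi * z / a) +
     c k * of_real (sqrt (2/a)) / (2 * \<i>) * (\<i> * of_real (real k * pi / a)) * cis (- (real k * pi * z / a))" for k z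
  proof -
    have ring: "c * (s * r * ((x + y) / 2)) = c * s / (2 * \<i>) * (\<i> * r) * x + c * s / (2 * \<i>) * (\<i> * r) * y" for c s r x y :: complex
      by (simp add: field_simps)
    show ?thesis unfolding ek1_def of_real_mult[of _ "cos _"] of_real_mult[of "sqrt _"] sin_cos_cis by (rule ring)
  qed
  have "pd (trunc a \<zeta> c N) dZ p = (\<Sum>k<N. \<Sum>b\<in>UNIV. trunc_amp a c (k, b) * (\<i> * of_real (inner (trunc_freq a \<zeta> (k, b)) dZ)) * wave (trunc_freq a \<zeta> (k, b)) p)"
    unfolding trunc_wave_sum pd_wave_sum wave_sum_def by (subst sum.cartesian_product) (simp add: case_prod_unfold)
  also have "\<dots> = (\<Sum>k<N. Ef \<zeta> p * (c k * of_real (ek1 a k (snd (snd p)))))"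
    unfolding wave_trunc_freq e by (simp add: UNIV_bool trunc_amp_def trunc_freq_def dZ_def algebra_simps)
  finally have z: "pd (trunc a \<zeta> c N) dZ p = Ef \<zeta> p * (\<Sum>k<N. c k * of_real (ek1 a k (snd (snd p))))" by (simp add: sum_distrib_left)
  show ?thesis unfolding grad_def x y z ..
qed

lemma cis_periodic: "cis (t + 2 * pi * of_int n) = cis t"
  using cis_multiple_2pi[of "of_int n"] by (simp add: cis_mult[symmetric])

lemma Ef_periodic: "Ef \<zeta> (x + 2 * pi, y, z) = Ef \<zeta> (x, y, z)" "Ef \<zeta> (x, y + 2 * pi, z) = Ef \<zeta> (x, y, z)"
proof -
  have "of_int (fst \<zeta>) * (x + 2 * pi) + of_int (snd \<zeta>) * y = (of_int (fst \<zeta>) * x + of_int (snd \<zeta>) * y) + 2 * pi * of_int (fst \<zeta>)"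
    "of_int (fst \<zeta>) * x + of_int (snd \<zeta>) * (y + 2 * pi) = (of_int (fst \<zeta>) * x + of_int (snd \<zeta>) * y) + 2 * pi * of_int (snd \<zeta>)"
    by (simp_all add: algebra_simps)
  thus "Ef \<zeta> (x + 2 * pi, y, z) = Ef \<zeta> (x, y, z)" "Ef \<zeta> (x, y + 2 * pi, z) = Ef \<zeta> (x, y, z)"
    unfolding Ef_def fst_conv snd_conv by (simp_all only: cis_periodic)
qed

lemma adm_trunc:
  assumes a: "a > 0" shows "adm a (trunc a \<zeta> c N)"
proof -
  have "smooth (trunc a \<zeta> c N)" unfolding trunc_wave_sum by (rule smooth_wave_sum)
  moreover have "ek a k 0 = 0" "ek a k a = 0" for k using a by (simp_all add: ek_def)
  ultimately show ?thesis unfolding adm_def by (simp add: trunc_def Ef_periodic)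
qed

lemma norm_Ef: "cmod (Ef \<zeta> p) = 1" by (simp add: Ef_def)

lemma Times_borel:
  fixes A :: "'a::second_countable_topology set" and B :: "'b::second_countable_topology set"
  assumes "A \<in> sets borel" "B \<in> sets borel" shows "A \<times> B \<in> sets borel"
  using pair_measureI[OF assms] by (simp only: borel_prod)

lemma Om_borel: "Om a \<in> sets borel"
  unfolding Om_def by (intro Times_borel) auto

lemma Om_bounded: "bounded (Om a)"
  unfolding Om_def by (intro bounded_Times bounded_closed_interval) (rule bounded_subset[OF bounded_closed_interval[of 0 a]], auto)

lemma Om_finite: "emeasure lborel (Om a) < \<infinity>"
  by (rule emeasure_bounded_finite[OF Om_bounded])

text \<open>The cell has finite measure, so a uniform error tending to 0 tends to 0 in the mean
  square.\<close>

lemma L2d_uniform: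
  fixes f :: "nat \<Rightarrow> pt \<Rightarrow> 'b::real_normed_vector"
  assumes e: "e \<longlonglongrightarrow> 0" and b: "\<And>n p. p \<in> Om a \<Longrightarrow> norm (f n p - g p) \<le> e n"
  shows "(\<lambda>n. L2d a (f n) g) \<longlonglongrightarrow> 0"
proof (rule tendsto_sandwich)
  show "\<forall>\<^sub>F n in sequentially. 0 \<le> L2d a (f n) g" by simp
  have le: "L2d a (f n) g \<le> ennreal ((e n)\<^sup>2 * measure lborel (Om a))" for n
  proof -
    have "L2d a (f n) g \<le> (\<integral>\<^sup>+p. ennreal ((e n)\<^sup>2) * indicator (Om a) p \<partial>lborel)"
      unfolding L2d_def
    proof (rule nn_integral_mono)
      fix p show "ennreal ((norm (f n p - g p))\<^sup>2) * indicator (Om a) p \<le> ennreal ((e n)\<^sup>2) * indicator (Om a) p"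
        using power_mono[OF b[of p n] norm_ge_zero, of 2] by (cases "p \<in> Om a") (auto intro: ennreal_leI)
    qed
    also have "\<dots> = ennreal ((e n)\<^sup>2) * emeasure lborel (Om a)"
      by (rule nn_integral_cmult_indicator) (simp add: Om_borel)
    also have "\<dots> = ennreal ((e n)\<^sup>2 * measure lborel (Om a))"
      using Om_finite[of a] by (simp add: emeasure_eq_ennreal_measure ennreal_mult less_top)
    finally show ?thesis .
  qed
  show "\<forall>\<^sub>F n in sequentially. L2d a (f n) g \<le> ennreal ((e n)\<^sup>2 * measure lborel (Om a))" using le by simp
  have "(\<lambda>n. (e n)\<^sup>2 * measure lborel (Om a)) \<longlonglongrightarrow> 0\<^sup>2 * measure lborel (Om a)" by (intro tendsto_intros e)
  hence "(\<lambda>n. ennreal ((e n)\<^sup>2 * measure lborel (Om a))) \<longlonglongrightarrow> ennreal (0\<^sup>2 * measure lborel (Om a))" by (rule tendsto_ennrealI)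
  thus "(\<lambda>n. ennreal ((e n)\<^sup>2 * measure lborel (Om a))) \<longlonglongrightarrow> 0" by simp
qed simp

lemma tail_bound:
  fixes f :: "nat \<Rightarrow> complex"
  assumes M: "summable M" and b: "\<And>k. cmod (f k) \<le> M k"
  shows "cmod ((\<Sum>k<N. f k) - (\<Sum>k. f k)) \<le> (\<Sum>k. M k) - (\<Sum>k<N. M k)"
proof -
  have f: "summable f" by (rule summable_comparison_test'[OF M, of 0]) (rule b)
  have "cmod (\<Sum>k. f (k + N)) \<le> (\<Sum>k. M (k + N))" by (rule norm_suminf_le[OF b]) (rule summable_ignore_initial_segment[OF M])
  thus ?thesis unfolding suminf_minus_initial_segment[OF M] suminf_minus_initial_segment[OF f] by (subst norm_minus_commute)
qed

lemma tail_tendsto: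
  assumes M: "summable (M :: nat \<Rightarrow> real)" shows "(\<lambda>n. (\<Sum>k. M k) - (\<Sum>k<n + 2. M k)) \<longlonglongrightarrow> 0"
  using tendsto_diff[OF tendsto_const[of "\<Sum>k. M k"] LIMSEQ_ignore_initial_segment[OF summable_LIMSEQ[OF M], of 2]] by (simp only: diff_self)

text \<open>Truncating a series destroys the vanishing of the mean divergence. Only the coefficient
  with index 1 is changed, for there the integral of e_k is nonzero. The truncation order n+2 used
  with it guarantees that this index is present.\<close>

definition corrected :: "coef \<Rightarrow> (nat \<Rightarrow> complex) \<Rightarrow> nat \<Rightarrow> coef" where
  "corrected u x n k = u k + (if k = 1 then x n else 0)"

definition mode :: "real \<Rightarrow> int \<times> int \<Rightarrow> coef \<Rightarrow> vfun" where
  "mode a \<zeta> u p = Ef \<zeta> p * ser a u (snd (snd p))"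

definition gmode :: "real \<Rightarrow> int \<times> int \<Rightarrow> coef \<Rightarrow> gfun" where
  "gmode a \<zeta> u p = (\<i> * of_int (fst \<zeta>) * mode a \<zeta> u p, \<i> * of_int (snd \<zeta>) * mode a \<zeta> u p, Ef \<zeta> p * ser1 a u (snd (snd p)))"

lemma corrected_sum: "(\<Sum>k<n + 2. corrected u x n k * h k) = (\<Sum>k<n + 2. u k * h k) + x n * h 1"
proof -
  have "(\<Sum>k<n + 2. corrected u x n k * h k) = (\<Sum>k<n + 2. u k * h k) + (\<Sum>k<n + 2. if k = 1 then x n * h k else 0)"
    unfolding sum.distrib[symmetric] by (rule sum.cong) (auto simp: corrected_def distrib_right)
  also have "(\<Sum>k<n + 2. if k = 1 then x n * h k else 0) = x n * h 1" by (subst sum.delta) auto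
  finally show ?thesis .
qed

text \<open>The truncation errors of the series and of its derivative are bounded, uniformly on the
  cell, by tails of the majorants behind \<open>dec\<close>; the corrections tend to 0 with
  x.\<close>

lemma mode_approx:
  assumes a: "a > 0" and u: "dec u" and x: "x \<longlonglongrightarrow> 0"
  shows "(\<lambda>n. L2d a (trunc a \<zeta> (corrected u x n) (n + 2)) (mode a \<zeta> u)) \<longlonglongrightarrow> 0"
    "(\<lambda>n. L2d a (grad (trunc a \<zeta> (corrected u x n) (n + 2))) (gmode a \<zeta> u)) \<longlonglongrightarrow> 0"
proof -
  let ?M = "\<lambda>k. sqrt (2/a) * cmod (u k)" and ?M1 = "\<lambda>k. sqrt (2/a) * (pi / a) * (real k * cmod (u k))"
  have s: "summable ?M" "summable ?M1" by (intro summable_mult dec_summable u, intro dec_summable1 u)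
  define e where "e n = ((\<Sum>k. ?M k) - (\<Sum>k<n + 2. ?M k)) + cmod (x n) * sqrt (2/a)" for n
  define e1 where "e1 n = ((\<Sum>k. ?M1 k) - (\<Sum>k<n + 2. ?M1 k)) + cmod (x n) * (sqrt (2/a) * (pi / a))" for n
  have nx: "(\<lambda>n. cmod (x n)) \<longlonglongrightarrow> 0" using x by (rule tendsto_norm_zero)
  have et: "e \<longlonglongrightarrow> 0" unfolding e_def using tendsto_add[OF tail_tendsto[OF s(1)] tendsto_mult_left_zero[OF nx, of "sqrt (2/a)"]] by (simp only: add_0)
  have e1t: "e1 \<longlonglongrightarrow> 0" unfolding e1_def using tendsto_add[OF tail_tendsto[OF s(2)] tendsto_mult_left_zero[OF nx, of "sqrt (2/a) * (pi / a)"]] by (simp only: add_0)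
  have b: "cmod (trunc a \<zeta> (corrected u x n) (n + 2) p - mode a \<zeta> u p) \<le> e n" for n p
  proof -
    let ?z = "snd (snd p)"
    have "cmod (trunc a \<zeta> (corrected u x n) (n + 2) p - mode a \<zeta> u p) = cmod (((\<Sum>k<n + 2. u k * of_real (ek a k ?z)) - ser a u ?z) + x n * of_real (ek a 1 ?z))"
      unfolding trunc_def mode_def right_diff_distrib[symmetric] norm_mult norm_Ef corrected_sum by (simp only: mult_1 add_diff_eq diff_add_eq)
    also have "\<dots> \<le> cmod ((\<Sum>k<n + 2. u k * of_real (ek a k ?z)) - ser a u ?z) + cmod (x n * of_real (ek a 1 ?z))" by (rule norm_triangle_ineq)
    also have "\<dots> \<le> e n" unfolding e_def ser_def
      by (intro add_mono tail_bound s ek_term_bound a) (simp add: norm_mult mult_left_mono ek_bound a)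
    finally show ?thesis .
  qed
  have b1: "cmod (Ef \<zeta> p * (\<Sum>k<n + 2. corrected u x n k * of_real (ek1 a k (snd (snd p)))) - Ef \<zeta> p * ser1 a u (snd (snd p))) \<le> e1 n" for n p
  proof -
    let ?z = "snd (snd p)"
    have "cmod (Ef \<zeta> p * (\<Sum>k<n + 2. corrected u x n k * of_real (ek1 a k ?z)) - Ef \<zeta> p * ser1 a u ?z) = cmod (((\<Sum>k<n + 2. u k * of_real (ek1 a k ?z)) - ser1 a u ?z) + x n * of_real (ek1 a 1 ?z))"
      unfolding right_diff_distrib[symmetric] norm_mult norm_Ef corrected_sum by (simp only: mult_1 add_diff_eq diff_add_eq)
    also have "\<dots> \<le> cmod ((\<Sum>k<n + 2. u k * of_real (ek1 a k ?z)) - ser1 a u ?z) + cmod (x n * of_real (ek1 a 1 ?z))" by (rule norm_triangle_ineq)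
    also have "\<dots> \<le> e1 n" unfolding e1_def ser1_def
    proof (intro add_mono tail_bound s ek1_term_bound a)
      show "cmod (x n * of_real (ek1 a 1 ?z)) \<le> cmod (x n) * (sqrt (2 / a) * (pi / a))"
        using mult_left_mono[OF ek1_bound[OF a, of 1 ?z], of "cmod (x n)"] by (simp add: norm_mult)
    qed
    finally show ?thesis .
  qed
  show "(\<lambda>n. L2d a (trunc a \<zeta> (corrected u x n) (n + 2)) (mode a \<zeta> u)) \<longlonglongrightarrow> 0" by (rule L2d_uniform[OF et b])
  let ?x = "\<bar>real_of_int (fst \<zeta>)\<bar>" and ?y = "\<bar>real_of_int (snd \<zeta>)\<bar>"
  have "(\<lambda>n. ?x * e n + (?y * e n + e1 n)) \<longlonglongrightarrow> ?x * 0 + (?y * 0 + 0)" by (intro tendsto_intros et e1t)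
  hence E: "(\<lambda>n. ?x * e n + (?y * e n + e1 n)) \<longlonglongrightarrow> 0" by simp
  have i: "cmod (\<i> * of_int j * A - \<i> * of_int j * B) \<le> \<bar>real_of_int j\<bar> * E" if "cmod (A - B) \<le> E" for A B :: complex and j E
    unfolding right_diff_distrib[symmetric] norm_mult using mult_left_mono[OF that, of "\<bar>real_of_int j\<bar>"] by simp
  show "(\<lambda>n. L2d a (grad (trunc a \<zeta> (corrected u x n) (n + 2))) (gmode a \<zeta> u)) \<longlonglongrightarrow> 0"
  proof (rule L2d_uniform[OF E])
    fix n p
    have nP: "norm (A, B) \<le> X + Y" if "norm A \<le> X" "norm B \<le> Y" for A :: "'x::real_normed_vector" and B :: "'y::real_normed_vector" and X Y
      using norm_Pair_le[of A B] that by linarith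
    show "norm (grad (trunc a \<zeta> (corrected u x n) (n + 2)) p - gmode a \<zeta> u p) \<le> ?x * e n + (?y * e n + e1 n)"
      unfolding grad_trunc gmode_def diff_Pair by (intro nP i b b1)
  qed
qed

lemma cont_UNIV_Icc:
  fixes f :: "real \<Rightarrow> complex"
  assumes "\<And>l b. continuous_on {l..b} f" shows "continuous_on UNIV f"
  unfolding continuous_on_eq_continuous_at[OF open_UNIV]
proof
  fix z :: real
  show "isCont f z" by (rule continuous_on_interior[OF assms[of "z - 1" "z + 1"]]) simp
qed

lemma ser_cont_UNIV:
  assumes "a > 0" "dec c"
  shows "continuous_on UNIV (ser a c)" "continuous_on UNIV (ser1 a c)"
  by (rule cont_UNIV_Icc, rule ser_cont[OF assms])+

lemma Ef_cont: "continuous_on S (Ef \<zeta>)"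
  unfolding Ef_def cis_conv_exp by (intro continuous_intros)

lemma mode_cont:
  assumes a: "a > 0" "dec c"
  shows "continuous_on S (mode a \<zeta> c)" "continuous_on S (gmode a \<zeta> c)"
proof -
  have z: "continuous_on S (\<lambda>p. f (snd (snd p)))" if "continuous_on UNIV f" for f :: "real \<Rightarrow> complex" and S :: "pt set"
    by (rule continuous_on_compose2[OF that], intro continuous_on_snd continuous_on_id) simp
  show 1: "continuous_on S (mode a \<zeta> c)" unfolding mode_def by (intro continuous_on_mult Ef_cont z ser_cont_UNIV a)
  show "continuous_on S (gmode a \<zeta> c)" unfolding gmode_def by (intro continuous_intros 1 Ef_cont z ser_cont_UNIV a)
qed

lemma one_c_has_integral:
  assumes a: "a > 0" shows "((\<lambda>z. complex_of_real (ek a k z)) has_integral one_c a k) {0..a}"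
proof (cases "k = 0")
  case True
  have "(\<lambda>z. complex_of_real (ek a k z)) = (\<lambda>z. 0)" using True by (simp add: ek_def)
  thus ?thesis using True by (simp add: one_c_def)
next
  case False
  thus ?thesis using one_coef[OF a, of k] integrable_integral[OF integrable_continuous_interval[OF ek_cont'[OF a, of "{0..a}" k]]] by simp
qed

lemma one_c_1_nz: "a > 0 \<Longrightarrow> one_c a 1 \<noteq> 0"
  using one_c_1[of a] by auto

lemma sum_lin2: "(\<Sum>k\<in>K. (x * f k + y * g k) * h k) = x * (\<Sum>k\<in>K. f k * h k) + y * (\<Sum>k\<in>K. g k * h k :: complex)"
  by (simp add: distrib_right sum.distrib sum_distrib_left mult.assoc)

text \<open>The truncated pair has a constraint defect S n that tends to 0. It is removed by moving
  the pair in the direction (\<xi>,\<eta>), which changes the constraint sum by |\<zeta>|^2 1_1 d n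
  with a nonzero factor; the corrections vanish in the limit.\<close>

lemma mode_inV:
  assumes a: "a > 0" and u: "dec u" "dec v" "dec t" and z: "\<zeta> \<noteq> (0, 0)"
    and div: "(\<Sum>k. (of_int (fst \<zeta>) * u k + of_int (snd \<zeta>) * v k) * one_c a k) = 0"
  shows "inV a (mode a \<zeta> u) (mode a \<zeta> v) (mode a \<zeta> t) (gmode a \<zeta> u) (gmode a \<zeta> v) (gmode a \<zeta> t)"
proof -
  define X Y :: complex where "X = of_int (fst \<zeta>)" and "Y = of_int (snd \<zeta>)"
  have Z: "X * X + Y * Y \<noteq> 0"
  proof -
    have "X * X + Y * Y = of_real (zabs2 \<zeta>)" by (simp add: X_def Y_def zabs2_def power2_eq_square)
    thus ?thesis using zabs2_ge1[OF z] by simp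
  qed
  define S where "S n = (\<Sum>k<n + 2. (X * u k + Y * v k) * one_c a k)" for n
  \<comment> \<open>The solution of S n + |\<zeta>|^2 1_1 d n = 0.\<close>
  define d where "d n = - S n / ((X * X + Y * Y) * one_c a 1)" for n
  have S0: "S \<longlonglongrightarrow> 0"
  proof -
    have "(\<lambda>k. X * (u k * one_c a k) + Y * (v k * one_c a k)) sums (X * integral {0..a} (ser a u) + Y * integral {0..a} (ser a v))"
      by (intro sums_add sums_mult ser_one a u)
    hence sm: "(\<lambda>k. (X * u k + Y * v k) * one_c a k) sums (X * integral {0..a} (ser a u) + Y * integral {0..a} (ser a v))"
      by (simp add: distrib_right mult.assoc)
    have "(\<lambda>n. \<Sum>k<n. (X * u k + Y * v k) * one_c a k) \<longlonglongrightarrow> 0"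
      using summable_LIMSEQ[OF sums_summable[OF sm]] div unfolding X_def Y_def by (simp only:)
    thus ?thesis unfolding S_def by (rule LIMSEQ_ignore_initial_segment)
  qed
  have d0: "d \<longlonglongrightarrow> 0"
  proof -
    have "(\<lambda>n. - S n / ((X * X + Y * Y) * one_c a 1)) \<longlonglongrightarrow> - 0 / ((X * X + Y * Y) * one_c a 1)"
      by (intro tendsto_intros S0) (use Z one_c_1_nz[OF a] in simp)
    thus ?thesis unfolding d_def by simp
  qed
  define xu where "xu n = X * d n" for n
  define xv where "xv n = Y * d n" for n
  have xu: "xu \<longlonglongrightarrow> 0" and xv: "xv \<longlonglongrightarrow> 0" unfolding xu_def xv_def by (rule tendsto_mult_right_zero[OF d0])+
  have adm1: "adm1 a (trunc a \<zeta> (corrected u xu n) (n + 2)) (trunc a \<zeta> (corrected v xv n) (n + 2))" for n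
    unfolding adm1_def
  proof (intro conjI adm_trunc a allI)
    fix x y
    let ?E = "Ef \<zeta> (x, y, 0) * \<i>"
    let ?c = "\<lambda>k. X * corrected u xu n k + Y * corrected v xv n k"
    let ?f = "\<lambda>z. pd (trunc a \<zeta> (corrected u xu n) (n + 2)) dX (x, y, z) + pd (trunc a \<zeta> (corrected v xv n) (n + 2)) dY (x, y, z)"
    have f: "?f = (\<lambda>z. ?E * (\<Sum>k<n + 2. ?c k * of_real (ek a k z)))"
    proof
      fix z
      have pX: "pd (trunc a \<zeta> c N) dX (x, y, z) = \<i> * X * trunc a \<zeta> c N (x, y, z)"
        and pY: "pd (trunc a \<zeta> c N) dY (x, y, z) = \<i> * Y * trunc a \<zeta> c N (x, y, z)" for c N
        using grad_trunc[of a \<zeta> c N "(x, y, z)"] by (simp_all add: grad_def X_def Y_def)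
      have E: "Ef \<zeta> (x, y, z) = Ef \<zeta> (x, y, 0)" by (simp add: Ef_def)
      show "?f z = ?E * (\<Sum>k<n + 2. ?c k * of_real (ek a k z))"
        unfolding pX pY trunc_def E snd_conv distrib_right sum.distrib mult.assoc sum_distrib_left[symmetric] by (simp add: algebra_simps)
    qed
    have "(\<Sum>k<n + 2. ?c k * one_c a k) = X * (\<Sum>k<n + 2. corrected u xu n k * one_c a k) + Y * (\<Sum>k<n + 2. corrected v xv n k * one_c a k)"
      by (rule sum_lin2)
    also have "\<dots> = S n + (X * X + Y * Y) * one_c a 1 * d n"
    proof -
      have "S n = X * (\<Sum>k<n + 2. u k * one_c a k) + Y * (\<Sum>k<n + 2. v k * one_c a k)"
        unfolding S_def by (rule sum_lin2)
      thus ?thesis unfolding corrected_sum xu_def xv_def by (simp add: algebra_simps)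
    qed
    also have "\<dots> = 0" unfolding d_def using Z one_c_1_nz[OF a] by simp
    finally have c0: "(\<Sum>k<n + 2. ?c k * one_c a k) = 0" .
    have "((\<lambda>z. ?E * (\<Sum>k<n + 2. ?c k * of_real (ek a k z))) has_integral ?E * (\<Sum>k<n + 2. ?c k * one_c a k)) {0..a}"
      by (intro has_integral_mult_right has_integral_sum one_c_has_integral a) simp
    hence I: "integral {0..a} ?f = 0" unfolding f c0 by (simp only: mult_zero_right) (rule integral_unique)
    have "continuous_on {0..a} ?f" unfolding f by (intro continuous_intros ek_continuous a)
    thus "(LINT z:{0..a}|lborel. ?f z) = 0"
      using set_borel_integral_eq_integral(2)[OF borel_integrable_atLeastAtMost'[of 0 a ?f]] I by (simp only:)
  qed
  have at: "adm a (trunc a \<zeta> (corrected t (\<lambda>n. 0) n) (n + 2))" for n by (rule adm_trunc[OF a])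
  have m: "mode a \<zeta> c \<in> borel_measurable lborel" "gmode a \<zeta> c \<in> borel_measurable lborel" if "dec c" for c
    using borel_measurable_continuous_onI[OF mode_cont(1)[OF a that]] borel_measurable_continuous_onI[OF mode_cont(2)[OF a that]] by simp_all
  show ?thesis unfolding inV_def
  proof (intro conjI m u)
    show "\<exists>\<phi> \<psi>. (\<forall>n. adm1 a (\<phi> n) (\<psi> n)) \<and>
        (\<lambda>n. L2d a (\<phi> n) (mode a \<zeta> u)) \<longlonglongrightarrow> 0 \<and> (\<lambda>n. L2d a (\<psi> n) (mode a \<zeta> v)) \<longlonglongrightarrow> 0 \<and>
        (\<lambda>n. L2d a (grad (\<phi> n)) (gmode a \<zeta> u)) \<longlonglongrightarrow> 0 \<and> (\<lambda>n. L2d a (grad (\<psi> n)) (gmode a \<zeta> v)) \<longlonglongrightarrow> 0"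
      by (rule exI[of _ "\<lambda>n. trunc a \<zeta> (corrected u xu n) (n + 2)"], rule exI[of _ "\<lambda>n. trunc a \<zeta> (corrected v xv n) (n + 2)"])
        (intro conjI allI adm1 mode_approx a u xu xv)
    show "\<exists>\<rho>. (\<forall>n. adm a (\<rho> n)) \<and>
        (\<lambda>n. L2d a (\<rho> n) (mode a \<zeta> t)) \<longlonglongrightarrow> 0 \<and> (\<lambda>n. L2d a (grad (\<rho> n)) (gmode a \<zeta> t)) \<longlonglongrightarrow> 0"
      by (rule exI[of _ "\<lambda>n. trunc a \<zeta> (corrected t (\<lambda>n. 0) n) (n + 2)"])
        (intro conjI allI at mode_approx a u tendsto_const)
  qed
qed

section \<open>Convergence in mean and vertical primitives\<close>

definition L1d :: "real \<Rightarrow> (pt \<Rightarrow> complex) \<Rightarrow> (pt \<Rightarrow> complex) \<Rightarrow> ennreal" where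
  "L1d a f g = (\<integral>\<^sup>+p \<in> Om a. ennreal (cmod (f p - g p)) \<partial>lborel)"

lemma ennreal_square_tendsto_0:
  fixes f :: "nat \<Rightarrow> ennreal"
  assumes "(\<lambda>n. (f n)\<^sup>2) \<longlonglongrightarrow> 0" shows "f \<longlonglongrightarrow> 0"
proof (rule order_tendstoI)
  fix e :: ennreal assume e: "0 < e"
  have "0 < e\<^sup>2" using e by (simp add: zero_less_iff_neq_zero)
  hence "\<forall>\<^sub>F n in sequentially. (f n)\<^sup>2 < e\<^sup>2" using order_tendstoD(2)[OF assms] by blast
  thus "\<forall>\<^sub>F n in sequentially. f n < e"
  proof (rule eventually_mono)
    fix n assume l: "(f n)\<^sup>2 < e\<^sup>2"
    show "f n < e"
    proof (rule ccontr)
      assume "\<not> f n < e"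
      hence "e \<le> f n" by simp
      hence "e\<^sup>2 \<le> (f n)\<^sup>2" unfolding power2_eq_square by (intro mult_mono) auto
      thus False using l by simp
    qed
  qed
qed simp

text \<open>Cauchy-Schwarz on a set of finite measure, carried out with extended values so that no
  integrability of the limit has to be known.\<close>

lemma L1_of_L2:
  assumes f: "\<And>n. fn n \<in> borel_measurable borel" and g: "f \<in> borel_measurable borel"
    and L: "(\<lambda>n. L2d a (fn n) f) \<longlonglongrightarrow> 0"
  shows "(\<lambda>n. L1d a (fn n) f) \<longlonglongrightarrow> 0"
proof -
  note [measurable] = f g Om_borel[of a]
  have le: "(L1d a (fn n) f)\<^sup>2 \<le> emeasure lborel (Om a) * L2d a (fn n) f" for n
  proof -
    have "(\<integral>\<^sup>+p. (ennreal (cmod (fn n p - f p)) * indicator (Om a) p) * indicator (Om a) p \<partial>lborel)\<^sup>2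
        \<le> (\<integral>\<^sup>+p. (ennreal (cmod (fn n p - f p)) * indicator (Om a) p)\<^sup>2 \<partial>lborel) * (\<integral>\<^sup>+p. (indicator (Om a) p)\<^sup>2 \<partial>lborel)"
      by (rule Cauchy_Schwarz_nn_integral) measurable
    also have "(\<integral>\<^sup>+p. (ennreal (cmod (fn n p - f p)) * indicator (Om a) p)\<^sup>2 \<partial>lborel) = L2d a (fn n) f"
      unfolding L2d_def by (rule nn_integral_cong) (simp add: indicator_def ennreal_power)
    also have "(\<integral>\<^sup>+p. (indicator (Om a) p)\<^sup>2 \<partial>lborel) = (\<integral>\<^sup>+p. indicator (Om a) p \<partial>lborel)"
      by (rule nn_integral_cong) (simp add: indicator_def)
    also have "\<dots> = emeasure lborel (Om a)" by (rule nn_integral_indicator) (simp add: Om_borel)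
    also have "(\<integral>\<^sup>+p. (ennreal (cmod (fn n p - f p)) * indicator (Om a) p) * indicator (Om a) p \<partial>lborel) = L1d a (fn n) f"
      unfolding L1d_def by (rule nn_integral_cong) (simp add: indicator_def)
    finally show ?thesis by (simp add: mult.commute)
  qed
  have "(\<lambda>n. emeasure lborel (Om a) * L2d a (fn n) f) \<longlonglongrightarrow> emeasure lborel (Om a) * 0"
    by (rule ennreal_tendsto_cmult[OF _ L]) (use Om_finite in simp)
  hence "(\<lambda>n. (L1d a (fn n) f)\<^sup>2) \<longlonglongrightarrow> 0"
    by (intro tendsto_sandwich[of "\<lambda>n. 0" "\<lambda>n. (L1d a (fn n) f)\<^sup>2" sequentially "\<lambda>n. emeasure lborel (Om a) * L2d a (fn n) f" 0]) (use le in auto)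
  thus ?thesis by (rule ennreal_square_tendsto_0)
qed

text \<open>Convergence for the test slot of the forms: the other factor is a bounded mode, and
  vertical primitives are continuous in L^1 over a bounded height. Measurability and integrability
  are packed in so that sums, products and primitives can be combined by rules.\<close>

definition L1conv :: "real \<Rightarrow> (nat \<Rightarrow> pt \<Rightarrow> complex) \<Rightarrow> (pt \<Rightarrow> complex) \<Rightarrow> bool" where
  "L1conv a fn f \<longleftrightarrow> (\<forall>n. fn n \<in> borel_measurable borel) \<and> (\<forall>n. set_integrable lborel (Om a) (fn n)) \<and>
     f \<in> borel_measurable borel \<and> (\<lambda>n. L1d a (fn n) f) \<longlonglongrightarrow> 0"

text \<open>The limit differs from some integrable approximant by a function of finite L^1
  norm.\<close>

lemma L1conv_int:
  assumes "L1conv a fn f" shows "set_integrable lborel (Om a) f"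
proof -
  have [measurable]: "fn n \<in> borel_measurable borel" "f \<in> borel_measurable borel" for n using assms by (simp_all add: L1conv_def)
  note [measurable] = Om_borel[of a]
  have "\<forall>\<^sub>F n in sequentially. L1d a (fn n) f < 1" using assms by (intro order_tendstoD(2)[where y=0]) (simp_all add: L1conv_def)
  then obtain n where "L1d a (fn n) f < 1" by (auto simp: eventually_sequentially)
  hence fin: "L1d a (fn n) f < \<infinity>" by (rule less_trans) simp
  have eq: "(\<integral>\<^sup>+p. ennreal (norm (indicator (Om a) p *\<^sub>R (fn n p - f p))) \<partial>lborel) = L1d a (fn n) f"
    unfolding L1d_def by (rule nn_integral_cong) (simp add: indicator_def)
  have "integrable lborel (\<lambda>p. indicator (Om a) p *\<^sub>R (fn n p - f p))"
  proof (rule integrableI_bounded)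
    show "(\<integral>\<^sup>+p. ennreal (norm (indicator (Om a) p *\<^sub>R (fn n p - f p))) \<partial>lborel) < \<infinity>" unfolding eq by (rule fin)
  qed measurable
  hence i: "set_integrable lborel (Om a) (\<lambda>p. fn n p - f p)" by (simp add: set_integrable_def)
  have "set_integrable lborel (Om a) (\<lambda>p. fn n p - (fn n p - f p))"
    by (rule set_integral_diff(1)[OF _ i]) (use assms in \<open>simp add: L1conv_def\<close>)
  thus ?thesis by simp
qed

lemma L1conv_lim:
  assumes "L1conv a fn f" shows "(\<lambda>n. intOm a (fn n)) \<longlonglongrightarrow> intOm a f"
  unfolding intOm_def set_lebesgue_integral_def
proof (rule tendsto_L1_int)
  show "integrable lborel (\<lambda>x. indicat_real (Om a) x *\<^sub>R fn n x)" for n using assms by (simp add: L1conv_def set_integrable_def)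
  show "integrable lborel (\<lambda>x. indicat_real (Om a) x *\<^sub>R f x)" using L1conv_int[OF assms] by (simp add: set_integrable_def)
  have "(\<integral>\<^sup>+ x. ennreal (norm (indicat_real (Om a) x *\<^sub>R fn n x - indicat_real (Om a) x *\<^sub>R f x)) \<partial>lborel) = L1d a (fn n) f" for n
    unfolding L1d_def by (rule nn_integral_cong) (simp add: indicator_def)
  thus "(\<lambda>n. \<integral>\<^sup>+ x. ennreal (norm (indicat_real (Om a) x *\<^sub>R fn n x - indicat_real (Om a) x *\<^sub>R f x)) \<partial>lborel) \<longlonglongrightarrow> 0"
    using assms by (simp add: L1conv_def)
qed

lemma L1conv_add:
  assumes A: "L1conv a fn f" "L1conv a gn g" shows "L1conv a (\<lambda>n p. fn n p + gn n p) (\<lambda>p. f p + g p)"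
proof -
  have [measurable]: "fn n \<in> borel_measurable borel" "gn n \<in> borel_measurable borel" "f \<in> borel_measurable borel" "g \<in> borel_measurable borel" for n
    using assms by (simp_all add: L1conv_def)
  note [measurable] = Om_borel[of a]
  have le: "L1d a (\<lambda>p. fn n p + gn n p) (\<lambda>p. f p + g p) \<le> L1d a (fn n) f + L1d a (gn n) g" for n
  proof -
    have "L1d a (fn n) f + L1d a (gn n) g = (\<integral>\<^sup>+p. ennreal (cmod (fn n p - f p)) * indicator (Om a) p + ennreal (cmod (gn n p - g p)) * indicator (Om a) p \<partial>lborel)"
      unfolding L1d_def by (rule nn_integral_add[symmetric]) measurable
    also have "\<dots> \<ge> L1d a (\<lambda>p. fn n p + gn n p) (\<lambda>p. f p + g p)" unfolding L1d_def
    proof (rule nn_integral_mono)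
      fix p
      have "cmod (fn n p + gn n p - (f p + g p)) \<le> cmod (fn n p - f p) + cmod (gn n p - g p)"
        using norm_triangle_ineq[of "fn n p - f p" "gn n p - g p"] by (simp add: algebra_simps)
      hence "ennreal (cmod (fn n p + gn n p - (f p + g p))) \<le> ennreal (cmod (fn n p - f p)) + ennreal (cmod (gn n p - g p))"
        by (metis ennreal_leI ennreal_plus norm_ge_zero)
      thus "ennreal (cmod (fn n p + gn n p - (f p + g p))) * indicator (Om a) p \<le> ennreal (cmod (fn n p - f p)) * indicator (Om a) p + ennreal (cmod (gn n p - g p)) * indicator (Om a) p"
        by (simp add: indicator_def)
    qed
    finally show ?thesis .
  qed
  have "(\<lambda>n. L1d a (fn n) f + L1d a (gn n) g) \<longlonglongrightarrow> 0 + 0" using A by (intro tendsto_add) (simp_all add: L1conv_def)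
  hence "(\<lambda>n. L1d a (\<lambda>p. fn n p + gn n p) (\<lambda>p. f p + g p)) \<longlonglongrightarrow> 0"
    by (intro tendsto_sandwich[of "\<lambda>n. 0" "\<lambda>n. L1d a (\<lambda>p. fn n p + gn n p) (\<lambda>p. f p + g p)" sequentially "\<lambda>n. L1d a (fn n) f + L1d a (gn n) g" 0]) (use le in auto)
  moreover have "set_integrable lborel (Om a) (\<lambda>p. fn n p + gn n p)" for n using A by (intro set_integral_add(1)) (simp_all add: L1conv_def)
  ultimately show ?thesis unfolding L1conv_def by simp
qed

text \<open>P plays the part of the bounded mode; the conjugate falls on the test field, as in all
  the forms.\<close>

lemma L1conv_mult:
  assumes A: "L1conv a fn f" and P: "P \<in> borel_measurable borel" and K: "\<And>p. p \<in> Om a \<Longrightarrow> cmod (P p) \<le> K"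
  shows "L1conv a (\<lambda>n p. P p * cnj (fn n p)) (\<lambda>p. P p * cnj (f p))"
proof -
  have [measurable]: "fn n \<in> borel_measurable borel" "f \<in> borel_measurable borel" for n
    using assms by (simp_all add: L1conv_def)
  note [measurable] = Om_borel[of a] P
  have [measurable]: "cnj \<in> borel_measurable borel" by (intro borel_measurable_continuous_onI continuous_intros)
  define K' where "K' = max K 0"
  have K': "cmod (P p) \<le> K'" if "p \<in> Om a" for p using K[OF that] by (simp add: K'_def)
  have K0: "K' \<ge> 0" by (simp add: K'_def)
  have le: "L1d a (\<lambda>p. P p * cnj (fn n p)) (\<lambda>p. P p * cnj (f p)) \<le> ennreal K' * L1d a (fn n) f" for n
  proof -
    have "ennreal K' * L1d a (fn n) f = (\<integral>\<^sup>+p. ennreal K' * (ennreal (cmod (fn n p - f p)) * indicator (Om a) p) \<partial>lborel)"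
      unfolding L1d_def by (rule nn_integral_cmult[symmetric]) measurable
    also have "\<dots> \<ge> L1d a (\<lambda>p. P p * cnj (fn n p)) (\<lambda>p. P p * cnj (f p))" unfolding L1d_def
    proof (rule nn_integral_mono)
      fix p
      show "ennreal (cmod (P p * cnj (fn n p) - P p * cnj (f p))) * indicator (Om a) p \<le> ennreal K' * (ennreal (cmod (fn n p - f p)) * indicator (Om a) p)"
      proof (cases "p \<in> Om a")
        case True
        have "cmod (P p * cnj (fn n p) - P p * cnj (f p)) = cmod (P p) * cmod (fn n p - f p)"
          unfolding right_diff_distrib[symmetric] complex_cnj_diff[symmetric] norm_mult complex_mod_cnj ..
        also have "\<dots> \<le> K' * cmod (fn n p - f p)" by (intro mult_right_mono K' True) simp
        finally have "ennreal (cmod (P p * cnj (fn n p) - P p * cnj (f p))) \<le> ennreal K' * ennreal (cmod (fn n p - f p))"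
          unfolding ennreal_mult[OF K0 norm_ge_zero, symmetric] by (rule ennreal_leI)
        thus ?thesis using True by simp
      qed simp
    qed
    finally show ?thesis .
  qed
  have "(\<lambda>n. ennreal K' * L1d a (fn n) f) \<longlonglongrightarrow> ennreal K' * 0" using A by (intro ennreal_tendsto_cmult) (simp_all add: L1conv_def)
  hence "(\<lambda>n. L1d a (\<lambda>p. P p * cnj (fn n p)) (\<lambda>p. P p * cnj (f p))) \<longlonglongrightarrow> 0"
    by (intro tendsto_sandwich[of "\<lambda>n. 0" "\<lambda>n. L1d a (\<lambda>p. P p * cnj (fn n p)) (\<lambda>p. P p * cnj (f p))" sequentially "\<lambda>n. ennreal K' * L1d a (fn n) f" 0]) (use le in auto)
  moreover have "set_integrable lborel (Om a) (\<lambda>p. P p * cnj (fn n p))" for n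
  proof (rule set_integrable_bound[where f="\<lambda>p. of_real K' * fn n p"])
    show "set_integrable lborel (Om a) (\<lambda>p. of_real K' * fn n p)" using A by (simp add: L1conv_def)
    show "set_borel_measurable lborel (Om a) (\<lambda>p. P p * cnj (fn n p))" unfolding set_borel_measurable_def by measurable
    show "AE p in lborel. p \<in> Om a \<longrightarrow> norm (P p * cnj (fn n p)) \<le> norm (of_real K' * fn n p)"
      using K' K0 by (intro AE_I2) (auto simp: norm_mult intro!: mult_right_mono)
  qed
  ultimately show ?thesis unfolding L1conv_def by simp
qed

lemma cont_Om_bounded:
  fixes f :: "pt \<Rightarrow> 'b::real_normed_vector"
  assumes "continuous_on UNIV f" obtains K where "\<And>x y z. x \<in> {0..2*pi} \<Longrightarrow> y \<in> {0..2*pi} \<Longrightarrow> z \<in> {0..a} \<Longrightarrow> norm (f (x, y, z)) \<le> K"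
proof -
  have "compact ({0..2*pi} \<times> {0..2*pi} \<times> {0..a})" by (intro compact_Times compact_Icc)
  hence "compact (f ` ({0..2*pi} \<times> {0..2*pi} \<times> {0..a}))" by (intro compact_continuous_image continuous_on_subset[OF assms]) auto
  then obtain K where "\<forall>y\<in>f ` ({0..2*pi} \<times> {0..2*pi} \<times> {0..a}). norm y \<le> K" using compact_imp_bounded bounded_iff by blast
  thus thesis by (intro that[of K]) auto
qed

lemma Om_bounded_borel:
  assumes "f \<in> borel_measurable borel" "\<And>p. p \<in> Om a \<Longrightarrow> cmod (f p) \<le> K"
  shows "set_integrable lborel (Om a) f"
  unfolding set_integrable_def using assms Om_finite[of a] Om_borel[of a] by (intro integrableI_bounded_set_indicator[where B=K]) auto

lemma L1conv_L2:
  assumes f: "\<And>n. continuous_on UNIV (fn n)" and g: "f \<in> borel_measurable borel"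
    and L: "(\<lambda>n. L2d a (fn n) f) \<longlonglongrightarrow> 0"
  shows "L1conv a fn f"
proof -
  have m: "fn n \<in> borel_measurable borel" for n by (rule borel_measurable_continuous_onI[OF f])
  have "set_integrable lborel (Om a) (fn n)" for n
  proof -
    obtain K where K: "\<And>x y z. x \<in> {0..2*pi} \<Longrightarrow> y \<in> {0..2*pi} \<Longrightarrow> z \<in> {0..a} \<Longrightarrow> norm (fn n (x, y, z)) \<le> K" using cont_Om_bounded[OF f[of n], of a] by blast
    show ?thesis by (rule Om_bounded_borel[OF m, where K=K]) (auto simp: Om_def intro!: K)
  qed
  thus ?thesis unfolding L1conv_def using m g L1_of_L2[OF m g L] by blast
qed

section \<open>Vertical primitives under convergence in mean\<close>

lemma nn_integral_iterated:
  fixes f :: "pt \<Rightarrow> ennreal"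
  assumes [measurable]: "f \<in> borel_measurable borel"
  shows "(\<integral>\<^sup>+p. f p \<partial>lborel) = (\<integral>\<^sup>+x. \<integral>\<^sup>+y. \<integral>\<^sup>+z. f (x, y, z) \<partial>lborel \<partial>lborel \<partial>lborel)"
proof -
  have m: "f \<in> borel_measurable (lborel \<Otimes>\<^sub>M lborel)" by (simp add: lborel_prod)
  have "(\<integral>\<^sup>+p. f p \<partial>lborel) = (\<integral>\<^sup>+x. \<integral>\<^sup>+q. f (x, q) \<partial>lborel \<partial>lborel)"
    using lborel.nn_integral_fst[OF m] by (simp only: lborel_prod)
  also have "\<dots> = (\<integral>\<^sup>+x. \<integral>\<^sup>+y. \<integral>\<^sup>+z. f (x, y, z) \<partial>lborel \<partial>lborel \<partial>lborel)"
  proof (rule nn_integral_cong)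
    fix x
    show "(\<integral>\<^sup>+q. f (x, q) \<partial>lborel) = (\<integral>\<^sup>+y. \<integral>\<^sup>+z. f (x, y, z) \<partial>lborel \<partial>lborel)"
    proof -
    have "(\<lambda>q. f (x, q)) \<in> borel_measurable (lborel \<Otimes>\<^sub>M lborel)" by (simp add: lborel_prod)
    from lborel.nn_integral_fst[OF this] show ?thesis by (simp only: lborel_prod)
    qed
  qed
  finally show ?thesis .
qed

definition vint :: "(pt \<Rightarrow> complex) \<Rightarrow> pt \<Rightarrow> complex" where
  "vint H p = (LINT s:{0..snd (snd p)}|lborel. H (fst p, fst (snd p), s))"

text \<open>The variable upper limit is encoded by the indicator of the closed set 0 \<le> s \<le>
  z, which turns the primitive into a parametric integral over a fixed domain.\<close>

lemma vint_borel:
  assumes [measurable]: "H \<in> borel_measurable borel" shows "vint H \<in> borel_measurable borel"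
proof -
  have "closed {q :: pt \<times> real. 0 \<le> snd q \<and> snd q \<le> snd (snd (fst q))}"
    by (intro closed_Collect_conj closed_Collect_le continuous_intros)
  hence [measurable]: "{q :: pt \<times> real. 0 \<le> snd q \<and> snd q \<le> snd (snd (fst q))} \<in> sets borel" by simp
  have c: "(\<lambda>q :: pt \<times> real. (fst (fst q), fst (snd (fst q)), snd q)) \<in> borel_measurable borel"
    by (intro borel_measurable_continuous_onI continuous_intros)
  have h: "(\<lambda>q :: pt \<times> real. H (fst (fst q), fst (snd (fst q)), snd q)) \<in> borel_measurable borel"
    using measurable_compose[OF c assms] by simp
  have "(\<lambda>q :: pt \<times> real. indicat_real {q :: pt \<times> real. 0 \<le> snd q \<and> snd q \<le> snd (snd (fst q))} q *\<^sub>R H (fst (fst q), fst (snd (fst q)), snd q)) \<in> borel_measurable borel"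
    using h by measurable
  hence m: "(\<lambda>(p, s). indicat_real {0..snd (snd p)} s *\<^sub>R H (fst p, fst (snd p), s)) \<in> borel_measurable ((lborel :: pt measure) \<Otimes>\<^sub>M (lborel :: real measure))"
    by (simp add: lborel_prod case_prod_unfold indicator_def)
  show ?thesis unfolding vint_def[abs_def] set_lebesgue_integral_def using lborel.borel_measurable_lebesgue_integral[OF m] by simp
qed

lemma vint_bound:
  assumes H: "\<And>s. s \<in> {0..a} \<Longrightarrow> cmod (H (x, y, s)) \<le> K" and K: "K \<ge> 0" and z: "z \<in> {0..a}"
  shows "cmod (vint H (x, y, z)) \<le> K * a"
proof (cases "set_integrable lborel {0..z} (\<lambda>s. H (x, y, s))")
  case True
  have "cmod (vint H (x, y, z)) \<le> (LINT s:{0..z}|lborel. cmod (H (x, y, s)))"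
    unfolding vint_def fst_conv snd_conv by (rule set_integral_norm_bound[OF True])
  also have "\<dots> \<le> (LINT s:{0..z}|lborel. K)"
    by (rule set_integral_mono) (use True z H in \<open>auto intro: set_integrable_norm borel_integrable_atLeastAtMost'\<close>)
  also have "\<dots> = K * z" using z by (simp add: set_lebesgue_integral_def)
  also have "\<dots> \<le> K * a" using z K by (intro mult_left_mono) auto
  finally show ?thesis .
next
  case False
  \<comment> \<open>A non-integrable integrand has integral 0 by convention, so the bound
    persists.\<close>
  hence "vint H (x, y, z) = 0" unfolding vint_def set_lebesgue_integral_def set_integrable_def by (simp add: not_integrable_integral_eq)
  thus ?thesis using K z by simp
qed

text \<open>Valid on every vertical line, including those on which the limit H is not integrable:
  there the right-hand side is infinite because h is integrable. This spares a discussion of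
  exceptional lines.\<close>

lemma vint_diff_bound:
  assumes H: "H \<in> borel_measurable borel" and h: "set_integrable lborel {0..z} (\<lambda>s. h (x, y, s))" and z: "z < a"
  shows "ennreal (cmod (vint h (x, y, z) - vint H (x, y, z))) \<le> (\<integral>\<^sup>+s\<in>{0<..<a}. ennreal (cmod (h (x, y, s) - H (x, y, s))) \<partial>lborel)"
proof -
  let ?d = "\<lambda>s. indicat_real {0..z} s *\<^sub>R (h (x, y, s) - H (x, y, s))"
  have c: "(\<lambda>s :: real. (x, y, s)) \<in> borel_measurable borel"
    by (intro borel_measurable_continuous_onI continuous_intros)
  have [measurable]: "(\<lambda>s. H (x, y, s)) \<in> borel_measurable borel" using measurable_compose[OF c H] by simp
  \<comment> \<open>[0,z] is contained in the open interval (0,a) up to the null set {0}.\<close>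
  have le: "(\<integral>\<^sup>+s. ennreal (cmod (?d s)) \<partial>lborel) \<le> (\<integral>\<^sup>+s\<in>{0<..<a}. ennreal (cmod (h (x, y, s) - H (x, y, s))) \<partial>lborel)"
    by (rule nn_integral_mono_AE, rule eventually_mono[OF AE_lborel_singleton[of "0::real"]]) (use z in \<open>auto simp: indicator_def\<close>)
  show ?thesis
  proof (cases "set_integrable lborel {0..z} (\<lambda>s. H (x, y, s))")
    case True
    have "set_integrable lborel {0..z} (\<lambda>s. h (x, y, s) - H (x, y, s))" by (rule set_integral_diff(1)[OF h True])
    hence i: "integrable lborel ?d" by (simp add: set_integrable_def)
    have "vint h (x, y, z) - vint H (x, y, z) = (\<integral>s. ?d s \<partial>lborel)"
      using set_integral_diff(2)[OF h True] by (simp add: vint_def set_lebesgue_integral_def)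
    thus ?thesis using order_trans[OF integral_norm_bound_ennreal[OF i] le] by simp
  next
    case False
    have "(\<integral>\<^sup>+s. ennreal (cmod (?d s)) \<partial>lborel) = \<infinity>"
    proof (rule ccontr)
      assume "\<not> ?thesis"
      hence fin: "(\<integral>\<^sup>+s. ennreal (cmod (?d s)) \<partial>lborel) < \<infinity>" by (simp add: less_top)
      have "(\<lambda>s. indicat_real {0..z} s *\<^sub>R h (x, y, s) - indicat_real {0..z} s *\<^sub>R H (x, y, s)) \<in> borel_measurable lborel"
        using borel_measurable_integrable[OF h[unfolded set_integrable_def]] by measurable
      hence m: "?d \<in> borel_measurable lborel" by (simp add: scaleR_diff_right)
      have "integrable lborel ?d" using m fin by (intro integrableI_bounded) auto
      hence "set_integrable lborel {0..z} (\<lambda>s. h (x, y, s) - H (x, y, s))" by (simp add: set_integrable_def)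
      from set_integral_diff(1)[OF h this] show False using False by simp
    qed
    with le have "(\<integral>\<^sup>+s\<in>{0<..<a}. ennreal (cmod (h (x, y, s) - H (x, y, s))) \<partial>lborel) = \<infinity>" by (simp add: top_unique)
    thus ?thesis by simp
  qed
qed

lemma cont_vert:
  assumes "continuous_on UNIV (f :: pt \<Rightarrow> complex)" shows "continuous_on S (\<lambda>s. f (x, y, s))"
  by (rule continuous_on_compose2[OF assms]) (auto intro!: continuous_intros)

text \<open>By Tonelli, integrating the line-wise bound over z costs a factor a, so the vertical
  primitive is Lipschitz in L^1 with constant a.\<close>

lemma L1conv_vint:
  assumes a: "a > 0" and c: "\<And>n. continuous_on UNIV (fn n)" and C: "L1conv a fn f"
  shows "L1conv a (\<lambda>n. vint (fn n)) (vint f)"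
proof -
  have m[measurable]: "fn n \<in> borel_measurable borel" "f \<in> borel_measurable borel" for n using C by (simp_all add: L1conv_def)
  have vm[measurable]: "vint (fn n) \<in> borel_measurable borel" "vint f \<in> borel_measurable borel" for n by (rule vint_borel[OF m(1)], rule vint_borel[OF m(2)])
  note [measurable] = Om_borel[of a]
  have int: "set_integrable lborel (Om a) (vint (fn n))" for n
  proof -
    obtain K where K: "\<And>x y z. x \<in> {0..2*pi} \<Longrightarrow> y \<in> {0..2*pi} \<Longrightarrow> z \<in> {0..a} \<Longrightarrow> norm (fn n (x, y, z)) \<le> K" using cont_Om_bounded[OF c[of n], of a] by blast
    have K0: "K \<ge> 0" using order_trans[OF norm_ge_zero K[of 0 0 0]] a by simp
    show ?thesis by (rule Om_bounded_borel[where K="K * a"]) (auto simp: Om_def intro!: vint_bound K K0 vm)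
  qed
  have le: "L1d a (vint (fn n)) (vint f) \<le> ennreal a * L1d a (fn n) f" for n
  proof -
    let ?I = "indicator {0..2*pi} :: real \<Rightarrow> ennreal" and ?J = "indicator {0<..<a} :: real \<Rightarrow> ennreal"
    let ?g = "\<lambda>x y. \<integral>\<^sup>+s\<in>{0<..<a}. ennreal (cmod (fn n (x, y, s) - f (x, y, s))) \<partial>lborel"
    have split: "L1d a F G = (\<integral>\<^sup>+x. \<integral>\<^sup>+y. \<integral>\<^sup>+z. ?I x * (?I y * (ennreal (cmod (F (x, y, z) - G (x, y, z))) * ?J z)) \<partial>lborel \<partial>lborel \<partial>lborel)"
      if [measurable]: "F \<in> borel_measurable borel" "G \<in> borel_measurable borel" for F G
      unfolding L1d_def by (subst nn_integral_iterated, measurable) (simp add: Om_def indicator_times mult_ac)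
    have pm: "(\<lambda>z. F (x, y, z)) \<in> borel_measurable lborel" if "F \<in> borel_measurable borel" for F :: "pt \<Rightarrow> complex" and x y
    proof -
      have "(\<lambda>s :: real. (x, y, s)) \<in> borel_measurable borel" by (intro borel_measurable_continuous_onI continuous_intros)
      from measurable_compose[OF this that] show ?thesis by simp
    qed
    note [measurable] = pm[OF m(1)] pm[OF m(2)] pm[OF vm(1)] pm[OF vm(2)]
    have "L1d a (vint (fn n)) (vint f) \<le> (\<integral>\<^sup>+x. \<integral>\<^sup>+y. \<integral>\<^sup>+z. ?I x * (?I y * (?g x y * ?J z)) \<partial>lborel \<partial>lborel \<partial>lborel)"
      unfolding split[OF vm(1) vm(2)]
    proof (intro nn_integral_mono mult_left_mono)
      fix x y z
      show "ennreal (cmod (vint (fn n) (x, y, z) - vint f (x, y, z))) * ?J z \<le> ?g x y * ?J z"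
      proof (cases "z \<in> {0<..<a}")
        case True
        have "set_integrable lborel {0..z} (\<lambda>s. fn n (x, y, s))" by (rule borel_integrable_atLeastAtMost'[OF cont_vert[OF c]])
        from vint_diff_bound[OF m(2) this, of a] True show ?thesis by simp
      qed simp
    qed auto
    also have "\<dots> = (\<integral>\<^sup>+x. \<integral>\<^sup>+y. ennreal a * (\<integral>\<^sup>+z. ?I x * (?I y * (ennreal (cmod (fn n (x, y, z) - f (x, y, z))) * ?J z)) \<partial>lborel) \<partial>lborel \<partial>lborel)"
    proof (intro nn_integral_cong)
      fix x y
      have "(\<integral>\<^sup>+z. ?I x * (?I y * (?g x y * ?J z)) \<partial>lborel) = ?I x * ?I y * ?g x y * (\<integral>\<^sup>+z. ?J z \<partial>lborel)"
        by (subst nn_integral_cmult[symmetric]) (simp_all add: mult_ac)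
      also have "(\<integral>\<^sup>+z. ?J z \<partial>lborel) = ennreal a" using a by simp
      also have "?I x * ?I y * ?g x y = (\<integral>\<^sup>+z. ?I x * (?I y * (ennreal (cmod (fn n (x, y, z) - f (x, y, z))) * ?J z)) \<partial>lborel)"
        by (subst nn_integral_cmult[symmetric]) (measurable, simp add: mult_ac)
      finally show "(\<integral>\<^sup>+z. ?I x * (?I y * (?g x y * ?J z)) \<partial>lborel) = ennreal a * (\<integral>\<^sup>+z. ?I x * (?I y * (ennreal (cmod (fn n (x, y, z) - f (x, y, z))) * ?J z)) \<partial>lborel)"
        by (simp add: mult_ac)
    qed
    also have "\<dots> = (\<integral>\<^sup>+x. \<integral>\<^sup>+y. \<integral>\<^sup>+z. ennreal a * (ennreal (cmod (fn n (x, y, z) - f (x, y, z))) * indicator (Om a) (x, y, z)) \<partial>lborel \<partial>lborel \<partial>lborel)"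
    proof (intro nn_integral_cong)
      fix x y
      show "ennreal a * (\<integral>\<^sup>+z. ?I x * (?I y * (ennreal (cmod (fn n (x, y, z) - f (x, y, z))) * ?J z)) \<partial>lborel)
        = (\<integral>\<^sup>+z. ennreal a * (ennreal (cmod (fn n (x, y, z) - f (x, y, z))) * indicator (Om a) (x, y, z)) \<partial>lborel)"
        by (subst nn_integral_cmult[symmetric]) (measurable, simp add: Om_def indicator_times mult_ac)
    qed
    also have "\<dots> = (\<integral>\<^sup>+p. ennreal a * (ennreal (cmod (fn n p - f p)) * indicator (Om a) p) \<partial>lborel)"
      by (rule nn_integral_iterated[symmetric]) measurable
    also have "\<dots> = ennreal a * L1d a (fn n) f"
      unfolding L1d_def by (rule nn_integral_cmult) measurable
    finally show ?thesis .
  qed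
  have "(\<lambda>n. ennreal a * L1d a (fn n) f) \<longlonglongrightarrow> ennreal a * 0" using C by (intro ennreal_tendsto_cmult) (simp_all add: L1conv_def)
  hence "(\<lambda>n. L1d a (vint (fn n)) (vint f)) \<longlonglongrightarrow> 0"
    by (intro tendsto_sandwich[of "\<lambda>n. 0" "\<lambda>n. L1d a (vint (fn n)) (vint f)" sequentially "\<lambda>n. ennreal a * L1d a (fn n) f" 0]) (use le in auto)
  thus ?thesis unfolding L1conv_def using vm int by blast
qed

section \<open>Integration by parts against test fields\<close>

lemma integral_zero_snd:
  fixes g :: "'a::euclidean_space \<times> 'b::euclidean_space \<Rightarrow> complex"
  assumes i: "integrable lborel g" and z: "\<And>x. (\<integral>q. g (x, q) \<partial>lborel) = 0"
  shows "integral\<^sup>L lborel g = 0"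
proof -
  have "integrable (lborel \<Otimes>\<^sub>M lborel) g" using i by (simp add: lborel_prod)
  from lborel_pair.integral_fst'[OF this] show ?thesis unfolding z by (simp add: lborel_prod)
qed

lemma integral_zero_fst:
  fixes g :: "'a::euclidean_space \<times> 'b::euclidean_space \<Rightarrow> complex"
  assumes i: "integrable lborel g" and z: "\<And>q. (\<integral>x. g (x, q) \<partial>lborel) = 0"
  shows "integral\<^sup>L lborel g = 0"
proof -
  have "integrable (lborel \<Otimes>\<^sub>M lborel) (case_prod (\<lambda>x q. g (x, q)))" using i by (simp add: lborel_prod)
  from lborel_pair.integral_snd[OF this] show ?thesis unfolding z by (simp add: lborel_prod)
qed

text \<open>A class closed under the algebra occurring in the forms and contained in L^1 of the
  cell; it makes each splitting of an integral legitimate by rules.\<close>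

definition bdd_meas :: "real \<Rightarrow> (pt \<Rightarrow> complex) \<Rightarrow> bool" where
  "bdd_meas a F \<longleftrightarrow> F \<in> borel_measurable borel \<and> (\<exists>K. \<forall>p\<in>Om a. cmod (F p) \<le> K)"

lemma bdd_meas_int: "bdd_meas a F \<Longrightarrow> set_integrable lborel (Om a) F"
  unfolding bdd_meas_def using Om_bounded_borel by blast

lemma bdd_meas_cont: "continuous_on UNIV F \<Longrightarrow> bdd_meas a F"
proof -
  assume c: "continuous_on UNIV F"
  obtain K where K: "\<And>x y z. x \<in> {0..2*pi} \<Longrightarrow> y \<in> {0..2*pi} \<Longrightarrow> z \<in> {0..a} \<Longrightarrow> norm (F (x, y, z)) \<le> K" using cont_Om_bounded[OF c, of a] by blast
  show "bdd_meas a F" unfolding bdd_meas_def using borel_measurable_continuous_onI[OF c] by (auto simp: Om_def intro!: exI[of _ K] K)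
qed

lemma bdd_meas_add: "bdd_meas a F \<Longrightarrow> bdd_meas a G \<Longrightarrow> bdd_meas a (\<lambda>p. F p + G p)"
proof -
  assume A: "bdd_meas a F" "bdd_meas a G"
  then obtain K L where "\<And>p. p\<in>Om a \<Longrightarrow> cmod (F p) \<le> K" "\<And>p. p\<in>Om a \<Longrightarrow> cmod (G p) \<le> L" unfolding bdd_meas_def by blast
  hence "\<forall>p\<in>Om a. cmod (F p + G p) \<le> K + L" by (blast intro: norm_triangle_mono)
  thus ?thesis using A unfolding bdd_meas_def by (blast intro: borel_measurable_add)
qed

lemma bdd_meas_mult: "bdd_meas a F \<Longrightarrow> bdd_meas a G \<Longrightarrow> bdd_meas a (\<lambda>p. F p * G p)"
proof -
  assume A: "bdd_meas a F" "bdd_meas a G"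
  then obtain K L where KL: "\<And>p. p\<in>Om a \<Longrightarrow> cmod (F p) \<le> K" "\<And>p. p\<in>Om a \<Longrightarrow> cmod (G p) \<le> L" unfolding bdd_meas_def by blast
  have "\<forall>p\<in>Om a. cmod (F p * G p) \<le> K * L"
  proof
    fix p assume p: "p \<in> Om a"
    have "0 \<le> K" using order_trans[OF norm_ge_zero KL(1)[OF p]] .
    thus "cmod (F p * G p) \<le> K * L" unfolding norm_mult by (intro mult_mono KL p) simp_all
  qed
  thus ?thesis using A unfolding bdd_meas_def by (blast intro: borel_measurable_times)
qed

lemma bdd_meas_cnj: "bdd_meas a F \<Longrightarrow> bdd_meas a (\<lambda>p. cnj (F p))"
proof -
  assume A: "bdd_meas a F"
  have "cnj \<in> borel_measurable borel" by (intro borel_measurable_continuous_onI continuous_intros)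
  from measurable_compose[OF _ this, of F borel] show ?thesis using A unfolding bdd_meas_def by simp
qed

lemma bdd_meas_const: "bdd_meas a (\<lambda>p. c)" by (rule bdd_meas_cont) simp

lemma bdd_meas_minus: "bdd_meas a F \<Longrightarrow> bdd_meas a (\<lambda>p. - F p)" unfolding bdd_meas_def by simp

lemma bdd_meas_vint:
  assumes a: "a > 0" and H: "continuous_on UNIV H" shows "bdd_meas a (vint H)"
proof -
  obtain K where K: "\<And>x y z. x \<in> {0..2*pi} \<Longrightarrow> y \<in> {0..2*pi} \<Longrightarrow> z \<in> {0..a} \<Longrightarrow> norm (H (x, y, z)) \<le> K" using cont_Om_bounded[OF H, of a] by blast
  have K0: "K \<ge> 0" using order_trans[OF norm_ge_zero K[of 0 0 0]] a by simp
  have "\<forall>p\<in>Om a. cmod (vint H p) \<le> K * a" by (auto simp: Om_def intro!: vint_bound K K0)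
  thus ?thesis unfolding bdd_meas_def using vint_borel[OF borel_measurable_continuous_onI[OF H]] by blast
qed

lemma intOm_add: "bdd_meas a F \<Longrightarrow> bdd_meas a G \<Longrightarrow> intOm a (\<lambda>p. F p + G p) = intOm a F + intOm a G"
  unfolding intOm_def by (intro set_integral_add bdd_meas_int)

lemma intOm_mult: "intOm a (\<lambda>p. c * F p) = c * intOm a F"
  unfolding intOm_def by (rule set_integral_mult_right)

lemma intOm_minus: "bdd_meas a F \<Longrightarrow> - intOm a F = intOm a (\<lambda>p. - F p)"
  using intOm_mult[of a "-1" F] by simp

lemma bdd_meas_section:
  assumes F: "bdd_meas a F" and m: "c \<in> borel_measurable borel" and S: "S \<in> sets borel" "bounded S" and c: "\<And>s. s \<in> S \<Longrightarrow> c s \<in> Om a"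
  shows "set_integrable lborel (S :: 'a::euclidean_space set) (\<lambda>s. F (c s))"
proof -
  obtain K where K: "\<And>p. p\<in>Om a \<Longrightarrow> cmod (F p) \<le> K" using F unfolding bdd_meas_def by blast
  have "(\<lambda>s. F (c s)) \<in> borel_measurable borel" using measurable_compose[OF m, of F borel] F unfolding bdd_meas_def by blast
  thus ?thesis unfolding set_integrable_def
    by (intro integrableI_bounded_set_indicator[where B=K]) (use K c S emeasure_bounded_finite[OF S(2)] in auto)
qed

lemma LINT_0: "set_integrable lborel S (f :: 'a::euclidean_space \<Rightarrow> complex) \<Longrightarrow> (f has_integral 0) S \<Longrightarrow> (\<integral>x. indicat_real S x *\<^sub>R f x \<partial>lborel) = 0"
  using set_borel_integral_eq_integral(2)[of S f] integral_unique[of f 0 S] by (simp add: set_lebesgue_integral_def)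

lemma intOm_zero_X:
  assumes F: "bdd_meas a F" and z: "\<And>y z. ((\<lambda>x. F (x, y, z)) has_integral 0) {0..2*pi}"
  shows "intOm a F = 0"
  unfolding intOm_def set_lebesgue_integral_def
proof (rule integral_zero_fst)
  show "integrable lborel (\<lambda>p. indicat_real (Om a) p *\<^sub>R F p)" using bdd_meas_int[OF F] by (simp add: set_integrable_def)
  fix q :: "real \<times> real"
  obtain y z where q: "q = (y, z)" by (cases q)
  show "(\<integral>x. indicat_real (Om a) (x, q) *\<^sub>R F (x, q) \<partial>lborel) = 0"
  proof (cases "q \<in> {0..2*pi} \<times> {0<..<a}")
    case True
    have "set_integrable lborel {0..2*pi} (\<lambda>x. F (x, q))"
      by (rule bdd_meas_section[OF F]) (use True in \<open>auto simp: Om_def intro!: borel_measurable_continuous_onI continuous_intros\<close>)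
    from LINT_0[OF this] z have "(\<integral>x. indicat_real {0..2*pi} x *\<^sub>R F (x, q) \<partial>lborel) = 0" unfolding q by blast
    moreover have "indicat_real (Om a) (x, q) = indicat_real {0..2*pi} x" for x using True by (simp add: Om_def indicator_def)
    ultimately show ?thesis by simp
  qed (simp add: Om_def)
qed

text \<open>Common first reduction for the y- and z-versions, which then integrate over the (y,z)
  section in the appropriate order. Measurability and integrability of the section are handed over
  as premises.\<close>

lemma intOm_zero_YZ:
  assumes F: "bdd_meas a F" and z: "\<And>x. ((\<lambda>q. indicat_real ({0..2*pi} \<times> {0<..<a}) q *\<^sub>R F (x, q)) \<in> borel_measurable lborel \<Longrightarrow>
       integrable lborel (\<lambda>q. indicat_real ({0..2*pi} \<times> {0<..<a}) q *\<^sub>R F (x, q)) \<Longrightarrow> x \<in> {0..2*pi} \<Longrightarrow>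
       (\<integral>q. indicat_real ({0..2*pi} \<times> {0<..<a}) q *\<^sub>R F (x, q) \<partial>lborel) = 0)"
  shows "intOm a F = 0"
  unfolding intOm_def set_lebesgue_integral_def
proof (rule integral_zero_snd)
  show "integrable lborel (\<lambda>p. indicat_real (Om a) p *\<^sub>R F p)" using bdd_meas_int[OF F] by (simp add: set_integrable_def)
  fix x :: real
  show "(\<integral>q. indicat_real (Om a) (x, q) *\<^sub>R F (x, q) \<partial>lborel) = 0"
  proof (cases "x \<in> {0..2*pi}")
    case True
    have "set_integrable lborel ({0..2*pi} \<times> {0<..<a}) (\<lambda>q. F (x, q))"
    proof (rule bdd_meas_section[OF F])
      show "{0..2*pi} \<times> {0<..<a} \<in> sets borel" by (intro Times_borel) auto
      show "bounded ({0..2*pi} \<times> {0<..<a})" by (intro bounded_Times) auto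
      show "(\<lambda>q. (x, q)) \<in> borel_measurable borel" by (intro borel_measurable_continuous_onI continuous_intros)
    qed (use True in \<open>auto simp: Om_def\<close>)
    hence i: "integrable lborel (\<lambda>q. indicat_real ({0..2*pi} \<times> {0<..<a}) q *\<^sub>R F (x, q))" by (simp add: set_integrable_def)
    have "indicat_real (Om a) (x, q) = indicat_real ({0..2*pi} \<times> {0<..<a}) q" for q using True by (simp add: Om_def indicator_def)
    thus ?thesis using z[OF borel_measurable_integrable[OF i] i True] by simp
  next
    case False
    hence "indicat_real (Om a) (x, q) = 0" for q by (auto simp: Om_def indicator_def)
    thus ?thesis by simp
  qed
qed

lemma intOm_zero_Y:
  assumes F: "bdd_meas a F" and z: "\<And>x z. ((\<lambda>y. F (x, y, z)) has_integral 0) {0..2*pi}"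
  shows "intOm a F = 0"
proof (rule intOm_zero_YZ[OF F], rule integral_zero_fst)
  fix x z :: real assume x: "x \<in> {0..2*pi}"
  show "(\<integral>y. indicat_real ({0..2*pi} \<times> {0<..<a}) (y, z) *\<^sub>R F (x, y, z) \<partial>lborel) = 0"
  proof (cases "z \<in> {0<..<a}")
    case True
    have "set_integrable lborel {0..2*pi} (\<lambda>y. F (x, y, z))"
      by (rule bdd_meas_section[OF F]) (use x True in \<open>auto simp: Om_def intro!: borel_measurable_continuous_onI continuous_intros\<close>)
    from LINT_0[OF this z] show ?thesis using True by (simp add: indicator_times)
  qed simp
qed

lemma intOm_zero_Z:
  assumes F: "bdd_meas a F" and z: "\<And>x y. ((\<lambda>z. F (x, y, z)) has_integral 0) {0..a}"
  shows "intOm a F = 0"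
proof (rule intOm_zero_YZ[OF F], rule integral_zero_snd)
  fix x y :: real assume x: "x \<in> {0..2*pi}"
  show "(\<integral>z. indicat_real ({0..2*pi} \<times> {0<..<a}) (y, z) *\<^sub>R F (x, y, z) \<partial>lborel) = 0"
  proof (cases "y \<in> {0..2*pi}")
    case True
    have "set_integrable lborel {0<..<a} (\<lambda>z. F (x, y, z))"
      by (rule bdd_meas_section[OF F]) (use x True in \<open>auto simp: Om_def intro!: borel_measurable_continuous_onI continuous_intros\<close>)
    from LINT_0[OF this] z show ?thesis using True by (simp add: indicator_times has_integral_Icc_iff_Ioo)
  next
    case False
    hence "indicat_real ({0..2*pi} \<times> {0<..<a}) (y, z) = 0" for z by (auto simp: indicator_def)
    thus ?thesis by simp
  qed
qed

lemma pd_partial: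
  assumes f: "f differentiable (at (x, y, z))"
  shows "((\<lambda>x. f (x, y, z)) has_vector_derivative pd f dX (x, y, z)) (at x within S)"
    "((\<lambda>y. f (x, y, z)) has_vector_derivative pd f dY (x, y, z)) (at y within S)"
    "((\<lambda>z. f (x, y, z)) has_vector_derivative pd f dZ (x, y, z)) (at z within S)"
proof -
  let ?D = "frechet_derivative f (at (x, y, z))"
  have D: "(f has_derivative ?D) (at (x, y, z))" using f frechet_derivative_works by blast
  have sc: "?D (h *\<^sub>R d) = h *\<^sub>R ?D d" for h d using linear_scale[OF has_derivative_linear[OF D]] .
  have d: "(h, 0, 0) = h *\<^sub>R dX" "(0, h, 0) = h *\<^sub>R dY" "(0, 0, h) = h *\<^sub>R dZ" for h by (simp_all add: dX_def dY_def dZ_def)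
  have "((\<lambda>x. (x, y, z)) has_derivative (\<lambda>h. (h, 0, 0))) (at x within S)" by (intro has_derivative_Pair has_derivative_ident has_derivative_const)
  from has_derivative_compose[OF this D] show "((\<lambda>x. f (x, y, z)) has_vector_derivative pd f dX (x, y, z)) (at x within S)"
    unfolding has_vector_derivative_def d sc pd_def .
  have "((\<lambda>y. (x, y, z)) has_derivative (\<lambda>h. (0, h, 0))) (at y within S)" by (intro has_derivative_Pair has_derivative_ident has_derivative_const)
  from has_derivative_compose[OF this D] show "((\<lambda>y. f (x, y, z)) has_vector_derivative pd f dY (x, y, z)) (at y within S)"
    unfolding has_vector_derivative_def d sc pd_def .
  have "((\<lambda>z. (x, y, z)) has_derivative (\<lambda>h. (0, 0, h))) (at z within S)" by (intro has_derivative_Pair has_derivative_ident has_derivative_const)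
  from has_derivative_compose[OF this D] show "((\<lambda>z. f (x, y, z)) has_vector_derivative pd f dZ (x, y, z)) (at z within S)"
    unfolding has_vector_derivative_def d sc pd_def .
qed

lemma smooth_cont:
  assumes "smooth f"
  shows "continuous_on UNIV f" "f differentiable (at p)" "continuous_on UNIV (pd f dX)" "continuous_on UNIV (pd f dY)" "continuous_on UNIV (pd f dZ)"
proof -
  have "Ck 0 f" "Ck (Suc 0) f" using assms unfolding smooth_def by blast+
  thus "continuous_on UNIV f" "f differentiable (at p)" "continuous_on UNIV (pd f dX)" "continuous_on UNIV (pd f dY)" "continuous_on UNIV (pd f dZ)"
    unfolding Ck.simps by blast+
qed

lemma Ef_wave: "Ef \<zeta> = wave (of_int (fst \<zeta>), of_int (snd \<zeta>), 0)"
  unfolding Ef_def wave_def cis_conv_exp by (auto simp: fun_eq_iff)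

lemma Ef_partial:
  "((\<lambda>x. Ef \<zeta> (x, y, z)) has_vector_derivative \<i> * of_int (fst \<zeta>) * Ef \<zeta> (x, y, z)) (at x within S)"
  "((\<lambda>y. Ef \<zeta> (x, y, z)) has_vector_derivative \<i> * of_int (snd \<zeta>) * Ef \<zeta> (x, y, z)) (at y within S)"
proof -
  have d: "Ef \<zeta> differentiable (at p)" for p unfolding Ef_wave by (rule differentiableI[OF wave_deriv])
  have p: "pd (Ef \<zeta>) d p = \<i> * of_real (inner (of_int (fst \<zeta>), of_int (snd \<zeta>), 0) d) * Ef \<zeta> p" for d p
    unfolding Ef_wave pd_def frechet_derivative_at[OF wave_deriv, symmetric] ..
  show "((\<lambda>x. Ef \<zeta> (x, y, z)) has_vector_derivative \<i> * of_int (fst \<zeta>) * Ef \<zeta> (x, y, z)) (at x within S)"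
    using pd_partial(1)[OF d, where x=x and y=y and z=z and S=S] unfolding p by (simp add: dX_def)
  show "((\<lambda>y. Ef \<zeta> (x, y, z)) has_vector_derivative \<i> * of_int (snd \<zeta>) * Ef \<zeta> (x, y, z)) (at y within S)"
    using pd_partial(2)[OF d, where x=x and y=y and z=z and S=S] unfolding p by (simp add: dY_def)
qed

section \<open>Exact derivatives and their vanishing integrals\<close>

lemma cont_z: "continuous_on UNIV (f :: real \<Rightarrow> complex) \<Longrightarrow> continuous_on S (\<lambda>p :: pt. f (snd (snd p)))"
  by (rule continuous_on_compose2, assumption, intro continuous_on_snd continuous_on_id) simp

text \<open>Boundedness is kept together with the vanishing integral, so that these functions form a
  vector space and a long integrand can be assembled from exact pieces.\<close>

definition int_null :: "real \<Rightarrow> (pt \<Rightarrow> complex) \<Rightarrow> bool" where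
  "int_null a F \<longleftrightarrow> bdd_meas a F \<and> intOm a F = 0"

lemma int_null_add: "int_null a F \<Longrightarrow> int_null a G \<Longrightarrow> int_null a (\<lambda>p. F p + G p)"
  unfolding int_null_def by (simp add: bdd_meas_add intOm_add)

lemma int_null_scale: "int_null a F \<Longrightarrow> int_null a (\<lambda>p. c * F p)"
  unfolding int_null_def by (simp add: bdd_meas_mult bdd_meas_const intOm_mult)

text \<open>The integrand is the x-derivative of the product of the horizontal exponential, A and
  the conjugate of f; periodicity makes its integral vanish.\<close>

lemma exact_X:
  assumes f: "adm a f" and A: "continuous_on UNIV A"
  shows "int_null a (\<lambda>p. Ef \<zeta> p * A (snd (snd p)) * (\<i> * of_int (fst \<zeta>) * cnj (f p) + cnj (pd f dX p)))" (is "int_null a ?F")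
proof -
  have s: "smooth f" using f by (simp add: adm_def)
  have b: "bdd_meas a ?F" by (intro bdd_meas_cont continuous_intros Ef_cont cont_z A smooth_cont[OF s])
  have "((\<lambda>x. ?F (x, y, z)) has_integral 0) {0..2*pi}" for y z
  proof -
    let ?P = "\<lambda>x. Ef \<zeta> (x, y, z) * (A z * cnj (f (x, y, z)))"
    have "((\<lambda>x. ?F (x, y, z)) has_integral ?P (2 * pi) - ?P 0) {0..2*pi}"
    proof (rule fundamental_theorem_of_calculus)
      fix x
      have "((\<lambda>x. cnj (f (x, y, z))) has_vector_derivative cnj (pd f dX (x, y, z))) (at x within {0..2*pi})"
        by (rule bounded_linear.has_vector_derivative[OF bounded_linear_cnj pd_partial(1)[OF smooth_cont(2)[OF s]]])
      hence "((\<lambda>x. A z * cnj (f (x, y, z))) has_vector_derivative A z * cnj (pd f dX (x, y, z))) (at x within {0..2*pi})"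
        by (rule has_vector_derivative_mult_right)
      from has_vector_derivative_mult[OF Ef_partial(1) this]
      show "(?P has_vector_derivative ?F (x, y, z)) (at x within {0..2*pi})" by (simp add: algebra_simps)
    qed simp
    moreover have "?P (2 * pi) = ?P 0"
    proof -
      have "f (0 + 2 * pi, y, z) = f (0, y, z)" using f unfolding adm_def by blast
      thus ?thesis using Ef_periodic(1)[of \<zeta> 0 y z] by simp
    qed
    ultimately show ?thesis by simp
  qed
  from intOm_zero_X[OF b this] b show ?thesis unfolding int_null_def by blast
qed

lemma exact_Y:
  assumes f: "adm a f" and A: "continuous_on UNIV A"
  shows "int_null a (\<lambda>p. Ef \<zeta> p * A (snd (snd p)) * (\<i> * of_int (snd \<zeta>) * cnj (f p) + cnj (pd f dY p)))" (is "int_null a ?F")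
proof -
  have s: "smooth f" using f by (simp add: adm_def)
  have b: "bdd_meas a ?F" by (intro bdd_meas_cont continuous_intros Ef_cont cont_z A smooth_cont[OF s])
  have "((\<lambda>y. ?F (x, y, z)) has_integral 0) {0..2*pi}" for x z
  proof -
    let ?P = "\<lambda>y. Ef \<zeta> (x, y, z) * (A z * cnj (f (x, y, z)))"
    have "((\<lambda>y. ?F (x, y, z)) has_integral ?P (2 * pi) - ?P 0) {0..2*pi}"
    proof (rule fundamental_theorem_of_calculus)
      fix y
      have "((\<lambda>y. cnj (f (x, y, z))) has_vector_derivative cnj (pd f dY (x, y, z))) (at y within {0..2*pi})"
        by (rule bounded_linear.has_vector_derivative[OF bounded_linear_cnj pd_partial(2)[OF smooth_cont(2)[OF s]]])
      hence "((\<lambda>y. A z * cnj (f (x, y, z))) has_vector_derivative A z * cnj (pd f dY (x, y, z))) (at y within {0..2*pi})"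
        by (rule has_vector_derivative_mult_right)
      from has_vector_derivative_mult[OF Ef_partial(2) this]
      show "(?P has_vector_derivative ?F (x, y, z)) (at y within {0..2*pi})" by (simp add: algebra_simps)
    qed simp
    moreover have "?P (2 * pi) = ?P 0"
    proof -
      have "f (x, 0 + 2 * pi, z) = f (x, 0, z)" using f unfolding adm_def by blast
      thus ?thesis using Ef_periodic(2)[of \<zeta> x 0 z] by simp
    qed
    ultimately show ?thesis by simp
  qed
  from intOm_zero_Y[OF b this] b show ?thesis unfolding int_null_def by blast
qed

text \<open>The integrand is a z-derivative, B being A', and the boundary terms vanish with F. F is
  kept general because it is used for test fields and also for the vertical primitive of their
  divergence, which is zero at z = a by the constraint.\<close>

lemma exact_Z:
  assumes a: "a > 0" and F: "bdd_meas a F" "bdd_meas a G" and A: "continuous_on UNIV A" "continuous_on UNIV B"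
    and d: "\<And>x y z. z \<in> {0..a} \<Longrightarrow> ((\<lambda>z. F (x, y, z)) has_vector_derivative G (x, y, z)) (at z within {0..a})"
    and dA: "\<And>z. z \<in> {0..a} \<Longrightarrow> (A has_vector_derivative B z) (at z within {0..a})"
    and e: "\<And>x y. F (x, y, 0) = 0" "\<And>x y. F (x, y, a) = 0"
  shows "int_null a (\<lambda>p. Ef \<zeta> p * (A (snd (snd p)) * cnj (G p) + B (snd (snd p)) * cnj (F p)))" (is "int_null a ?F")
proof -
  have b: "bdd_meas a ?F" by (intro bdd_meas_mult bdd_meas_add bdd_meas_cnj F) (intro bdd_meas_cont Ef_cont cont_z A)+
  have "((\<lambda>z. ?F (x, y, z)) has_integral 0) {0..a}" for x y
  proof -
    let ?P = "\<lambda>z. Ef \<zeta> (x, y, 0) * (A z * cnj (F (x, y, z)))"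
    have "((\<lambda>z. ?F (x, y, z)) has_integral ?P a - ?P 0) {0..a}"
    proof (rule fundamental_theorem_of_calculus)
      fix z assume z: "z \<in> {0..a}"
      have "((\<lambda>z. cnj (F (x, y, z))) has_vector_derivative cnj (G (x, y, z))) (at z within {0..a})"
        by (rule bounded_linear.has_vector_derivative[OF bounded_linear_cnj d[OF z]])
      from has_vector_derivative_mult_right[OF has_vector_derivative_mult[OF dA[OF z] this], of "Ef \<zeta> (x, y, 0)"]
      show "(?P has_vector_derivative ?F (x, y, z)) (at z within {0..a})" by (simp add: Ef_def)
    qed (use a in simp)
    thus ?thesis by (simp add: e)
  qed
  from intOm_zero_Z[OF b this] b show ?thesis unfolding int_null_def by blast
qed

text \<open>For negative z the interval is empty and the integral 0, so the primitive extends
  continuously to the line, as needed for functions defined on all of R^3.\<close>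

lemma cont_prim:
  fixes f :: "real \<Rightarrow> complex"
  assumes f: "continuous_on UNIV f" shows "continuous_on UNIV (\<lambda>z. integral {0..z} f)"
proof (rule cont_UNIV_Icc)
  fix l b :: real
  have eq: "integral {0..z} f = integral {0..max 0 z} f" for z by (cases "z \<ge> 0") (auto simp: max_def)
  have c: "continuous_on {0..max 0 b} (\<lambda>z. integral {0..z} f)"
    by (rule integral_0z_cont[OF continuous_on_subset[OF f]]) simp
  have "continuous_on {l..b} (\<lambda>z. integral {0..max 0 z} f)"
    by (rule continuous_on_compose2[OF c]) (auto intro!: continuous_intros)
  thus "continuous_on {l..b} (\<lambda>z. integral {0..z} f)" unfolding eq[symmetric] .
qed

section \<open>The weak formulation on the closure of the smooth test fields\<close>

lemma vint_HK:
  assumes "continuous_on UNIV H" shows "vint H (x, y, z) = integral {0..z} (\<lambda>s. H (x, y, s))"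
  unfolding vint_def fst_conv snd_conv
  by (rule set_borel_integral_eq_integral(2)[OF borel_integrable_atLeastAtMost'[OF cont_vert[OF assms]]])

lemma wfun_vint: "wfun Gu Gv = (\<lambda>p. - vint (\<lambda>q. fst (Gu q) + fst (snd (Gv q))) p)"
  by (auto simp: wfun_def vint_def fun_eq_iff)

lemma L1conv_multb: "bdd_meas a P \<Longrightarrow> L1conv a fn f \<Longrightarrow> L1conv a (\<lambda>n p. P p * cnj (fn n p)) (\<lambda>p. P p * cnj (f p))"
  unfolding bdd_meas_def using L1conv_mult by blast

lemma L2d_mono:
  assumes "\<And>p. norm (f p - g p) \<le> norm (F p - G p)" shows "L2d a f g \<le> L2d a F G"
  unfolding L2d_def
proof (rule nn_integral_mono)
  fix p
  have "ennreal ((norm (f p - g p))\<^sup>2) \<le> ennreal ((norm (F p - G p))\<^sup>2)" by (intro ennreal_leI power_mono assms norm_ge_zero)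
  thus "ennreal ((norm (f p - g p))\<^sup>2) * indicator (Om a) p \<le> ennreal ((norm (F p - G p))\<^sup>2) * indicator (Om a) p"
    by (rule mult_right_mono) simp
qed

lemma L2d_mono_tendsto:
  assumes "\<And>n p. norm (f n p - g p) \<le> norm (F n p - G p)" and L: "(\<lambda>n. L2d a (F n) G) \<longlonglongrightarrow> 0"
  shows "(\<lambda>n. L2d a (f n) g) \<longlonglongrightarrow> 0"
  by (rule tendsto_sandwich[of "\<lambda>n. 0" "\<lambda>n. L2d a (f n) g" sequentially "\<lambda>n. L2d a (F n) G" 0])
    (use L2d_mono[of "f _" g "F _" G a, OF assms(1)] L in auto)

lemma L1conv_grad:
  assumes s: "\<And>n. smooth (\<phi> n)" and G: "G \<in> borel_measurable borel" and L: "(\<lambda>n. L2d a (grad (\<phi> n)) G) \<longlonglongrightarrow> 0"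
  shows "L1conv a (\<lambda>n. pd (\<phi> n) dX) (\<lambda>p. fst (G p))" "L1conv a (\<lambda>n. pd (\<phi> n) dY) (\<lambda>p. fst (snd (G p)))" "L1conv a (\<lambda>n. pd (\<phi> n) dZ) (\<lambda>p. snd (snd (G p)))"
proof -
  have c: "(\<lambda>x. fst x) \<in> borel_measurable borel" "(\<lambda>x. fst (snd x)) \<in> borel_measurable borel" "(\<lambda>x. snd (snd x)) \<in> borel_measurable borel"
    for x :: "complex \<times> complex \<times> complex"
    by (intro borel_measurable_continuous_onI continuous_intros)+
  have m: "(\<lambda>p. fst (G p)) \<in> borel_measurable borel" "(\<lambda>p. fst (snd (G p))) \<in> borel_measurable borel" "(\<lambda>p. snd (snd (G p))) \<in> borel_measurable borel"
    using measurable_compose[OF G c(1)] measurable_compose[OF G c(2)] measurable_compose[OF G c(3)] .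
  have n: "norm (fst x) \<le> norm x" "norm (fst (snd x)) \<le> norm x" "norm (snd (snd x)) \<le> norm x" for x :: "complex \<times> complex \<times> complex"
    using norm_fst_le[of "fst x" "snd x"] norm_snd_le[of "snd x" "fst x"] norm_fst_le[of "fst (snd x)" "snd (snd x)"] norm_snd_le[of "snd (snd x)" "fst (snd x)"]
    by simp_all
  show "L1conv a (\<lambda>n. pd (\<phi> n) dX) (\<lambda>p. fst (G p))"
    by (rule L1conv_L2[OF smooth_cont(3)[OF s] m(1) L2d_mono_tendsto[OF _ L]]) (use n(1)[of "grad _ _ - G _"] in \<open>simp add: grad_def\<close>)
  show "L1conv a (\<lambda>n. pd (\<phi> n) dY) (\<lambda>p. fst (snd (G p)))"
    by (rule L1conv_L2[OF smooth_cont(4)[OF s] m(2) L2d_mono_tendsto[OF _ L]]) (use n(2)[of "grad _ _ - G _"] in \<open>simp add: grad_def\<close>)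
  show "L1conv a (\<lambda>n. pd (\<phi> n) dZ) (\<lambda>p. snd (snd (G p)))"
    by (rule L1conv_L2[OF smooth_cont(5)[OF s] m(3) L2d_mono_tendsto[OF _ L]]) (use n(3)[of "grad _ _ - G _"] in \<open>simp add: grad_def\<close>)
qed

text \<open>In the test slot each form is an integral against a bounded factor, hence continuous
  under the defining approximations; the terms with w use the L^1 continuity of the vertical
  primitive. The identity therefore has to be checked for smooth test fields only.\<close>

lemma weak_closure:
  assumes a: "a > 0" and c: "continuous_on UNIV u" "continuous_on UNIV v" "continuous_on UNIV t"
      "continuous_on UNIV Gu" "continuous_on UNIV Gv" "continuous_on UNIV Gt"
    and S: "\<And>f g h. adm1 a f g \<Longrightarrow> adm a h \<Longrightarrow> lam * formH a \<beta> \<gamma> u v t f g h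
         + of_real \<nu> * formV a \<beta> \<gamma> Gu Gv Gt (grad f) (grad g) (grad h)
         + of_real \<beta> * formB a t Gu Gv h (grad f) (grad g)
         + of_real \<alpha> * formC a u v f g = 0"
    and V: "inV a u' v' t' Gu' Gv' Gt'"
  shows "lam * formH a \<beta> \<gamma> u v t u' v' t'
         + of_real \<nu> * formV a \<beta> \<gamma> Gu Gv Gt Gu' Gv' Gt'
         + of_real \<beta> * formB a t Gu Gv t' Gu' Gv'
         + of_real \<alpha> * formC a u v u' v' = 0"
proof -
  have m: "u' \<in> borel_measurable borel" "v' \<in> borel_measurable borel" "t' \<in> borel_measurable borel"
    "Gu' \<in> borel_measurable borel" "Gv' \<in> borel_measurable borel" "Gt' \<in> borel_measurable borel"
    using V by (simp_all add: inV_def)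
  obtain \<phi> \<psi> \<rho> where A: "\<And>n. adm1 a (\<phi> n) (\<psi> n)" "\<And>n. adm a (\<rho> n)"
    and L: "(\<lambda>n. L2d a (\<phi> n) u') \<longlonglongrightarrow> 0" "(\<lambda>n. L2d a (\<psi> n) v') \<longlonglongrightarrow> 0" "(\<lambda>n. L2d a (\<rho> n) t') \<longlonglongrightarrow> 0"
     "(\<lambda>n. L2d a (grad (\<phi> n)) Gu') \<longlonglongrightarrow> 0" "(\<lambda>n. L2d a (grad (\<psi> n)) Gv') \<longlonglongrightarrow> 0" "(\<lambda>n. L2d a (grad (\<rho> n)) Gt') \<longlonglongrightarrow> 0"
    using V unfolding inV_def by blast
  have s: "smooth (\<phi> n)" "smooth (\<psi> n)" "smooth (\<rho> n)" for n using A[of n] unfolding adm1_def adm_def by blast+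
  have C: "L1conv a \<phi> u'" "L1conv a \<psi> v'" "L1conv a \<rho> t'"
    by (rule L1conv_L2[OF smooth_cont(1)[OF s(1)] m(1) L(1)], rule L1conv_L2[OF smooth_cont(1)[OF s(2)] m(2) L(2)], rule L1conv_L2[OF smooth_cont(1)[OF s(3)] m(3) L(3)])
  note G1 = L1conv_grad[OF s(1) m(4) L(4)] and G2 = L1conv_grad[OF s(2) m(5) L(5)] and G3 = L1conv_grad[OF s(3) m(6) L(6)]
  have W: "L1conv a (\<lambda>n. vint (\<lambda>q. pd (\<phi> n) dX q + pd (\<psi> n) dY q)) (vint (\<lambda>q. fst (Gu' q) + fst (snd (Gv' q))))"
    by (rule L1conv_vint[OF a _ L1conv_add[OF G1(1) G2(2)]]) (intro continuous_on_add smooth_cont s)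
  have bG: "bdd_meas a (\<lambda>p. fst (G p))" "bdd_meas a (\<lambda>p. fst (snd (G p)))" "bdd_meas a (\<lambda>p. snd (snd (G p)))" if "continuous_on UNIV G" for G :: gfun
    by (intro bdd_meas_cont continuous_intros that)+
  have bw: "bdd_meas a (vint (\<lambda>q. fst (Gu q) + fst (snd (Gv q))))" by (intro bdd_meas_vint a continuous_intros c)
  have H: "(\<lambda>n. formH a \<beta> \<gamma> u v t (\<phi> n) (\<psi> n) (\<rho> n)) \<longlonglongrightarrow> formH a \<beta> \<gamma> u v t u' v' t'"
    unfolding formH_def by (rule L1conv_lim) (intro L1conv_add L1conv_multb C bdd_meas_mult bdd_meas_const bdd_meas_cont c)
  have FV: "(\<lambda>n. formV a \<beta> \<gamma> Gu Gv Gt (grad (\<phi> n)) (grad (\<psi> n)) (grad (\<rho> n))) \<longlonglongrightarrow> formV a \<beta> \<gamma> Gu Gv Gt Gu' Gv' Gt'"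
    unfolding formV_def gdot_def grad_def fst_conv snd_conv distrib_left mult.assoc[symmetric]
    by (rule L1conv_lim) (intro L1conv_add L1conv_multb G1 G2 G3 bdd_meas_mult bdd_meas_const bG c)
  have FB: "(\<lambda>n. formB a t Gu Gv (\<rho> n) (grad (\<phi> n)) (grad (\<psi> n))) \<longlonglongrightarrow> formB a t Gu Gv t' Gu' Gv'"
    unfolding formB_def wfun_vint grad_def fst_conv snd_conv complex_cnj_minus mult_minus_right mult_minus_left[of "t _", symmetric]
    by (intro tendsto_add tendsto_minus L1conv_lim L1conv_multb W C bdd_meas_minus bdd_meas_cont[OF c(3)] bw)
  have FC: "(\<lambda>n. formC a u v (\<phi> n) (\<psi> n)) \<longlonglongrightarrow> formC a u v u' v'"
    unfolding formC_def by (intro tendsto_add tendsto_minus L1conv_lim L1conv_multb C bdd_meas_cont c)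
  have "(\<lambda>n. lam * formH a \<beta> \<gamma> u v t (\<phi> n) (\<psi> n) (\<rho> n)
         + of_real \<nu> * formV a \<beta> \<gamma> Gu Gv Gt (grad (\<phi> n)) (grad (\<psi> n)) (grad (\<rho> n))
         + of_real \<beta> * formB a t Gu Gv (\<rho> n) (grad (\<phi> n)) (grad (\<psi> n))
         + of_real \<alpha> * formC a u v (\<phi> n) (\<psi> n)) \<longlonglongrightarrow> lam * formH a \<beta> \<gamma> u v t u' v' t'
         + of_real \<nu> * formV a \<beta> \<gamma> Gu Gv Gt Gu' Gv' Gt'
         + of_real \<beta> * formB a t Gu Gv t' Gu' Gv'
         + of_real \<alpha> * formC a u v u' v'"
    by (intro tendsto_add tendsto_mult_left H FV FB FC)
  thus ?thesis unfolding S[OF A] by (simp add: LIMSEQ_const_iff)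
qed

text \<open>Polynomial identity in which the conjugated test values and derivatives are independent
  variables, X and Y stand for i\<xi> and i\<eta>, Th and D for the vertical primitives of \<theta>
  and of the divergence. After substitution of the three equations the integrand is a sum of exact
  x-, y- and z-derivatives. The pressure p0 + \<beta> Th is moved onto fx + gy, whose primitive is
  G; differentiating the pressure then yields the buoyancy term. The factor \<beta>/\<gamma> turns
  \<gamma> D into \<beta> D.\<close>

lemma weak_ring:
  fixes e :: complex
  assumes h: "\<nu> * U2 = (lam + \<nu> * Z2) * U + X * p0 - \<alpha> * V + X * \<beta> * Th"
    "\<nu> * V2 = (lam + \<nu> * Z2) * V + Y * p0 + \<alpha> * U + Y * \<beta> * Th"
    "\<nu> * T2 = (lam + \<nu> * Z2) * T - \<gamma> * D" and Z: "Z2 = - (X * X + Y * Y)" and k: "\<beta> = \<kappa> * \<gamma>"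
  shows "lam * (e * U * fb + e * V * gb + \<kappa> * (e * T) * hb)
     + \<nu> * ((X * (e * U) * fx + Y * (e * U) * fy + e * U1 * fz) + (X * (e * V) * gx + Y * (e * V) * gy + e * V1 * gz)
         + \<kappa> * (X * (e * T) * hx + Y * (e * T) * hy + e * T1 * hz))
     + \<beta> * (- (e * T * - G) + - (e * D) * hb) + \<alpha> * (- (e * V * fb) + e * U * gb)
   = (\<nu> * X * (e * U * (X * fb + fx)) + (\<nu> * Y * (e * U * (Y * fb + fy)) + \<nu> * (e * (U1 * fz + U2 * fb))))
     + ((\<nu> * X * (e * V * (X * gb + gx)) + (\<nu> * Y * (e * V * (Y * gb + gy)) + \<nu> * (e * (V1 * gz + V2 * gb))))
     + ((\<nu> * \<kappa> * X * (e * T * (X * hb + hx)) + (\<nu> * \<kappa> * Y * (e * T * (Y * hb + hy)) + \<nu> * \<kappa> * (e * (T1 * hz + T2 * hb))))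
     + (- 1 * (e * (p0 + \<beta> * Th) * (X * fb + fx)) + (- 1 * (e * (p0 + \<beta> * Th) * (Y * gb + gy))
     + e * ((p0 + \<beta> * Th) * (fx + gy) + \<beta> * T * G)))))"
proof -
  have r1: "\<nu> * \<kappa> * (e * (A * b + B * c)) = \<kappa> * e * (\<nu> * A * b + (\<nu> * B) * c)"
    and r2: "\<nu> * (e * (A * b + B * c)) = e * (\<nu> * A * b + (\<nu> * B) * c)" for A b B c :: complex
    by (simp_all add: algebra_simps)
  show ?thesis unfolding r1 unfolding r2 h Z k by (simp add: algebra_simps)
qed

text \<open>Every exact piece in \<open>weak_ring\<close> has integral zero, by periodicity in x and
  y and by boundary values in z. The constraint on the test pair makes G vanish at z = a, which
  removes the pressure although p0 does not vanish at the boundary.\<close>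

lemma weak_smooth:
  assumes a: "a > 0" and g0: "\<gamma> > 0" and d: "dec u" "dec v" "dec t"
    and c2: "continuous_on UNIV U2" "continuous_on UNIV V2" "continuous_on UNIV T2"
    and dd: "\<And>z. z \<in> {0..a} \<Longrightarrow> (ser1 a u has_vector_derivative U2 z) (at z within {0..a})"
      "\<And>z. z \<in> {0..a} \<Longrightarrow> (ser1 a v has_vector_derivative V2 z) (at z within {0..a})"
      "\<And>z. z \<in> {0..a} \<Longrightarrow> (ser1 a t has_vector_derivative T2 z) (at z within {0..a})"
    and ode: "\<And>z. of_real \<nu> * U2 z = (lam + of_real \<nu> * of_real (zabs2 \<zeta>)) * ser a u z + \<i> * of_int (fst \<zeta>) * p0 - of_real \<alpha> * ser a v z
         + \<i> * of_int (fst \<zeta>) * of_real \<beta> * integral {0..z} (ser a t)"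
      "\<And>z. of_real \<nu> * V2 z = (lam + of_real \<nu> * of_real (zabs2 \<zeta>)) * ser a v z + \<i> * of_int (snd \<zeta>) * p0 + of_real \<alpha> * ser a u z
         + \<i> * of_int (snd \<zeta>) * of_real \<beta> * integral {0..z} (ser a t)"
      "\<And>z. of_real \<nu> * T2 z = (lam + of_real \<nu> * of_real (zabs2 \<zeta>)) * ser a t z
         - of_real \<gamma> * integral {0..z} (\<lambda>s. \<i> * of_int (fst \<zeta>) * ser a u s + \<i> * of_int (snd \<zeta>) * ser a v s)"
    and fg: "adm1 a f g" and h: "adm a h"
  shows "lam * formH a \<beta> \<gamma> (mode a \<zeta> u) (mode a \<zeta> v) (mode a \<zeta> t) f g h
         + of_real \<nu> * formV a \<beta> \<gamma> (gmode a \<zeta> u) (gmode a \<zeta> v) (gmode a \<zeta> t) (grad f) (grad g) (grad h)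
         + of_real \<beta> * formB a (mode a \<zeta> t) (gmode a \<zeta> u) (gmode a \<zeta> v) h (grad f) (grad g)
         + of_real \<alpha> * formC a (mode a \<zeta> u) (mode a \<zeta> v) f g = 0"
proof -
  define X Y :: complex where "X = \<i> * of_int (fst \<zeta>)" and "Y = \<i> * of_int (snd \<zeta>)"
  define Th where "Th z = integral {0..z} (ser a t)" for z
  define D where "D z = integral {0..z} (\<lambda>s. X * ser a u s + Y * ser a v s)" for z
  define G where "G = vint (\<lambda>q. pd f dX q + pd g dY q)"
  define \<kappa> :: complex where "\<kappa> = of_real (\<beta> / \<gamma>)"
  have f: "adm a f" "adm a g" using fg by (simp_all add: adm1_def)
  have s: "smooth f" "smooth g" "smooth h" using f h by (simp_all add: adm_def)
  note sc = smooth_cont[OF s(1)] smooth_cont[OF s(2)] smooth_cont[OF s(3)]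
  note U = ser_cont_UNIV[OF a d(1)] and V = ser_cont_UNIV[OF a d(2)] and T = ser_cont_UNIV[OF a d(3)]
  have cTh: "continuous_on UNIV Th" unfolding Th_def by (rule cont_prim[OF T(1)])
  have cD: "continuous_on UNIV D" unfolding D_def by (intro cont_prim continuous_intros U V)
  have cdiv: "continuous_on UNIV (\<lambda>q. pd f dX q + pd g dY q)" by (intro continuous_on_add sc)
  have bG: "bdd_meas a G" unfolding G_def by (rule bdd_meas_vint[OF a cdiv])
  have bpd: "bdd_meas a f" "bdd_meas a g" "bdd_meas a h" "bdd_meas a (pd f d)" "bdd_meas a (pd g d)" "bdd_meas a (pd h d)" if "d \<in> {dX, dY, dZ}" for d
    using that sc by (auto intro: bdd_meas_cont)
  have p0: "continuous_on UNIV (\<lambda>z. p0 + of_real \<beta> * Th z)" by (intro continuous_intros cTh)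
  let ?e = "Ef \<zeta>" and ?U = "\<lambda>p. ser a u (snd (snd p))" and ?V = "\<lambda>p. ser a v (snd (snd p))" and ?T = "\<lambda>p. ser a t (snd (snd p))"
    and ?U1 = "\<lambda>p. ser1 a u (snd (snd p))" and ?V1 = "\<lambda>p. ser1 a v (snd (snd p))" and ?T1 = "\<lambda>p. ser1 a t (snd (snd p))"
    and ?U2 = "\<lambda>p. U2 (snd (snd p))" and ?V2 = "\<lambda>p. V2 (snd (snd p))" and ?T2 = "\<lambda>p. T2 (snd (snd p))"
    and ?P = "\<lambda>p. p0 + of_real \<beta> * Th (snd (snd p))"
  have xX: "int_null a (\<lambda>p. ?e p * A (snd (snd p)) * (X * cnj (f p) + cnj (pd f dX p)))" if "adm a f" "continuous_on UNIV A" for f A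
    using exact_X[OF that, of \<zeta>] unfolding X_def .
  have xY: "int_null a (\<lambda>p. ?e p * A (snd (snd p)) * (Y * cnj (f p) + cnj (pd f dY p)))" if "adm a f" "continuous_on UNIV A" for f A
    using exact_Y[OF that, of \<zeta>] unfolding Y_def .
  have xZ: "int_null a (\<lambda>p. ?e p * (A (snd (snd p)) * cnj (pd f dZ p) + B (snd (snd p)) * cnj (f p)))"
    if f: "adm a f" and A: "continuous_on UNIV A" "continuous_on UNIV B" and dA: "\<And>z. z \<in> {0..a} \<Longrightarrow> (A has_vector_derivative B z) (at z within {0..a})" for f A B
  proof -
    have s: "smooth f" using f by (simp add: adm_def)
    show ?thesis by (rule exact_Z[OF a bdd_meas_cont[OF smooth_cont(1)[OF s]] bdd_meas_cont[OF smooth_cont(5)[OF s]] A pd_partial(3)[OF smooth_cont(2)[OF s]] dA])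
      (use f in \<open>auto simp: adm_def\<close>)
  qed
  have xG: "int_null a (\<lambda>p. ?e p * (?P p * cnj (pd f dX p + pd g dY p) + of_real \<beta> * ?T p * cnj (G p)))"
  proof (rule exact_Z[OF a bG bdd_meas_cont[OF cdiv] p0])
    show "continuous_on UNIV (\<lambda>z. of_real \<beta> * ser a t z)" by (intro continuous_intros T)
    fix x y z
    show "G (x, y, 0) = 0" unfolding G_def vint_HK[OF cdiv] by simp
    show "G (x, y, a) = 0" using fg unfolding G_def vint_def adm1_def by simp
    assume z: "z \<in> {0..a}"
    show "((\<lambda>z. G (x, y, z)) has_vector_derivative pd f dX (x, y, z) + pd g dY (x, y, z)) (at z within {0..a})"
      unfolding G_def vint_HK[OF cdiv] by (rule integral_has_vector_derivative[OF cont_vert[OF cdiv] z])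
    have "(Th has_vector_derivative ser a t z) (at z within {0..a})"
      unfolding Th_def[abs_def] by (rule integral_has_vector_derivative[OF continuous_on_subset[OF T(1)] z]) simp
    from has_vector_derivative_add[OF has_vector_derivative_const has_vector_derivative_mult_right[OF this]]
    show "((\<lambda>z. p0 + of_real \<beta> * Th z) has_vector_derivative of_real \<beta> * ser a t z) (at z within {0..a})" by simp
  qed
  have sd: "z \<in> {0..a} \<Longrightarrow> (ser a c has_vector_derivative ser1 a c z) (at z within {0..a})" if "dec c" for c z by (rule ser_deriv[OF a that])
  let ?R = "\<lambda>p. (of_real \<nu> * X * (?e p * ?U p * (X * cnj (f p) + cnj (pd f dX p))) + (of_real \<nu> * Y * (?e p * ?U p * (Y * cnj (f p) + cnj (pd f dY p))) + of_real \<nu> * (?e p * (?U1 p * cnj (pd f dZ p) + ?U2 p * cnj (f p)))))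
     + ((of_real \<nu> * X * (?e p * ?V p * (X * cnj (g p) + cnj (pd g dX p))) + (of_real \<nu> * Y * (?e p * ?V p * (Y * cnj (g p) + cnj (pd g dY p))) + of_real \<nu> * (?e p * (?V1 p * cnj (pd g dZ p) + ?V2 p * cnj (g p)))))
     + ((of_real \<nu> * \<kappa> * X * (?e p * ?T p * (X * cnj (h p) + cnj (pd h dX p))) + (of_real \<nu> * \<kappa> * Y * (?e p * ?T p * (Y * cnj (h p) + cnj (pd h dY p))) + of_real \<nu> * \<kappa> * (?e p * (?T1 p * cnj (pd h dZ p) + ?T2 p * cnj (h p)))))
     + (- 1 * (?e p * ?P p * (X * cnj (f p) + cnj (pd f dX p))) + (- 1 * (?e p * ?P p * (Y * cnj (g p) + cnj (pd g dY p)))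
     + ?e p * (?P p * (cnj (pd f dX p) + cnj (pd g dY p)) + of_real \<beta> * ?T p * cnj (G p))))))"
  have R: "int_null a ?R"
    by (intro int_null_add int_null_scale xX[OF f(1)] xX[OF f(2)] xX[OF h] xY[OF f(1)] xY[OF f(2)] xY[OF h] xZ[OF f(1)] xZ[OF f(2)] xZ[OF h] xG[unfolded complex_cnj_add] U V T p0 c2 dd)
  have W: "wfun (gmode a \<zeta> u) (gmode a \<zeta> v) p = - (?e p * D (snd (snd p)))" for p
  proof -
    obtain x y z where p: "p = (x, y, z)" by (cases p)
    have c: "continuous_on UNIV (\<lambda>q. fst (gmode a \<zeta> u q) + fst (snd (gmode a \<zeta> v q)))" by (intro continuous_intros mode_cont a d)
    have E: "fst (gmode a \<zeta> u (x, y, s)) + fst (snd (gmode a \<zeta> v (x, y, s))) = Ef \<zeta> (x, y, z) * (X * ser a u s + Y * ser a v s)" for s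
    proof -
      have "Ef \<zeta> (x, y, s) = Ef \<zeta> (x, y, z)" by (simp add: Ef_def)
      thus ?thesis by (simp add: gmode_def mode_def X_def Y_def algebra_simps)
    qed
    have "vint (\<lambda>q. fst (gmode a \<zeta> u q) + fst (snd (gmode a \<zeta> v q))) p = integral {0..z} (\<lambda>s. Ef \<zeta> p * (X * ser a u s + Y * ser a v s))"
      unfolding p vint_HK[OF c] E ..
    also have "\<dots> = Ef \<zeta> p * D (snd (snd p))" unfolding D_def p snd_conv by (rule integral_mult_right)
    finally show ?thesis unfolding wfun_vint by simp
  qed
  have W': "wfun (grad f) (grad g) p = - G p" for p unfolding wfun_vint grad_def G_def fst_conv snd_conv ..
  have bm: "bdd_meas a (mode a \<zeta> u)" "bdd_meas a (mode a \<zeta> v)" "bdd_meas a (mode a \<zeta> t)" by (intro bdd_meas_cont mode_cont a d)+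
  have be: "bdd_meas a (\<lambda>p. ?e p * k (snd (snd p)))" if "continuous_on UNIV k" for k by (intro bdd_meas_cont continuous_intros Ef_cont cont_z that)
  have bH: "bdd_meas a (\<lambda>p. mode a \<zeta> u p * cnj (f p) + mode a \<zeta> v p * cnj (g p) + of_real (\<beta> / \<gamma>) * mode a \<zeta> t p * cnj (h p))"
    by (intro bdd_meas_add bdd_meas_mult bdd_meas_cnj bdd_meas_const bm bpd[of dX]) simp_all
  have bgd: "bdd_meas a (\<lambda>p. gdot (gmode a \<zeta> c p) (grad k p))" if c: "dec c" and k: "smooth k" for c k
    unfolding gdot_def gmode_def grad_def fst_conv snd_conv
    by (intro bdd_meas_cont continuous_intros mode_cont Ef_cont cont_z ser_cont_UNIV smooth_cont[OF k] a c)
  have bV: "bdd_meas a (\<lambda>p. gdot (gmode a \<zeta> u p) (grad f p) + gdot (gmode a \<zeta> v p) (grad g p) + of_real (\<beta> / \<gamma>) * gdot (gmode a \<zeta> t p) (grad h p))"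
    by (intro bdd_meas_add bdd_meas_mult bdd_meas_const bgd d s)
  have bB1: "bdd_meas a (\<lambda>p. mode a \<zeta> t p * cnj (wfun (grad f) (grad g) p))" unfolding W' by (intro bdd_meas_mult bm bdd_meas_cnj bdd_meas_minus bG)
  have bB2: "bdd_meas a (\<lambda>p. wfun (gmode a \<zeta> u) (gmode a \<zeta> v) p * cnj (h p))" unfolding W by (intro bdd_meas_mult bdd_meas_minus be cD bdd_meas_cnj bpd[of dX]) simp
  have bC1: "bdd_meas a (\<lambda>p. mode a \<zeta> v p * cnj (f p))" and bC2: "bdd_meas a (\<lambda>p. mode a \<zeta> u p * cnj (g p))" by (intro bdd_meas_mult bm bdd_meas_cnj bpd[of dX], simp)+
  \<comment> \<open>Gathers the four forms into one integral whose integrand has the shape of the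
    left-hand side of \<open>weak_ring\<close>.\<close>
  have b4: "bdd_meas a A \<Longrightarrow> bdd_meas a B \<Longrightarrow> bdd_meas a C1 \<Longrightarrow> bdd_meas a C2 \<Longrightarrow> bdd_meas a D1 \<Longrightarrow> bdd_meas a D2 \<Longrightarrow> c1 * intOm a A + c2 * intOm a B + c3 * (- intOm a C1 + intOm a C2) + c4 * (- intOm a D1 + intOm a D2)
     = intOm a (\<lambda>p. c1 * A p + c2 * B p + c3 * (- C1 p + C2 p) + c4 * (- D1 p + D2 p))" for A B C1 C2 D1 D2 c1 c2 c3 c4
    by (simp only: intOm_add intOm_mult intOm_minus[symmetric] bdd_meas_add bdd_meas_mult bdd_meas_const bdd_meas_minus)
  have "lam * formH a \<beta> \<gamma> (mode a \<zeta> u) (mode a \<zeta> v) (mode a \<zeta> t) f g h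
         + of_real \<nu> * formV a \<beta> \<gamma> (gmode a \<zeta> u) (gmode a \<zeta> v) (gmode a \<zeta> t) (grad f) (grad g) (grad h)
         + of_real \<beta> * formB a (mode a \<zeta> t) (gmode a \<zeta> u) (gmode a \<zeta> v) h (grad f) (grad g)
         + of_real \<alpha> * formC a (mode a \<zeta> u) (mode a \<zeta> v) f g
     = intOm a (\<lambda>p. lam * (mode a \<zeta> u p * cnj (f p) + mode a \<zeta> v p * cnj (g p) + of_real (\<beta> / \<gamma>) * mode a \<zeta> t p * cnj (h p))
       + of_real \<nu> * (gdot (gmode a \<zeta> u p) (grad f p) + gdot (gmode a \<zeta> v p) (grad g p) + of_real (\<beta> / \<gamma>) * gdot (gmode a \<zeta> t p) (grad h p))
       + of_real \<beta> * (- (mode a \<zeta> t p * cnj (wfun (grad f) (grad g) p)) + wfun (gmode a \<zeta> u) (gmode a \<zeta> v) p * cnj (h p))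
       + of_real \<alpha> * (- (mode a \<zeta> v p * cnj (f p)) + mode a \<zeta> u p * cnj (g p)))"
    unfolding formH_def formV_def formB_def formC_def by (rule b4[OF bH bV bB1 bB2 bC1 bC2])
  also have "\<dots> = intOm a ?R"
  proof (rule arg_cong[of _ _ "intOm a"], rule ext)
    fix p :: pt
    have Z2: "complex_of_real (zabs2 \<zeta>) = - (X * X + Y * Y)" by (simp add: X_def Y_def zabs2_def power2_eq_square algebra_simps)
    let ?z = "snd (snd p)"
    have o1: "of_real \<nu> * U2 ?z = (lam + of_real \<nu> * of_real (zabs2 \<zeta>)) * ser a u ?z + X * p0 - of_real \<alpha> * ser a v ?z + X * of_real \<beta> * Th ?z"
      using ode(1)[of ?z] unfolding X_def Th_def .
    have o2: "of_real \<nu> * V2 ?z = (lam + of_real \<nu> * of_real (zabs2 \<zeta>)) * ser a v ?z + Y * p0 + of_real \<alpha> * ser a u ?z + Y * of_real \<beta> * Th ?z"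
      using ode(2)[of ?z] unfolding Y_def Th_def .
    have o3: "of_real \<nu> * T2 ?z = (lam + of_real \<nu> * of_real (zabs2 \<zeta>)) * ser a t ?z - of_real \<gamma> * D ?z"
      using ode(3)[of ?z] unfolding D_def X_def Y_def .
    have k: "complex_of_real \<beta> = \<kappa> * of_real \<gamma>" using g0 by (simp add: \<kappa>_def)
    show "lam * (mode a \<zeta> u p * cnj (f p) + mode a \<zeta> v p * cnj (g p) + of_real (\<beta> / \<gamma>) * mode a \<zeta> t p * cnj (h p))
       + of_real \<nu> * (gdot (gmode a \<zeta> u p) (grad f p) + gdot (gmode a \<zeta> v p) (grad g p) + of_real (\<beta> / \<gamma>) * gdot (gmode a \<zeta> t p) (grad h p))
       + of_real \<beta> * (- (mode a \<zeta> t p * cnj (wfun (grad f) (grad g) p)) + wfun (gmode a \<zeta> u) (gmode a \<zeta> v) p * cnj (h p))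
       + of_real \<alpha> * (- (mode a \<zeta> v p * cnj (f p)) + mode a \<zeta> u p * cnj (g p)) = ?R p"
      unfolding W W' gdot_def gmode_def grad_def mode_def fst_conv snd_conv complex_cnj_minus X_def[symmetric] Y_def[symmetric] \<kappa>_def[symmetric]
      by (rule weak_ring[OF o1 o2 o3 Z2 k])
  qed
  also have "\<dots> = 0" using R by (simp add: int_null_def)
  finally show ?thesis .
qed

section \<open>Injectivity\<close>

text \<open>One statement for all three equations through the constants A, B, C, E; for the
  temperature B and C are 0 and the primitive acts on the divergence. \<open>G\<close> is the
  right-hand side divided by n, and \<open>ser_ode\<close> recognises it as the second derivative of
  the series.\<close>

lemma ode_from_coef:
  assumes a: "a > 0" and n: "n \<noteq> 0" and d: "dec u" "dec v" "dec t"
    and H: "\<And>k. k \<ge> 1 \<Longrightarrow> (A + n * of_real ((real k * pi / a)\<^sup>2)) * u k + B * one_c a k + C * v k + E * prim a t k = 0"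
  shows "\<exists>G. continuous_on UNIV G \<and> (\<forall>z\<in>{0..a}. (ser1 a u has_vector_derivative G z) (at z within {0..a})) \<and>
    (\<forall>z. n * G z = A * ser a u z + B + C * ser a v z + E * integral {0..z} (ser a t))"
proof -
  define G where "G z = (1 / n) * (A * ser a u z + B + C * ser a v z + E * integral {0..z} (ser a t))" for z
  note su = ser_cont_UNIV(1)[OF a d(1)] and sv = ser_cont_UNIV(1)[OF a d(2)] and st = cont_prim[OF ser_cont_UNIV(1)[OF a d(3)]]
  have c: "continuous_on UNIV G" unfolding G_def by (intro continuous_intros su sv st)
  have hi: "((\<lambda>z. f z * of_real (ek a k z)) has_integral I) {0..a}"
    if "continuous_on UNIV f" "integral {0..a} (\<lambda>z. f z * of_real (ek a k z)) = I" for f :: "real \<Rightarrow> complex" and I k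
    unfolding that(2)[symmetric]
    by (intro integrable_integral integrable_continuous_interval continuous_intros continuous_on_subset[OF that(1)] ek_continuous a) simp
  have ode: "(ser1 a u has_vector_derivative G z) (at z within {0..a})" if z: "z \<in> {0..a}" for z
  proof (rule ser_ode[OF a d(1) continuous_on_subset[OF c] _ z])
    fix k :: nat assume k: "k \<ge> 1"
    have "((\<lambda>z. (1 / n) * (A * (ser a u z * of_real (ek a k z)) + B * of_real (ek a k z) + C * (ser a v z * of_real (ek a k z))
        + E * (integral {0..z} (ser a t) * of_real (ek a k z)))) has_integral (1 / n) * (A * u k + B * one_c a k + C * v k + E * prim a t k)) {0..a}"
      by (intro has_integral_add has_integral_mult_right one_c_has_integral a hi su sv st ser_coef prim_coef d k)
    moreover have "(1 / n) * (A * (ser a u z * of_real (ek a k z)) + B * of_real (ek a k z) + C * (ser a v z * of_real (ek a k z))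
        + E * (integral {0..z} (ser a t) * of_real (ek a k z))) = G z * of_real (ek a k z)" for z
      unfolding G_def by (simp add: algebra_simps)
    moreover have "(1 / n) * (A * u k + B * one_c a k + C * v k + E * prim a t k) = - of_real ((real k * pi / a)\<^sup>2) * u k"
    proof -
      have r: "(1 / n) * w = - q * x" if "n \<noteq> 0" "w + n * q * x = 0" for w q x n :: complex
      proof -
        have "w = - (n * q * x)" using that(2) by (simp add: eq_neg_iff_add_eq_0)
        thus ?thesis using that(1) by simp
      qed
      show ?thesis by (rule r[OF n]) (use H[OF k] in \<open>simp add: algebra_simps\<close>)
    qed
    ultimately have "((\<lambda>z. G z * of_real (ek a k z)) has_integral - of_real ((real k * pi / a)\<^sup>2) * u k) {0..a}" by (simp only:)
    thus "integral {0..a} (\<lambda>z. G z * of_real (ek a k z)) = - of_real ((real k * pi / a)\<^sup>2) * u k" by (rule integral_unique)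
  qed simp
  have "n * G z = A * ser a u z + B + C * ser a v z + E * integral {0..z} (ser a t)" for z
    unfolding G_def using n by simp
  with c ode show ?thesis by blast
qed

lemma dec_lin: "dec u \<Longrightarrow> dec v \<Longrightarrow> dec (\<lambda>k. x * u k + y * v k)"
proof -
  assume A: "dec u" "dec v"
  have "summable (\<lambda>k. real k * cmod (x * u k + y * v k))"
  proof (rule summable_comparison_test'[where N=0])
    show "summable (\<lambda>k. cmod x * (real k * cmod (u k)) + cmod y * (real k * cmod (v k)))"
      using A by (intro summable_add summable_mult) (auto simp: dec_def)
    fix k :: nat
    have "real k * cmod (x * u k + y * v k) \<le> real k * (cmod x * cmod (u k) + cmod y * cmod (v k))"
      by (intro mult_left_mono order_trans[OF norm_triangle_ineq]) (simp_all add: norm_mult)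
    thus "norm (real k * cmod (x * u k + y * v k)) \<le> cmod x * (real k * cmod (u k)) + cmod y * (real k * cmod (v k))"
      by (simp add: algebra_simps)
  qed
  thus ?thesis using A by (simp add: dec_def)
qed

lemma ser_lin:
  assumes a: "a > 0" and d: "dec u" "dec v"
  shows "ser a (\<lambda>k. x * u k + y * v k) z = x * ser a u z + y * ser a v z"
proof -
  have "(\<lambda>k. x * (u k * of_real (ek a k z)) + y * (v k * of_real (ek a k z))) sums (x * ser a u z + y * ser a v z)"
    unfolding ser_def by (intro sums_add sums_mult summable_sums ser_summable a d)
  hence "(\<lambda>k. (x * u k + y * v k) * of_real (ek a k z)) sums (x * ser a u z + y * ser a v z)" by (simp add: algebra_simps)
  thus ?thesis unfolding ser_def by (rule sums_unique[symmetric])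
qed

text \<open>A continuous function that vanishes almost everywhere on an open box vanishes there. The
  horizontal exponential has modulus 1, so the vertical profile is zero, and orthogonality recovers
  its coefficients.\<close>

lemma mode_AE_zero:
  assumes a: "a > 0" and d: "dec u" and z: "AE p in lborel. p \<in> Om a \<longrightarrow> mode a \<zeta> u p = 0"
  shows "u = (\<lambda>k. 0)"
proof -
  \<comment> \<open>\<open>Om\<close> is closed in x and y; the horizontal sides are opened because
    the density argument needs an open set.\<close>
  let ?S = "{0<..<2*pi} \<times> {0<..<2*pi} \<times> {0<..<a}"
  have S: "open ?S" by (intro open_Times open_greaterThanLessThan)
  have C: "closed {p. mode a \<zeta> u p = 0}" by (intro closed_Collect_eq mode_cont a d continuous_on_const)
  have "AE p in lebesgue. p \<in> Om a \<longrightarrow> mode a \<zeta> u p = 0" by (rule AE_completion[OF z])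
  hence A: "AE p\<in>?S in lebesgue. p \<in> {p. mode a \<zeta> u p = 0}" by (rule eventually_mono) (auto simp: Om_def)
  have s0: "ser a u z = 0" if z: "z \<in> {0<..<a}" for z
  proof -
    have "(pi, pi, z) \<in> {p. mode a \<zeta> u p = 0}" by (rule mem_closed_if_AE_lebesgue_open[OF S C A]) (use z in simp)
    thus ?thesis using norm_Ef[of \<zeta> "(pi, pi, z)"] by (auto simp: mode_def)
  qed
  have s1: "ser a u z = 0" if "z \<in> {0..a}" for z
    using s0[of z] ser_ends[OF a, of u] that by (cases "z = 0 \<or> z = a") auto
  have "u k = 0" for k
  proof (cases "k = 0")
    case True
    thus ?thesis using d by (simp add: dec_def)
  next
    case False
    have "integral {0..a} (\<lambda>z. ser a u z * of_real (ek a k z)) = integral {0..a} (\<lambda>z. 0)"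
      by (rule integral_cong) (simp add: s1)
    thus ?thesis using ser_coef[OF a d, of k] False by simp
  qed
  thus ?thesis by blast
qed

context prim_eq
begin

text \<open>For \<sigma> > -1/2 the domain already has more than 3/2 derivatives. For \<sigma> <
  -1/2 the exponent \<sigma>+1 is admissible again, and L0 X = R X lifts X to H^(\<sigma>+3). This
  requires 1/D in H^(\<sigma>+3), that is \<sigma>+3 < 5/2; at \<sigma> = -1/2 both arguments break
  down.\<close>

lemma kernel_dec:
  assumes g: "good lam \<zeta>" and X: "(u, v, p0, t) \<in> Dom a \<nu> (\<sigma>+2) \<zeta>" and L: "Lop a \<nu> \<alpha> \<beta> \<gamma> lam \<zeta> (u, v, p0, t) = (\<lambda>k. 0, \<lambda>k. 0, \<lambda>k. 0)"
    and s: "\<sigma> \<noteq> -1/2"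
  shows "dec u \<and> dec v \<and> dec t"
proof (cases "\<sigma> > -1/2")
  case True
  hence "\<sigma> + 2 > 3/2" by simp
  thus ?thesis using X Hs_dec[OF nu] unfolding Dom_iff by blast
next
  case False
  interpret P: prim_eq a \<nu> \<alpha> \<beta> \<gamma> \<delta>1 \<delta>2 "\<sigma> + 1"
    by unfold_locales (use a nu d1 d2 sg s False in auto)
  have h: "u \<in> Hs \<nu> (\<sigma> + 1 + 1) \<zeta>" "v \<in> Hs \<nu> (\<sigma> + 1 + 1) \<zeta>" "t \<in> Hs \<nu> (\<sigma> + 1 + 1) \<zeta>"
    using X unfolding Dom_iff by (simp_all add: add.assoc)
  let ?R = "Rop a \<alpha> \<beta> \<gamma> \<zeta> (u, v, p0, t)"
  have R: "?R \<in> Tgt \<nu> (\<sigma> + 1) \<zeta>" using P.Rop_bound h by fastforce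
  obtain f h' q where R3: "?R = (f, h', q)" by (cases ?R)
  have F: "f \<in> Hs \<nu> (\<sigma>+1) \<zeta>" "h' \<in> Hs \<nu> (\<sigma>+1) \<zeta>" "q \<in> Hs \<nu> (\<sigma>+1) \<zeta>" using R unfolding R3 by (simp_all add: Tgt_iff)
  have "L0 a \<nu> lam \<zeta> (u, v, p0, t) = ?R"
    using L unfolding Lop_alt[OF X] by (cases "L0 a \<nu> lam \<zeta> (u, v, p0, t)"; cases ?R) (auto simp: lin3_def fun_eq_iff)
  note comp = L0_components[OF g this[unfolded R3]]
  obtain C where "\<forall>lam \<zeta> f. good lam \<zeta> \<longrightarrow> f \<in> Hs \<nu> (\<sigma>+1) \<zeta> \<longrightarrow> (\<lambda>k. 1 / symb a \<nu> lam \<zeta> k * f k) \<in> Hs \<nu> (\<sigma> + 1 + 2) \<zeta>"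
    using P.invD by blast
  hence I: "(\<lambda>k. 1 / symb a \<nu> lam \<zeta> k * f k) \<in> Hs \<nu> (\<sigma> + 1 + 2) \<zeta>" if "f \<in> Hs \<nu> (\<sigma>+1) \<zeta>" for f using g that by blast
  have O: "(\<lambda>k. one_c a k / symb a \<nu> lam \<zeta> k) \<in> Hs \<nu> (\<sigma> + 1 + 2) \<zeta>"
  proof -
    have "\<sigma> + 1 + 2 < 5/2" using False s by simp
    from one_over_D[OF this] g show ?thesis by blast
  qed
  have "(\<lambda>k. 1 * (1 / symb a \<nu> lam \<zeta> k * f k) + (- \<i> * of_int (fst \<zeta>) * p0) * (one_c a k / symb a \<nu> lam \<zeta> k)) \<in> Hs \<nu> (\<sigma> + 1 + 2) \<zeta>"
    "(\<lambda>k. 1 * (1 / symb a \<nu> lam \<zeta> k * h' k) + (- \<i> * of_int (snd \<zeta>) * p0) * (one_c a k / symb a \<nu> lam \<zeta> k)) \<in> Hs \<nu> (\<sigma> + 1 + 2) \<zeta>"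
    using Hs_lin2[OF I[OF F(1)] O] Hs_lin2[OF I[OF F(2)] O] by blast+
  moreover have "1 * (1 / symb a \<nu> lam \<zeta> k * f k) + (- \<i> * of_int (fst \<zeta>) * p0) * (one_c a k / symb a \<nu> lam \<zeta> k) = u k"
    "1 * (1 / symb a \<nu> lam \<zeta> k * h' k) + (- \<i> * of_int (snd \<zeta>) * p0) * (one_c a k / symb a \<nu> lam \<zeta> k) = v k"
    "1 / symb a \<nu> lam \<zeta> k * q k = t k" for k
    using comp(1)[of k] comp(2)[of k] comp(3)[of k] by simp_all
  ultimately have "u \<in> Hs \<nu> (\<sigma> + 1 + 2) \<zeta>" "v \<in> Hs \<nu> (\<sigma> + 1 + 2) \<zeta>" "t \<in> Hs \<nu> (\<sigma> + 1 + 2) \<zeta>" using I[OF F(3)] by simp_all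
  moreover have "\<sigma> + 1 + 2 > 3/2" using sg by simp
  ultimately show ?thesis using Hs_dec[OF nu] by blast
qed

text \<open>A nonzero mode would be an eigenvector at \<lambda>, which is excluded, so u, v and
  \<theta> vanish. The pressure is invisible in the variational problem and is removed separately,
  through the equations at k = 1.\<close>

lemma kernel_trivial:
  assumes g: "good lam \<zeta>" and X: "(u, v, p0, t) \<in> Dom a \<nu> (\<sigma>+2) \<zeta>" and L: "Lop a \<nu> \<alpha> \<beta> \<gamma> lam \<zeta> (u, v, p0, t) = (\<lambda>k. 0, \<lambda>k. 0, \<lambda>k. 0)"
    and s: "\<sigma> \<noteq> -1/2" and g0: "\<gamma> > 0" and VP: "lam \<notin> VP a \<nu> \<alpha> \<beta> \<gamma>"
  shows "(u, v, p0, t) = (\<lambda>k. 0, \<lambda>k. 0, 0, \<lambda>k. 0)"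
proof -
  define Xi Et :: complex where "Xi = \<i> * of_int (fst \<zeta>)" and "Et = \<i> * of_int (snd \<zeta>)"
  have z: "\<zeta> \<noteq> (0, 0)" using g by (simp add: good_def)
  have d: "dec u" "dec v" "dec t" using kernel_dec[OF g X L s] by blast+
  have n: "complex_of_real \<nu> \<noteq> 0" using nu by simp
  let ?A = "lam + of_real \<nu> * of_real (zabs2 \<zeta>)" and ?c = "\<lambda>k. Xi * u k + Et * v k"
  have dc: "dec ?c" by (rule dec_lin[OF d(1) d(2)])
  have sy: "symb a \<nu> lam \<zeta> k = ?A + of_real \<nu> * of_real ((real k * pi / a)\<^sup>2)" for k by (simp add: symb_def)
  have L1: "(if k = 0 then 0 else symb a \<nu> lam \<zeta> k * u k + Xi * p0 * one_c a k - of_real \<alpha> * v k + Xi * of_real \<beta> * prim a t k) = 0"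
    and L2: "(if k = 0 then 0 else symb a \<nu> lam \<zeta> k * v k + Et * p0 * one_c a k + of_real \<alpha> * u k + Et * of_real \<beta> * prim a t k) = 0"
    and L3: "(if k = 0 then 0 else symb a \<nu> lam \<zeta> k * t k - of_real \<gamma> * prim a ?c k) = 0" for k
    using L unfolding Lop_def Let_def Xi_def Et_def by (simp_all only: split prod.inject fun_eq_iff)
  have HU2: "(?A + of_real \<nu> * of_real ((real k * pi / a)\<^sup>2)) * u k + Xi * p0 * one_c a k + - of_real \<alpha> * v k + Xi * of_real \<beta> * prim a t k = 0" if "k \<ge> 1" for k
    using that L1[of k] unfolding sy by simp
  obtain U2 where U2_all: "continuous_on UNIV U2 \<and> (\<forall>z\<in>{0..a}. (ser1 a u has_vector_derivative U2 z) (at z within {0..a})) \<and>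
    (\<forall>z. of_real \<nu> * U2 z = ?A * ser a u z + Xi * p0 + - of_real \<alpha> * ser a v z + Xi * of_real \<beta> * integral {0..z} (ser a t))"
    using ode_from_coef[OF a n d HU2] by (rule exE)
  note U2 = U2_all[THEN conjunct1] U2_all[THEN conjunct2, THEN conjunct1, rule_format] U2_all[THEN conjunct2, THEN conjunct2, rule_format]
  have HV2: "(?A + of_real \<nu> * of_real ((real k * pi / a)\<^sup>2)) * v k + Et * p0 * one_c a k + of_real \<alpha> * u k + Et * of_real \<beta> * prim a t k = 0" if "k \<ge> 1" for k
    using that L2[of k] unfolding sy by simp
  obtain V2 where V2_all: "continuous_on UNIV V2 \<and> (\<forall>z\<in>{0..a}. (ser1 a v has_vector_derivative V2 z) (at z within {0..a})) \<and>
    (\<forall>z. of_real \<nu> * V2 z = ?A * ser a v z + Et * p0 + of_real \<alpha> * ser a u z + Et * of_real \<beta> * integral {0..z} (ser a t))"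
    using ode_from_coef[OF a n d(2) d(1) d(3) HV2] by (rule exE)
  note V2 = V2_all[THEN conjunct1] V2_all[THEN conjunct2, THEN conjunct1, rule_format] V2_all[THEN conjunct2, THEN conjunct2, rule_format]
  have HT2: "(?A + of_real \<nu> * of_real ((real k * pi / a)\<^sup>2)) * t k + 0 * one_c a k + 0 * u k + - of_real \<gamma> * prim a ?c k = 0" if "k \<ge> 1" for k
    using that L3[of k] unfolding sy by simp
  obtain T2 where T2_all: "continuous_on UNIV T2 \<and> (\<forall>z\<in>{0..a}. (ser1 a t has_vector_derivative T2 z) (at z within {0..a})) \<and>
    (\<forall>z. of_real \<nu> * T2 z = ?A * ser a t z + 0 + 0 * ser a u z + - of_real \<gamma> * integral {0..z} (ser a ?c))"
    using ode_from_coef[OF a n d(3) d(1) dc HT2] by (rule exE)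
  note T2 = T2_all[THEN conjunct1] T2_all[THEN conjunct2, THEN conjunct1, rule_format] T2_all[THEN conjunct2, THEN conjunct2, rule_format]
  have div: "(\<Sum>k. (of_int (fst \<zeta>) * u k + of_int (snd \<zeta>) * v k) * one_c a k) = 0" using X by (simp add: Dom_iff)
  have sc: "ser a ?c = (\<lambda>s. Xi * ser a u s + Et * ser a v s)" using ser_lin[OF a d(1) d(2)] by blast
  have oU: "of_real \<nu> * U2 z = ?A * ser a u z + \<i> * of_int (fst \<zeta>) * p0 - of_real \<alpha> * ser a v z + \<i> * of_int (fst \<zeta>) * of_real \<beta> * integral {0..z} (ser a t)" for z
    using U2(3)[of z] by (simp add: Xi_def)
  have oV: "of_real \<nu> * V2 z = ?A * ser a v z + \<i> * of_int (snd \<zeta>) * p0 + of_real \<alpha> * ser a u z + \<i> * of_int (snd \<zeta>) * of_real \<beta> * integral {0..z} (ser a t)" for z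
    using V2(3)[of z] by (simp add: Et_def)
  have oT: "of_real \<nu> * T2 z = ?A * ser a t z - of_real \<gamma> * integral {0..z} (\<lambda>s. \<i> * of_int (fst \<zeta>) * ser a u s + \<i> * of_int (snd \<zeta>) * ser a v s)" for z
    using T2(3)[of z] unfolding sc by (simp add: Xi_def Et_def)
  have AE: "AE p in lborel. p \<in> Om a \<longrightarrow> mode a \<zeta> u p = 0 \<and> mode a \<zeta> v p = 0 \<and> mode a \<zeta> t p = 0"
  proof (rule ccontr)
    assume nz: "\<not> ?thesis"
    have "lam \<in> VP a \<nu> \<alpha> \<beta> \<gamma>"
      unfolding VP_def
      apply (rule CollectI, rule exI[of _ "mode a \<zeta> u"], rule exI[of _ "mode a \<zeta> v"], rule exI[of _ "mode a \<zeta> t"])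
      apply (rule exI[of _ "gmode a \<zeta> u"], rule exI[of _ "gmode a \<zeta> v"], rule exI[of _ "gmode a \<zeta> t"])
      apply (intro conjI mode_inV[OF a d z div] nz allI impI)
      apply (rule weak_closure[OF a mode_cont(1)[OF a d(1)] mode_cont(1)[OF a d(2)] mode_cont(1)[OF a d(3)]
         mode_cont(2)[OF a d(1)] mode_cont(2)[OF a d(2)] mode_cont(2)[OF a d(3)]])
       apply (rule weak_smooth[OF a g0 d U2(1) V2(1) T2(1) U2(2) V2(2) T2(2) oU oV oT], assumption+)
      done
    thus False using VP by blast
  qed
  have "u = (\<lambda>k. 0)" "v = (\<lambda>k. 0)" "t = (\<lambda>k. 0)"
    by (rule mode_AE_zero[OF a d(1)], rule eventually_mono[OF AE], blast,
        rule mode_AE_zero[OF a d(2)], rule eventually_mono[OF AE], blast,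
        rule mode_AE_zero[OF a d(3)], rule eventually_mono[OF AE], blast)
  moreover have "p0 = 0"
  proof (rule ccontr)
    assume p: "p0 \<noteq> 0"
    have "prim a (\<lambda>k. 0) 1 = 0" by (simp add: prim_def)
    \<comment> \<open>With u, v and \<theta> zero only the pressure term survives; 1_1 is nonzero,
      so p0 \<noteq> 0 would force \<zeta> = 0.\<close>
    hence "Xi * p0 * one_c a 1 = 0" "Et * p0 * one_c a 1 = 0"
      using L1[of 1] L2[of 1] calculation by simp_all
    hence "fst \<zeta> = 0" "snd \<zeta> = 0" using p one_c_1_nz[OF a] by (simp_all add: Xi_def Et_def)
    thus False using z by (cases \<zeta>) simp
  qed
  ultimately show ?thesis by simp
qed

end

theorem theorem3:
  fixes a \<nu> \<alpha> \<beta> \<gamma> \<delta>1 \<delta>2 \<sigma> :: real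
  assumes a_pos: "a > 0" and nu_pos: "\<nu> > 0" and beta_pos: "\<beta> > 0" and gamma_pos: "\<gamma> > 0"
    and d1_pos: "\<delta>1 > 0"
    and d1_spec: "Sset \<delta>1 \<delta>2 \<inter> VP a \<nu> \<alpha> \<beta> \<gamma> = {}"
    and d2: "\<delta>2 < min (\<nu> * pi\<^sup>2 / (2 * a\<^sup>2)) (\<nu> / 2)"
    and sigma: "- 3 / 2 < \<sigma>" "\<sigma> < 1 / 2" "\<sigma> \<noteq> - 1 / 2"
  shows "\<exists>C. \<forall>lam \<zeta>. lam \<in> Sset \<delta>1 \<delta>2 \<and> \<zeta> \<noteq> (0, 0) \<longrightarrow>
     (\<forall>X\<in>Dom a \<nu> (\<sigma> + 2) \<zeta>. \<forall>\<epsilon>>0. \<exists>\<delta>>0. \<forall>X'\<in>Dom a \<nu> (\<sigma> + 2) \<zeta>.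
         nrmD \<nu> (\<sigma> + 2) \<zeta> (subD X' X) < \<delta> \<longrightarrow>
         nrm3 \<nu> \<sigma> \<zeta> (sub3 (Lop a \<nu> \<alpha> \<beta> \<gamma> lam \<zeta> X') (Lop a \<nu> \<alpha> \<beta> \<gamma> lam \<zeta> X)) < \<epsilon>) \<and>
     bij_betw (Lop a \<nu> \<alpha> \<beta> \<gamma> lam \<zeta>) (Dom a \<nu> (\<sigma> + 2) \<zeta>) (Tgt \<nu> \<sigma> \<zeta>) \<and>
     (\<forall>u v p0 t. (u, v, p0, t) \<in> Dom a \<nu> (\<sigma> + 2) \<zeta> \<longrightarrow>
        (let F = Lop a \<nu> \<alpha> \<beta> \<gamma> lam \<zeta> (u, v, p0, t) in
         \<exists>u1 v1 u2 v2.
           u1 \<in> Hs \<nu> (\<sigma> + 2) \<zeta> \<and> v1 \<in> Hs \<nu> (\<sigma> + 2) \<zeta> \<and>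
           u2 \<in> Hs \<nu> (\<sigma> + 2) \<zeta> \<and> v2 \<in> Hs \<nu> (\<sigma> + 2) \<zeta> \<and>
           (\<forall>k. u k = u1 k + u2 k \<and> v k = v1 k + v2 k) \<and>
           zabs \<zeta> * cmod p0 \<le> C * bw2 lam \<zeta> * Ms \<sigma> lam \<zeta> * nrm3 \<nu> \<sigma> \<zeta> F \<and>
           Ms (- \<sigma> - 2) lam \<zeta> / Ms (- \<sigma>) lam \<zeta> * nrm2 \<nu> \<sigma> \<zeta> (u1, v1)
             + nrm2 \<nu> (\<sigma> + 2) \<zeta> (u1, v1)
             \<le> C * bw2 lam \<zeta> * Ms \<sigma> lam \<zeta> * Ms (- \<sigma> - 2) lam \<zeta> * nrm3 \<nu> \<sigma> \<zeta> F \<and>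
           bw2 lam \<zeta> * nrm2 \<nu> \<sigma> \<zeta> (u2, v2) + nrm2 \<nu> (\<sigma> + 2) \<zeta> (u2, v2)
             \<le> C * nrm3 \<nu> \<sigma> \<zeta> F \<and>
           bw2 lam \<zeta> * nrm \<nu> \<sigma> \<zeta> t + nrm \<nu> (\<sigma> + 2) \<zeta> t \<le> C * nrm3 \<nu> \<sigma> \<zeta> F))"
proof -
  interpret P: prim_eq a \<nu> \<alpha> \<beta> \<gamma> \<delta>1 \<delta>2 \<sigma>
    by unfold_locales (use assms in auto)
  interpret Q: prim_eq_inj a \<nu> \<alpha> \<beta> \<gamma> \<delta>1 \<delta>2 \<sigma>
  proof unfold_locales
    fix lam \<zeta> X
    assume g: "P.good lam \<zeta>" and X: "X \<in> Dom a \<nu> (\<sigma> + 2) \<zeta>" and L: "Lop a \<nu> \<alpha> \<beta> \<gamma> lam \<zeta> X = (\<lambda>k. 0, \<lambda>k. 0, \<lambda>k. 0)"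
    obtain u v p0 t where X4: "X = (u, v, p0, t)" by (cases X)
    \<comment> \<open>The choice of \<delta>1 enters here: the spectral set avoids all
      eigenvalues.\<close>
    have "lam \<notin> VP a \<nu> \<alpha> \<beta> \<gamma>" using g d1_spec unfolding P.good_def by blast
    from P.kernel_trivial[OF g X[unfolded X4] L[unfolded X4] _ gamma_pos this] show "X = (\<lambda>k. 0, \<lambda>k. 0, 0, \<lambda>k. 0)"
      using sigma(3) unfolding X4 by simp
  qed
  obtain C where C: "\<And>lam \<zeta> u v p0 t. P.good lam \<zeta> \<Longrightarrow> (u, v, p0, t) \<in> Dom a \<nu> (\<sigma> + 2) \<zeta> \<Longrightarrow>
      P.est C lam \<zeta> u v p0 t (nrm3 \<nu> \<sigma> \<zeta> (Lop a \<nu> \<alpha> \<beta> \<gamma> lam \<zeta> (u, v, p0, t)))"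
    using Q.Lop_estimate by blast
  show ?thesis
  proof (rule exI[of _ C], rule allI, rule allI, rule impI, intro conjI)
    fix lam :: complex and \<zeta> :: "int \<times> int" assume "lam \<in> Sset \<delta>1 \<delta>2 \<and> \<zeta> \<noteq> (0, 0)"
    hence g: "P.good lam \<zeta>" unfolding P.good_def .
    show "\<forall>X\<in>Dom a \<nu> (\<sigma> + 2) \<zeta>. \<forall>\<epsilon>>0. \<exists>\<delta>>0. \<forall>X'\<in>Dom a \<nu> (\<sigma> + 2) \<zeta>.
         nrmD \<nu> (\<sigma> + 2) \<zeta> (subD X' X) < \<delta> \<longrightarrow>
         nrm3 \<nu> \<sigma> \<zeta> (sub3 (Lop a \<nu> \<alpha> \<beta> \<gamma> lam \<zeta> X') (Lop a \<nu> \<alpha> \<beta> \<gamma> lam \<zeta> X)) < \<epsilon>"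
      by (rule ballI, rule allI, rule impI, rule Q.Lop_continuous[OF g])
    show "bij_betw (Lop a \<nu> \<alpha> \<beta> \<gamma> lam \<zeta>) (Dom a \<nu> (\<sigma> + 2) \<zeta>) (Tgt \<nu> \<sigma> \<zeta>)" by (rule Q.Lop_bij[OF g])
  qed (unfold Let_def P.est_def[symmetric] P.good_def[symmetric], intro allI impI C)
qed

end
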